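(* Let $\mathbb V_h,\mathbb Q_h,\mathbb M_h$ be the finite element spaces described in the context; in particular $\mathcal T_\Omega$ is quasi-uniform and $\mathbb V_h|_\Gamma=\mathbb M_h$. There exist constants $h_0>0$ and $c_{\mathrm{CFL}}>0$, independent of $\tau$ and $h$, such that the following holds whenever $h\le h_0$ and $\tau\le c_{\mathrm{CFL}}\,h$. Let $(u,p,\lambda)$ be the solution of the semi-discrete problem $$M_u\dot u+K_uu-B_u^T\lambda=f(t),\qquad M_p\dot p+K_pp+B_p^T\lambda=g(t),\qquad B_uu-B_pp=0$$ on $[0,T]$, and assume that it is sufficiently regular, namely $u\in H^3(0,T;\mathbb R^{N_u})$ and $p\in H^3(0,T;\mathbb R^{N_p})$. Let the initial data $u^k\in\mathbb R^{N_u}$, $p^k\in\mathbb R^{N_p}$, $k=0,1,2$, satisfy $$\|u^k-u(t^k)\|_{M_u}^2+\tau\,\|u^k-u(t^k)\|_{K_u}^2+\|p^k-p(t^k)\|_{M_p}^2+\tau\,\|p^k-p(t^k)\|_{K_p}^2\lesssim\tau^5,\qquad k=0,1,2,$$ and let $u^2,p^2$ be consistent, i.e. $B_uu^2=B_pp^2$. Let $(u^n,p^n)$, $n\ge3$, be computed by the $3$-step bulk--surface splitting scheme: for $n\ge0$, first determine $u^{n+3}=[(u_1^{n+3})^T,(u_2^{n+3})^T]^T$, $\lambda^{n+3}$, $w^{n+3}$ from $$\begin{aligned} M_{11}D_\tau^{BDF}u_1^{n+3}+K_{11}u_1^{n+3}&=f_1^{n+3}-M_{12}w^{n+3}-K_{12}u_2^{n+3},\\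 M_{21}D_\tau^{BDF}u_1^{n+3}+K_{21}u_1^{n+3}-M_\lambda\lambda^{n+3}&=f_2^{n+3}-M_{22}w^{n+3}-K_{22}u_2^{n+3},\\ M_\lambda u_2^{n+3}&=B_p(2p^{n+2}-p^{n+1}),\\ M_\lambda w^{n+3}&=B_pD_\tau^{alt}p^{n+2}, \end{aligned}$$ and then $p^{n+3}$ from $$M_pD_\tau^{BDF}p^{n+3}+K_pp^{n+3}+B_p^T\lambda^{n+3}=g^{n+3}.$$ Then $$\|u^n-u(t^n)\|_{M_u}^2+\|p^n-p(t^n)\|_{M_p}^2+\tau\sum_{k=1}^n\Big(\|u^k-u(t^k)\|_{K_u}^2+\|p^k-p(t^k)\|_{K_p}^2\Big)\lesssim\tau^4$$ for every $n\ge 0$ with $t^n\le T$.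
   Context: Setting. $\Omega\subseteq\mathbb R^d$, $d\in\{2,3\}$, is a bounded Lipschitz domain with boundary $\Gamma=\partial\Omega$; $\alpha\in L^\infty(\Omega)$ and $\kappa\in L^\infty(\Gamma)$ are uniformly positive; $T>0$. $\mathcal T_\Omega$ is a quasi-uniform triangulation of $\Omega$ with maximal mesh width $h$. $\mathbb V_h\subseteq H^1(\Omega)$, $\mathbb Q_h\subseteq H^1(\Gamma)$, $\mathbb M_h\subseteq H^{-1/2}(\Gamma)$ are conforming (polynomial) finite element spaces of dimensions $N_u,N_p,N_\lambda$, with $\mathbb V_h=\mathcal P_k(\mathcal T_\Omega)$ (continuous piecewise polynomials of degree $k$), $\mathbb M_h=\mathcal P_k(\mathcal T_\Omega|_\Gamma)=\mathbb V_h|_\Gamma$, and $\mathbb Q_h$ a finite element space on a boundary mesh $\mathcal T_\Gamma$ which is a refinement of $\mathcal T_\Omega|_\Gamma$ (so $N_\lambda\le N_p$). The spaces satisfy the inf--sup condition $$\inf_{\lambda_h\in\mathbb M_h\setminus\{0\}}\sup_{(u_h,p_h)\in\mathbb V_h\times\mathbb Q_h\setminus\{0\}}\frac{\int_\Gamma(u_h|_\Gamma-p_h)\lambda_h\,dx}{\|\lambda_h\|_{H^{-1/2}(\Gamma)}(\|u_h\|^2_{H^1(\Omega)}+\|p_h\|^2_{H^1(\Gamma)})^{1/2}}\ge\beta>0.$$ Discrete functions are identified with coefficient vectors. Matrices. $M_u,M_p,M_\lambda$ are the $L^2$ mass matrices of $\mathbb V_h$ (over $\Omega$), $\mathbb Q_h$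 (over $\Gamma$), $\mathbb M_h$ (over $\Gamma$). $K_u$ and $K_p$ are the stiffness matrices of $\int_\Omega\alpha\nabla u\cdot\nabla v\,dx$ on $\mathbb V_h$ and $\int_\Gamma\kappa\nabla_\Gamma p\cdot\nabla_\Gamma q\,dx$ on $\mathbb Q_h$. $B_u\in\mathbb R^{N_\lambda\times N_u}$ and $B_p\in\mathbb R^{N_\lambda\times N_p}$ represent $\int_\Gamma u|_\Gamma\mu\,dx$ and $\int_\Gamma p\,\mu\,dx$, $\mu\in\mathbb M_h$. The nodes of $\mathbb V_h$ are ordered such that the last $N_\lambda$ are the boundary nodes, so $B_u=[\,0\ \ M_\lambda\,]$; correspondingly $u=[u_1^T,u_2^T]^T$ with $u_1\in\mathbb R^{N_u-N_\lambda}$, $u_2\in\mathbb R^{N_\lambda}$, $f=[f_1^T,f_2^T]^T$, and $M_u,K_u$ have blocks $M_{ij},K_{ij}$, $i,j\in\{1,2\}$. For a symmetric positive (semi-)definite matrix $A$, $\|x\|_A^2=x^TAx$. Time discretization. $\tau>0$ is the constant step size, $t^n=n\tau$, and $$D_\tau^{BDF}x^{n+3}=\tfrac1{2\tau}(3x^{n+3}-4x^{n+2}+x^{n+1}),\qquad D_\tau^{alt}x^{n+2}=\tfrac1{2\tau}(5x^{n+2}-8x^{n+1}+3x^n).$$ The right-hand sides are sufficiently smooth and depend on time only: $f^{n}=f(t^{n})$, $g^{n}=g(t^{n})$. Notation $\lesssim$: $a\lesssim b$ means $a\le Cb$ with a constant $C$ independent of $\tau$, $n$ and $h$; in the conclusion,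 $C$ may depend on $T$, $\Omega$, $\alpha,\kappa$, the polynomial degrees, the mesh uniformity parameter, the constant in the hypothesis on the initial data, and on the semi-discrete solution $(u,p,\lambda)$. *)

theory Defs
  imports "HOL-Analysis.Analysis" "Jordan_Normal_Form.Matrix"
begin

unbundle no vec_syntax

text \<open>Local epigraph condition: \<open>\<gamma>\<close> is only evaluated on the hyperplane orthogonal to the unit
  vector \<open>e\<close>.\<close>

definition lipschitz_domain :: "'a::euclidean_space set \<Rightarrow> bool" where
  "lipschitz_domain \<Omega> \<longleftrightarrow> open \<Omega> \<and> connected \<Omega> \<and> bounded \<Omega> \<and> \<Omega> \<noteq> {} \<and>
     (\<forall>x \<in> frontier \<Omega>. \<exists>r>0. \<exists>e \<gamma> L. norm e = 1 \<and> L-lipschitz_on UNIV (\<gamma> :: 'a \<Rightarrow> real) \<and>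
        \<Omega> \<inter> ball x r = {y \<in> ball x r. \<gamma> (y - inner y e *\<^sub>R e) < inner y e})"

text \<open>The \<open>s\<close>-dimensional Hausdorff measure (for \<open>s \<ge> 1\<close>), normalised so as to agree with Lebesgue
  measure on \<open>s\<close>-dimensional affine subspaces.  Boundedness of the covering sets is required because
  the library's \<^const>\<open>diameter\<close> of an unbounded set is meaningless.\<close>

definition hausdorff_outer :: "nat \<Rightarrow> 'a::euclidean_space set \<Rightarrow> ennreal" where
  "hausdorff_outer s A =
     (SUP \<delta> \<in> {0<..}. INF U \<in> {U :: nat \<Rightarrow> 'a set.
          A \<subseteq> (\<Union>i. U i) \<and> (\<forall>i. bounded (U i) \<and> diameter (U i) \<le> (\<delta>::real))}.
        (\<Sum>i. ennreal (unit_ball_vol (real s) / 2 ^ s * diameter (U i) ^ s)))"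

definition hausdorff_measure :: "nat \<Rightarrow> 'a::euclidean_space measure" where
  "hausdorff_measure s = measure_of UNIV (sets borel) (hausdorff_outer s)"

definition surface_measure :: "'a::euclidean_space set \<Rightarrow> 'a measure" where
  "surface_measure \<Gamma> = restrict_space (hausdorff_measure (DIM('a) - 1)) \<Gamma>"

definition uniformly_positive_Linfty :: "'a measure \<Rightarrow> ('a \<Rightarrow> real) \<Rightarrow> bool" where
  "uniformly_positive_Linfty M a \<longleftrightarrow> a \<in> borel_measurable M \<and>
     (\<exists>a0 a1. 0 < a0 \<and> (AE x in M. a0 \<le> a x \<and> a x \<le> a1))"

text \<open>All gradients are applied to continuous piecewise polynomials.  For these the classical gradient
  exists almost everywhere and is the weak gradient; the default value \<open>0\<close> only concerns a null set.\<close>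

definition grad :: "('a::euclidean_space \<Rightarrow> real) \<Rightarrow> 'a \<Rightarrow> 'a" where
  "grad v x = (if \<exists>D. GDERIV v x :> D then THE D. GDERIV v x :> D else 0)"

definition tangent_space :: "'a::euclidean_space set \<Rightarrow> 'a \<Rightarrow> 'a set" where
  "tangent_space S x = span {v. \<exists>(X :: nat \<Rightarrow> 'a) (t :: nat \<Rightarrow> real).
      (\<forall>n. X n \<in> S \<and> 0 \<le> t n) \<and> X \<longlonglongrightarrow> x \<and> (\<lambda>n. t n *\<^sub>R (X n - x)) \<longlonglongrightarrow> v}"

definition is_surface_grad :: "'a::euclidean_space set \<Rightarrow> ('a \<Rightarrow> real) \<Rightarrow> 'a \<Rightarrow> 'a \<Rightarrow> bool" where
  "is_surface_grad \<Gamma> v x g \<longleftrightarrow>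
     g \<in> tangent_space \<Gamma> x \<and> (v has_derivative (\<lambda>y. inner g y)) (at x within \<Gamma>)"

definition surface_grad :: "'a::euclidean_space set \<Rightarrow> ('a \<Rightarrow> real) \<Rightarrow> 'a \<Rightarrow> 'a" where
  "surface_grad \<Gamma> v x =
     (if \<exists>g. is_surface_grad \<Gamma> v x g then THE g. is_surface_grad \<Gamma> v x g else 0)"

definition H1_norm_sq :: "'a::euclidean_space set \<Rightarrow> ('a \<Rightarrow> real) \<Rightarrow> real" where
  "H1_norm_sq \<Omega> v = (LINT x|lebesgue_on \<Omega>. (v x)\<^sup>2 + (norm (grad v x))\<^sup>2)"

definition H1_surface_norm_sq :: "'a::euclidean_space set \<Rightarrow> ('a \<Rightarrow> real) \<Rightarrow> real" where
  "H1_surface_norm_sq \<Gamma> v = (LINT x|surface_measure \<Gamma>. (v x)\<^sup>2 + (norm (surface_grad \<Gamma> v x))\<^sup>2)"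

text \<open>\<open>H\<^sup>1\<^sup>/\<^sup>2(\<Gamma>)\<close> with the Sobolev--Slobodeckij norm; on a surface of dimension \<open>d - 1\<close> the exponent of
  the kernel is \<open>(d - 1) + 2 \<cdot> 1/2 = d\<close>.  \<open>H\<^sup>-\<^sup>1\<^sup>/\<^sup>2(\<Gamma>)\<close> carries the dual norm, here for functionals
  represented by a function through the \<open>L\<^sup>2(\<Gamma>)\<close> pairing.\<close>

definition slobodeckij_kernel :: "('a::euclidean_space \<Rightarrow> real) \<Rightarrow> 'a \<times> 'a \<Rightarrow> real" where
  "slobodeckij_kernel v = (\<lambda>(x, y). (v x - v y)\<^sup>2 / dist x y ^ DIM('a))"

definition H_half :: "'a::euclidean_space set \<Rightarrow> ('a \<Rightarrow> real) set" where
  "H_half \<Gamma> = {v \<in> borel_measurable (surface_measure \<Gamma>).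
     integrable (surface_measure \<Gamma>) (\<lambda>x. (v x)\<^sup>2) \<and>
     integrable (surface_measure \<Gamma> \<Otimes>\<^sub>M surface_measure \<Gamma>) (slobodeckij_kernel v)}"

definition H_half_norm :: "'a::euclidean_space set \<Rightarrow> ('a \<Rightarrow> real) \<Rightarrow> real" where
  "H_half_norm \<Gamma> v = sqrt ((LINT x|surface_measure \<Gamma>. (v x)\<^sup>2) +
     (LINT z|(surface_measure \<Gamma> \<Otimes>\<^sub>M surface_measure \<Gamma>). slobodeckij_kernel v z))"

definition H_minus_half_norm :: "'a::euclidean_space set \<Rightarrow> ('a \<Rightarrow> real) \<Rightarrow> real" where
  "H_minus_half_norm \<Gamma> l =
     (SUP v \<in> {v \<in> H_half \<Gamma>. H_half_norm \<Gamma> v \<noteq> 0}.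
        (LINT x|surface_measure \<Gamma>. l x * v x) / H_half_norm \<Gamma> v)"

definition mesh_width :: "'a::euclidean_space set set \<Rightarrow> real" where
  "mesh_width \<T> = Max (diameter ` \<T>)"

definition mesh_of :: "'a::euclidean_space set \<Rightarrow> int \<Rightarrow> 'a set set \<Rightarrow> bool" where
  "mesh_of S n \<T> \<longleftrightarrow> triangulation \<T> \<and> (\<forall>T\<in>\<T>. n simplex T) \<and> \<Union>\<T> = S"

text \<open>Shape regularity and uniformity in one parameter: every element contains a ball whose radius is
  comparable with the maximal diameter.\<close>

definition quasi_uniform :: "real \<Rightarrow> 'a::euclidean_space set set \<Rightarrow> bool" where
  "quasi_uniform \<sigma> \<T> \<longleftrightarrow> (\<forall>T\<in>\<T>. \<exists>x. cball x (\<sigma> * mesh_width \<T>) \<subseteq> T)"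

definition boundary_mesh :: "'a::euclidean_space set set \<Rightarrow> 'a set \<Rightarrow> 'a set set" where
  "boundary_mesh \<T> \<Gamma> = {F. F \<subseteq> \<Gamma> \<and> (\<exists>T\<in>\<T>. F facet_of T)}"

definition polynomials_le :: "nat \<Rightarrow> ('a::euclidean_space \<Rightarrow> real) set" where
  "polynomials_le k = {P. \<exists>c. P = (\<lambda>x. \<Sum>m | (\<forall>b. b \<notin> Basis \<longrightarrow> m b = 0) \<and> sum m Basis \<le> k.
       c m * (\<Prod>b\<in>Basis. inner x b ^ m b))}"

text \<open>Continuous piecewise polynomials; values outside \<open>\<Union>\<T>\<close> are irrelevant.\<close>

definition pw_poly :: "nat \<Rightarrow> 'a::euclidean_space set set \<Rightarrow> ('a \<Rightarrow> real) set" where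
  "pw_poly k \<T> = {v. continuous_on (\<Union>\<T>) v \<and> (\<forall>T\<in>\<T>. \<exists>P\<in>polynomials_le k. \<forall>x\<in>T. v x = P x)}"

text \<open>The principal lattice of each simplex: points whose barycentric coordinates are multiples of \<open>1/k\<close>.\<close>

definition lagrange_nodes :: "nat \<Rightarrow> 'a::euclidean_space set set \<Rightarrow> 'a set" where
  "lagrange_nodes k \<T> = {x. \<exists>T\<in>\<T>. \<exists>m :: 'a \<Rightarrow> nat. sum m {z. z extreme_point_of T} = k \<and>
       x = (\<Sum>z | z extreme_point_of T. (real (m z) / real k) *\<^sub>R z)}"

text \<open>\<open>basis_u D 0, \<dots>, basis_u D (dim_u D - 1)\<close> is the nodal basis of \<open>\<V>\<^sub>h\<close>, in which the last
  \<open>dim_l D\<close> functions belong to the boundary nodes; \<open>basis_p D\<close> is a basis of \<open>\<Q>\<^sub>h\<close>.\<close>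

record 'a fe_data =
  mesh_bulk :: "'a set set"
  mesh_surf :: "'a set set"
  dim_u :: nat
  dim_p :: nat
  dim_l :: nat
  node :: "nat \<Rightarrow> 'a"
  basis_u :: "nat \<Rightarrow> 'a \<Rightarrow> real"
  basis_p :: "nat \<Rightarrow> 'a \<Rightarrow> real"

text \<open>The basis of \<open>\<M>\<^sub>h = \<V>\<^sub>h|\<^sub>\<Gamma>\<close>: traces of the boundary nodal functions.\<close>

definition basis_l :: "'a fe_data \<Rightarrow> nat \<Rightarrow> 'a \<Rightarrow> real" where
  "basis_l D i = basis_u D (dim_u D - dim_l D + i)"

definition fe_fun :: "(nat \<Rightarrow> 'a \<Rightarrow> real) \<Rightarrow> real vec \<Rightarrow> 'a \<Rightarrow> real" where
  "fe_fun b c x = (\<Sum>i<dim_vec c. c $ i * b i x)"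

text \<open>The infimum and supremum are taken in the extended reals, so that no boundedness is presupposed.\<close>

definition inf_sup :: "'a::euclidean_space set \<Rightarrow> real \<Rightarrow> 'a fe_data \<Rightarrow> bool" where
  "inf_sup \<Omega> \<beta> D \<longleftrightarrow>
     (INF c \<in> carrier_vec (dim_l D) - {0\<^sub>v (dim_l D)}.
      SUP (a, b) \<in> carrier_vec (dim_u D) \<times> carrier_vec (dim_p D) - {(0\<^sub>v (dim_u D), 0\<^sub>v (dim_p D))}.
        ereal ((LINT x|surface_measure (frontier \<Omega>).
                  (fe_fun (basis_u D) a x - fe_fun (basis_p D) b x) * fe_fun (basis_l D) c x) /
               (H_minus_half_norm (frontier \<Omega>) (fe_fun (basis_l D) c) *
                sqrt (H1_norm_sq \<Omega> (fe_fun (basis_u D) a) +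
                      H1_surface_norm_sq (frontier \<Omega>) (fe_fun (basis_p D) b))))) \<ge> ereal \<beta>"

text \<open>\<open>\<Q>\<^sub>h\<close> is an arbitrary space of continuous piecewise polynomials of degree at most \<open>q\<close> on the
  refined boundary mesh.\<close>

definition fe_discretization ::
    "'a::euclidean_space set \<Rightarrow> real \<Rightarrow> nat \<Rightarrow> nat \<Rightarrow> real \<Rightarrow> 'a fe_data \<Rightarrow> bool" where
  "fe_discretization \<Omega> \<sigma> k q \<beta> D \<longleftrightarrow>
     mesh_of (closure \<Omega>) (int DIM('a)) (mesh_bulk D) \<and>
     quasi_uniform \<sigma> (mesh_bulk D) \<and>
     mesh_of (frontier \<Omega>) (int DIM('a) - 1) (mesh_surf D) \<and>
     (\<forall>S\<in>mesh_surf D. \<exists>F\<in>boundary_mesh (mesh_bulk D) (frontier \<Omega>). S \<subseteq> F) \<and>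
     bij_betw (node D) {..<dim_u D} (lagrange_nodes k (mesh_bulk D)) \<and>
     dim_l D \<le> dim_u D \<and>
     (\<forall>i<dim_u D. node D i \<in> frontier \<Omega> \<longleftrightarrow> dim_u D - dim_l D \<le> i) \<and>
     (\<forall>i<dim_u D. basis_u D i \<in> pw_poly k (mesh_bulk D) \<and>
        (\<forall>j<dim_u D. basis_u D i (node D j) = (if i = j then 1 else 0))) \<and>
     (\<forall>i<dim_p D. basis_p D i \<in> pw_poly q (mesh_surf D)) \<and>
     (\<forall>c\<in>carrier_vec (dim_p D). (\<forall>x\<in>frontier \<Omega>. fe_fun (basis_p D) c x = 0) \<longrightarrow> c = 0\<^sub>v (dim_p D)) \<and>
     dim_l D \<le> dim_p D \<and>
     inf_sup \<Omega> \<beta> D"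

definition mass_u :: "'a::euclidean_space set \<Rightarrow> 'a fe_data \<Rightarrow> real mat" where
  "mass_u \<Omega> D = Matrix.mat (dim_u D) (dim_u D) (\<lambda>(i, j).
     LINT x|lebesgue_on \<Omega>. basis_u D j x * basis_u D i x)"

definition stiff_u :: "'a::euclidean_space set \<Rightarrow> ('a \<Rightarrow> real) \<Rightarrow> 'a fe_data \<Rightarrow> real mat" where
  "stiff_u \<Omega> \<alpha> D = Matrix.mat (dim_u D) (dim_u D) (\<lambda>(i, j).
     LINT x|lebesgue_on \<Omega>. \<alpha> x * inner (grad (basis_u D j) x) (grad (basis_u D i) x))"

definition mass_p :: "'a::euclidean_space set \<Rightarrow> 'a fe_data \<Rightarrow> real mat" where
  "mass_p \<Omega> D = Matrix.mat (dim_p D) (dim_p D) (\<lambda>(i, j).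
     LINT x|surface_measure (frontier \<Omega>). basis_p D j x * basis_p D i x)"

definition stiff_p :: "'a::euclidean_space set \<Rightarrow> ('a \<Rightarrow> real) \<Rightarrow> 'a fe_data \<Rightarrow> real mat" where
  "stiff_p \<Omega> \<kappa> D = Matrix.mat (dim_p D) (dim_p D) (\<lambda>(i, j).
     LINT x|surface_measure (frontier \<Omega>). \<kappa> x *
       inner (surface_grad (frontier \<Omega>) (basis_p D j) x) (surface_grad (frontier \<Omega>) (basis_p D i) x))"

definition mass_l :: "'a::euclidean_space set \<Rightarrow> 'a fe_data \<Rightarrow> real mat" where
  "mass_l \<Omega> D = Matrix.mat (dim_l D) (dim_l D) (\<lambda>(i, j).
     LINT x|surface_measure (frontier \<Omega>). basis_l D j x * basis_l D i x)"

definition coupling_u :: "'a::euclidean_space set \<Rightarrow> 'a fe_data \<Rightarrow> real mat" where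
  "coupling_u \<Omega> D = Matrix.mat (dim_l D) (dim_u D) (\<lambda>(i, j).
     LINT x|surface_measure (frontier \<Omega>). basis_u D j x * basis_l D i x)"

definition coupling_p :: "'a::euclidean_space set \<Rightarrow> 'a fe_data \<Rightarrow> real mat" where
  "coupling_p \<Omega> D = Matrix.mat (dim_l D) (dim_p D) (\<lambda>(i, j).
     LINT x|surface_measure (frontier \<Omega>). basis_p D j x * basis_l D i x)"

definition norm_sq :: "real mat \<Rightarrow> real vec \<Rightarrow> real" where
  "norm_sq A x = scalar_prod x (A *\<^sub>v x)"

text \<open>Weak derivative on \<open>(0, T)\<close>, with compactly supported \<open>C\<^sup>1\<close> test functions.\<close>

definition weak_derivative :: "real \<Rightarrow> (real \<Rightarrow> real) \<Rightarrow> (real \<Rightarrow> real) \<Rightarrow> bool" where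
  "weak_derivative T v w \<longleftrightarrow>
     (\<forall>\<phi> \<phi>'. (\<forall>t. (\<phi> has_real_derivative \<phi>' t) (at t)) \<and> continuous_on UNIV \<phi>' \<and>
        (\<exists>a b. 0 < a \<and> b < T \<and> (\<forall>t. t \<notin> {a..b} \<longrightarrow> \<phi> t = 0)) \<longrightarrow>
        (LINT t|lebesgue_on {0<..<T}. v t * \<phi>' t) = - (LINT t|lebesgue_on {0<..<T}. w t * \<phi> t))"

definition L2_time :: "real \<Rightarrow> (real \<Rightarrow> real) \<Rightarrow> bool" where
  "L2_time T v \<longleftrightarrow> v \<in> borel_measurable (lebesgue_on {0<..<T}) \<and>
     integrable (lebesgue_on {0<..<T}) (\<lambda>t. (v t)\<^sup>2)"

text \<open>\<open>v \<in> H\<^sup>m(0, T; \<real>\<^sup>N)\<close>, with \<open>V j\<close> the \<open>j\<close>-th weak derivative.\<close>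

definition sobolev_derivs ::
    "nat \<Rightarrow> real \<Rightarrow> nat \<Rightarrow> (real \<Rightarrow> real vec) \<Rightarrow> (nat \<Rightarrow> real \<Rightarrow> real vec) \<Rightarrow> bool" where
  "sobolev_derivs m T N v V \<longleftrightarrow> V 0 = v \<and>
     (\<forall>j\<le>m. (\<forall>t. V j t \<in> carrier_vec N) \<and> (\<forall>i<N. L2_time T (\<lambda>t. V j t $ i))) \<and>
     (\<forall>j<m. \<forall>i<N. weak_derivative T (\<lambda>t. V j t $ i) (\<lambda>t. V (Suc j) t $ i))"

text \<open>The squared norm of \<open>H\<^sup>m(0, T; \<real>\<^sup>N)\<close>, where \<open>\<real>\<^sup>N\<close> carries the norm induced by \<open>A\<close>.\<close>

definition sobolev_norm_sq :: "nat \<Rightarrow> real \<Rightarrow> real mat \<Rightarrow> (nat \<Rightarrow> real \<Rightarrow> real vec) \<Rightarrow> real" where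
  "sobolev_norm_sq m T A V = (\<Sum>j\<le>m. LINT t|lebesgue_on {0<..<T}. norm_sq A (V j t))"

definition vec_derivative_on :: "real \<Rightarrow> nat \<Rightarrow> (real \<Rightarrow> real vec) \<Rightarrow> (real \<Rightarrow> real vec) \<Rightarrow> bool" where
  "vec_derivative_on T N v v' \<longleftrightarrow>
     (\<forall>t\<in>{0..T}. v' t \<in> carrier_vec N \<and>
        (\<forall>i<N. ((\<lambda>s. v s $ i) has_real_derivative v' t $ i) (at t within {0..T})))"

definition continuous_data :: "real \<Rightarrow> nat \<Rightarrow> (real \<Rightarrow> real vec) \<Rightarrow> bool" where
  "continuous_data T N f \<longleftrightarrow>
     (\<forall>t. f t \<in> carrier_vec N) \<and> (\<forall>i<N. continuous_on {0..T} (\<lambda>t. f t $ i))"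

definition semidiscrete_solution ::
    "'a::euclidean_space set \<Rightarrow> ('a \<Rightarrow> real) \<Rightarrow> ('a \<Rightarrow> real) \<Rightarrow> real \<Rightarrow> 'a fe_data \<Rightarrow>
     (real \<Rightarrow> real vec) \<Rightarrow> (real \<Rightarrow> real vec) \<Rightarrow>
     (real \<Rightarrow> real vec) \<Rightarrow> (real \<Rightarrow> real vec) \<Rightarrow> (real \<Rightarrow> real vec) \<Rightarrow> bool" where
  "semidiscrete_solution \<Omega> \<alpha> \<kappa> T D f g u p l \<longleftrightarrow>
     (\<forall>t. u t \<in> carrier_vec (dim_u D) \<and> p t \<in> carrier_vec (dim_p D) \<and> l t \<in> carrier_vec (dim_l D)) \<and>
     (\<exists>u' p'. vec_derivative_on T (dim_u D) u u' \<and> vec_derivative_on T (dim_p D) p p' \<and>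
        (\<forall>t\<in>{0..T}.
           mass_u \<Omega> D *\<^sub>v u' t + stiff_u \<Omega> \<alpha> D *\<^sub>v u t
             - transpose_mat (coupling_u \<Omega> D) *\<^sub>v l t = f t \<and>
           mass_p \<Omega> D *\<^sub>v p' t + stiff_p \<Omega> \<kappa> D *\<^sub>v p t
             + transpose_mat (coupling_p \<Omega> D) *\<^sub>v l t = g t \<and>
           coupling_u \<Omega> D *\<^sub>v u t - coupling_p \<Omega> D *\<^sub>v p t = 0\<^sub>v (dim_l D)))"

text \<open>\<open>D_BDF \<tau> x n\<close> and \<open>D_alt \<tau> x n\<close> are the difference quotients \<open>D\<^sub>\<tau>\<^sup>B\<^sup>D\<^sup>F x\<^sup>n\<^sup>+\<^sup>3\<close> and
  \<open>D\<^sub>\<tau>\<^sup>a\<^sup>l\<^sup>t x\<^sup>n\<^sup>+\<^sup>2\<close>; the index \<open>n\<close> is the base index of the three-step stencil.\<close>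

definition D_BDF :: "real \<Rightarrow> (nat \<Rightarrow> real vec) \<Rightarrow> nat \<Rightarrow> real vec" where
  "D_BDF \<tau> x n = (1 / (2 * \<tau>)) \<cdot>\<^sub>v (3 \<cdot>\<^sub>v x (n + 3) - 4 \<cdot>\<^sub>v x (n + 2) + x (n + 1))"

definition D_alt :: "real \<Rightarrow> (nat \<Rightarrow> real vec) \<Rightarrow> nat \<Rightarrow> real vec" where
  "D_alt \<tau> x n = (1 / (2 * \<tau>)) \<cdot>\<^sub>v (5 \<cdot>\<^sub>v x (n + 2) - 8 \<cdot>\<^sub>v x (n + 1) + 3 \<cdot>\<^sub>v x n)"

text \<open>One step \<open>n \<mapsto> n + 3\<close>.  The vectors \<open>lam\<close> and \<open>w\<close> are \<open>\<lambda>\<^sup>n\<^sup>+\<^sup>3\<close> and \<open>w\<^sup>n\<^sup>+\<^sup>3\<close>; the first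
  \<open>dim_u D - dim_l D\<close> components of \<open>u\<^sup>n\<close> form \<open>u\<^sub>1\<^sup>n\<close>, the remaining ones \<open>u\<^sub>2\<^sup>n\<close>.\<close>

definition splitting_step ::
    "'a::euclidean_space set \<Rightarrow> ('a \<Rightarrow> real) \<Rightarrow> ('a \<Rightarrow> real) \<Rightarrow> 'a fe_data \<Rightarrow> real \<Rightarrow>
     (real \<Rightarrow> real vec) \<Rightarrow> (real \<Rightarrow> real vec) \<Rightarrow> (nat \<Rightarrow> real vec) \<Rightarrow> (nat \<Rightarrow> real vec) \<Rightarrow>
     real vec \<Rightarrow> real vec \<Rightarrow> nat \<Rightarrow> bool" where
  "splitting_step \<Omega> \<alpha> \<kappa> D \<tau> f g u p lam w n \<longleftrightarrow>
     (let N1 = dim_u D - dim_l D; N2 = dim_l D;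
          (M11, M12, M21, M22) = split_block (mass_u \<Omega> D) N1 N1;
          (K11, K12, K21, K22) = split_block (stiff_u \<Omega> \<alpha> D) N1 N1;
          Ml = mass_l \<Omega> D; Bp = coupling_p \<Omega> D;
          u1 = (\<lambda>j. vec_first (u j) N1); u2 = (\<lambda>j. vec_last (u j) N2);
          t = real (n + 3) * \<tau>;
          f1 = vec_first (f t) N1; f2 = vec_last (f t) N2
      in M11 *\<^sub>v D_BDF \<tau> u1 n + K11 *\<^sub>v u1 (n + 3) = f1 - M12 *\<^sub>v w - K12 *\<^sub>v u2 (n + 3) \<and>
         M21 *\<^sub>v D_BDF \<tau> u1 n + K21 *\<^sub>v u1 (n + 3) - Ml *\<^sub>v lam
           = f2 - M22 *\<^sub>v w - K22 *\<^sub>v u2 (n + 3) \<and>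
         Ml *\<^sub>v u2 (n + 3) = Bp *\<^sub>v (2 \<cdot>\<^sub>v p (n + 2) - p (n + 1)) \<and>
         Ml *\<^sub>v w = Bp *\<^sub>v D_alt \<tau> p n \<and>
         mass_p \<Omega> D *\<^sub>v D_BDF \<tau> p n + stiff_p \<Omega> \<kappa> D *\<^sub>v p (n + 3) + transpose_mat Bp *\<^sub>v lam = g t)"

definition splitting_scheme ::
    "'a::euclidean_space set \<Rightarrow> ('a \<Rightarrow> real) \<Rightarrow> ('a \<Rightarrow> real) \<Rightarrow> real \<Rightarrow> 'a fe_data \<Rightarrow> real \<Rightarrow>
     (real \<Rightarrow> real vec) \<Rightarrow> (real \<Rightarrow> real vec) \<Rightarrow> (nat \<Rightarrow> real vec) \<Rightarrow> (nat \<Rightarrow> real vec) \<Rightarrow> bool" where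
  "splitting_scheme \<Omega> \<alpha> \<kappa> T D \<tau> f g u p \<longleftrightarrow>
     (\<forall>n. u n \<in> carrier_vec (dim_u D) \<and> p n \<in> carrier_vec (dim_p D)) \<and>
     (\<forall>n. real (n + 3) * \<tau> \<le> T \<longrightarrow>
        (\<exists>lam\<in>carrier_vec (dim_l D). \<exists>w\<in>carrier_vec (dim_l D).
           splitting_step \<Omega> \<alpha> \<kappa> D \<tau> f g u p lam w n))"

end

theory Submission
  imports Defs "HOL-Library.Function_Algebras" "Jordan_Normal_Form.Determinant"
begin

text \<open>The proof is an energy argument for the error, tested with functions that satisfy the coupling
  condition between bulk and surface, so that the Lagrange multiplier drops out.  The computed bulk error
  \<open>e\<^sub>u\<close> is not such a function: its boundary values come from the extrapolation \<open>2 p\<^sup>n\<^sup>+\<^sup>2 - p\<^sup>n\<^sup>+\<^sup>1\<close> and so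
  miss a second difference of \<open>p\<^sup>n\<^sup>+\<^sup>3\<close>.  The share of the exact solution in it is compensated by adding
  the second difference of the exact \<open>u\<close>, which is of order \<open>\<tau>\<^sup>2\<close> and has the right boundary values because
  the exact solution is coupled at all times.  The share of the surface error \<open>e\<^sub>p\<close> is compensated by
  \<open>s = E P \<nabla>\<^sup>2 e\<^sub>p\<close>, where \<open>P\<close> is the \<open>L\<^sup>2\<close> projection onto the boundary functions and \<open>E\<close> extends boundary
  values by zero at the interior nodes.  As the two difference quotients of the scheme differ by a third
  difference, the corrected error solves the second-order BDF scheme with the perturbations
  \<open>3/(2 \<tau>) (s\<^sup>n\<^sup>+\<^sup>3 - s\<^sup>n\<^sup>+\<^sup>2)\<close> in the mass term and \<open>s\<^sup>n\<^sup>+\<^sup>3\<close> in the stiffness term, up to consistency errors of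
  order \<open>\<tau>\<^sup>2\<close>.

  The method is \<open>G\<close>-stable and dissipates the mass norm of the second difference of the corrected error, in
  particular that of \<open>\<nabla>\<^sup>2 e\<^sub>p\<close>.  Since \<open>E\<close> produces functions on a layer of width \<open>h\<close>, the squares of the mass
  and stiffness norms of \<open>s\<close> are bounded by \<open>C h\<close> and \<open>C / h\<close> times the dissipated quantity.  For small \<open>h\<close> and
  \<open>\<tau> / h\<close> both perturbations can be absorbed, the first one after summation by parts since it
  lacks a factor \<open>\<tau>\<close>: this is \<open>bdf2_energy_estimate\<close>, and \<open>splitting_error_bound\<close> derives the error bound
  from it for abstract forms.

  The powers of \<open>h\<close> come from norm equivalences for nodal coefficients, collected in
  \<open>coefficient_bounds\<close>.  Up to constants, \<open>h\<^sup>d \<bar>a\<bar>\<^sup>2\<close> is comparable with the bulk mass form and bounds \<open>h\<^sup>2\<close> times the stiffness form,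
  while \<open>h\<^sup>d\<^sup>-\<^sup>1 \<bar>c\<bar>\<^sup>2\<close> is bounded by the boundary mass form.  The upper bounds rest on interpolation
  at the principal lattice; the lower ones on the fact that a polynomial keeps half of
  its maximum on a copy of fixed relative size of the element or facet.  The size of the copy of a facet
  is measured by the Hausdorff measure, which \<open>volume_cone_le_hausdorff\<close> bounds below by a volume.
  Finally, \<open>sampled_regularity\<close> bounds the consistency errors by the \<open>H\<^sup>3\<close> norm in time, where the solution has
  only weak derivatives; \<open>difference_quotient_estimates\<close> is its scalar core.\<close>

section \<open>Hausdorff measure\<close>

text \<open>The infimum over covers of mesh \<open>\<delta>\<close>; the Hausdorff outer measure is its supremum over \<open>\<delta>\<close>.\<close>

definition hausdorff_content :: "nat \<Rightarrow> real \<Rightarrow> 'a::euclidean_space set \<Rightarrow> ennreal" where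
  "hausdorff_content s \<delta> A = (INF U \<in> {U :: nat \<Rightarrow> 'a set.
          A \<subseteq> (\<Union>i. U i) \<and> (\<forall>i. bounded (U i) \<and> diameter (U i) \<le> \<delta>)}.
        (\<Sum>i. ennreal (unit_ball_vol (real s) / 2 ^ s * diameter (U i) ^ s)))"

lemma hausdorff_outer_eq_SUP: "hausdorff_outer s A = (SUP \<delta>\<in>{0<..}. hausdorff_content s \<delta> A)"
  unfolding hausdorff_outer_def hausdorff_content_def ..

lemma hausdorff_content_le:
  assumes "A \<subseteq> (\<Union>i. U i)" "\<And>i. bounded (U i)" "\<And>i. diameter (U i) \<le> \<delta>"
  shows "hausdorff_content s \<delta> A \<le> (\<Sum>i. ennreal (unit_ball_vol (real s) / 2 ^ s * diameter (U i) ^ s))"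
  unfolding hausdorff_content_def by (rule INF_lower) (use assms in auto)

lemma hausdorff_content_antimono:
  "\<delta> \<le> \<delta>' \<Longrightarrow> hausdorff_content s \<delta>' A \<le> hausdorff_content s \<delta> A"
  unfolding hausdorff_content_def
  by (rule INF_superset_mono) (auto intro: order_trans)

lemma hausdorff_content_mono:
  "A \<subseteq> B \<Longrightarrow> hausdorff_content s \<delta> A \<le> hausdorff_content s \<delta> B"
  unfolding hausdorff_content_def by (rule INF_superset_mono) auto

lemma hausdorff_content_le_outer:
  "0 < \<delta> \<Longrightarrow> hausdorff_content s \<delta> A \<le> hausdorff_outer s A"
  unfolding hausdorff_outer_eq_SUP by (rule SUP_upper) simp

lemma hausdorff_outer_mono: "A \<subseteq> B \<Longrightarrow> hausdorff_outer s A \<le> hausdorff_outer s B"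
  unfolding hausdorff_outer_eq_SUP by (intro SUP_mono) (auto intro: hausdorff_content_mono)

lemma hausdorff_outer_empty:
  assumes "1 \<le> s" shows "hausdorff_outer s {} = 0"
proof -
  have "hausdorff_content s \<delta> {} = 0" if "0 < \<delta>" for \<delta>
    using hausdorff_content_le[of "{}" "\<lambda>_. {}" \<delta> s] that assms by (auto simp: power_0_left)
  then show ?thesis unfolding hausdorff_outer_eq_SUP by (intro antisym SUP_least) auto
qed

text \<open>Near-optimal covers of the sets \<open>A n\<close> with errors \<open>e / 2\<^sup>n\<^sup>+\<^sup>1\<close> are merged by a pairing of the indices.\<close>

lemma hausdorff_content_UN:
  fixes A :: "nat \<Rightarrow> 'a::euclidean_space set"
  shows "hausdorff_content s \<delta> (\<Union>i. A i) \<le> (\<Sum>i. hausdorff_content s \<delta> (A i))"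
proof (rule ennreal_le_epsilon)
  fix e :: real assume fin: "(\<Sum>i. hausdorff_content s \<delta> (A i)) < top_class.top" and e: "0 < e"
  let ?c = "\<lambda>V. ennreal (unit_ball_vol (real s) / 2 ^ s * diameter V ^ s)"
  have "\<exists>U. A i \<subseteq> (\<Union>j. U j) \<and> (\<forall>j. bounded (U j) \<and> diameter (U j) \<le> \<delta>) \<and>
     (\<Sum>j. ?c (U j)) \<le> hausdorff_content s \<delta> (A i) + ennreal (e * (1/2)^Suc i)" for i
  proof -
    have "hausdorff_content s \<delta> (A i) < top_class.top"
      using fin by (metis ennreal_suminf_lessD)
    then have "hausdorff_content s \<delta> (A i) < hausdorff_content s \<delta> (A i) + ennreal (e * (1/2)^Suc i)"
      using e by (simp add: ennreal_zero_less_mult_iff)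
    then show ?thesis
      unfolding hausdorff_content_def INF_less_iff by (auto intro: less_imp_le)
  qed
  then obtain U where U: "\<And>i. A i \<subseteq> (\<Union>j. U i j)" "\<And>i j. bounded (U i j)"
     "\<And>i j. diameter (U i j) \<le> \<delta>"
     "\<And>i. (\<Sum>j. ?c (U i j)) \<le> hausdorff_content s \<delta> (A i) + ennreal (e * (1/2)^Suc i)"
    by metis
  let ?W = "\<lambda>n. case prod_decode n of (i, j) \<Rightarrow> U i j"
  have "x \<in> (\<Union>n. ?W n)" if x: "x \<in> (\<Union>i. A i)" for x
  proof -
    obtain i j where "x \<in> U i j" using x U(1) by blast
    then show ?thesis by (intro UN_I[of "prod_encode (i, j)"]) auto
  qed
  then have "hausdorff_content s \<delta> (\<Union>i. A i) \<le> (\<Sum>n. ?c (?W n))"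
    by (intro hausdorff_content_le subsetI) (simp_all add: U split: prod.split)
  also have "\<dots> = (\<Sum>n. (\<lambda>(i, j). ?c (U i j)) (prod_decode n))"
    by (intro suminf_cong) (auto split: prod.split)
  also have "\<dots> = (\<Sum>i. \<Sum>j. ?c (U i j))"
    by (rule suminf_ennreal_2dimen) simp
  also have "\<dots> \<le> (\<Sum>i. hausdorff_content s \<delta> (A i) + ennreal (e * (1/2)^Suc i))"
    by (intro suminf_le U) auto
  also have "\<dots> = (\<Sum>i. hausdorff_content s \<delta> (A i)) + (\<Sum>i. ennreal (e * (1/2)^Suc i))"
    by (rule suminf_add[symmetric]) auto
  also have "(\<Sum>i. ennreal (e * (1/2)^Suc i)) = ennreal e"
    using sums_mult[OF power_half_series, of e] e by (intro suminf_ennreal_eq) auto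
  finally show "hausdorff_content s \<delta> (\<Union>i. A i) \<le> (\<Sum>i. hausdorff_content s \<delta> (A i)) + ennreal e" .
qed

lemma hausdorff_outer_UN:
  fixes A :: "nat \<Rightarrow> 'a::euclidean_space set"
  shows "hausdorff_outer s (\<Union>i. A i) \<le> (\<Sum>i. hausdorff_outer s (A i))"
  unfolding hausdorff_outer_eq_SUP[of s "\<Union>i. A i"]
proof (rule SUP_least)
  fix \<delta> :: real assume "\<delta> \<in> {0<..}"
  then show "hausdorff_content s \<delta> (\<Union>i. A i) \<le> (\<Sum>i. hausdorff_outer s (A i))"
    by (intro order_trans[OF hausdorff_content_UN] suminf_le hausdorff_content_le_outer) auto
qed

lemma hausdorff_outer_Un:
  fixes A B :: "'a::euclidean_space set"
  assumes "1 \<le> s"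
  shows "hausdorff_outer s (A \<union> B) \<le> hausdorff_outer s A + hausdorff_outer s B"
proof -
  have "hausdorff_outer s (A \<union> B) = hausdorff_outer s (\<Union>i. binaryset A B i)"
    by (simp add: UN_binaryset_eq)
  also have "\<dots> \<le> (\<Sum>i. hausdorff_outer s (binaryset A B i))" by (rule hausdorff_outer_UN)
  also have "\<dots> = hausdorff_outer s A + hausdorff_outer s B"
    using suminf_binaryset_eq[of "hausdorff_outer s" A B] hausdorff_outer_empty[OF assms] by auto
  finally show ?thesis .
qed

text \<open>A covering set that is smaller than the gap between \<open>A\<close> and \<open>B\<close> meets only one of them, so
  every fine cover of the union splits into a cover of \<open>A\<close> and a cover of \<open>B\<close>.\<close>

lemma hausdorff_outer_separated:
  fixes A B :: "'a::euclidean_space set"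
  assumes s: "1 \<le> s" and r: "0 < r" and sep: "\<And>x y. x \<in> A \<Longrightarrow> y \<in> B \<Longrightarrow> r \<le> dist x y"
  shows "hausdorff_outer s A + hausdorff_outer s B \<le> hausdorff_outer s (A \<union> B)"
proof -
  let ?c = "\<lambda>V::'a set. ennreal (unit_ball_vol (real s) / 2 ^ s * diameter V ^ s)"
  have c0: "?c {} = 0" using s by (simp add: power_0_left)
  have key: "hausdorff_content s \<delta> A + hausdorff_content s \<delta> B \<le> hausdorff_content s \<delta> (A \<union> B)"
    if d: "0 < \<delta>" "\<delta> < r" for \<delta>
    unfolding hausdorff_content_def[of s \<delta> "A \<union> B"]
  proof (rule INF_greatest, clarify)
    fix U :: "nat \<Rightarrow> 'a set"
    assume U: "A \<union> B \<subseteq> (\<Union>i. U i)" "\<forall>i. bounded (U i) \<and> diameter (U i) \<le> \<delta>"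
    let ?V = "\<lambda>S i. if U i \<inter> S = {} then {} else U i"
    have disj: "U i \<inter> A = {} \<or> U i \<inter> B = {}" for i
    proof (rule ccontr)
      assume "\<not> ?thesis"
      then obtain x y where xy: "x \<in> U i" "x \<in> A" "y \<in> U i" "y \<in> B" by blast
      then have "dist x y \<le> diameter (U i)" using U by (intro diameter_bounded_bound) auto
      then show False using U(2) d sep[OF xy(2,4)] by (smt (verit))
    qed
    have "hausdorff_content s \<delta> A + hausdorff_content s \<delta> B \<le> (\<Sum>i. ?c (?V A i)) + (\<Sum>i. ?c (?V B i))"
      by (intro add_mono hausdorff_content_le) (use U d in \<open>auto 4 4 simp: subset_iff\<close>)
    also have "\<dots> = (\<Sum>i. ?c (?V A i) + ?c (?V B i))" by (rule suminf_add) auto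
    also have "\<dots> \<le> (\<Sum>i. ?c (U i))"
    proof (intro suminf_le)
      fix i show "?c (?V A i) + ?c (?V B i) \<le> ?c (U i)"
        using disj[of i] c0 by (cases "U i \<inter> A = {}"; cases "U i \<inter> B = {}") (simp_all del: diameter_empty)
    qed auto
    finally show "hausdorff_content s \<delta> A + hausdorff_content s \<delta> B \<le> (\<Sum>i. ?c (U i))" .
  qed
  have "(SUP \<delta>\<in>{0<..}. hausdorff_content s \<delta> A + hausdorff_content s \<delta> B)
      = hausdorff_outer s A + hausdorff_outer s B"
    unfolding hausdorff_outer_eq_SUP
  proof (rule SUP_add_directed_ennreal)
    fix i j :: real assume "i \<in> {0<..}" "j \<in> {0<..}"
    then show "\<exists>k\<in>{0<..}. hausdorff_content s i A + hausdorff_content s j B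
        \<le> hausdorff_content s k A + hausdorff_content s k B"
      by (intro bexI[of _ "min i j"] add_mono hausdorff_content_antimono) auto
  qed
  moreover have "hausdorff_content s \<delta> A + hausdorff_content s \<delta> B \<le> hausdorff_outer s (A \<union> B)"
    if "0 < \<delta>" for \<delta>
  proof -
    have "hausdorff_content s \<delta> A + hausdorff_content s \<delta> B
        \<le> hausdorff_content s (min \<delta> (r/2)) A + hausdorff_content s (min \<delta> (r/2)) B"
      by (intro add_mono hausdorff_content_antimono) auto
    also have "\<dots> \<le> hausdorff_content s (min \<delta> (r/2)) (A \<union> B)" using that r by (intro key) auto
    also have "\<dots> \<le> hausdorff_outer s (A \<union> B)" using that r by (intro hausdorff_content_le_outer) auto
    finally show ?thesis .
  qed
  ultimately show ?thesis by (metis (no_types, lifting) SUP_least greaterThan_iff)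
qed

text \<open>The classical ring argument: the part of \<open>A\<close> outside a closed set \<open>C\<close> is exhausted by the
  sets \<open>B n\<close> at distance \<open>1 / (n + 1)\<close> from \<open>C\<close>.  Every second one of the rings
  between consecutive \<open>B n\<close> are separated, so their measures form a convergent series, and its
  tail bounds what \<open>B n\<close> misses.\<close>

lemma hausdorff_outer_closed_split:
  fixes A C :: "'a::euclidean_space set"
  assumes s: "1 \<le> s" and C: "closed C"
  shows "hausdorff_outer s (A \<inter> C) + hausdorff_outer s (A - C) \<le> hausdorff_outer s A"
proof (cases "hausdorff_outer s A = top_class.top \<or> C = {}")
  case True
  then show ?thesis using hausdorff_outer_empty[OF s] by auto
next
  case False
  then have fin: "hausdorff_outer s A < top_class.top" and C0: "C \<noteq> {}" by (auto simp: less_top)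
  let ?f = "hausdorff_outer s :: 'a set \<Rightarrow> ennreal"
  define B where "B n = {x \<in> A. 1 / real (n + 1) \<le> infdist x C}" for n
  define R where "R n = B (Suc n) - B n" for n
  have fR: "(\<Sum>j<n. ?f (R (2 * j + p))) \<le> ?f (\<Union>j<n. R (2 * j + p))" for n p
  proof (induction n)
    case 0
    then show ?case by simp
  next
    case (Suc n)
    define r where "r = 1 / real (2 * n + p) - 1 / real (2 * n + p + 1)"
    show ?case
    proof (cases "n = 0")
      case True then show ?thesis by (simp add: lessThan_Suc)
    next
      case False
      then have r: "0 < r" unfolding r_def
        by (simp only: diff_gt_0_iff_gt, intro divide_strict_left_mono) auto
      have "r \<le> dist x y" if x: "x \<in> (\<Union>j<n. R (2 * j + p))" and y: "y \<in> R (2 * n + p)" for x y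
      proof -
        obtain j where j: "j < n" "x \<in> R (2 * j + p)" using x by auto
        have "1 / real (2 * n + p) \<le> 1 / real (2 * j + p + 2)"
          using j by (intro divide_left_mono) auto
        also have "\<dots> \<le> infdist x C" using j by (auto simp: R_def B_def add.commute)
        finally have "1 / real (2 * n + p) \<le> infdist x C" .
        moreover have "infdist y C < 1 / real (2 * n + p + 1)"
          using y by (auto simp: R_def B_def)
        ultimately show ?thesis using infdist_triangle[of x C y] by (simp add: r_def)
      qed
      then have "?f (\<Union>j<n. R (2 * j + p)) + ?f (R (2 * n + p))
          \<le> ?f ((\<Union>j<n. R (2 * j + p)) \<union> R (2 * n + p))"
        by (intro hausdorff_outer_separated[OF s r])
      then have "(\<Sum>j<n. ?f (R (2 * j + p))) + ?f (R (2 * n + p))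
          \<le> ?f ((\<Union>j<n. R (2 * j + p)) \<union> R (2 * n + p))"
        by (rule order_trans[OF add_right_mono[OF Suc]])
      then show ?thesis by (simp add: lessThan_Suc Un_commute add.commute)
    qed
  qed
  have fRA: "(\<Sum>j. ?f (R (2 * j + p))) \<le> ?f A" for p
    by (rule suminf_le_const)
      (simp, rule order_trans[OF fR hausdorff_outer_mono], auto simp: R_def B_def)
  have sumR: "(\<Sum>j. ?f (R j)) < top_class.top"
  proof -
    have "(\<Sum>j<n. ?f (R j)) \<le> ?f A + ?f A" for n
    proof -
      have "(\<Sum>j<n. ?f (R j)) \<le> (\<Sum>j<2*n. ?f (R j))" by (intro sum_mono2) auto
      also have "\<dots> = (\<Sum>j<n. ?f (R (2 * j))) + (\<Sum>j<n. ?f (R (2 * j + 1)))"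
        by (induction n) (auto simp: add_ac)
      also have "\<dots> \<le> ?f A + ?f A"
        using fRA[of 0] fRA[of 1]
        by (intro add_mono; auto intro: order_trans[OF sum_le_suminf])
      finally show ?thesis .
    qed
    then have "(\<Sum>j. ?f (R j)) \<le> ?f A + ?f A" by (intro suminf_le_const) auto
    moreover have "?f A + ?f A < top_class.top" using fin by (auto simp: less_top[symmetric])
    ultimately show ?thesis by (rule le_less_trans)
  qed
  have split: "?f (A \<inter> C) + ?f (B n) \<le> ?f A" for n
  proof -
    have "?f (A \<inter> C) + ?f (B n) \<le> ?f ((A \<inter> C) \<union> B n)"
    proof (rule hausdorff_outer_separated[OF s, of "1 / real (n + 1)"])
      fix x y assume "x \<in> A \<inter> C" "y \<in> B n"
      then show "1 / real (n + 1) \<le> dist x y"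
        using infdist_le[of x C y] by (auto simp: B_def dist_commute)
    qed simp
    also have "\<dots> \<le> ?f A" by (intro hausdorff_outer_mono) (auto simp: B_def)
    finally show ?thesis .
  qed
  have cov: "A - C \<subseteq> B n \<union> (\<Union>j. R (j + n))" for n
  proof
    fix x assume x: "x \<in> A - C"
    then have "0 < infdist x C"
      using C C0 by (simp add: infdist_pos_not_in_closed)
    then obtain m where "1 / real (Suc m) < infdist x C" using nat_approx_posE by metis
    then have ex: "x \<in> B m" using x by (auto simp: B_def)
    define m0 where "m0 = (LEAST m. x \<in> B m)"
    have m0: "x \<in> B m0" unfolding m0_def using ex by (rule LeastI)
    have mono: "B i \<subseteq> B j" if "i \<le> j" for i j
    proof -
      have "1 / real (j + 1) \<le> 1 / real (i + 1)" using that by (intro divide_left_mono) auto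
      then show ?thesis unfolding B_def by (auto simp del: of_nat_add)
    qed
    show "x \<in> B n \<union> (\<Union>j. R (j + n))"
    proof (cases "m0 \<le> n")
      case True then show ?thesis using m0 mono by blast
    next
      case False
      then have "x \<in> R (m0 - 1)" using m0 not_less_Least[of "m0 - 1" "\<lambda>m. x \<in> B m"]
        by (auto simp: R_def m0_def)
      then have "x \<in> R ((m0 - 1 - n) + n)" using False by simp
      then show ?thesis by blast
    qed
  qed
  have "?f (A \<inter> C) + ?f (A - C) \<le> ?f A + ennreal e" if e: "0 < e" for e
  proof -
    have "(\<lambda>n. \<Sum>j. ?f (R (j + n))) \<longlonglongrightarrow> 0"
    proof -
      define g where "g j = enn2real (?f (R j))" for j
      have fg: "?f (R j) = ennreal (g j)" for j
        using fin hausdorff_outer_mono[of "R j" A s] unfolding g_def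
        by (subst ennreal_enn2real) (auto simp: R_def B_def intro: le_less_trans)
      have g0: "0 \<le> g j" for j by (simp add: g_def)
      have sg: "summable g"
        using sumR by (intro summable_suminf_not_top) (auto simp: g0 fg)
      have "(\<Sum>j. ?f (R (j + n))) = ennreal (\<Sum>j. g (j + n))" for n
        unfolding fg using sg g0 by (intro suminf_ennreal2) (auto simp: summable_iff_shift)
      moreover have "(\<lambda>n. ennreal (\<Sum>j. g (j + n))) \<longlonglongrightarrow> ennreal 0"
        by (intro tendsto_ennrealI suminf_exist_split2 sg)
      ultimately show ?thesis by simp
    qed
    then have "eventually (\<lambda>n. (\<Sum>j. ?f (R (j + n))) < ennreal e) sequentially"
      using e by (intro order_tendstoD) auto
    then obtain n where n: "(\<Sum>j. ?f (R (j + n))) < ennreal e"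
      by (auto simp: eventually_sequentially)
    have "?f (A - C) \<le> ?f (B n) + ?f (\<Union>j. R (j + n))"
      by (rule order_trans[OF hausdorff_outer_mono[OF cov] hausdorff_outer_Un[OF s]])
    also have "\<dots> \<le> ?f (B n) + ennreal e"
      using n by (intro add_mono order_trans[OF hausdorff_outer_UN]) auto
    finally have "?f (A \<inter> C) + ?f (A - C) \<le> ?f (A \<inter> C) + (?f (B n) + ennreal e)"
      by (intro add_mono) auto
    also have "\<dots> = (?f (A \<inter> C) + ?f (B n)) + ennreal e" by (rule add.assoc[symmetric])
    also have "\<dots> \<le> ?f A + ennreal e" by (rule add_right_mono[OF split])
    finally show ?thesis .
  qed
  then show ?thesis by (rule ennreal_le_epsilon)
qed

text \<open>Caratheodory's criterion: closed sets split every set additively by the ring argument, and they generate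
  the Borel sets.\<close>

lemma hausdorff_measure_space:
  assumes s: "1 \<le> s"
  shows "measure_space UNIV (sets (borel :: 'a::euclidean_space measure)) (hausdorff_outer s)"
proof -
  let ?f = "hausdorff_outer s :: 'a set \<Rightarrow> ennreal"
  interpret P: sigma_algebra "UNIV :: 'a set" "UNIV :: 'a set set"
    using sigma_algebra_Pow[of "UNIV :: 'a set"] by simp
  let ?L = "lambda_system UNIV UNIV ?f"
  have "outer_measure_space UNIV ?f"
    unfolding outer_measure_space_def positive_def increasing_def countably_subadditive_def
    using hausdorff_outer_empty[OF s] hausdorff_outer_mono hausdorff_outer_UN by auto
  then have ms: "measure_space UNIV ?L ?f" by (rule P.caratheodory_lemma)
  then have L: "sigma_algebra UNIV ?L" by (simp add: measure_space_def)
  have "C \<in> ?L" if "closed C" for C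
  proof -
    have "?f (C \<inter> X) + ?f ((UNIV - C) \<inter> X) = ?f X" for X
    proof (rule antisym)
      show "?f (C \<inter> X) + ?f ((UNIV - C) \<inter> X) \<le> ?f X"
        using hausdorff_outer_closed_split[OF s that, of X]
        by (simp add: Int_commute Diff_eq)
      have "?f X = ?f ((C \<inter> X) \<union> ((UNIV - C) \<inter> X))" by (rule arg_cong[of _ _ ?f]) auto
      then show "?f X \<le> ?f (C \<inter> X) + ?f ((UNIV - C) \<inter> X)"
        using hausdorff_outer_Un[OF s, of "C \<inter> X" "(UNIV - C) \<inter> X"] by simp
    qed
    then show ?thesis by (simp add: lambda_system_def)
  qed
  then have "sets (borel :: 'a measure) \<subseteq> ?L"
    unfolding borel_eq_closed by (simp, intro sigma_algebra.sigma_sets_subset[OF L]) auto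
  then show ?thesis
    using measure_down[OF ms] sets.sigma_algebra_axioms[of "borel :: 'a measure"] by simp
qed

lemma space_hausdorff_measure [simp]: "space (hausdorff_measure s) = UNIV"
  by (simp add: hausdorff_measure_def)

lemma sets_hausdorff_measure [simp, measurable_cong]: "sets (hausdorff_measure s) = sets borel"
  using sets.sigma_sets_eq[of borel] by (simp add: hausdorff_measure_def)

lemma emeasure_hausdorff_measure:
  assumes "1 \<le> s" "A \<in> sets borel"
  shows "emeasure (hausdorff_measure s) A = hausdorff_outer s A"
  using hausdorff_measure_space[OF assms(1)] assms(2)
  unfolding hausdorff_measure_def measure_space_def
  by (intro emeasure_measure_of_sigma) (auto simp: sets.sigma_sets_eq[of borel, simplified])

lemma hausdorff_content_finite_cover:
  fixes G :: "'i \<Rightarrow> 'a::euclidean_space set"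
  assumes s: "1 \<le> s" and J: "finite J" and A: "A \<subseteq> (\<Union>j\<in>J. G j)"
    and G: "\<And>j. j \<in> J \<Longrightarrow> bounded (G j) \<and> diameter (G j) \<le> r" and r: "0 \<le> r" "r \<le> \<delta>"
  shows "hausdorff_content s \<delta> A \<le> ennreal (unit_ball_vol (real s) / 2 ^ s * (real (card J) * r ^ s))"
proof -
  let ?c = "\<lambda>V::'a set. ennreal (unit_ball_vol (real s) / 2 ^ s * diameter V ^ s)"
  have c0: "?c {} = 0" using s by (simp add: power_0_left)
  obtain e where e: "bij_betw e {0..<card J} J" using J ex_bij_betw_nat_finite by blast
  define U where "U i = (if i < card J then G (e i) else {})" for i
  have "hausdorff_content s \<delta> A \<le> (\<Sum>i. ?c (U i))"
  proof (rule hausdorff_content_le)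
    show "A \<subseteq> (\<Union>i. U i)"
    proof
      fix x assume "x \<in> A"
      then obtain j where "j \<in> J" "x \<in> G j" using A by blast
      moreover then obtain i where "i < card J" "j = e i"
        using e by (metis atLeastLessThan_iff bij_betw_def imageE)
      ultimately show "x \<in> (\<Union>i. U i)" by (auto simp: U_def)
    qed
    have eJ: "e i \<in> J" if "i < card J" for i using bij_betwE[OF e] that by auto
    show "bounded (U i)" "diameter (U i) \<le> \<delta>" for i
      using G[OF eJ[of i]] r by (auto simp: U_def)
  qed
  also have "\<dots> = (\<Sum>i<card J. ?c (U i))"
    using c0 by (intro suminf_finite) (auto simp: U_def)
  also have "\<dots> \<le> (\<Sum>i<card J. ennreal (unit_ball_vol (real s) / 2 ^ s * r ^ s))"
    using G e by (intro sum_mono ennreal_leI mult_left_mono power_mono diameter_ge_0)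
      (auto simp: U_def dest!: bij_betwE)
  also have "\<dots> = ennreal (\<Sum>i<card J. unit_ball_vol (real s) / 2 ^ s * r ^ s)"
    using r by (intro sum_ennreal) auto
  finally show ?thesis by (simp add: mult_ac)
qed

text \<open>A simplex with \<open>s + 1\<close> vertices is a Lipschitz image of the cube \<open>[0, 1]\<^sup>s\<close>; the image of a grid of
  mesh \<open>1 / N\<close> covers it by \<open>O(N\<^sup>s)\<close> sets of diameter \<open>O(1 / N)\<close>.\<close>

lemma hausdorff_outer_convex_hull_finite:
  fixes V :: "'a::euclidean_space set"
  assumes s: "1 \<le> s" and V: "finite V" "card V = s + 1"
  shows "hausdorff_outer s (convex hull V) < \<infinity>"
proof -
  obtain a W where aW: "V = insert a W" "a \<notin> W" "finite W" "card W = s"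
    using V by (metis Suc_eq_plus1 card_Suc_eq_finite)
  define L where "L = (\<Sum>w\<in>W. norm (w - a))"
  have L0: "0 \<le> L" by (auto simp: L_def intro: sum_nonneg)
  have bound: "hausdorff_content s \<delta> (convex hull V)
      \<le> ennreal (unit_ball_vol (real s) / 2 ^ s * (2 * L) ^ s)" if d: "0 < \<delta>" for \<delta>
  proof -
    obtain N :: nat where N: "L / \<delta> < real N" using reals_Archimedean2 by blast
    then have N0: "0 < N" using L0 d by (metis divide_nonneg_pos le_less_trans of_nat_0_less_iff)
    have LN: "L / real N \<le> \<delta>" using N N0 d by (simp add: field_simps)
    define J where "J = PiE W (\<lambda>_. {..N})"
    define G where "G j = (\<lambda>t. a + (\<Sum>w\<in>W. t w *\<^sub>R (w - a))) `
        {t. \<forall>w\<in>W. real (j w) / real N \<le> t w \<and> t w \<le> (real (j w) + 1) / real N}" for j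
    have Gd: "norm (x - y) \<le> L / real N" if xy: "x \<in> G j" "y \<in> G j" for x y j
    proof -
      obtain t t' where
        t: "x = a + (\<Sum>w\<in>W. t w *\<^sub>R (w - a))" "\<forall>w\<in>W. real (j w) / real N \<le> t w \<and> t w \<le> (real (j w) + 1) / real N"
        and t': "y = a + (\<Sum>w\<in>W. t' w *\<^sub>R (w - a))" "\<forall>w\<in>W. real (j w) / real N \<le> t' w \<and> t' w \<le> (real (j w) + 1) / real N"
        using xy by (auto simp: G_def)
      have "x - y = (\<Sum>w\<in>W. (t w - t' w) *\<^sub>R (w - a))"
        unfolding t t' by (simp add: sum_subtractf scaleR_left_diff_distrib)
      also have "norm \<dots> \<le> (\<Sum>w\<in>W. (1 / real N) * norm (w - a))"
      proof (intro sum_norm_le)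
        fix w assume w: "w \<in> W"
        have "\<bar>t w - t' w\<bar> \<le> 1 / real N"
          using t(2)[rule_format, OF w] t'(2)[rule_format, OF w] by (simp add: add_divide_distrib abs_le_iff)
        then show "norm ((t w - t' w) *\<^sub>R (w - a)) \<le> (1 / real N) * norm (w - a)"
          unfolding norm_scaleR by (rule mult_right_mono) simp
      qed
      also have "\<dots> = L / real N" by (simp add: L_def sum_divide_distrib)
      finally show ?thesis .
    qed
    have "hausdorff_content s \<delta> (convex hull V)
        \<le> ennreal (unit_ball_vol (real s) / 2 ^ s * (real (card J) * (L / real N) ^ s))"
    proof (rule hausdorff_content_finite_cover[OF s, where G = G])
      show "finite J" using aW by (auto simp: J_def intro: finite_PiE)
      show "bounded (G j) \<and> diameter (G j) \<le> L / real N" for j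
      proof
        show "diameter (G j) \<le> L / real N"
          using Gd L0 N0 by (intro diameter_le) (auto simp: dist_norm)
        show "bounded (G j)"
        proof (cases "G j = {}")
          case False
          then obtain z where "z \<in> G j" by blast
          then show ?thesis using Gd[of z j] unfolding bounded_def
            by (intro exI[of _ z] exI[of _ "L / real N"]) (auto simp: dist_norm)
        qed simp
      qed
      show "convex hull V \<subseteq> (\<Union>j\<in>J. G j)"
      proof
        fix x assume "x \<in> convex hull V"
        then obtain u where u: "\<forall>v\<in>V. 0 \<le> u v" "sum u V = 1" "(\<Sum>v\<in>V. u v *\<^sub>R v) = x"
          using V(1) by (auto simp: convex_hull_finite)
        have ua: "u a = 1 - sum u W" using u(2) aW by simp
        have "x = a + (\<Sum>w\<in>W. u w *\<^sub>R (w - a))"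
          unfolding u(3)[symmetric] using aW ua
          by (simp add: scaleR_right_diff_distrib sum_subtractf scaleR_left_diff_distrib scaleR_left.sum)
        moreover have le1: "u w \<le> 1" if "w \<in> W" for w
          using u(1,2) aW that member_le_sum[of w V u] by auto
        define j where "j = restrict (\<lambda>w. nat \<lfloor>real N * u w\<rfloor>) W"
        have "j \<in> J" unfolding J_def j_def
        proof (rule restrict_PiE_iff[THEN iffD2], intro ballI)
          fix w assume w: "w \<in> W"
          then have "real N * u w \<le> real N" using le1[OF w] N0 by (simp add: mult_left_le)
          then show "nat \<lfloor>real N * u w\<rfloor> \<in> {..N}" by (simp add: nat_le_iff floor_le_iff)
        qed
        moreover have "real (j w) / real N \<le> u w \<and> u w \<le> (real (j w) + 1) / real N" if w: "w \<in> W" for w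
        proof -
          have "0 \<le> real N * u w" using u(1) aW w by auto
          then have "real (j w) \<le> real N * u w \<and> real N * u w \<le> real (j w) + 1"
            using w by (simp add: j_def)
          then show ?thesis using N0 by (simp add: field_simps)
        qed
        ultimately show "x \<in> (\<Union>j\<in>J. G j)" unfolding G_def by blast
      qed
    qed (use L0 LN N0 in auto)
    also have "\<dots> \<le> ennreal (unit_ball_vol (real s) / 2 ^ s * (2 * L) ^ s)"
    proof (intro ennreal_leI mult_left_mono)
      have "real (card J) * (L / real N) ^ s = ((real N + 1) * (L / real N)) ^ s"
        using aW by (simp add: J_def card_PiE power_mult_distrib add.commute power_divide)
      also have "\<dots> \<le> (2 * L) ^ s"
      proof (intro power_mono)
        have "(real N + 1) * L \<le> (2 * real N) * L" using N0 L0 by (intro mult_right_mono) auto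
        then show "(real N + 1) * (L / real N) \<le> 2 * L" using N0 by (simp add: field_simps)
      qed (use L0 in auto)
      finally show "real (card J) * (L / real N) ^ s \<le> (2 * L) ^ s" .
    qed auto
    finally show ?thesis .
  qed
  then have "hausdorff_outer s (convex hull V) \<le> ennreal (unit_ball_vol (real s) / 2 ^ s * (2 * L) ^ s)"
    unfolding hausdorff_outer_eq_SUP by (intro SUP_least) auto
  then show ?thesis by (simp add: le_less_trans)
qed

text \<open>The cone with apex \<open>a\<close> over a set of diameter \<open>r\<close> lies in the \<open>r\<close>-neighbourhood of a segment of
  length at most \<open>h\<close>, which about \<open>h / r\<close> balls of radius \<open>2 r\<close> cover.  Hence its volume is at most
  of order \<open>h r\<^sup>d\<^sup>-\<^sup>1\<close>.\<close>

lemma cone_small_volume: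
  fixes A :: "'a::euclidean_space set" and a :: 'a
  assumes r: "0 < r" "r \<le> h" and A: "\<And>y. y \<in> A \<Longrightarrow> dist a y \<le> h"
    and diam: "\<And>x y. x \<in> A \<Longrightarrow> y \<in> A \<Longrightarrow> dist x y \<le> r"
  shows "\<exists>B\<in>sets borel. (\<forall>y\<in>A. closed_segment y a \<subseteq> B) \<and>
    emeasure lborel B \<le> ennreal (3 * 2 ^ DIM('a) * unit_ball_vol (real DIM('a)) * h * r ^ (DIM('a) - 1))"
proof (cases "A = {}")
  case True
  then show ?thesis by (intro bexI[of _ "{}"]) auto
next
  case False
  then obtain y0 where y0: "y0 \<in> A" by blast
  let ?d = "DIM('a)"
  define M where "M = nat \<lceil>h / r\<rceil>"
  have hr: "1 \<le> h / r" using r by simp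
  have M: "h / r \<le> real M" "real M \<le> h / r + 1" "0 < M"
    using hr unfolding M_def by linarith+
  define c where "c m = y0 + (real m / real M) *\<^sub>R (a - y0)" for m
  define B where "B = (\<Union>m\<le>M. cball (c m) (2 * r))"
  have "closed_segment y a \<subseteq> B" if y: "y \<in> A" for y
  proof
    fix z assume "z \<in> closed_segment y a"
    then obtain t where t: "0 \<le> t" "t \<le> 1" "z = (1 - t) *\<^sub>R y + t *\<^sub>R a" by (auto simp: in_segment)
    define m where "m = nat \<lfloor>t * real M\<rfloor>"
    have m: "real m \<le> t * real M" "t * real M \<le> real m + 1"
      using t unfolding m_def by (auto simp: le_floor_iff intro: less_imp_le)
    have "m \<le> M"
    proof -
      have "t * real M \<le> real M" using t by (simp add: mult_left_le_one_le)
      then show ?thesis using m by linarith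
    qed
    moreover have "dist z (c m) \<le> 2 * r"
    proof -
      have "z - c m = (1 - t) *\<^sub>R (y - y0) + (t - real m / real M) *\<^sub>R (a - y0)"
        by (simp add: t c_def algebra_simps)
      then have "norm (z - c m) \<le> (1 - t) * norm (y - y0) + \<bar>t - real m / real M\<bar> * norm (a - y0)"
        by (metis (no_types, lifting) norm_triangle_ineq norm_scaleR abs_of_nonneg diff_ge_0_iff_ge t(2))
      also have "\<dots> \<le> 1 * r + (1 / real M) * h"
      proof (intro add_mono mult_mono)
        show "norm (y - y0) \<le> r" using diam[OF y y0] by (simp add: dist_norm)
        show "norm (a - y0) \<le> h" using A[OF y0] by (simp add: dist_norm)
        have "0 \<le> t - real m / real M" "t - real m / real M \<le> 1 / real M"
        proof -
          have "t - real m / real M = (t * real M - real m) / real M" using M by (simp add: field_simps)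
          then show "0 \<le> t - real m / real M" "t - real m / real M \<le> 1 / real M"
            using m M by (simp_all add: divide_right_mono)
        qed
        then show "\<bar>t - real m / real M\<bar> \<le> 1 / real M" by simp
      qed (use t in auto)
      also have "(1 / real M) * h \<le> r" using M r by (simp add: field_simps)
      finally show ?thesis by (simp add: dist_norm)
    qed
    ultimately show "z \<in> B" by (auto simp: B_def dist_commute)
  qed
  moreover have "B \<in> sets borel" by (simp add: B_def)
  moreover have "emeasure lborel B \<le> ennreal (3 * 2 ^ ?d * unit_ball_vol (real ?d) * h * r ^ (?d - 1))"
  proof -
    have "emeasure lborel B \<le> (\<Sum>m\<le>M. emeasure lborel (cball (c m) (2 * r)))"
      unfolding B_def by (intro emeasure_subadditive_finite) auto
    also have "\<dots> = ennreal (\<Sum>m\<le>M. unit_ball_vol (real ?d) * (2 * r) ^ ?d)"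
      using r by (simp add: emeasure_cball sum_ennreal del: sum_constant)
    also have "\<dots> \<le> ennreal (3 * 2 ^ ?d * unit_ball_vol (real ?d) * h * r ^ (?d - 1))"
    proof (rule ennreal_leI)
      have rd: "r ^ ?d = r * r ^ (?d - 1)" by (metis DIM_positive power_eq_if not_gr_zero)
      have "real (Suc M) * r \<le> (3 * (h / r)) * r"
      proof (intro mult_right_mono)
        show "real (Suc M) \<le> 3 * (h / r)" using M(2) hr unfolding of_nat_Suc by linarith
      qed (use r in auto)
      then have "real (Suc M) * r \<le> 3 * h" using r by simp
      then have "real (Suc M) * r * (unit_ball_vol (real ?d) * 2 ^ ?d * r ^ (?d - 1))
          \<le> 3 * h * (unit_ball_vol (real ?d) * 2 ^ ?d * r ^ (?d - 1))"
        using r by (intro mult_right_mono) auto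
      then show "(\<Sum>m\<le>M. unit_ball_vol (real ?d) * (2 * r) ^ ?d)
          \<le> 3 * 2 ^ ?d * unit_ball_vol (real ?d) * h * r ^ (?d - 1)"
        by (simp add: power_mult_distrib rd mult_ac)
    qed
    finally show ?thesis .
  qed
  ultimately show ?thesis by blast
qed

text \<open>Lower bounds for the surface measure come from volumes: if the segments from \<open>A\<close> to \<open>a\<close> fill \<open>T\<close>,
  then the cones over the sets of any cover of \<open>A\<close> cover \<open>T\<close>.\<close>

lemma volume_cone_le_hausdorff:
  assumes d2: "2 \<le> DIM('a::euclidean_space)"
  shows "\<exists>K>0. \<forall>(A :: 'a set) a h T. 0 < h \<and> (\<forall>y\<in>A. dist a y \<le> h) \<and> T \<in> sets borel \<and>
      T \<subseteq> (\<Union>y\<in>A. closed_segment y a) \<longrightarrow>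
      emeasure lborel T \<le> ennreal (K * h) * hausdorff_outer (DIM('a) - 1) A"
proof -
  let ?d = "DIM('a)" and ?s = "DIM('a) - 1"
  define K0 where "K0 = 3 * 2 ^ ?d * unit_ball_vol (real ?d)"
  define c where "c = unit_ball_vol (real ?s) / 2 ^ ?s"
  have K0: "0 < K0" and c: "0 < c" by (auto simp: K0_def c_def)
  have "emeasure lborel T \<le> ennreal (K0 / c * h) * hausdorff_outer ?s A"
    if h: "0 < h" and A: "\<forall>y\<in>A. dist a y \<le> h" and T: "T \<in> sets borel" "T \<subseteq> (\<Union>y\<in>A. closed_segment y a)"
    for A :: "'a set" and a h T
  proof -
    have cone: "\<exists>B\<in>sets borel. (\<forall>y\<in>A \<inter> U. closed_segment y a \<subseteq> B) \<and>
        emeasure lborel B \<le> ennreal (K0 * h * diameter U ^ ?s)"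
      if U: "bounded U" "diameter U \<le> h" for U
    proof (cases "diameter U = 0")
      case False
      then have "0 < diameter U" using diameter_ge_0[OF U(1)] by simp
      then show ?thesis
        using cone_small_volume[of "diameter U" h "A \<inter> U" a] U A diameter_bounded_bound[OF U(1)]
        unfolding K0_def by blast
    next
      case True
      show ?thesis
      proof (cases "A \<inter> U = {}")
        case True then show ?thesis by (intro bexI[of _ "{}"]) auto
      next
        case False
        then obtain y0 where y0: "y0 \<in> A" "y0 \<in> U" by blast
        have single: "y = y0" if "y \<in> U" for y
          using diameter_bounded_bound[OF U(1) that y0(2)] True by simp
        have "emeasure lborel (closed_segment y0 a) \<le> ennreal e" if e: "0 < e" for e
        proof -
          define r where "r = min (min h 1) (e / (K0 * h))"
          have r: "0 < r" "r \<le> h" using h e K0 by (auto simp: r_def)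
          obtain B where B: "B \<in> sets borel" "closed_segment y0 a \<subseteq> B"
            "emeasure lborel B \<le> ennreal (K0 * h * r ^ ?s)"
            using cone_small_volume[OF r, of "{y0}" a] A y0 r unfolding K0_def by auto
          have "r ^ ?s \<le> r"
            using r d2 power_decreasing[of 1 ?s r] by (auto simp: r_def)
          then have "K0 * h * r ^ ?s \<le> K0 * h * (e / (K0 * h))"
            using K0 h by (intro mult_left_mono) (auto simp: r_def)
          then have "K0 * h * r ^ ?s \<le> e" using K0 h by simp
          then show ?thesis
            using B by (intro order_trans[OF emeasure_mono[OF B(2)]] order_trans[OF B(3)] ennreal_leI) auto
        qed
        then have "emeasure lborel (closed_segment y0 a) = 0"
          by (metis ennreal_le_epsilon add_0 le_zero_eq)
        then show ?thesis using single by (intro bexI[of _ "closed_segment y0 a"]) auto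
      qed
    qed
    have Kh: "0 < K0 / c * h" using K0 c h by simp
    have inv: "ennreal (1 / (K0 / c * h)) * (ennreal (K0 / c * h) * X) = X"
        "ennreal (K0 / c * h) * (ennreal (1 / (K0 / c * h)) * X) = X" for X
    proof -
      have "ennreal (1 / (K0 / c * h)) * ennreal (K0 / c * h) = 1"
        using K0 c h by (subst ennreal_mult[symmetric]) simp_all
      then show "ennreal (1 / (K0 / c * h)) * (ennreal (K0 / c * h) * X) = X"
        "ennreal (K0 / c * h) * (ennreal (1 / (K0 / c * h)) * X) = X"
        unfolding mult.assoc[symmetric] mult.commute[of "ennreal (K0 / c * h)" "ennreal (1 / (K0 / c * h))"]
        by simp_all
    qed
    have "ennreal (1 / (K0 / c * h)) * emeasure lborel T \<le> hausdorff_content ?s h A"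
      unfolding hausdorff_content_def
    proof (rule INF_greatest)
      fix U :: "nat \<Rightarrow> 'a set"
      assume "U \<in> {U. A \<subseteq> (\<Union>i. U i) \<and> (\<forall>i. bounded (U i) \<and> diameter (U i) \<le> h)}"
      then have U: "A \<subseteq> (\<Union>i. U i)" "\<And>i. bounded (U i)" "\<And>i. diameter (U i) \<le> h" by auto
      obtain B where B: "\<And>i. B i \<in> sets borel" "\<And>i y. y \<in> A \<inter> U i \<Longrightarrow> closed_segment y a \<subseteq> B i"
        "\<And>i. emeasure lborel (B i) \<le> ennreal (K0 * h * diameter (U i) ^ ?s)"
        using cone[OF U(2,3)] by metis
      have "T \<subseteq> (\<Union>i. B i)" using T(2) U(1) B(2) by fastforce
      then have "emeasure lborel T \<le> emeasure lborel (\<Union>i. B i)" using B by (intro emeasure_mono) auto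
      also have "\<dots> \<le> (\<Sum>i. emeasure lborel (B i))" using B by (intro emeasure_subadditive_countably) auto
      also have "\<dots> \<le> (\<Sum>i. ennreal (K0 / c * h) * ennreal (c * diameter (U i) ^ ?s))"
        using B(3) c h K0 diameter_ge_0[OF U(2)]
        by (intro suminf_le) (auto simp: ennreal_mult[symmetric] mult.assoc)
      also have "\<dots> = ennreal (K0 / c * h) * (\<Sum>i. ennreal (c * diameter (U i) ^ ?s))" by simp
      finally have "ennreal (1 / (K0 / c * h)) * emeasure lborel T
          \<le> ennreal (1 / (K0 / c * h)) * (ennreal (K0 / c * h) * (\<Sum>i. ennreal (c * diameter (U i) ^ ?s)))"
        by (rule mult_left_mono) simp
      then show "ennreal (1 / (K0 / c * h)) * emeasure lborel T \<le>
          (\<Sum>i. ennreal (unit_ball_vol (real ?s) / 2 ^ ?s * diameter (U i) ^ ?s))"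
        unfolding inv by (simp add: c_def)
    qed
    then have "emeasure lborel T \<le> ennreal (K0 / c * h) * hausdorff_content ?s h A"
      by (subst inv(2)[of "emeasure lborel T", symmetric]) (rule mult_left_mono, simp_all)
    also have "\<dots> \<le> ennreal (K0 / c * h) * hausdorff_outer ?s A"
      using h by (intro mult_left_mono hausdorff_content_le_outer) auto
    finally show ?thesis .
  qed
  then show ?thesis using K0 c by (intro exI[of _ "K0 / c"]) auto
qed

section \<open>Polynomials on simplices\<close>

text \<open>Barycentric coordinates at the lattice nodes are \<open>m / n\<close> for these \<open>m\<close>.\<close>

definition multi_indices :: "'i set \<Rightarrow> nat \<Rightarrow> ('i \<Rightarrow> nat) set" where
  "multi_indices I n = {m. (\<forall>i. i \<notin> I \<longrightarrow> m i = 0) \<and> sum m I = n}"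

lemma finite_multi_indices: "finite I \<Longrightarrow> finite (multi_indices I n)"
proof -
  assume I: "finite I"
  have "multi_indices I n \<subseteq> {m. \<forall>i. (i \<in> I \<longrightarrow> m i \<in> {..n}) \<and> (i \<notin> I \<longrightarrow> m i = 0)}"
    using I by (auto simp: multi_indices_def member_le_sum)
  moreover have "finite {m. \<forall>i. (i \<in> I \<longrightarrow> m i \<in> {..n}) \<and> (i \<notin> I \<longrightarrow> m i = (0::nat))}"
    using I by (intro finite_set_of_finite_funs) auto
  ultimately show ?thesis by (rule finite_subset)
qed

lemma card_multi_indices_le: "finite I \<Longrightarrow> card (multi_indices I n) \<le> (n + 1) ^ card I"
proof -
  assume I: "finite I"
  have "card (multi_indices I n) \<le> card (PiE I (\<lambda>_. {..n}))"
  proof (rule card_inj_on_le[where f = "\<lambda>m. restrict m I"])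
    show "inj_on (\<lambda>m. restrict m I) (multi_indices I n)"
    proof (rule inj_onI, rule ext)
      fix m m' i assume mm: "m \<in> multi_indices I n" "m' \<in> multi_indices I n" "restrict m I = restrict m' I"
      show "m i = m' i" using mm by (cases "i \<in> I") (auto simp: multi_indices_def dest: fun_cong[of _ _ i])
    qed
    show "(\<lambda>m. restrict m I) ` multi_indices I n \<subseteq> PiE I (\<lambda>_. {..n})"
      using I by (auto simp: multi_indices_def member_le_sum)
    show "finite (PiE I (\<lambda>_. {..n}))" using I by (intro finite_PiE) auto
  qed
  then show ?thesis using I by (simp add: card_PiE)
qed

lemma sum_multi_indices_insert:
  fixes f :: "('i \<Rightarrow> nat) \<Rightarrow> real"
  assumes I: "finite I" "a \<notin> I"
  shows "(\<Sum>m\<in>multi_indices (insert a I) n. f m)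
    = (\<Sum>j\<le>n. \<Sum>m\<in>multi_indices I (n - j). f (m(a := j)))"
proof -
  have "(\<Sum>m\<in>multi_indices (insert a I) n. f m)
      = (\<Sum>p\<in>(SIGMA j:{..n}. multi_indices I (n - j)). f ((snd p)(a := fst p)))"
  proof (rule sum.reindex_bij_witness[where i = "\<lambda>p. (snd p)(a := fst p)" and j = "\<lambda>m. (m a, m(a := 0))"])
    fix m assume m: "m \<in> multi_indices (insert a I) n"
    have "sum (m(a := 0)) I = sum m I" using I by (intro sum.cong) auto
    then show "(m a, m(a := 0)) \<in> (SIGMA j:{..n}. multi_indices I (n - j))"
      using m I by (auto simp: multi_indices_def)
  next
    fix p assume p: "p \<in> (SIGMA j:{..n}. multi_indices I (n - j))"
    have "sum ((snd p)(a := fst p)) I = sum (snd p) I" using I by (intro sum.cong) auto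
    then show "(snd p)(a := fst p) \<in> multi_indices (insert a I) n"
      using p I by (auto simp: multi_indices_def)
    have "snd p a = 0" using p I by (auto simp: multi_indices_def)
    then show "(((snd p)(a := fst p)) a, ((snd p)(a := fst p))(a := 0)) = p"
      by (cases p) (auto simp: fun_eq_iff)
  qed auto
  also have "\<dots> = (\<Sum>j\<le>n. \<Sum>m\<in>multi_indices I (n - j). f (m(a := j)))"
    using I by (subst sum.Sigma) (auto simp: finite_multi_indices split_def)
  finally show ?thesis .
qed

text \<open>A Vandermonde convolution in several variables: the trinomial revision
  \<open>(x choose m) (m choose r) = (x choose r) (x - r choose m - r)\<close> reduces it to the classical one.\<close>

lemma multi_Vandermonde:
  fixes x :: "'i \<Rightarrow> real" and r :: "'i \<Rightarrow> nat"
  assumes "finite I"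
  shows "(\<Sum>m\<in>multi_indices I n. \<Prod>i\<in>I. (real (m i) gchoose r i) * (x i gchoose m i))
    = (if sum r I \<le> n then (\<Prod>i\<in>I. x i gchoose r i) * ((sum x I - real (sum r I)) gchoose (n - sum r I)) else 0)"
  using assms
proof (induction I arbitrary: n rule: finite_induct)
  case empty
  have "multi_indices ({} :: 'i set) n = (if n = 0 then {\<lambda>_. 0 :: nat} else {})" for n
    by (auto simp: multi_indices_def)
  then show ?case by (auto simp: gbinomial_0_left)
next
  case (insert a I)
  let ?R = "sum r I" and ?X = "sum x I" and ?P = "\<Prod>i\<in>I. x i gchoose r i"
  have "(\<Sum>m\<in>multi_indices (insert a I) n. \<Prod>i\<in>insert a I. (real (m i) gchoose r i) * (x i gchoose m i))
      = (\<Sum>j\<le>n. \<Sum>m\<in>multi_indices I (n - j). ((real j gchoose r a) * (x a gchoose j)) *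
          (\<Prod>i\<in>I. (real (m i) gchoose r i) * (x i gchoose m i)))"
    unfolding sum_multi_indices_insert[OF insert.hyps]
  proof (intro sum.cong refl)
    fix j m
    have "(\<Prod>i\<in>I. (real ((m(a := j)) i) gchoose r i) * (x i gchoose (m(a := j)) i))
        = (\<Prod>i\<in>I. (real (m i) gchoose r i) * (x i gchoose m i))"
      using insert.hyps by (intro prod.cong) auto
    then show "(\<Prod>i\<in>insert a I. (real ((m(a := j)) i) gchoose r i) * (x i gchoose (m(a := j)) i))
        = ((real j gchoose r a) * (x a gchoose j)) * (\<Prod>i\<in>I. (real (m i) gchoose r i) * (x i gchoose m i))"
      using insert.hyps by simp
  qed
  also have "\<dots> = (\<Sum>j\<le>n. ((real j gchoose r a) * (x a gchoose j)) *
      (if ?R \<le> n - j then ?P * ((?X - real ?R) gchoose (n - j - ?R)) else 0))"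
    unfolding sum_distrib_left[symmetric] insert.IH ..
  also have "\<dots> = (\<Sum>j\<in>{j. r a \<le> j \<and> j + ?R \<le> n}. (x a gchoose r a) * ((x a - real (r a)) gchoose (j - r a)) *
      (?P * ((?X - real ?R) gchoose (n - j - ?R))))"
  proof (rule sum.mono_neutral_cong_right)
    show "{j. r a \<le> j \<and> j + ?R \<le> n} \<subseteq> {..n}" by auto
    show "\<forall>j\<in>{..n} - {j. r a \<le> j \<and> j + ?R \<le> n}. ((real j gchoose r a) * (x a gchoose j)) *
      (if ?R \<le> n - j then ?P * ((?X - real ?R) gchoose (n - j - ?R)) else 0) = 0"
    proof
      fix j assume j: "j \<in> {..n} - {j. r a \<le> j \<and> j + ?R \<le> n}"
      have "real j gchoose r a = 0" if "j < r a"
        using that by (simp add: binomial_gbinomial[symmetric])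
      then show "((real j gchoose r a) * (x a gchoose j)) *
        (if ?R \<le> n - j then ?P * ((?X - real ?R) gchoose (n - j - ?R)) else 0) = 0"
        using j by (cases "j < r a") auto
    qed
    fix j assume j: "j \<in> {j. r a \<le> j \<and> j + ?R \<le> n}"
    then have "(real j gchoose r a) * (x a gchoose j) = (x a gchoose r a) * ((x a - real (r a)) gchoose (j - r a))"
      using gbinomial_trinomial_revision[of "r a" j "x a"] by (simp add: mult.commute)
    then show "((real j gchoose r a) * (x a gchoose j)) *
        (if ?R \<le> n - j then ?P * ((?X - real ?R) gchoose (n - j - ?R)) else 0)
      = (x a gchoose r a) * ((x a - real (r a)) gchoose (j - r a)) * (?P * ((?X - real ?R) gchoose (n - j - ?R)))"
      using j by auto
  qed auto
  also have "\<dots> = (if r a + ?R \<le> n then (x a gchoose r a) * ?P *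
      ((x a + ?X - real (r a + ?R)) gchoose (n - (r a + ?R))) else 0)"
  proof (cases "r a + ?R \<le> n")
    case True
    define N where "N = n - (r a + ?R)"
    have "(\<Sum>j\<in>{j. r a \<le> j \<and> j + ?R \<le> n}. (x a gchoose r a) * ((x a - real (r a)) gchoose (j - r a)) *
          (?P * ((?X - real ?R) gchoose (n - j - ?R))))
        = (\<Sum>i\<in>{0..N}. (x a gchoose r a) * ?P * (((x a - real (r a)) gchoose i) * ((?X - real ?R) gchoose (N - i))))"
      using True by (intro sum.reindex_bij_witness[where i = "\<lambda>i. i + r a" and j = "\<lambda>j. j - r a"])
        (auto simp: N_def mult_ac diff_diff_left add_ac)
    also have "\<dots> = (x a gchoose r a) * ?P * (((x a - real (r a)) + (?X - real ?R)) gchoose N)"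
      by (simp only: sum_distrib_left[symmetric] gbinomial_Vandermonde)
    finally show ?thesis using True by (simp add: N_def algebra_simps)
  next
    case False
    then have e: "{j. r a \<le> j \<and> j + ?R \<le> n} = {}" by auto
    show ?thesis unfolding e using False by simp
  qed
  finally show ?case using insert.hyps by simp
qed

text \<open>Multiplication with a coordinate stays in the span and raises the degree by one, so all polynomials in
  \<open>x\<close> are reached.\<close>

inductive newton_span :: "'i set \<Rightarrow> nat \<Rightarrow> (('i \<Rightarrow> real) \<Rightarrow> real) \<Rightarrow> bool" for I where
  basis: "sum r I \<le> j \<Longrightarrow> newton_span I j (\<lambda>x. \<Prod>i\<in>I. x i gchoose r i)"
| add: "newton_span I j f \<Longrightarrow> newton_span I j g \<Longrightarrow> newton_span I j (\<lambda>x. f x + g x)"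
| scale: "newton_span I j f \<Longrightarrow> newton_span I j (\<lambda>x. c * f x)"

lemma newton_span_mono: "newton_span I j f \<Longrightarrow> j \<le> j' \<Longrightarrow> newton_span I j' f"
  by (induction rule: newton_span.induct) (auto intro: newton_span.intros)

lemma newton_span_sum:
  assumes "finite A" "\<And>a. a \<in> A \<Longrightarrow> newton_span I j (f a)"
  shows "newton_span I j (\<lambda>x. \<Sum>a\<in>A. f a x)"
  using assms
proof (induction A rule: finite_induct)
  case empty
  have "newton_span I 0 (\<lambda>x. \<Prod>i\<in>I. x i gchoose 0)" by (rule newton_span.basis) simp
  then have "newton_span I j (\<lambda>x. 0 * (\<Prod>i\<in>I. x i gchoose 0))" by (intro newton_span.scale) (rule newton_span_mono, auto)
  then show ?case by simp
qed (auto intro: newton_span.add)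

lemma newton_span_mult_coordinate:
  assumes f: "newton_span I j f" and i: "finite I" "i \<in> I"
  shows "newton_span I (Suc j) (\<lambda>x. x i * f x)"
  using f
proof (induction rule: newton_span.induct)
  case (basis r j)
  \<comment> \<open>\<open>x (x choose r) = (r + 1) (x choose r + 1) + r (x choose r)\<close>\<close>
  have "x i * (\<Prod>l\<in>I. x l gchoose r l) = (real (r i) + 1) * (\<Prod>l\<in>I. x l gchoose (r(i := Suc (r i))) l)
      + real (r i) * (\<Prod>l\<in>I. x l gchoose r l)" for x :: "'a \<Rightarrow> real"
  proof -
    have "(\<Prod>l\<in>I - {i}. x l gchoose (r(i := Suc (r i))) l) = (\<Prod>l\<in>I - {i}. x l gchoose r l)"
      by (intro prod.cong) auto
    moreover have "x i * (x i gchoose r i) = (real (r i) + 1) * (x i gchoose Suc (r i)) + real (r i) * (x i gchoose r i)"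
      using gbinomial_mult_1[of "x i" "r i"] by (simp add: algebra_simps)
    ultimately show ?thesis using i
      by (simp add: prod.remove[OF i] mult.assoc[symmetric] distrib_right[symmetric])
  qed
  moreover have "sum (r(i := Suc (r i))) I = Suc (sum r I)"
  proof -
    have "sum (r(i := Suc (r i))) (I - {i}) = sum r (I - {i})" by (intro sum.cong) auto
    then show ?thesis using i by (simp add: sum.remove[OF i])
  qed
  ultimately show ?case
    using basis by (simp only:) (intro newton_span.add newton_span.scale newton_span.basis; simp)
next
  case (add j f g)
  then show ?case by (simp add: distrib_left newton_span.add)
next
  case (scale j f c)
  then show ?case using newton_span.scale[OF scale.IH, of c] by (simp add: mult.left_commute)
qed

lemma newton_span_mult_linear:
  assumes f: "newton_span I j f" and I: "finite I"
  shows "newton_span I (Suc j) (\<lambda>x. (\<Sum>i\<in>I. x i * c i) * f x)"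
proof -
  have "newton_span I (Suc j) (\<lambda>x. \<Sum>i\<in>I. c i * (x i * f x))"
    by (intro newton_span_sum I newton_span.scale newton_span_mult_coordinate[OF f I])
  then show ?thesis by (simp add: sum_distrib_left sum_distrib_right mult_ac)
qed

text \<open>On the simplex \<open>\<Sum> x = k\<close> of scaled coordinates the binomials of lower degree are combinations of those
  of degree \<open>k\<close> by the Vandermonde convolution.\<close>

lemma newton_span_interpolation:
  assumes "newton_span I k f" "finite I" "sum x I = real k"
  shows "f x = (\<Sum>m\<in>multi_indices I k. f (\<lambda>i. real (m i)) * (\<Prod>i\<in>I. x i gchoose m i))"
  using assms
proof (induction rule: newton_span.induct)
  case (basis r j)
  have "(\<Sum>m\<in>multi_indices I j. (\<Prod>i\<in>I. real (m i) gchoose r i) * (\<Prod>i\<in>I. x i gchoose m i))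
      = (\<Prod>i\<in>I. x i gchoose r i) * ((real j - real (sum r I)) gchoose (j - sum r I))"
    using multi_Vandermonde[OF basis.prems(1), of r x j] basis by (simp add: prod.distrib)
  also have "(real j - real (sum r I)) gchoose (j - sum r I) = 1"
  proof -
    have "real j - real (sum r I) = real (j - sum r I)" using basis.hyps by (rule of_nat_diff[symmetric])
    then show ?thesis by (simp only: binomial_gbinomial[symmetric] binomial_n_n of_nat_1)
  qed
  finally show ?case by simp
qed (simp_all add: sum.distrib sum_distrib_left algebra_simps)

lemma newton_span_monomial:
  assumes I: "finite I" and M: "finite M"
  shows "newton_span I (sum e M) (\<lambda>x. \<Prod>b\<in>M. (\<Sum>i\<in>I. x i * c b i) ^ e b)"
  using M
proof (induction M rule: finite_induct)
  case empty
  have "newton_span I 0 (\<lambda>x. \<Prod>i\<in>I. x i gchoose 0)" by (rule newton_span.basis) simp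
  then show ?case by simp
next
  case (insert b M)
  have "newton_span I (n + sum e M) (\<lambda>x. (\<Sum>i\<in>I. x i * c b i) ^ n * (\<Prod>b\<in>M. (\<Sum>i\<in>I. x i * c b i) ^ e b))" for n
  proof (induction n)
    case 0
    then show ?case using insert.IH by simp
  next
    case (Suc n)
    then show ?case using newton_span_mult_linear[OF Suc I, of "c b"] by (simp add: mult.assoc)
  qed
  then show ?case using insert.hyps by simp
qed

text \<open>In barycentric coordinates, the values at the lattice of a (possibly degenerate) simplex are the
  coefficients with respect to the products of binomials of total degree \<open>k\<close>.  The coordinates \<open>\<mu>\<close> may be negative.\<close>

theorem lagrange_interpolation:
  fixes v :: "'a::euclidean_space \<Rightarrow> real" and a :: "'i \<Rightarrow> 'a"
  assumes v: "v \<in> polynomials_le k" and k: "1 \<le> k" and I: "finite I" and l: "sum \<mu> I = 1"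
  shows "v (\<Sum>i\<in>I. \<mu> i *\<^sub>R a i) = (\<Sum>m\<in>multi_indices I k.
     v (\<Sum>i\<in>I. (real (m i) / real k) *\<^sub>R a i) * (\<Prod>i\<in>I. (real k * \<mu> i) gchoose m i))"
proof -
  obtain c where c: "v = (\<lambda>x. \<Sum>m | (\<forall>b. b \<notin> Basis \<longrightarrow> m b = 0) \<and> sum m Basis \<le> k.
       c m * (\<Prod>b\<in>Basis. inner x b ^ m b))"
    using v by (auto simp: polynomials_le_def)
  define A where "A = {m :: 'a \<Rightarrow> nat. (\<forall>b. b \<notin> Basis \<longrightarrow> m b = 0) \<and> sum m Basis \<le> k}"
  have "A \<subseteq> (\<Union>n\<le>k. multi_indices Basis n)" by (auto simp: A_def multi_indices_def)
  then have A: "finite A" by (rule finite_subset) (auto intro: finite_multi_indices)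
  define f where "f x = v (\<Sum>i\<in>I. (x i / real k) *\<^sub>R a i)" for x
  have "f = (\<lambda>x. \<Sum>m\<in>A. c m * (\<Prod>b\<in>Basis. (\<Sum>i\<in>I. x i * (inner (a i) b / real k)) ^ m b))"
    unfolding f_def c A_def by (simp add: inner_sum_left)
  moreover have "newton_span I k (\<lambda>x. \<Sum>m\<in>A. c m * (\<Prod>b\<in>Basis. (\<Sum>i\<in>I. x i * (inner (a i) b / real k)) ^ m b))"
    by (intro newton_span_sum A newton_span.scale newton_span_mono[OF newton_span_monomial] I) (auto simp: A_def)
  ultimately have "newton_span I k f" by simp
  from newton_span_interpolation[OF this I, of "\<lambda>i. real k * \<mu> i"]
  show ?thesis using l k by (simp add: f_def sum_distrib_left[symmetric])
qed

lemma gchoose_bound: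
  assumes "0 \<le> x" "x \<le> real k" "m \<le> k"
  shows "\<bar>x gchoose m\<bar> \<le> real k ^ m"
proof -
  have "\<bar>x gchoose m\<bar> = (\<Prod>i<m. \<bar>x - real i\<bar>) / fact m"
    by (simp add: gbinomial_prod_rev abs_prod atLeast0LessThan)
  also have "\<dots> \<le> (\<Prod>i<m. \<bar>x - real i\<bar>) / 1"
    by (intro divide_left_mono) (auto simp: fact_ge_1 intro: prod_nonneg)
  also have "\<dots> \<le> (\<Prod>i<m. real k)" unfolding div_by_1 using assms by (intro prod_mono) auto
  finally show ?thesis by simp
qed

text \<open>Since \<open>0 \<le> k \<mu>\<^sub>i \<le> k\<close>, the factors are at most \<open>k\<close> to the power \<open>m i\<close>, and these exponents add up to \<open>k\<close>.\<close>

lemma lagrange_weight_bound: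
  fixes \<mu> :: "'i \<Rightarrow> real"
  assumes I: "finite I" and m: "m \<in> multi_indices I k" and l: "\<And>i. i \<in> I \<Longrightarrow> 0 \<le> \<mu> i \<and> \<mu> i \<le> 1"
  shows "\<bar>\<Prod>i\<in>I. (real k * \<mu> i) gchoose m i\<bar> \<le> real k ^ k"
proof -
  have "\<bar>\<Prod>i\<in>I. (real k * \<mu> i) gchoose m i\<bar> \<le> (\<Prod>i\<in>I. real k ^ m i)"
    unfolding abs_prod
  proof (rule prod_mono)
    fix i assume i: "i \<in> I"
    then have "m i \<le> k" using m I by (auto simp: multi_indices_def member_le_sum)
    then show "0 \<le> \<bar>real k * \<mu> i gchoose m i\<bar> \<and> \<bar>real k * \<mu> i gchoose m i\<bar> \<le> real k ^ m i"
      using l[OF i] by (auto intro!: gchoose_bound simp: mult_left_le)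
  qed
  also have "\<dots> = real k ^ k" using m by (simp add: power_sum[symmetric] multi_indices_def)
  finally show ?thesis .
qed

text \<open>Only the one-dimensional Lagrange basis, which is a fixed finite family of functions, enters the
  constant of the following inverse estimate.\<close>

lemma gchoose_lipschitz:
  "\<exists>L. \<forall>s\<in>{0..1}. \<bar>((a + b * s) gchoose m) * ((c + d * s) gchoose n) - ((a gchoose m) * (c gchoose n))\<bar> \<le> L * s"
  for a b c d :: real
proof -
  define f where "f s = ((a + b * s) gchoose m) * ((c + d * s) gchoose n)" for s
  have "f = (\<lambda>s. ((\<Prod>i<m. a + b * s - real i) / fact m) * ((\<Prod>i<n. c + d * s - real i) / fact n))"
    by (simp add: f_def gbinomial_prod_rev atLeast0LessThan fun_eq_iff)
  moreover have "real_polynomial_function (\<lambda>s::real. ((\<Prod>i<m. a + b * s - real i) / fact m) * ((\<Prod>i<n. c + d * s - real i) / fact n))"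
    by (intro real_polynomial_function.intros real_polynomial_function_divide real_polynomial_function_prod
      real_polynomial_function_diff bounded_linear_ident) auto
  ultimately obtain p' where p': "real_polynomial_function p'" "\<And>x. (f has_real_derivative p' x) (at x)"
    using has_real_derivative_polynomial_function by metis
  have "compact (p' ` {0..1})"
    using p'(1) by (intro compact_continuous_image continuous_on_polymonial_function) (auto simp: real_polynomial_function_eq)
  then obtain L where "\<forall>y\<in>p' ` {0..1}. norm y \<le> L" using compact_imp_bounded bounded_iff by metis
  then have L: "\<bar>p' x\<bar> \<le> L" if "x \<in> {0..1}" for x using that by auto
  have "\<bar>f s - f 0\<bar> \<le> L * s" if s: "s \<in> {0..1}" for s
  proof (cases "s = 0")
    case False
    then obtain z where "0 < z" "z < s" "f s - f 0 = s * p' z"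
      using MVT2[of 0 s f p'] p'(2) s by auto
    then show ?thesis using L[of z] s by (simp add: abs_mult mult.commute mult_right_mono)
  qed simp
  then show ?thesis by (intro exI[of _ L]) (auto simp: f_def)
qed

lemma polynomial_segment_estimate:
  assumes k: "1 \<le> k"
  shows "\<exists>C\<ge>1. \<forall>(v :: 'a::euclidean_space \<Rightarrow> real) x y M s. v \<in> polynomials_le k \<longrightarrow>
     (\<forall>z\<in>closed_segment x y. \<bar>v z\<bar> \<le> M) \<longrightarrow> s \<in> {0..1} \<longrightarrow> \<bar>v (x + s *\<^sub>R (y - x)) - v x\<bar> \<le> C * M * s"
proof -
  define J where "J = multi_indices (UNIV :: bool set) k"
  have J: "finite J" by (simp add: J_def finite_multi_indices)
  define l where "l m s = ((real k * s) gchoose m True) * ((real k * (1 - s)) gchoose m False)" for m :: "bool \<Rightarrow> nat" and s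
  have "\<exists>L. \<forall>s\<in>{0..1}. \<bar>l m s - l m 0\<bar> \<le> L * s" for m
    using gchoose_lipschitz[of 0 "real k" "m True" "real k" "- real k" "m False"] by (simp add: l_def algebra_simps)
  then obtain L where L: "\<And>m s. s \<in> {0..1} \<Longrightarrow> \<bar>l m s - l m 0\<bar> \<le> L m * s" by metis
  define C where "C = 1 + (\<Sum>m\<in>J. \<bar>L m\<bar>)"
  have C: "1 \<le> C" by (auto simp: C_def intro: sum_nonneg)
  have "\<bar>v (x + s *\<^sub>R (y - x)) - v x\<bar> \<le> C * M * s"
    if v: "v \<in> polynomials_le k" and M: "\<forall>z\<in>closed_segment x y. \<bar>v z\<bar> \<le> M" and s: "s \<in> {0..1}"
    for v :: "'a \<Rightarrow> real" and x y M s
  proof -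
    define pt where "pt m = x + (real (m True) / real k) *\<^sub>R (y - x)" for m :: "bool \<Rightarrow> nat"
    have M0: "0 \<le> M" using M by (meson abs_ge_zero ends_in_segment(1) order_trans)
    have mk: "m True + m False = k" if "m \<in> J" for m
      using that by (auto simp: J_def multi_indices_def UNIV_bool)
    have eq: "v (x + s *\<^sub>R (y - x)) = (\<Sum>m\<in>J. v (pt m) * l m s)" for s
    proof -
      have "v (\<Sum>i\<in>UNIV. (if i then s else 1 - s) *\<^sub>R (if i then y else x)) = (\<Sum>m\<in>multi_indices UNIV k.
        v (\<Sum>i\<in>UNIV. (real (m i) / real k) *\<^sub>R (if i then y else x)) *
        (\<Prod>i\<in>UNIV. (real k * (if i then s else 1 - s)) gchoose m i))"
        by (rule lagrange_interpolation[OF v k]) (auto simp: UNIV_bool)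
      also have "\<dots> = (\<Sum>m\<in>J. v (pt m) * l m s)"
        unfolding J_def[symmetric]
      proof (intro sum.cong refl)
        fix m assume "m \<in> J"
        then have "real (m False) / real k = 1 - real (m True) / real k"
          using mk[of m] k by (simp add: field_simps)
        then have h: "(real (m False) / real k) *\<^sub>R x = x - (real (m True) / real k) *\<^sub>R x"
          by (simp add: scaleR_left_diff_distrib)
        then have "(\<Sum>i\<in>UNIV. (real (m i) / real k) *\<^sub>R (if i then y else x)) = pt m"
          by (simp only: UNIV_bool) (simp add: pt_def algebra_simps)
        then show "v (\<Sum>i\<in>UNIV. (real (m i) / real k) *\<^sub>R (if i then y else x)) *
            (\<Prod>i\<in>UNIV. (real k * (if i then s else 1 - s)) gchoose m i) = v (pt m) * l m s"
          by (simp add: UNIV_bool l_def mult_ac)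
      qed
      finally show ?thesis by (simp add: UNIV_bool algebra_simps)
    qed
    have "v (x + s *\<^sub>R (y - x)) - v x = (\<Sum>m\<in>J. v (pt m) * (l m s - l m 0))"
      using eq[of s] eq[of 0] by (simp add: right_diff_distrib sum_subtractf)
    also have "\<bar>\<dots>\<bar> \<le> (\<Sum>m\<in>J. M * (\<bar>L m\<bar> * s))"
    proof (rule order_trans[OF sum_abs sum_mono])
      fix m assume m: "m \<in> J"
      have "pt m \<in> closed_segment x y"
        using mk[OF m] k unfolding pt_def in_segment
        by (intro exI[of _ "real (m True) / real k"]) (auto simp: algebra_simps)
      then have "\<bar>v (pt m)\<bar> \<le> M" using M by blast
      moreover have "\<bar>l m s - l m 0\<bar> \<le> \<bar>L m\<bar> * s"
        using L[OF s, of m] s by (meson abs_ge_self atLeastAtMost_iff mult_right_mono order_trans)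
      ultimately show "\<bar>v (pt m) * (l m s - l m 0)\<bar> \<le> M * (\<bar>L m\<bar> * s)"
        unfolding abs_mult using M0 by (intro mult_mono) auto
    qed
    also have "\<dots> = (\<Sum>m\<in>J. \<bar>L m\<bar>) * M * s"
      by (simp add: sum_distrib_left sum_distrib_right mult_ac)
    also have "\<dots> \<le> C * M * s" using M0 s by (intro mult_right_mono) (auto simp: C_def)
    finally show ?thesis .
  qed
  then show ?thesis using C by blast
qed

lemma polynomials_le_real_polynomial_function:
  "v \<in> polynomials_le k \<Longrightarrow> real_polynomial_function (v :: 'a::euclidean_space \<Rightarrow> real)"
proof -
  assume "v \<in> polynomials_le k"
  then obtain c where c: "v = (\<lambda>x. \<Sum>m | (\<forall>b. b \<notin> Basis \<longrightarrow> m b = 0) \<and> sum m Basis \<le> k.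
       c m * (\<Prod>b\<in>Basis. inner x b ^ m b))"
    by (auto simp: polynomials_le_def)
  have "{m :: 'a \<Rightarrow> nat. (\<forall>b. b \<notin> Basis \<longrightarrow> m b = 0) \<and> sum m Basis \<le> k} \<subseteq> (\<Union>n\<le>k. multi_indices Basis n)"
    by (auto simp: multi_indices_def)
  then have "finite {m :: 'a \<Rightarrow> nat. (\<forall>b. b \<notin> Basis \<longrightarrow> m b = 0) \<and> sum m Basis \<le> k}"
    by (rule finite_subset) (auto intro: finite_multi_indices)
  then show ?thesis unfolding c
    by (intro real_polynomial_function_sum real_polynomial_function.intros
      real_polynomial_function_prod real_polynomial_function_power
      bounded_linear_inner_left) auto
qed

lemma real_polynomial_function_gradient:
  fixes p :: "'a::euclidean_space \<Rightarrow> real"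
  assumes "real_polynomial_function p"
  shows "\<exists>g. continuous_on UNIV g \<and> (\<forall>x. GDERIV p x :> g x)"
  using assms
proof (induction rule: real_polynomial_function.induct)
  case (linear f)
  define w where "w = (\<Sum>b\<in>Basis. f b *\<^sub>R b)"
  have "f x = inner x w" for x
  proof -
    interpret bounded_linear f by (rule linear)
    have "f x = f (\<Sum>b\<in>Basis. inner x b *\<^sub>R b)" by (simp add: euclidean_representation)
    also have "\<dots> = inner x w" by (simp add: sum scaleR w_def inner_sum_right mult.commute)
    finally show ?thesis .
  qed
  then have "f = (\<lambda>x. inner x w)" by auto
  then have "\<forall>x. GDERIV f x :> w"
    unfolding gderiv_def by (auto intro!: derivative_eq_intros)
  then show ?case by (intro exI[of _ "\<lambda>_. w"]) auto
next
  case (const c)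
  then show ?case by (intro exI[of _ "\<lambda>_. 0"]) (auto intro: GDERIV_const)
next
  case (add f g)
  then obtain f' g' where "continuous_on UNIV f'" "\<forall>x. GDERIV f x :> f' x" "continuous_on UNIV g'" "\<forall>x. GDERIV g x :> g' x"
    by blast
  then show ?case by (intro exI[of _ "\<lambda>x. f' x + g' x"]) (auto intro!: continuous_intros GDERIV_add)
next
  case (mult f g)
  then obtain f' g' where fg: "continuous_on UNIV f'" "\<forall>x. GDERIV f x :> f' x" "continuous_on UNIV g'" "\<forall>x. GDERIV g x :> g' x"
    by blast
  moreover have "continuous_on UNIV f" "continuous_on UNIV g"
    using mult.hyps by (auto intro!: continuous_on_polymonial_function simp: real_polynomial_function_eq)
  ultimately show ?case
    by (intro exI[of _ "\<lambda>x. f x *\<^sub>R g' x + g x *\<^sub>R f' x"]) (auto intro!: continuous_intros GDERIV_mult)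
qed

lemma polynomials_le_gradient:
  fixes v :: "'a::euclidean_space \<Rightarrow> real"
  assumes "v \<in> polynomials_le k"
  obtains g where "continuous_on UNIV g" "\<And>x. GDERIV v x :> g x"
  using real_polynomial_function_gradient[OF polynomials_le_real_polynomial_function[OF assms]] by blast

lemma GDERIV_directional:
  assumes "GDERIV v x :> g"
  shows "((\<lambda>s. v (x + s *\<^sub>R w)) has_real_derivative inner g w) (at 0 within S)"
proof -
  have "(v has_derivative (\<lambda>h. inner h g)) (at (x + 0 *\<^sub>R w))" using assms by (simp add: gderiv_def)
  then have "((\<lambda>s. v (x + s *\<^sub>R w)) has_derivative (\<lambda>s. inner (s *\<^sub>R w) g)) (at 0 within S)"
    by (rule has_derivative_compose[rotated]) (auto intro!: derivative_eq_intros)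
  then show ?thesis by (simp add: has_field_derivative_def inner_commute mult.commute[of _ "inner _ _"] mult_commute_abs)
qed

text \<open>Inverse estimate for the gradient: the segment estimate bounds the derivative of \<open>v\<close> at \<open>x\<close> in the
  directions of all points of a ball of radius \<open>r\<close> in \<open>T\<close>, and antipodal points differ by \<open>2 r\<close>.\<close>

lemma polynomial_gradient_bound:
  assumes k: "1 \<le> k"
  shows "\<exists>C\<ge>1. \<forall>(v :: 'a::euclidean_space \<Rightarrow> real) T x0 r M x g. v \<in> polynomials_le k \<longrightarrow> convex T \<longrightarrow> 0 < r \<longrightarrow>
     cball x0 r \<subseteq> T \<longrightarrow> (\<forall>z\<in>T. \<bar>v z\<bar> \<le> M) \<longrightarrow> x \<in> T \<longrightarrow> GDERIV v x :> g \<longrightarrow> norm g \<le> C * M / r"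
proof -
  obtain C where C: "C \<ge> 1" "\<And>(v :: 'a \<Rightarrow> real) x y M s. v \<in> polynomials_le k \<Longrightarrow>
     (\<forall>z\<in>closed_segment x y. \<bar>v z\<bar> \<le> M) \<Longrightarrow> s \<in> {0..1} \<Longrightarrow> \<bar>v (x + s *\<^sub>R (y - x)) - v x\<bar> \<le> C * M * s"
    using polynomial_segment_estimate[OF k, where 'a = 'a] by blast
  have "norm g \<le> C * M / r"
    if v: "v \<in> polynomials_le k" and T: "convex T" "cball x0 r \<subseteq> T" and r: "0 < r"
      and M: "\<forall>z\<in>T. \<bar>v z\<bar> \<le> M" and x: "x \<in> T" and g: "GDERIV v x :> g"
    for v :: "'a \<Rightarrow> real" and T x0 r M x g
  proof -
    have M0: "0 \<le> M" using M x by force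
    have dir: "\<bar>inner g (y - x)\<bar> \<le> C * M" if y: "y \<in> T" for y
    proof -
      have seg: "\<forall>z\<in>closed_segment x y. \<bar>v z\<bar> \<le> M" using T(1) x y M by (meson closed_segment_subset subsetD)
      have "((\<lambda>s. v (x + s *\<^sub>R (y - x))) has_real_derivative inner g (y - x)) (at_right 0)"
        by (rule GDERIV_directional[OF g])
      then have "((\<lambda>s. (v (x + s *\<^sub>R (y - x)) - v x) / s) \<longlongrightarrow> inner g (y - x)) (at_right 0)"
        by (simp add: has_field_derivative_iff)
      then have "((\<lambda>s. \<bar>(v (x + s *\<^sub>R (y - x)) - v x) / s\<bar>) \<longlongrightarrow> \<bar>inner g (y - x)\<bar>) (at_right 0)"
        by (rule tendsto_rabs)
      moreover have "eventually (\<lambda>s. \<bar>(v (x + s *\<^sub>R (y - x)) - v x) / s\<bar> \<le> C * M) (at_right 0)"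
      proof -
        have "eventually (\<lambda>s::real. s \<in> {0<..<1}) (at_right 0)" by (rule eventually_at_right_real) simp
        then show ?thesis
        proof eventually_elim
          case (elim s)
          then show ?case using C(2)[OF v seg, of s] by (simp add: field_simps)
        qed
      qed
      ultimately show ?thesis by (rule tendsto_upperbound) simp
    qed
    show ?thesis
    proof (cases "g = 0")
      case False
      define e where "e = (r / norm g) *\<^sub>R g"
      have ne: "norm e = r" using False r by (simp add: e_def)
      then have "x0 + e \<in> T" "x0 - e \<in> T" using T(2) by (auto simp: dist_norm subset_iff)
      from dir[OF this(1)] dir[OF this(2)] have "inner g (x0 + e - x) - inner g (x0 - e - x) \<le> 2 * (C * M)"
        by linarith
      moreover have "inner g (x0 + e - x) - inner g (x0 - e - x) = 2 * inner g e" by (simp add: inner_simps)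
      moreover have "inner g e = r * norm g" using False by (simp add: e_def power2_norm_eq_inner[symmetric] power2_eq_square)
      ultimately show ?thesis using r by (simp add: field_simps)
    qed (use C M0 r in auto)
  qed
  then show ?thesis using C(1) by blast
qed

section \<open>Surface gradients of piecewise polynomials\<close>

text \<open>The simplices of a mesh that contain \<open>x\<close> determine the tangent space and the conditions on the surface
  gradient at \<open>x\<close>, so the surface is split according to this set of simplices.\<close>

definition stratum :: "'a set set \<Rightarrow> 'a set set \<Rightarrow> 'a set" where
  "stratum \<M> \<A> = {x. \<forall>S\<in>\<M>. x \<in> S \<longleftrightarrow> S \<in> \<A>}"

definition directions :: "'a::euclidean_space set set \<Rightarrow> 'a set" where
  "directions \<A> = span {y - y' | y y' S. S \<in> \<A> \<and> y \<in> S \<and> y' \<in> S}"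

lemma stratum_nhd:
  fixes x :: "'a::euclidean_space"
  assumes fin: "finite \<M>" and cl: "\<And>S. S \<in> \<M> \<Longrightarrow> closed S" and sub: "\<A> \<subseteq> \<M>" and x: "x \<in> stratum \<M> \<A>"
  obtains e where "0 < e" "\<Union>\<M> \<inter> ball x e = \<Union>\<A> \<inter> ball x e"
proof -
  have "closed (\<Union>(\<M> - \<A>))" using fin cl by (intro closed_Union) auto
  moreover have "x \<notin> \<Union>(\<M> - \<A>)" using x by (auto simp: stratum_def)
  ultimately obtain e where e: "0 < e" "ball x e \<inter> \<Union>(\<M> - \<A>) = {}"
    by (metis Compl_iff disjoint_eq_subset_Compl openE open_Compl)
  show ?thesis
  proof (rule that[OF e(1)])
    show "\<Union>\<M> \<inter> ball x e = \<Union>\<A> \<inter> ball x e" using e(2) sub by auto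
  qed
qed

text \<open>Near \<open>x\<close> the mesh is a union of convex sets through \<open>x\<close>, whose differences are limits of difference
  quotients; conversely all quotients lie in the closed subspace of the directions.\<close>

lemma tangent_space_stratum:
  fixes x :: "'a::euclidean_space"
  assumes fin: "finite \<M>" and cl: "\<And>S. S \<in> \<M> \<Longrightarrow> closed S" and cv: "\<And>S. S \<in> \<M> \<Longrightarrow> convex S"
    and sub: "\<A> \<subseteq> \<M>" and x: "x \<in> stratum \<M> \<A>"
  shows "tangent_space (\<Union>\<M>) x = directions \<A>"
proof -
  let ?C = "{v. \<exists>(X :: nat \<Rightarrow> 'a) (t :: nat \<Rightarrow> real).
      (\<forall>n. X n \<in> \<Union>\<M> \<and> 0 \<le> t n) \<and> X \<longlonglongrightarrow> x \<and> (\<lambda>n. t n *\<^sub>R (X n - x)) \<longlonglongrightarrow> v}"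
  have xS: "x \<in> S" if "S \<in> \<A>" for S using x sub that by (auto simp: stratum_def)
  have "?C \<subseteq> directions \<A>"
  proof
    fix v assume "v \<in> ?C"
    then obtain X t where X: "\<And>n. X n \<in> \<Union>\<M>" "X \<longlonglongrightarrow> x" "(\<lambda>n. t n *\<^sub>R (X n - x)) \<longlonglongrightarrow> v"
      by auto
    obtain e where e: "0 < e" "\<Union>\<M> \<inter> ball x e = \<Union>\<A> \<inter> ball x e"
      using stratum_nhd[OF fin cl sub x] by blast
    have "eventually (\<lambda>n. X n \<in> ball x e) sequentially"
      using X(2) e(1) by (simp add: tendsto_iff dist_commute)
    then have "eventually (\<lambda>n. t n *\<^sub>R (X n - x) \<in> directions \<A>) sequentially"
    proof eventually_elim
      case (elim n)
      then obtain S where "S \<in> \<A>" "X n \<in> S" using X(1)[of n] e(2) by blast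
      then show ?case unfolding directions_def using xS by (intro span_scale span_base) blast
    qed
    moreover have "closed (directions \<A>)" unfolding directions_def by (rule closed_span)
    ultimately show "v \<in> directions \<A>"
      by (intro Lim_in_closed_set[OF _ _ trivial_limit_sequentially X(3)])
  qed
  then have "span ?C \<subseteq> directions \<A>" by (simp add: directions_def span_minimal)
  moreover have "directions \<A> \<subseteq> span ?C"
    unfolding directions_def
  proof (rule span_minimal)
    have one: "y - x \<in> ?C" if "S \<in> \<A>" "y \<in> S" for S y
    proof -
      let ?X = "\<lambda>n::nat. x + (1 / real (Suc n)) *\<^sub>R (y - x)"
      have "?X n \<in> S" for n
      proof -
        have "?X n = (1 - 1 / real (Suc n)) *\<^sub>R x + (1 / real (Suc n)) *\<^sub>R y" by (simp add: algebra_simps)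
        also have "\<dots> \<in> S" using cv sub that xS by (intro convexD_alt) auto
        finally show ?thesis .
      qed
      moreover have "?X \<longlonglongrightarrow> x + 0 *\<^sub>R (y - x)"
        by (intro tendsto_intros) (rule LIMSEQ_inverse_real_of_nat[unfolded inverse_eq_divide])
      moreover have "(\<lambda>n. real (Suc n) *\<^sub>R (?X n - x)) \<longlonglongrightarrow> y - x"
        by (rule tendsto_eventually) (simp del: of_nat_Suc)
      ultimately show ?thesis using that sub
        by (intro CollectI exI[of _ ?X] exI[of _ "\<lambda>n. real (Suc n)"]) auto
    qed
    show "{y - y' |y y' S. S \<in> \<A> \<and> y \<in> S \<and> y' \<in> S} \<subseteq> span ?C"
    proof clarify
      fix y y' S assume S: "S \<in> \<A>" "y \<in> S" "y' \<in> S"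
      have "y - y' = (y - x) - (y' - x)" by simp
      also have "\<dots> \<in> span ?C" using one[OF S(1,2)] one[OF S(1,3)] by (intro span_diff span_base)
      finally show "y - y' \<in> span ?C" .
    qed
  qed (rule subspace_span)
  ultimately show ?thesis unfolding tangent_space_def by blast
qed

lemma has_derivative_within_Union:
  fixes f :: "'a::real_normed_vector \<Rightarrow> 'b::real_normed_vector"
  assumes "finite \<A>" "\<A> \<noteq> {}" "\<And>S. S \<in> \<A> \<Longrightarrow> (f has_derivative f') (at x within S)"
  shows "(f has_derivative f') (at x within \<Union>\<A>)"
proof -
  obtain S0 where "S0 \<in> \<A>" using assms(2) by blast
  then have bl: "bounded_linear f'" using assms(3) by (auto simp: has_derivative_def)
  show ?thesis
    unfolding has_derivative_within_alt
  proof (intro conjI bl allI impI)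
    fix e :: real assume "0 < e"
    then have "\<forall>S\<in>\<A>. \<exists>d>0. \<forall>y\<in>S. norm (y - x) < d \<longrightarrow> norm (f y - f x - f' (y - x)) \<le> e * norm (y - x)"
      using assms(3) by (simp add: has_derivative_within_alt)
    then obtain d where d: "\<And>S. S \<in> \<A> \<Longrightarrow> 0 < d S"
      "\<And>S y. S \<in> \<A> \<Longrightarrow> y \<in> S \<Longrightarrow> norm (y - x) < d S \<Longrightarrow> norm (f y - f x - f' (y - x)) \<le> e * norm (y - x)"
      by metis
    have "0 < Min (d ` \<A>)" using assms(1,2) d by auto
    moreover have "norm (f y - f x - f' (y - x)) \<le> e * norm (y - x)"
      if y: "y \<in> \<Union>\<A>" "norm (y - x) < Min (d ` \<A>)" for y
    proof -
      obtain S where S: "S \<in> \<A>" "y \<in> S" using y(1) by blast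
      then have "Min (d ` \<A>) \<le> d S" using assms(1) by auto
      then show ?thesis using d(2)[OF S] y(2) by simp
    qed
    ultimately show "\<exists>d>0. \<forall>y\<in>\<Union>\<A>. norm (y - x) < d \<longrightarrow> norm (f y - f x - f' (y - x)) \<le> e * norm (y - x)"
      by blast
  qed
qed

text \<open>On each simplex through \<open>x\<close> the surface gradient must act on the directions of the simplex like the
  gradient of the polynomial there, and this is all that is required of it.\<close>

lemma is_surface_grad_iff:
  fixes v :: "'a::euclidean_space \<Rightarrow> real"
  assumes fin: "finite \<M>" and cl: "\<And>S. S \<in> \<M> \<Longrightarrow> closed S" and cv: "\<And>S. S \<in> \<M> \<Longrightarrow> convex S"
    and sub: "\<A> \<subseteq> \<M>" and ne: "\<A> \<noteq> {}" and x: "x \<in> stratum \<M> \<A>"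
    and v: "\<And>S y. S \<in> \<M> \<Longrightarrow> y \<in> S \<Longrightarrow> v y = P S y" and P: "\<And>S y. S \<in> \<M> \<Longrightarrow> GDERIV (P S) y :> dP S y"
  shows "is_surface_grad (\<Union>\<M>) v x g \<longleftrightarrow> g \<in> directions \<A> \<and>
     (\<forall>S\<in>\<A>. \<forall>y\<in>S. \<forall>y'\<in>S. inner (g - dP S x) (y - y') = 0)"
proof -
  have xS: "x \<in> S" "S \<in> \<M>" if "S \<in> \<A>" for S using x sub that by (auto simp: stratum_def)
  obtain e where e: "0 < e" "\<Union>\<M> \<inter> ball x e = \<Union>\<A> \<inter> ball x e"
    using stratum_nhd[OF fin cl sub x] by blast
  have Pd: "(P S has_derivative (\<lambda>h. inner (dP S x) h)) (at x within U)" if "S \<in> \<A>" for S U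
    using P[OF xS(2)[OF that], of x] by (simp add: gderiv_def inner_commute has_derivative_at_withinI)
  have "(v has_derivative (\<lambda>y. inner g y)) (at x within \<Union>\<M>) \<longleftrightarrow>
      (\<forall>S\<in>\<A>. \<forall>y\<in>S. \<forall>y'\<in>S. inner (g - dP S x) (y - y') = 0)" (is "?l \<longleftrightarrow> ?r")
  proof
    assume ?l
    show ?r
    proof (intro ballI)
      fix S y y' assume S: "S \<in> \<A>" "y \<in> S" "y' \<in> S"
      have zero: "inner (g - dP S x) (z - x) = 0" if z: "z \<in> S" for z
      proof -
        let ?s = "\<lambda>s::real. x + s *\<^sub>R (z - x)"
        have seg: "?s s \<in> S" if "s \<in> {0..1}" for s
        proof -
          have "?s s = (1 - s) *\<^sub>R x + s *\<^sub>R z" by (simp add: algebra_simps)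
          also have "\<dots> \<in> S" using cv xS[OF S(1)] z that by (intro convexD_alt) auto
          finally show ?thesis .
        qed
        have sd: "(?s has_derivative (\<lambda>s. s *\<^sub>R (z - x))) (at 0 within {0..1})"
          by (auto intro!: derivative_eq_intros)
        have "(v has_derivative (\<lambda>y. inner g y)) (at (?s 0) within ?s ` {0..1})"
          using \<open>?l\<close> seg xS(2)[OF S(1)] by (auto intro!: has_derivative_subset[of v _ x "\<Union>\<M>"])
        then have "((v \<circ> ?s) has_derivative ((\<lambda>y. inner g y) \<circ> (\<lambda>s. s *\<^sub>R (z - x)))) (at 0 within {0..1})"
          by (rule diff_chain_within[OF sd])
        then have d1: "((v \<circ> ?s) has_real_derivative inner g (z - x)) (at 0 within {0..1})"
          by (simp add: has_field_derivative_def o_def mult_commute_abs)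
        have "(P S has_derivative (\<lambda>y. inner (dP S x) y)) (at (?s 0) within ?s ` {0..1})"
          using Pd[OF S(1)] by simp
        then have "((P S \<circ> ?s) has_derivative ((\<lambda>y. inner (dP S x) y) \<circ> (\<lambda>s. s *\<^sub>R (z - x)))) (at 0 within {0..1})"
          by (rule diff_chain_within[OF sd])
        then have "((P S \<circ> ?s) has_real_derivative inner (dP S x) (z - x)) (at 0 within {0..1})"
          by (simp add: has_field_derivative_def o_def mult_commute_abs)
        then have d2: "((v \<circ> ?s) has_real_derivative inner (dP S x) (z - x)) (at 0 within {0..1})"
          by (rule has_field_derivative_transform_within[where d = 1]) (use v xS(2)[OF S(1)] seg in auto)
        have "inner g (z - x) = inner (dP S x) (z - x)"
          using vector_derivative_unique_within_closed_interval[of 0 1 0 "v \<circ> ?s"] d1 d2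
          by (simp add: has_real_derivative_iff_has_vector_derivative)
        then show ?thesis by (simp add: inner_diff_left)
      qed
      have "inner (g - dP S x) (y - y') = inner (g - dP S x) (y - x) - inner (g - dP S x) (y' - x)"
        by (simp add: inner_diff_right)
      then show "inner (g - dP S x) (y - y') = 0" using zero S by simp
    qed
  next
    assume r: ?r
    have "(v has_derivative (\<lambda>y. inner g y)) (at x within S)" if S: "S \<in> \<A>" for S
    proof -
      have "((\<lambda>y. P S y + inner (g - dP S x) (y - x)) has_derivative (\<lambda>h. inner g h)) (at x within S)"
        by (rule has_derivative_eq_rhs, rule has_derivative_add[OF Pd[OF S]])
          (auto intro!: derivative_eq_intros simp: inner_diff_left)
      then show ?thesis
        by (rule has_derivative_transform[rotated 2]) (use r S xS v in auto)
    qed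
    then have "(v has_derivative (\<lambda>y. inner g y)) (at x within \<Union>\<A>)"
      using fin sub ne by (intro has_derivative_within_Union) (auto intro: finite_subset)
    then show ?l
      using at_within_nhd[of x "ball x e" "\<Union>\<M>" "\<Union>\<A>"] e by auto
  qed
  moreover have "tangent_space (\<Union>\<M>) x = directions \<A>"
    using tangent_space_stratum[OF fin _ _ sub x] cl cv by blast
  ultimately show ?thesis
    unfolding is_surface_grad_def by simp
qed

text \<open>The dual family turns the prescribed inner products on a basis back into the vector itself.\<close>

lemma subspace_dual_family:
  fixes B :: "'a::euclidean_space set"
  assumes B: "independent B"
  obtains d where "\<And>w. w \<in> B \<Longrightarrow> d w \<in> span B" "\<And>w w'. w \<in> B \<Longrightarrow> w' \<in> B \<Longrightarrow> inner (d w) w' = (if w = w' then 1 else 0)"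
proof -
  have "\<exists>z. z \<in> span B \<and> (\<forall>w'\<in>B. inner z w' = (if w = w' then 1 else 0))" for w
  proof -
    obtain f :: "'a \<Rightarrow> real" where f: "linear f" "\<forall>w'\<in>B. f w' = (if w = w' then 1 else 0)"
      using linear_independent_extend[OF B, of "\<lambda>w'. if w = w' then 1 else 0"] by blast
    define r where "r = (\<Sum>b\<in>Basis. f b *\<^sub>R b)"
    have fr: "f y = inner r y" for y
    proof -
      have "f y = f (\<Sum>b\<in>Basis. inner y b *\<^sub>R b)" by (simp add: euclidean_representation)
      also have "\<dots> = inner r y"
        using f(1) by (simp add: linear_sum linear_cmul r_def inner_sum_left inner_sum_right inner_commute mult.commute)
      finally show ?thesis .
    qed
    obtain p q where pq: "p \<in> span B" "\<And>y. y \<in> span B \<Longrightarrow> inner q y = 0" "r = p + q"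
      using orthogonal_subspace_decomp_exists[of B r] unfolding Linear_Algebra.orthogonal_def by metis
    have "inner p w' = f w'" if "w' \<in> B" for w'
      using pq(2)[of w'] that unfolding fr pq(3) by (simp add: span_base inner_add_left)
    then show ?thesis using pq(1) f(2) by auto
  qed
  then obtain d where "\<And>w. d w \<in> span B \<and> (\<forall>w'\<in>B. inner (d w) w' = (if w = w' then 1 else 0))" by metis
  then show ?thesis using that[of d] by blast
qed

text \<open>On a stratum the values of the gradients on a basis of the tangent space determine the surface
  gradient through the dual basis; so it is a continuous function wherever it exists, and it exists on a
  relatively closed set.\<close>

lemma surface_grad_on_stratum:
  fixes v :: "'a::euclidean_space \<Rightarrow> real"
  assumes fin: "finite \<M>" and cl: "\<And>S. S \<in> \<M> \<Longrightarrow> closed S" and cv: "\<And>S. S \<in> \<M> \<Longrightarrow> convex S"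
    and sub: "\<A> \<subseteq> \<M>" and ne: "\<A> \<noteq> {}"
    and v: "\<And>S y. S \<in> \<M> \<Longrightarrow> y \<in> S \<Longrightarrow> v y = P S y" and P: "\<And>S y. S \<in> \<M> \<Longrightarrow> GDERIV (P S) y :> dP S y"
    and dP: "\<And>S. S \<in> \<M> \<Longrightarrow> continuous_on UNIV (dP S)"
  obtains G E where "continuous_on UNIV G" "closed E"
    "\<And>x. x \<in> stratum \<M> \<A> \<Longrightarrow> surface_grad (\<Union>\<M>) v x = (if x \<in> E then G x else 0)"
proof -
  define D where "D = {y - y' | y y' S. S \<in> \<A> \<and> y \<in> S \<and> y' \<in> S}"
  obtain B where B: "B \<subseteq> D" "independent B" "D \<subseteq> span B" using maximal_independent_subset by metis
  have spB: "span B = directions \<A>"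
    using B(1,3) unfolding directions_def D_def[symmetric]
    by (metis span_eq span_superset subset_trans)
  have finB: "finite B" using B(2) independent_bound by blast
  obtain d where d: "\<And>w. w \<in> B \<Longrightarrow> d w \<in> span B" "\<And>w w'. w \<in> B \<Longrightarrow> w' \<in> B \<Longrightarrow> inner (d w) w' = (if w = w' then 1 else 0)"
    using subspace_dual_family[OF B(2)] by blast
  have "\<forall>w\<in>B. \<exists>S. S \<in> \<A> \<and> (\<exists>y\<in>S. \<exists>y'\<in>S. w = y - y')" using B(1) unfolding D_def by blast
  then obtain Sw where Sw: "\<And>w. w \<in> B \<Longrightarrow> Sw w \<in> \<A>" "\<And>w. w \<in> B \<Longrightarrow> \<exists>y\<in>Sw w. \<exists>y'\<in>Sw w. w = y - y'" by metis
  define G where "G x = (\<Sum>w\<in>B. inner (dP (Sw w) x) w *\<^sub>R d w)" for x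
  define E where "E = (\<Inter>S\<in>\<A>. \<Inter>y\<in>S. \<Inter>y'\<in>S. {x. inner (G x - dP S x) (y - y') = 0})"
  have Gc: "continuous_on UNIV G"
    unfolding G_def using dP Sw(1) sub by (intro continuous_intros) auto
  have Ec: "closed E"
    unfolding E_def using Gc dP sub
    by (intro closed_INT ballI closed_Collect_eq continuous_intros) auto
  have GB: "G x \<in> directions \<A>" for x
    unfolding G_def spB[symmetric] using d(1) by (intro span_sum span_scale)
  have Gw: "inner (G x) w' = inner (dP (Sw w') x) w'" if "w' \<in> B" for x w'
  proof -
    have "inner (G x) w' = (\<Sum>w\<in>B. inner (dP (Sw w) x) w * (if w = w' then 1 else 0))"
      unfolding G_def inner_sum_left using d(2) that by (intro sum.cong) auto
    also have "\<dots> = inner (dP (Sw w') x) w'" using that finB by (simp add: if_distrib cong: if_cong)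
    finally show ?thesis .
  qed
  have "surface_grad (\<Union>\<M>) v x = (if x \<in> E then G x else 0)" if x: "x \<in> stratum \<M> \<A>" for x
  proof -
    have iff: "is_surface_grad (\<Union>\<M>) v x g \<longleftrightarrow> g \<in> directions \<A> \<and>
       (\<forall>S\<in>\<A>. \<forall>y\<in>S. \<forall>y'\<in>S. inner (g - dP S x) (y - y') = 0)" for g
      by (rule is_surface_grad_iff[where v = v and P = P, OF fin _ _ sub ne x]) (use cl cv v P in auto)
    have uniq: "g = G x" if g: "is_surface_grad (\<Union>\<M>) v x g" for g
    proof -
      have "inner (g - G x) w = 0" if w: "w \<in> B" for w
      proof -
        have "inner (g - dP (Sw w) x) w = 0" using g Sw[OF w] unfolding iff by force
        then show ?thesis using Gw[OF w, of x] by (simp add: inner_diff_left)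
      qed
      then have "inner (g - G x) y = 0" if "y \<in> span B" for y
        using span_minimal[OF _ subspace_hyperplane[of "g - G x"], of B] that by blast
      moreover have "g - G x \<in> span B" using g GB spB unfolding iff by (metis span_diff)
      ultimately have "inner (g - G x) (g - G x) = 0" by blast
      then show ?thesis by simp
    qed
    show ?thesis
    proof (cases "x \<in> E")
      case True
      then have "is_surface_grad (\<Union>\<M>) v x (G x)" using GB unfolding iff by (auto simp: E_def)
      then show ?thesis using True uniq unfolding surface_grad_def by (metis the_equality)
    next
      case False
      then have "\<not> is_surface_grad (\<Union>\<M>) v x (G x)" unfolding iff by (auto simp: E_def)
      then have "\<not> (\<exists>g. is_surface_grad (\<Union>\<M>) v x g)" using uniq by metis
      then show ?thesis using False by (simp add: surface_grad_def)
    qed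
  qed
  then show ?thesis using that Gc Ec by blast
qed

text \<open>There are finitely many strata, and each of them is a Borel set on which the previous lemma applies.\<close>

theorem surface_grad_measurable_bounded:
  fixes v :: "'a::euclidean_space \<Rightarrow> real"
  assumes fin: "finite \<M>" and cp: "\<And>S. S \<in> \<M> \<Longrightarrow> compact S" and cv: "\<And>S. S \<in> \<M> \<Longrightarrow> convex S"
    and v: "v \<in> pw_poly q \<M>"
  obtains g C where "g \<in> borel_measurable borel" "\<And>x. norm (g x) \<le> C"
    "\<And>x. x \<in> \<Union>\<M> \<Longrightarrow> surface_grad (\<Union>\<M>) v x = g x"
proof -
  have cl: "closed S" if "S \<in> \<M>" for S using cp[OF that] by (rule compact_imp_closed)
  have "\<forall>S\<in>\<M>. \<exists>P. P \<in> polynomials_le q \<and> (\<forall>x\<in>S. v x = P x)" using v by (auto simp: pw_poly_def)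
  then obtain P where P: "\<And>S. S \<in> \<M> \<Longrightarrow> P S \<in> polynomials_le q" "\<And>S x. S \<in> \<M> \<Longrightarrow> x \<in> S \<Longrightarrow> v x = P S x"
    by metis
  have "\<exists>g. continuous_on UNIV g \<and> (\<forall>x. GDERIV (P S) x :> g x)" if "S \<in> \<M>" for S
    using polynomials_le_gradient[OF P(1)[OF that]] by metis
  then obtain dP where dP: "\<And>S. S \<in> \<M> \<Longrightarrow> continuous_on UNIV (dP S)" "\<And>S x. S \<in> \<M> \<Longrightarrow> GDERIV (P S) x :> dP S x"
    by metis
  let ?I = "{\<A>. \<A> \<subseteq> \<M> \<and> \<A> \<noteq> {}}"
  have finI: "finite ?I" using fin by simp
  have "\<forall>\<A>\<in>?I. \<exists>p. continuous_on UNIV (fst p) \<and> closed (snd p) \<and>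
     (\<forall>x. x \<in> stratum \<M> \<A> \<longrightarrow> surface_grad (\<Union>\<M>) v x = (if x \<in> snd p then fst p x else 0))"
  proof
    fix \<A> assume A: "\<A> \<in> ?I"
    obtain G E where GE: "continuous_on UNIV G" "closed E"
      "\<And>x. x \<in> stratum \<M> \<A> \<Longrightarrow> surface_grad (\<Union>\<M>) v x = (if x \<in> E then G x else 0)"
      by (rule surface_grad_on_stratum[where \<M> = \<M> and \<A> = \<A> and v = v and P = P and dP = dP, OF fin])
        (use cl cv P dP A in auto)
    show "\<exists>p. continuous_on UNIV (fst p) \<and> closed (snd p) \<and>
     (\<forall>x. x \<in> stratum \<M> \<A> \<longrightarrow> surface_grad (\<Union>\<M>) v x = (if x \<in> snd p then fst p x else 0))"
      by (rule exI[of _ "(G, E)"]) (use GE in simp)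
  qed
  then obtain p where p: "\<forall>\<A>\<in>?I. continuous_on UNIV (fst (p \<A>)) \<and> closed (snd (p \<A>)) \<and>
     (\<forall>x. x \<in> stratum \<M> \<A> \<longrightarrow> surface_grad (\<Union>\<M>) v x = (if x \<in> snd (p \<A>) then fst (p \<A>) x else 0))"
    unfolding bchoice_iff by blast
  define G E where "G \<A> = fst (p \<A>)" and "E \<A> = snd (p \<A>)" for \<A>
  have GE: "\<And>\<A>. \<A> \<in> ?I \<Longrightarrow> continuous_on UNIV (G \<A>)" "\<And>\<A>. \<A> \<in> ?I \<Longrightarrow> closed (E \<A>)"
     "\<And>\<A> x. \<A> \<in> ?I \<Longrightarrow> x \<in> stratum \<M> \<A> \<Longrightarrow> surface_grad (\<Union>\<M>) v x = (if x \<in> E \<A> then G \<A> x else 0)"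
    using p unfolding G_def E_def by blast+
  have strat: "stratum \<M> \<A> \<in> sets borel" if "\<A> \<in> ?I" for \<A>
  proof -
    have "stratum \<M> \<A> = (\<Inter>S\<in>\<A>. S) - \<Union>(\<M> - \<A>)" using that by (auto simp: stratum_def)
    moreover have "closed (\<Inter>S\<in>\<A>. S)" using cl that by (intro closed_INT) auto
    moreover have "closed (\<Union>(\<M> - \<A>))" using cl fin by (intro closed_Union) auto
    ultimately show ?thesis by auto
  qed
  define g where "g x = (\<Sum>\<A>\<in>?I. indicator (stratum \<M> \<A> \<inter> E \<A> \<inter> \<Union>\<M>) x *\<^sub>R G \<A> x)" for x
  have cpM: "compact (\<Union>\<M>)" using fin cp by (intro compact_Union) auto
  have gm: "g \<in> borel_measurable borel"
    unfolding g_def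
  proof (intro borel_measurable_sum borel_measurable_scaleR borel_measurable_indicator)
    fix \<A> assume A: "\<A> \<in> ?I"
    show "stratum \<M> \<A> \<inter> E \<A> \<inter> \<Union>\<M> \<in> sets borel"
      using strat[OF A] GE(2)[OF A] cpM by (intro sets.Int) (auto intro: borel_closed compact_imp_closed)
    show "G \<A> \<in> borel_measurable borel" using GE(1)[OF A] by (rule borel_measurable_continuous_onI)
  qed
  have "\<exists>C. \<forall>x\<in>\<Union>\<M>. norm (G \<A> x) \<le> C" if "\<A> \<in> ?I" for \<A>
  proof -
    have "compact (G \<A> ` \<Union>\<M>)" using GE(1)[OF that] cpM by (intro compact_continuous_image) (auto intro: continuous_on_subset)
    then show ?thesis using compact_imp_bounded bounded_iff by (metis imageI)
  qed
  then have "\<forall>\<A>\<in>?I. \<exists>C. \<forall>x\<in>\<Union>\<M>. norm (G \<A> x) \<le> C" by blast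
  then obtain C where "\<forall>\<A>\<in>?I. \<forall>x\<in>\<Union>\<M>. norm (G \<A> x) \<le> C \<A>" unfolding bchoice_iff by blast
  then have C: "\<And>\<A> x. \<A> \<in> ?I \<Longrightarrow> x \<in> \<Union>\<M> \<Longrightarrow> norm (G \<A> x) \<le> C \<A>" by blast
  have gb: "norm (g x) \<le> (\<Sum>\<A>\<in>?I. \<bar>C \<A>\<bar>)" for x
    unfolding g_def
  proof (rule sum_norm_le)
    fix \<A> assume A: "\<A> \<in> ?I"
    show "norm (indicator (stratum \<M> \<A> \<inter> E \<A> \<inter> \<Union>\<M>) x *\<^sub>R G \<A> x) \<le> \<bar>C \<A>\<bar>"
    proof (cases "x \<in> stratum \<M> \<A> \<inter> E \<A> \<inter> \<Union>\<M>")
      case True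
      then have "norm (G \<A> x) \<le> C \<A>" by (intro C[OF A]) blast
      then show ?thesis using True by (simp add: indicator_def)
    next
      case False
      then have "(indicator (stratum \<M> \<A> \<inter> E \<A> \<inter> \<Union>\<M>) x :: real) = 0" by (rule indicator_simps)
      then show ?thesis by simp
    qed
  qed
  have "surface_grad (\<Union>\<M>) v x = g x" if x: "x \<in> \<Union>\<M>" for x
  proof -
    define \<A> where "\<A> = {S \<in> \<M>. x \<in> S}"
    have A: "\<A> \<in> ?I" "x \<in> stratum \<M> \<A>" using x by (auto simp: \<A>_def stratum_def)
    have "x \<notin> stratum \<M> \<A>'" if "\<A>' \<in> ?I" "\<A>' \<noteq> \<A>" for \<A>'
      using that by (auto simp: stratum_def \<A>_def)
    then have "g x = (\<Sum>\<A>'\<in>?I. if \<A>' = \<A> then indicator (E \<A>) x *\<^sub>R G \<A> x else 0)"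
      unfolding g_def using A x by (intro sum.cong) (auto simp: indicator_def)
    also have "\<dots> = indicator (E \<A>) x *\<^sub>R G \<A> x" using A(1) finI by simp
    finally show ?thesis using GE(3)[OF A] by (auto simp: indicator_def)
  qed
  then show ?thesis using that[OF gm gb] by blast
qed

section \<open>Nodal estimates on quasi-uniform meshes\<close>

subsection \<open>Simplices of the mesh\<close>

lemma simplex_vertices:
  assumes "int n simplex T"
  obtains V where "finite V" "\<not> affine_dependent V" "card V = n + 1" "T = convex hull V"
    "{z. z extreme_point_of T} = V"
proof -
  obtain V where V: "finite V" "\<not> affine_dependent V" "int (card V) = int n + 1" "T = convex hull V"
    using assms unfolding simplex by blast
  have "{z. z extreme_point_of T} = V"
    using extreme_point_of_convex_hull_affine_independent[OF V(2)] V(4) by auto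
  then show ?thesis using that V by auto
qed

text \<open>The nodes in terms of the multi-indices of the interpolation formula; the values of \<open>m\<close> outside the
  vertices are irrelevant and set to \<open>0\<close>.\<close>

lemma lagrange_nodes_single:
  fixes T :: "'a::euclidean_space set"
  assumes V: "finite V" "{z. z extreme_point_of T} = V"
  shows "lagrange_nodes k {T} = (\<lambda>m. \<Sum>z\<in>V. (real (m z) / real k) *\<^sub>R z) ` multi_indices V k"
proof (intro subset_antisym subsetI)
  fix x assume "x \<in> lagrange_nodes k {T}"
  then obtain m where m: "sum m V = k" "x = (\<Sum>z\<in>V. (real (m z) / real k) *\<^sub>R z)"
    using V(2) by (auto simp: lagrange_nodes_def)
  define m' where "m' z = (if z \<in> V then m z else 0)" for z
  have "m' \<in> multi_indices V k" using m by (auto simp: multi_indices_def m'_def)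
  moreover have "x = (\<Sum>z\<in>V. (real (m' z) / real k) *\<^sub>R z)" by (simp add: m m'_def)
  ultimately show "x \<in> (\<lambda>m. \<Sum>z\<in>V. (real (m z) / real k) *\<^sub>R z) ` multi_indices V k" by blast
next
  fix x assume "x \<in> (\<lambda>m. \<Sum>z\<in>V. (real (m z) / real k) *\<^sub>R z) ` multi_indices V k"
  then show "x \<in> lagrange_nodes k {T}" using V(2) by (auto simp: lagrange_nodes_def multi_indices_def)
qed

lemma lagrange_nodes_UN: "lagrange_nodes k \<T> = (\<Union>T\<in>\<T>. lagrange_nodes k {T})"
  unfolding lagrange_nodes_def by auto

lemma lattice_point_in_hull:
  fixes V :: "'a::real_vector set"
  assumes "finite V" "1 \<le> k" "m \<in> multi_indices V k"
  shows "(\<Sum>z\<in>V. (real (m z) / real k) *\<^sub>R z) \<in> convex hull V"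
proof -
  have "(\<Sum>z\<in>V. real (m z) / real k) = 1"
    using assms by (simp add: sum_divide_distrib[symmetric] multi_indices_def flip: of_nat_sum)
  then show ?thesis unfolding convex_hull_finite[OF assms(1)]
    by (intro CollectI exI[of _ "\<lambda>z. real (m z) / real k"]) auto
qed

lemma card_lagrange_nodes_simplex:
  fixes T :: "'a::euclidean_space set"
  assumes "int n simplex T" "1 \<le> k"
  shows "finite (lagrange_nodes k {T})" "card (lagrange_nodes k {T}) \<le> (k + 1) ^ (n + 1)"
    "lagrange_nodes k {T} \<subseteq> T"
proof -
  obtain V where V: "finite V" "card V = n + 1" "T = convex hull V" "{z. z extreme_point_of T} = V"
    using simplex_vertices[OF assms(1)] by metis
  note e = lagrange_nodes_single[OF V(1,4), of k]
  show "finite (lagrange_nodes k {T})" unfolding e using V by (intro finite_imageI finite_multi_indices)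
  show "card (lagrange_nodes k {T}) \<le> (k + 1) ^ (n + 1)"
    unfolding e using card_image_le[OF finite_multi_indices[OF V(1)]] card_multi_indices_le[OF V(1), of k] V(2)
    by (metis (no_types, lifting) order_trans)
  show "lagrange_nodes k {T} \<subseteq> T" unfolding e using lattice_point_in_hull[OF V(1) assms(2)] V(3) by auto
qed

text \<open>The constant counts the nodes and bounds their interpolation weights, so it does not depend on the shape of
  the simplex.\<close>

lemma nodal_bound_simplex:
  fixes T :: "'a::euclidean_space set"
  assumes T: "int n simplex T" and k: "1 \<le> k" and P: "P \<in> polynomials_le k"
    and B: "\<And>z. z \<in> lagrange_nodes k {T} \<Longrightarrow> \<bar>P z\<bar> \<le> B" and x: "x \<in> T"
  shows "\<bar>P x\<bar> \<le> real ((k + 1) ^ (n + 1) * k ^ k) * B"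
proof -
  obtain V where V: "finite V" "card V = n + 1" "T = convex hull V" "{z. z extreme_point_of T} = V"
    using simplex_vertices[OF T] by metis
  obtain \<mu> where \<mu>: "\<forall>z\<in>V. 0 \<le> \<mu> z" "sum \<mu> V = 1" "x = (\<Sum>z\<in>V. \<mu> z *\<^sub>R z)"
    using x V(1,3) by (auto simp: convex_hull_finite)
  have \<mu>1: "0 \<le> \<mu> z \<and> \<mu> z \<le> 1" if "z \<in> V" for z
    using \<mu>(1,2) that member_le_sum[of z V \<mu>] V(1) by auto
  let ?z = "\<lambda>m. \<Sum>z\<in>V. (real (m z) / real k) *\<^sub>R z"
  have "P x = (\<Sum>m\<in>multi_indices V k. P (?z m) * (\<Prod>i\<in>V. (real k * \<mu> i) gchoose m i))"
    unfolding \<mu>(3) using lagrange_interpolation[OF P k V(1) \<mu>(2), of "\<lambda>z. z"] by simp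
  also have "\<bar>\<dots>\<bar> \<le> (\<Sum>m\<in>multi_indices V k. B * real k ^ k)"
  proof (rule order_trans[OF sum_abs sum_mono])
    fix m assume m: "m \<in> multi_indices V k"
    have "\<bar>P (?z m)\<bar> \<le> B" by (rule B) (use m in \<open>auto simp: lagrange_nodes_single[OF V(1,4)]\<close>)
    then show "\<bar>P (?z m) * (\<Prod>i\<in>V. (real k * \<mu> i) gchoose m i)\<bar> \<le> B * real k ^ k"
      unfolding abs_mult using lagrange_weight_bound[OF V(1) m \<mu>1] by (intro mult_mono) auto
  qed
  also have "\<dots> = real (card (multi_indices V k)) * (B * real k ^ k)" by simp
  also have "\<dots> \<le> real ((k + 1) ^ (n + 1)) * (B * real k ^ k)"
  proof (intro mult_right_mono)
    show "real (card (multi_indices V k)) \<le> real ((k + 1) ^ (n + 1))"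
      using card_multi_indices_le[OF V(1), of k] V(2) by (simp only: of_nat_le_iff)
    have "card V > 0" using V(2) by simp
    then obtain z where "z \<in> V" by fastforce
    then have "(\<lambda>z'. if z' = z then k else 0) \<in> multi_indices V k" using V(1) by (auto simp: multi_indices_def)
    then have "\<bar>P (?z (\<lambda>z'. if z' = z then k else 0))\<bar> \<le> B"
      by (intro B) (auto simp: lagrange_nodes_single[OF V(1,4)])
    then show "0 \<le> B * real k ^ k" by (intro mult_nonneg_nonneg) auto
  qed
  finally show ?thesis by (simp add: mult_ac)
qed

text \<open>Used for facets, whose nodes are those nodes of the simplex with no weight on the opposite vertex.\<close>

lemma polynomial_zero_on_hull:
  fixes V :: "'a::euclidean_space set"
  assumes V: "finite V" and k: "1 \<le> k" and P: "P \<in> polynomials_le k"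
    and z: "\<And>m. m \<in> multi_indices V k \<Longrightarrow> P (\<Sum>z\<in>V. (real (m z) / real k) *\<^sub>R z) = 0" and x: "x \<in> convex hull V"
  shows "P x = 0"
proof -
  obtain \<mu> where \<mu>: "sum \<mu> V = 1" "x = (\<Sum>z\<in>V. \<mu> z *\<^sub>R z)"
    using x V by (auto simp: convex_hull_finite)
  show ?thesis unfolding \<mu>(2) using lagrange_interpolation[OF P k V \<mu>(1), of "\<lambda>z. z"] z by simp
qed

lemma facet_of_simplex:
  fixes T :: "'a::euclidean_space set"
  assumes "int n simplex T" "F facet_of T"
  obtains V a where "finite V" "\<not> affine_dependent V" "T = convex hull V" "{z. z extreme_point_of T} = V" "a \<in> V" "F = convex hull (V - {a})"
proof -
  obtain V where V: "finite V" "\<not> affine_dependent V" "card V = n + 1" "T = convex hull V" "{z. z extreme_point_of T} = V"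
    using simplex_vertices[OF assms(1)] by metis
  have "\<exists>u\<in>V. F = convex hull (V - {u})"
    using assms(2) facet_of_convex_hull_affine_independent[OF V(2), of F] V(4) by auto
  then show ?thesis using that V by blast
qed

text \<open>The polynomial keeps at least half of its maximal modulus on a homothetic copy of \<open>K\<close> of a fixed
  ratio, centred where the maximum is attained.\<close>

lemma polynomial_large_on_copy:
  assumes k: "1 \<le> k"
  shows "\<exists>s. 0 < s \<and> s \<le> 1 \<and> (\<forall>(P :: 'a::euclidean_space \<Rightarrow> real) K z. P \<in> polynomials_le k \<longrightarrow> compact K \<longrightarrow> convex K \<longrightarrow> z \<in> K \<longrightarrow>
     (\<exists>x\<in>K. \<forall>y\<in>K. x + s *\<^sub>R (y - x) \<in> K \<and> \<bar>P z\<bar> \<le> 2 * \<bar>P (x + s *\<^sub>R (y - x))\<bar>))"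
proof -
  obtain C where C: "C \<ge> 1" "\<And>(v :: 'a \<Rightarrow> real) x y M s. v \<in> polynomials_le k \<Longrightarrow>
     (\<forall>z\<in>closed_segment x y. \<bar>v z\<bar> \<le> M) \<Longrightarrow> s \<in> {0..1} \<Longrightarrow> \<bar>v (x + s *\<^sub>R (y - x)) - v x\<bar> \<le> C * M * s"
    using polynomial_segment_estimate[OF k, where 'a = 'a] by blast
  define s where "s = 1 / (2 * C)"
  have s: "0 < s" "s \<le> 1" "C * s = 1/2" using C(1) by (auto simp: s_def)
  have "\<exists>x\<in>K. \<forall>y\<in>K. x + s *\<^sub>R (y - x) \<in> K \<and> \<bar>P z\<bar> \<le> 2 * \<bar>P (x + s *\<^sub>R (y - x))\<bar>"
    if P: "P \<in> polynomials_le k" and K: "compact K" "convex K" and z: "z \<in> K" for P :: "'a \<Rightarrow> real" and K z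
  proof -
    have "continuous_on K (\<lambda>x. \<bar>P x\<bar>)"
      using polynomials_le_real_polynomial_function[OF P]
      by (intro continuous_intros continuous_on_polymonial_function) (simp add: real_polynomial_function_eq)
    then obtain x where x: "x \<in> K" "\<And>y. y \<in> K \<Longrightarrow> \<bar>P y\<bar> \<le> \<bar>P x\<bar>"
      using continuous_attains_sup[OF K(1)] z by blast
    show ?thesis
    proof (intro bexI[OF _ x(1)] ballI conjI)
      fix y assume y: "y \<in> K"
      have seg: "closed_segment x y \<subseteq> K" using K(2) x(1) y by (simp add: closed_segment_subset)
      have "x + s *\<^sub>R (y - x) = (1 - s) *\<^sub>R x + s *\<^sub>R y" by (simp add: algebra_simps)
      also have "\<dots> \<in> K" using K(2) x(1) y s by (intro convexD_alt) auto
      finally show "x + s *\<^sub>R (y - x) \<in> K" .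
      have "\<bar>P (x + s *\<^sub>R (y - x)) - P x\<bar> \<le> C * \<bar>P x\<bar> * s"
        using seg x(2) s by (intro C(2)[OF P]) auto
      also have "\<dots> = \<bar>P x\<bar> * (C * s)" by simp
      also have "\<dots> = \<bar>P x\<bar> / 2" using s(3) by simp
      finally show "\<bar>P z\<bar> \<le> 2 * \<bar>P (x + s *\<^sub>R (y - x))\<bar>" using x(2)[OF z] by linarith
    qed
  qed
  then show ?thesis using s by blast
qed

subsection \<open>Counting\<close>

lemma triangulation_interiors_disjoint:
  assumes "triangulation \<T>" "T \<in> \<T>" "T' \<in> \<T>" "T \<noteq> T'"
  shows "interior T \<inter> interior T' = {}"
proof (rule ccontr)
  assume ne: "interior T \<inter> interior T' \<noteq> {}"
  have f: "(T \<inter> T') face_of T" "(T' \<inter> T) face_of T'" using assms by (auto simp: triangulation_def)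
  have "T \<inter> T' = T" "T' \<inter> T = T'"
    using face_of_disjoint_interior[OF f(1)] face_of_disjoint_interior[OF f(2)] ne interior_subset[of T] interior_subset[of T']
    by blast+
  then show False using assms(4) by blast
qed

text \<open>The elements in a ball contain disjoint balls of comparable size, so comparing volumes bounds their number.\<close>

lemma mesh_volume_bounds:
  fixes \<T> :: "'a::euclidean_space set set"
  assumes tr: "mesh_of S (int DIM('a)) \<T>" and qu: "quasi_uniform \<sigma> \<T>" and \<sigma>: "0 < \<sigma>"
    and ne: "S \<noteq> {}"
  shows "0 < mesh_width \<T>" "\<And>T x y. T \<in> \<T> \<Longrightarrow> x \<in> T \<Longrightarrow> y \<in> T \<Longrightarrow> dist x y \<le> mesh_width \<T>"
    and "\<And>x \<rho>. 0 \<le> \<rho> \<Longrightarrow> real (card {T \<in> \<T>. T \<subseteq> cball x (\<rho> * mesh_width \<T>)}) \<le> (\<rho> / \<sigma>) ^ DIM('a)"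
proof -
  have tri: "triangulation \<T>" and sx: "\<And>T. T \<in> \<T> \<Longrightarrow> int DIM('a) simplex T" and US: "\<Union>\<T> = S"
    using tr by (auto simp: mesh_of_def)
  have fin: "finite \<T>" using tri by (simp add: triangulation_def)
  let ?h = "mesh_width \<T>"
  have cp: "compact T" if "T \<in> \<T>" for T using compact_simplex sx that by blast
  have dm: "diameter T \<le> ?h" if "T \<in> \<T>" for T
    unfolding mesh_width_def using fin that by (intro Max_ge) auto
  show dist: "dist x y \<le> ?h" if "T \<in> \<T>" "x \<in> T" "y \<in> T" for T x y
    using diameter_bounded_bound[OF compact_imp_bounded[OF cp[OF that(1)]] that(2,3)] dm[OF that(1)] by simp
  show h: "0 < ?h"
  proof -
    obtain T where T: "T \<in> \<T>" using ne US by auto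
    have "aff_dim T = int DIM('a)" using aff_dim_simplex[OF sx[OF T]] .
    then have "\<nexists>a. T = {a}" "T \<noteq> {}" by (auto simp: aff_dim_sing)
    then obtain x y where xy: "x \<in> T" "y \<in> T" "x \<noteq> y" by blast
    then have "0 < dist x y" by simp
    also have "\<dots> \<le> ?h" by (rule dist[OF T xy(1,2)])
    finally show ?thesis .
  qed
  show "real (card {T \<in> \<T>. T \<subseteq> cball x (\<rho> * ?h)}) \<le> (\<rho> / \<sigma>) ^ DIM('a)" if \<rho>: "0 \<le> \<rho>" for x \<rho>
  proof -
    let ?A = "{T \<in> \<T>. T \<subseteq> cball x (\<rho> * ?h)}"
    let ?w = "unit_ball_vol (real DIM('a))"
    have finA: "finite ?A" using fin by simp
    have "(\<Sum>T\<in>?A. ?w * (\<sigma> * ?h) ^ DIM('a)) \<le> (\<Sum>T\<in>?A. measure lborel (interior T))"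
    proof (rule sum_mono)
      fix T assume T: "T \<in> ?A"
      then obtain y where y: "cball y (\<sigma> * ?h) \<subseteq> T" using qu by (auto simp: quasi_uniform_def)
      then have sub: "ball y (\<sigma> * ?h) \<subseteq> interior T"
        by (meson ball_subset_cball interior_maximal open_ball order_trans)
      have "measure lborel (ball y (\<sigma> * ?h)) \<le> measure lborel (interior T)"
      proof (rule measure_mono_fmeasurable[OF sub])
        have "bounded (interior T)" using T cp by (intro bounded_interior compact_imp_bounded) auto
        then show "interior T \<in> fmeasurable lborel"
          using emeasure_bounded_finite by (intro fmeasurableI) auto
      qed auto
      then show "?w * (\<sigma> * ?h) ^ DIM('a) \<le> measure lborel (interior T)"
        using \<sigma> h by (simp add: content_ball)
    qed
    also have "\<dots> = measure lborel (\<Union>T\<in>?A. interior T)"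
    proof (rule measure_finite_Union[symmetric, OF finA])
      show "disjoint_family_on interior ?A"
        using triangulation_interiors_disjoint[OF tri] by (auto simp: disjoint_family_on_def)
      show "emeasure lborel (interior T) \<noteq> \<infinity>" if "T \<in> ?A" for T
      proof -
        have "bounded (interior T)" using that cp by (intro bounded_interior compact_imp_bounded) auto
        then show ?thesis using emeasure_bounded_finite by force
      qed
    qed auto
    also have "\<dots> \<le> measure lborel (cball x (\<rho> * ?h))"
    proof (rule measure_mono_fmeasurable)
      show "(\<Union>T\<in>?A. interior T) \<subseteq> cball x (\<rho> * ?h)" using interior_subset by blast
      show "(\<Union>T\<in>?A. interior T) \<in> sets lborel" unfolding sets_lborel by (intro borel_open open_UN) auto
      show "cball x (\<rho> * ?h) \<in> fmeasurable lborel"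
        using emeasure_bounded_finite[of "cball x (\<rho> * ?h)"] by (intro fmeasurableI) auto
    qed
    also have "\<dots> = ?w * (\<rho> * ?h) ^ DIM('a)" using \<rho> h by (intro content_cball) auto
    finally have "?w * ?h ^ DIM('a) * (real (card ?A) * \<sigma> ^ DIM('a)) \<le> ?w * ?h ^ DIM('a) * \<rho> ^ DIM('a)"
      by (simp add: power_mult_distrib mult_ac)
    then have "real (card ?A) * \<sigma> ^ DIM('a) \<le> \<rho> ^ DIM('a)"
      using h by (subst (asm) mult_le_cancel_left_pos) auto
    then show ?thesis using \<sigma> by (simp add: power_divide field_simps)
  qed
qed

text \<open>A node in the ball belongs to an element in the ball of twice the radius, and these elements have boundedly
  many nodes.\<close>

lemma nodes_in_ball_bound:
  fixes \<T> :: "'a::euclidean_space set set"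
  assumes tr: "mesh_of S (int DIM('a)) \<T>" and qu: "quasi_uniform \<sigma> \<T>" and \<sigma>: "0 < \<sigma>"
    and ne: "S \<noteq> {}" and k: "1 \<le> k" and Z: "Z \<subseteq> lagrange_nodes k \<T>" "Z \<subseteq> cball x (mesh_width \<T>)"
  shows "real (card Z) \<le> (2 / \<sigma>) ^ DIM('a) * real ((k + 1) ^ (DIM('a) + 1))"
proof -
  let ?h = "mesh_width \<T>"
  let ?A = "{T \<in> \<T>. T \<subseteq> cball x (2 * ?h)}"
  note mv = mesh_volume_bounds[OF tr qu \<sigma> ne]
  have sx: "\<And>T. T \<in> \<T> \<Longrightarrow> int DIM('a) simplex T" and fin: "finite \<T>"
    using tr by (auto simp: mesh_of_def triangulation_def)
  have "Z \<subseteq> (\<Union>T\<in>?A. lagrange_nodes k {T})"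
  proof
    fix z assume z: "z \<in> Z"
    then obtain T where T: "T \<in> \<T>" "z \<in> lagrange_nodes k {T}" using Z(1) lagrange_nodes_UN[of k \<T>] by blast
    have zT: "z \<in> T" using card_lagrange_nodes_simplex(3)[OF sx[OF T(1)] k] T(2) by blast
    have "T \<subseteq> cball x (2 * ?h)"
    proof
      fix y assume "y \<in> T"
      then have "dist z y \<le> ?h" "dist x z \<le> ?h" using mv(2)[OF T(1) zT] z Z(2) by auto
      then show "y \<in> cball x (2 * ?h)" using dist_triangle[of x y z] by simp
    qed
    then show "z \<in> (\<Union>T\<in>?A. lagrange_nodes k {T})" using T by blast
  qed
  then have "card Z \<le> card (\<Union>T\<in>?A. lagrange_nodes k {T})"
    using fin card_lagrange_nodes_simplex(1)[OF sx k] by (intro card_mono) auto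
  also have "\<dots> \<le> (\<Sum>T\<in>?A. card (lagrange_nodes k {T}))" using fin by (intro card_UN_le) auto
  also have "\<dots> \<le> (\<Sum>T\<in>?A. (k + 1) ^ (DIM('a) + 1))"
    using card_lagrange_nodes_simplex(2)[OF sx k] by (intro sum_mono) auto
  finally have "card Z \<le> card ?A * (k + 1) ^ (DIM('a) + 1)" by simp
  then have "real (card Z) \<le> real (card ?A) * real ((k + 1) ^ (DIM('a) + 1))"
    by (simp only: of_nat_mult[symmetric] of_nat_le_iff)
  also have "\<dots> \<le> (2 / \<sigma>) ^ DIM('a) * real ((k + 1) ^ (DIM('a) + 1))"
    using mv(3)[of 2 x] by (intro mult_right_mono) auto
  finally show ?thesis .
qed

subsection \<open>Measures\<close>

text \<open>Each \<open>a i\<close> is paid by the integral over \<open>A i\<close>, and no point is used more than \<open>C\<close> times.\<close>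

lemma sum_local_lower_bounds:
  fixes w :: "'x \<Rightarrow> real" and a :: "'i \<Rightarrow> real"
  assumes I: "finite I" and w: "integrable M w" "\<And>x. 0 \<le> w x"
    and A: "\<And>i. i \<in> I \<Longrightarrow> A i \<in> sets M" "\<And>i. i \<in> I \<Longrightarrow> \<beta> \<le> measure M (A i)"
    and a: "\<And>i. i \<in> I \<Longrightarrow> 0 \<le> a i" "\<And>i x. i \<in> I \<Longrightarrow> x \<in> A i \<Longrightarrow> a i \<le> w x"
    and C: "\<And>x. real (card {i \<in> I. x \<in> A i}) \<le> C" and fin: "emeasure M (space M) < \<infinity>"
  shows "\<beta> * (\<Sum>i\<in>I. a i) \<le> C * (LINT x|M. w x)"
proof -
  have ind: "integrable M (\<lambda>x. indicator (A i) x * w x)" if "i \<in> I" for i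
    using integrable_mult_indicator[OF A(1)[OF that] w(1)] by simp
  have "\<beta> * (\<Sum>i\<in>I. a i) = (\<Sum>i\<in>I. \<beta> * a i)" by (simp add: sum_distrib_left)
  also have "\<dots> \<le> (\<Sum>i\<in>I. (LINT x|M. indicator (A i) x * w x))"
  proof (rule sum_mono)
    fix i assume i: "i \<in> I"
    have fA: "emeasure M (A i) < \<infinity>"
      using emeasure_mono[OF sets.sets_into_space[OF A(1)[OF i]] sets.top] fin by (rule le_less_trans)
    have "\<beta> * a i \<le> measure M (A i) * a i" using A(2)[OF i] a(1)[OF i] by (intro mult_right_mono)
    also have "\<dots> = (LINT x|M. indicator (A i) x * a i)" using A(1)[OF i] fA by simp
    also have "\<dots> \<le> (LINT x|M. indicator (A i) x * w x)"
    proof (rule integral_mono)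
      show "integrable M (\<lambda>x. indicator (A i) x * a i)" using A(1)[OF i] fA by simp
      show "indicator (A i) x * a i \<le> indicator (A i) x * w x" for x
        using a(2)[OF i, of x] by (auto simp: indicator_def)
    qed (rule ind[OF i])
    finally show "\<beta> * a i \<le> (LINT x|M. indicator (A i) x * w x)" .
  qed
  also have "\<dots> = (LINT x|M. (\<Sum>i\<in>I. indicator (A i) x * w x))"
    by (rule Bochner_Integration.integral_sum[symmetric]) (rule ind)
  also have "\<dots> \<le> (LINT x|M. C * w x)"
  proof (rule integral_mono)
    show "integrable M (\<lambda>x. \<Sum>i\<in>I. indicator (A i) x * w x)" by (intro Bochner_Integration.integrable_sum ind)
    show "integrable M (\<lambda>x. C * w x)" using w(1) by simp
    show "(\<Sum>i\<in>I. indicator (A i) x * w x) \<le> C * w x" for x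
    proof -
      have "(\<Sum>i\<in>I. indicator (A i) x * w x) = real (card {i \<in> I. x \<in> A i}) * w x"
        using I by (simp add: sum_distrib_right[symmetric] indicator_def sum.If_cases Int_def)
      also have "\<dots> \<le> C * w x" using C w(2) by (intro mult_right_mono)
      finally show ?thesis .
    qed
  qed
  finally show ?thesis by simp
qed

text \<open>Bounded integrands over a finite measure make the interchange of sums and integrals legitimate; this serves
  all mass, coupling and stiffness matrices, the latter with the coefficient as the weight \<open>w\<close>.\<close>

lemma gram_sum:
  fixes \<psi> :: "nat \<Rightarrow> 'x \<Rightarrow> 'b::euclidean_space" and w :: "'x \<Rightarrow> real"
  assumes fin: "emeasure M (space M) < \<infinity>"
    and w: "w \<in> borel_measurable M" "AE x in M. 0 \<le> w x \<and> w x \<le> W"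
    and \<psi>: "\<And>i. i < n \<Longrightarrow> \<psi> i \<in> borel_measurable M" "\<And>i. i < n \<Longrightarrow> AE x in M. norm (\<psi> i x) \<le> B"
    and \<psi>': "\<And>i. i < n' \<Longrightarrow> \<psi>' i \<in> borel_measurable M" "\<And>i. i < n' \<Longrightarrow> AE x in M. norm (\<psi>' i x) \<le> B"
  shows "(\<Sum>i<n. \<Sum>j<n'. a i * (LINT x|M. w x * inner (\<psi>' j x) (\<psi> i x)) * b j)
      = (LINT x|M. w x * inner (\<Sum>i<n. a i *\<^sub>R \<psi> i x) (\<Sum>j<n'. b j *\<^sub>R \<psi>' j x))"
    and "integrable M (\<lambda>x. w x * inner (\<Sum>i<n. a i *\<^sub>R \<psi> i x) (\<Sum>j<n'. b j *\<^sub>R \<psi>' j x))"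
proof -
  interpret finite_measure M by (rule finite_measureI) (use fin in auto)
  have i: "integrable M (\<lambda>x. w x * inner (\<psi>' j x) (\<psi> i x))" if ij: "i < n" "j < n'" for i j
  proof (rule integrable_const_bound[where B = "\<bar>W\<bar> * (\<bar>B\<bar> * \<bar>B\<bar>)"])
    show "AE x in M. norm (w x * inner (\<psi>' j x) (\<psi> i x)) \<le> \<bar>W\<bar> * (\<bar>B\<bar> * \<bar>B\<bar>)"
      using w(2) \<psi>(2)[OF ij(1)] \<psi>'(2)[OF ij(2)]
    proof eventually_elim
      case (elim x)
      have "\<bar>inner (\<psi>' j x) (\<psi> i x)\<bar> \<le> norm (\<psi>' j x) * norm (\<psi> i x)" by (rule Cauchy_Schwarz_ineq2)
      also have "\<dots> \<le> \<bar>B\<bar> * \<bar>B\<bar>"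
        using elim(2,3) by (intro mult_mono) auto
      finally show ?case using elim(1) unfolding real_norm_def abs_mult by (intro mult_mono) auto
    qed
    show "(\<lambda>x. w x * inner (\<psi>' j x) (\<psi> i x)) \<in> borel_measurable M" using w(1) \<psi>(1) \<psi>'(1) ij by simp
  qed
  have eq: "w x * inner (\<Sum>i<n. a i *\<^sub>R \<psi> i x) (\<Sum>j<n'. b j *\<^sub>R \<psi>' j x)
      = (\<Sum>i<n. \<Sum>j<n'. a i * b j * (w x * inner (\<psi>' j x) (\<psi> i x)))" for x
    by (simp add: inner_sum_left inner_sum_right sum_distrib_left inner_commute mult_ac)
  show "integrable M (\<lambda>x. w x * inner (\<Sum>i<n. a i *\<^sub>R \<psi> i x) (\<Sum>j<n'. b j *\<^sub>R \<psi>' j x))"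
    unfolding eq using i by (intro Bochner_Integration.integrable_sum integrable_mult_right) auto
  show "(\<Sum>i<n. \<Sum>j<n'. a i * (LINT x|M. w x * inner (\<psi>' j x) (\<psi> i x)) * b j)
      = (LINT x|M. w x * inner (\<Sum>i<n. a i *\<^sub>R \<psi> i x) (\<Sum>j<n'. b j *\<^sub>R \<psi>' j x))"
    proof -
    have "(LINT x|M. (\<Sum>i<n. \<Sum>j<n'. a i * b j * (w x * inner (\<psi>' j x) (\<psi> i x))))
        = (\<Sum>i<n. (LINT x|M. (\<Sum>j<n'. a i * b j * (w x * inner (\<psi>' j x) (\<psi> i x)))))"
      using i by (intro Bochner_Integration.integral_sum Bochner_Integration.integrable_sum integrable_mult_right) auto
    also have "\<dots> = (\<Sum>i<n. \<Sum>j<n'. (LINT x|M. a i * b j * (w x * inner (\<psi>' j x) (\<psi> i x))))"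
      using i by (intro sum.cong refl Bochner_Integration.integral_sum integrable_mult_right) auto
    finally show ?thesis unfolding eq by (simp add: mult_ac)
  qed
qed

lemma sum_less_top_ennreal:
  "finite A \<Longrightarrow> (\<And>a. a \<in> A \<Longrightarrow> f a < top_class.top) \<Longrightarrow> sum f A < (top_class.top :: ennreal)"
  by (induction A rule: finite_induct) auto

text \<open>The boundary has finite surface measure because it is a finite union of simplices of dimension \<open>d - 1\<close>.\<close>

lemma surface_measure_facts:
  fixes \<Gamma> :: "'a::euclidean_space set"
  assumes d2: "2 \<le> DIM('a)" and m: "mesh_of \<Gamma> (int DIM('a) - 1) \<M>"
  shows "compact \<Gamma>" "space (surface_measure \<Gamma>) = \<Gamma>" "emeasure (surface_measure \<Gamma>) (space (surface_measure \<Gamma>)) < \<infinity>"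
    "\<And>A. A \<in> sets borel \<Longrightarrow> A \<subseteq> \<Gamma> \<Longrightarrow> A \<in> sets (surface_measure \<Gamma>) \<and> emeasure (surface_measure \<Gamma>) A = hausdorff_outer (DIM('a) - 1) A"
    "\<And>f :: 'a \<Rightarrow> 'b::topological_space. f \<in> borel_measurable borel \<Longrightarrow> f \<in> borel_measurable (surface_measure \<Gamma>)"
proof -
  have M: "finite \<M>" "\<And>S. S \<in> \<M> \<Longrightarrow> int (DIM('a) - 1) simplex S" "\<Gamma> = \<Union>\<M>"
    using m d2 by (auto simp: mesh_of_def triangulation_def of_nat_diff)
  show cp: "compact \<Gamma>" unfolding M(3) using M compact_simplex by (intro compact_Union) auto
  have s1: "1 \<le> DIM('a) - 1" using d2 by simp
  show sp: "space (surface_measure \<Gamma>) = \<Gamma>" by (simp add: surface_measure_def space_restrict_space)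
  have \<Gamma>b: "\<Gamma> \<in> sets borel" using cp by (simp add: borel_compact)
  show A: "A \<in> sets (surface_measure \<Gamma>) \<and> emeasure (surface_measure \<Gamma>) A = hausdorff_outer (DIM('a) - 1) A"
    if "A \<in> sets borel" "A \<subseteq> \<Gamma>" for A
    using that \<Gamma>b s1 unfolding surface_measure_def
    by (auto simp: sets_restrict_space_iff emeasure_restrict_space emeasure_hausdorff_measure)
  have "emeasure (surface_measure \<Gamma>) (\<Union>S\<in>\<M>. S) \<le> (\<Sum>S\<in>\<M>. emeasure (surface_measure \<Gamma>) S)"
  proof (rule emeasure_subadditive_finite[OF M(1)], clarify)
    fix S assume S: "S \<in> \<M>"
    then have "compact S" using M(2) compact_simplex by blast
    then show "S \<in> sets (surface_measure \<Gamma>)" using A[of S] S M(3) by (auto simp: borel_compact)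
  qed
  also have "\<dots> < \<infinity>"
  proof (simp only: infinity_ennreal_def, rule sum_less_top_ennreal[OF M(1)])
    fix S assume S: "S \<in> \<M>"
    obtain V where V: "finite V" "card V = (DIM('a) - 1) + 1" "S = convex hull V"
      using simplex_vertices[OF M(2)[OF S]] by metis
    have "compact S" using M(2)[OF S] compact_simplex by blast
    then have "emeasure (surface_measure \<Gamma>) S = hausdorff_outer (DIM('a) - 1) S"
      using A[of S] S M(3) by (auto simp: borel_compact)
    also have "\<dots> < \<infinity>" unfolding V(3) by (rule hausdorff_outer_convex_hull_finite[OF s1 V(1,2)])
    finally show "emeasure (surface_measure \<Gamma>) S < top_class.top" by simp
  qed
  finally show "emeasure (surface_measure \<Gamma>) (space (surface_measure \<Gamma>)) < \<infinity>" by (simp add: sp M(3)[symmetric])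
  show "f \<in> borel_measurable (surface_measure \<Gamma>)" if "f \<in> borel_measurable borel" for f :: "'a \<Rightarrow> 'b::topological_space"
  proof -
    have "f \<in> borel_measurable (hausdorff_measure (DIM('a) - 1))"
      using that by (simp add: measurable_cong_sets[OF sets_hausdorff_measure refl])
    then show ?thesis unfolding surface_measure_def by (rule measurable_restrict_space1)
  qed
qed

lemma surface_measure_continuous_measurable:
  fixes \<Gamma> :: "'a::euclidean_space set" and f :: "'a \<Rightarrow> real"
  assumes cp: "compact \<Gamma>" and f: "continuous_on \<Gamma> f"
  shows "f \<in> borel_measurable (surface_measure \<Gamma>)"
proof -
  have "f \<in> borel_measurable (restrict_space borel \<Gamma>)" by (rule borel_measurable_continuous_on_restrict[OF f])
  moreover have "sets (restrict_space borel \<Gamma>) = sets (surface_measure \<Gamma>)"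
    unfolding surface_measure_def by (simp add: sets_restrict_space)
  ultimately show ?thesis by (simp cong: measurable_cong_sets)
qed

section \<open>Weak derivatives in time\<close>

text \<open>Integration by parts for a primitive that is differentiable only almost everywhere, by Fubini's
  theorem on the set \<open>t \<le> s\<close>.\<close>

lemma primitive_by_parts:
  fixes w \<phi> \<phi>' :: "real \<Rightarrow> real"
  assumes w: "integrable lborel w"
    and \<phi>: "\<And>t. (\<phi> has_real_derivative \<phi>' t) (at t)" and c: "continuous_on UNIV \<phi>'"
    and supp: "\<And>t. t \<notin> {a..b} \<Longrightarrow> \<phi> t = 0"
  shows "integrable lborel \<phi>'" and "\<And>t. t \<notin> {a..b} \<Longrightarrow> \<phi>' t = 0"
    and "(LBINT t. w t * \<phi> t) = - (LBINT s. \<phi>' s * (LBINT t. indicator {..s} t * w t))"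
proof -
  show z: "\<phi>' t = 0" if t: "t \<notin> {a..b}" for t
  proof -
    have "(\<phi> has_real_derivative 0) (at t)"
      by (rule has_field_derivative_transform_within_open[where f = "\<lambda>_. 0" and S = "- {a..b}"])
        (use t supp in auto)
    then show ?thesis using \<phi>[of t] DERIV_unique by blast
  qed
  have "set_integrable lborel {a..b} \<phi>'"
    by (rule borel_integrable_atLeastAtMost') (use c continuous_on_subset in blast)
  moreover have "(\<lambda>x. indicator {a..b} x *\<^sub>R \<phi>' x) = \<phi>'"
  proof
    fix x show "indicator {a..b} x *\<^sub>R \<phi>' x = \<phi>' x" using z[of x] by (cases "x \<in> {a..b}") auto
  qed
  ultimately show i: "integrable lborel \<phi>'" by (simp add: set_integrable_def)
  have [measurable]: "\<phi>' \<in> borel_measurable borel" "w \<in> borel_measurable borel"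
    using i w by (auto dest: borel_measurable_integrable)
  have it: "integrable lborel (\<lambda>s. if t \<le> s then \<phi>' s else 0)" for t
    by (rule Bochner_Integration.integrable_bound[OF i]) auto
  have eq: "\<phi> t = - (LBINT s. (if t \<le> s then \<phi>' s else 0))" for t
  proof -
    define B where "B = max t b + 1"
    have "(LBINT s. indicator {t..B} s *\<^sub>R \<phi>' s) = \<phi> B - \<phi> t"
      by (rule integral_FTC_atLeastAtMost)
        (use \<phi> c in \<open>auto simp: B_def has_real_derivative_iff_has_vector_derivative[symmetric]
          intro: has_field_derivative_at_within continuous_on_subset\<close>)
    also have "\<phi> B = 0" by (rule supp) (auto simp: B_def)
    also have "(\<lambda>s. indicator {t..B} s *\<^sub>R \<phi>' s) = (\<lambda>s. if t \<le> s then \<phi>' s else 0)"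
    proof
      fix s show "indicator {t..B} s *\<^sub>R \<phi>' s = (if t \<le> s then \<phi>' s else 0)"
        using z[of s] by (cases "s \<in> {a..b}") (auto simp: B_def indicator_def)
    qed
    finally show ?thesis by simp
  qed
  have P: "integrable (lborel \<Otimes>\<^sub>M lborel) (case_prod (\<lambda>t s. w t * (if t \<le> s then \<phi>' s else 0)))"
  proof (rule lborel_pair.Fubini_integrable)
    have "integrable lborel (\<lambda>t. \<bar>w t\<bar> * (LBINT s. \<bar>\<phi>' s\<bar>))" using w by auto
    then show "integrable lborel (\<lambda>x. LBINT y. norm (case (x, y) of (t, s) \<Rightarrow> w t * (if t \<le> s then \<phi>' s else 0)))"
    proof (rule Bochner_Integration.integrable_bound)
      show "AE t in lborel. norm (LBINT y. norm (case (t, y) of (t, s) \<Rightarrow> w t * (if t \<le> s then \<phi>' s else 0)))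
          \<le> norm (\<bar>w t\<bar> * (LBINT s. \<bar>\<phi>' s\<bar>))"
      proof (rule AE_I2)
        fix t
        have "(LBINT s. \<bar>if t \<le> s then \<phi>' s else 0\<bar>) \<le> (LBINT s. \<bar>\<phi>' s\<bar>)"
          using it[of t] i by (intro integral_mono) auto
        then show "norm (LBINT y. norm (case (t, y) of (t, s) \<Rightarrow> w t * (if t \<le> s then \<phi>' s else 0)))
          \<le> norm (\<bar>w t\<bar> * (LBINT s. \<bar>\<phi>' s\<bar>))"
          by (simp add: abs_mult mult_left_mono)
      qed
    qed measurable
    show "AE x in lborel. integrable lborel (\<lambda>y. case (x, y) of (t, s) \<Rightarrow> w t * (if t \<le> s then \<phi>' s else 0))"
      using it by auto
  qed measurable
  have "(LBINT t. w t * \<phi> t) = - (LBINT t. LBINT s. w t * (if t \<le> s then \<phi>' s else 0))"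
    by (subst eq) simp
  also have "\<dots> = - (LBINT s. LBINT t. w t * (if t \<le> s then \<phi>' s else 0))"
    by (subst lborel_pair.Fubini_integral[OF P]) simp
  also have "(\<lambda>s. LBINT t. w t * (if t \<le> s then \<phi>' s else 0))
      = (\<lambda>s. \<phi>' s * (LBINT t. indicator {..s} t * w t))"
  proof
    fix s
    have "(LBINT t. w t * (if t \<le> s then \<phi>' s else 0)) = (LBINT t. \<phi>' s * (indicator {..s} t * w t))"
      by (intro Bochner_Integration.integral_cong) (auto simp: indicator_def)
    then show "(LBINT t. w t * (if t \<le> s then \<phi>' s else 0)) = \<phi>' s * (LBINT t. indicator {..s} t * w t)"
      by simp
  qed
  finally show "(LBINT t. w t * \<phi> t) = - (LBINT s. \<phi>' s * (LBINT t. indicator {..s} t * w t))" .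
qed

text \<open>Continuous approximations of the indicator of \<open>(x, y)\<close>, since test functions have continuous derivatives.\<close>

definition trapezoid :: "real \<Rightarrow> real \<Rightarrow> nat \<Rightarrow> real \<Rightarrow> real" where
  "trapezoid x y n t = max 0 (min 1 (min (real n * (t - x)) (real n * (y - t))))"

lemma trapezoid_properties:
  shows "continuous_on UNIV (trapezoid x y n)" and "t \<notin> {x..y} \<Longrightarrow> trapezoid x y n t = 0"
    and "\<bar>trapezoid x y n t\<bar> \<le> indicator {x..y} t"
    and "(\<lambda>n. trapezoid x y n t) \<longlonglongrightarrow> indicator {x<..<y} t"
proof -
  show "continuous_on UNIV (trapezoid x y n)"
    unfolding trapezoid_def by (intro continuous_intros)
  show z: "trapezoid x y n t = 0" if "t \<notin> {x..y}" for n t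
  proof -
    have "real n * (t - x) \<le> 0 \<or> real n * (y - t) \<le> 0"
      using that by (auto intro: mult_nonneg_nonpos)
    then show ?thesis unfolding trapezoid_def by linarith
  qed
  then show "\<bar>trapezoid x y n t\<bar> \<le> indicator {x..y} t"
    by (cases "t \<in> {x..y}") (auto simp: trapezoid_def)
  show "(\<lambda>n. trapezoid x y n t) \<longlonglongrightarrow> indicator {x<..<y} t"
  proof (cases "x < t \<and> t < y")
    case True
    obtain N where N: "1 / (t - x) + 1 / (y - t) \<le> real N" using real_arch_simple by blast
    have "trapezoid x y n t = 1" if "N \<le> n" for n
    proof -
      have "1 / (t - x) \<le> real n" "1 / (y - t) \<le> real n"
        using N that True by (smt (verit) of_nat_le_iff divide_nonneg_pos)+
      then have "1 \<le> real n * (t - x)" "1 \<le> real n * (y - t)" using True by (auto simp: field_simps)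
      then show ?thesis by (simp add: trapezoid_def)
    qed
    then show ?thesis using True
      by (intro tendsto_eventually) (auto simp: eventually_sequentially)
  next
    case False
    then have "trapezoid x y n t = 0" for n
      using z[of t n] by (cases "t = x \<or> t = y") (auto simp: trapezoid_def)
    then show ?thesis using False by auto
  qed
qed

text \<open>A continuous function with integral zero is the derivative of a test function.  So the
  trapezoids for \<open>(x, y)\<close> and for a fixed interval, weighted to have the same integral, are indistinguishable for \<open>g\<close>.\<close>

lemma du_Bois_Reymond:
  fixes g :: "real \<Rightarrow> real"
  assumes T: "0 < T" and g: "integrable lborel g"
    and orth: "\<And>\<phi> \<phi>' a b. (\<And>t. (\<phi> has_real_derivative \<phi>' t) (at t)) \<Longrightarrow> continuous_on UNIV \<phi>' \<Longrightarrow>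
        0 < a \<Longrightarrow> b < T \<Longrightarrow> (\<And>t. t \<notin> {a..b} \<Longrightarrow> \<phi> t = 0) \<Longrightarrow> (LBINT t. g t * \<phi>' t) = 0"
  shows "\<exists>c. \<forall>x y. 0 < x \<longrightarrow> x < y \<longrightarrow> y < T \<longrightarrow> (LBINT t. g t * indicator {x<..<y} t) = c * (y - x)"
proof -
  have zero: "(LBINT t. g t * \<psi> t) = 0"
    if c: "continuous_on UNIV \<psi>" and s: "\<And>t. t \<notin> {a..b} \<Longrightarrow> \<psi> t = 0" and ab: "0 < a" "b < T"
      and i: "(LBINT t. \<psi> t) = 0" for a b and \<psi> :: "real \<Rightarrow> real"
  proof -
    define \<phi> where "\<phi> t = integral {a - 1..t} \<psi>" for t
    have z: "\<phi> t = 0" if "t < a" for t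
      unfolding \<phi>_def using s that by (intro integral_unique has_integral_is_0) auto
    have d: "(\<phi> has_real_derivative \<psi> t) (at t)" for t
    proof (cases "t < a")
      case True
      have "(\<phi> has_real_derivative 0) (at t)"
        by (rule has_field_derivative_transform_within_open[where f = "\<lambda>_. 0" and S = "{..<a}"])
          (use True z in auto)
      then show ?thesis using s[of t] True by simp
    next
      case False
      have "((\<lambda>x. integral {a - 1..x} \<psi>) has_real_derivative \<psi> t) (at t within {a - 1..t + 1})"
        using False c by (intro integral_has_real_derivative) (auto intro: continuous_on_subset)
      then show ?thesis using False at_within_Icc_at[of "a - 1" t "t + 1"] by (simp add: \<phi>_def[abs_def])
    qed
    have b: "\<phi> t = 0" if t: "t > b" for t
    proof (cases "t < a")
      case False
      have "(LBINT s. indicator {a - 1..t} s *\<^sub>R \<psi> s) = \<phi> t - \<phi> (a - 1)"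
        by (rule integral_FTC_atLeastAtMost)
         (use d c False in \<open>auto simp: has_real_derivative_iff_has_vector_derivative[symmetric]
          intro: has_field_derivative_at_within continuous_on_subset\<close>)
      moreover have "(\<lambda>s. indicator {a - 1..t} s *\<^sub>R \<psi> s) = \<psi>"
      proof
        fix x show "indicator {a - 1..t} x *\<^sub>R \<psi> x = \<psi> x" using s[of x] t by (cases "x \<in> {a..b}") auto
      qed
      ultimately show ?thesis using i z[of "a - 1"] by simp
    qed (use z in auto)
    show ?thesis by (rule orth[OF d c ab]) (use z b in auto)
  qed
  let ?\<theta> = trapezoid
  have int\<theta>: "integrable lborel (?\<theta> x y n)" "(?\<theta> x y n) \<in> borel_measurable borel" for x y n
  proof -
    have m: "continuous_on S (?\<theta> x y n)" for S using trapezoid_properties(1) continuous_on_subset by blast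
    show "(?\<theta> x y n) \<in> borel_measurable borel" using m by (intro borel_measurable_continuous_onI)
    have "set_integrable lborel {x..y} (?\<theta> x y n)" by (intro borel_integrable_atLeastAtMost' m)
    moreover have "(\<lambda>t. indicator {x..y} t *\<^sub>R ?\<theta> x y n t) = ?\<theta> x y n"
      using trapezoid_properties(2)[of _ x y n] by (auto simp: indicator_def fun_eq_iff)
    ultimately show "integrable lborel (?\<theta> x y n)" by (simp add: set_integrable_def)
  qed
  have [measurable]: "g \<in> borel_measurable borel" using g by (auto dest: borel_measurable_integrable)
  have lim1: "(\<lambda>n. LBINT t. g t * ?\<theta> x y n t) \<longlonglongrightarrow> (LBINT t. g t * indicator {x<..<y} t)" for x y
  proof (rule integral_dominated_convergence[where w = "\<lambda>t. \<bar>g t\<bar>"])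
    show "AE t in lborel. norm (g t * ?\<theta> x y n t) \<le> \<bar>g t\<bar>" for n
    proof (rule AE_I2)
      fix t have "\<bar>?\<theta> x y n t\<bar> \<le> 1" using trapezoid_properties(3)[of x y n t] by (cases "t \<in> {x..y}") auto
      then show "norm (g t * ?\<theta> x y n t) \<le> \<bar>g t\<bar>" by (simp add: abs_mult mult_left_le)
    qed
  qed (use g int\<theta> in \<open>auto intro!: tendsto_mult trapezoid_properties\<close>)
  have lim2: "(\<lambda>n. LBINT t. ?\<theta> x y n t) \<longlonglongrightarrow> y - x" if "x < y" for x y
  proof -
    have "(\<lambda>n. LBINT t. ?\<theta> x y n t) \<longlonglongrightarrow> (LBINT t. indicator {x<..<y} t)"
    proof (rule integral_dominated_convergence[where w = "indicator {x..y}"])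
      show "integrable lborel (indicator {x..y} :: real \<Rightarrow> real)"
        by (intro integrable_real_indicator) (auto intro: emeasure_bounded_finite[simplified])
    qed (use int\<theta> in \<open>auto intro!: trapezoid_properties\<close>)
    then show ?thesis using that by simp
  qed
  define x0 where "x0 = T / 3"
  define y0 where "y0 = 2 * T / 3"
  have xy0: "0 < x0" "x0 < y0" "y0 < T" using T by (auto simp: x0_def y0_def)
  define c where "c = (LBINT t. g t * indicator {x0<..<y0} t) / (y0 - x0)"
  have "(LBINT t. g t * indicator {x<..<y} t) = c * (y - x)" if xy: "0 < x" "x < y" "y < T" for x y
  proof -
    have eq: "(LBINT t. ?\<theta> x0 y0 n t) * (LBINT t. g t * ?\<theta> x y n t)
        = (LBINT t. ?\<theta> x y n t) * (LBINT t. g t * ?\<theta> x0 y0 n t)" for n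
    proof -
      define I J where "I = (LBINT t. ?\<theta> x y n t)" and "J = (LBINT t. ?\<theta> x0 y0 n t)"
      have ig: "integrable lborel (\<lambda>t. g t * ?\<theta> x y n t)" for x y n
      proof (rule Bochner_Integration.integrable_bound[OF g])
        show "AE t in lborel. norm (g t * ?\<theta> x y n t) \<le> norm (g t)"
        proof (rule AE_I2)
          fix t have "\<bar>?\<theta> x y n t\<bar> \<le> 1" using trapezoid_properties(3)[of x y n t] by (cases "t \<in> {x..y}") auto
          then show "norm (g t * ?\<theta> x y n t) \<le> norm (g t)" by (simp add: abs_mult mult_left_le)
        qed
      qed (use int\<theta>(2)[of x y n] in measurable)
      have "(LBINT t. g t * (J * ?\<theta> x y n t - I * ?\<theta> x0 y0 n t)) = 0"
      proof (rule zero[where a = "min x x0" and b = "max y y0"])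
        show "continuous_on UNIV (\<lambda>t. J * ?\<theta> x y n t - I * ?\<theta> x0 y0 n t)"
          by (intro continuous_intros trapezoid_properties)
        show "J * ?\<theta> x y n t - I * ?\<theta> x0 y0 n t = 0" if "t \<notin> {min x x0..max y y0}" for t
        proof -
          have "t \<notin> {x..y}" "t \<notin> {x0..y0}" using that by auto
          then show ?thesis by (simp add: trapezoid_properties(2))
        qed
        show "(LBINT t. J * ?\<theta> x y n t - I * ?\<theta> x0 y0 n t) = 0"
          using int\<theta> by (simp add: I_def J_def)
      qed (use xy xy0 in auto)
      moreover have "(LBINT t. g t * (J * ?\<theta> x y n t - I * ?\<theta> x0 y0 n t))
          = (LBINT t. J * (g t * ?\<theta> x y n t) - I * (g t * ?\<theta> x0 y0 n t))"
        by (intro Bochner_Integration.integral_cong) (auto simp: algebra_simps)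
      ultimately show ?thesis using ig by (simp add: I_def J_def)
    qed
    have "(y0 - x0) * (LBINT t. g t * indicator {x<..<y} t)
        = (y - x) * (LBINT t. g t * indicator {x0<..<y0} t)"
    proof (rule LIMSEQ_unique)
      show "(\<lambda>n. (LBINT t. ?\<theta> x0 y0 n t) * (LBINT t. g t * ?\<theta> x y n t))
          \<longlonglongrightarrow> (y0 - x0) * (LBINT t. g t * indicator {x<..<y} t)"
        by (intro tendsto_mult lim1 lim2 xy0)
      show "(\<lambda>n. (LBINT t. ?\<theta> x0 y0 n t) * (LBINT t. g t * ?\<theta> x y n t))
          \<longlonglongrightarrow> (y - x) * (LBINT t. g t * indicator {x0<..<y0} t)"
        unfolding eq by (intro tendsto_mult lim1 lim2 xy)
    qed
    then show ?thesis using xy0 by (simp add: c_def field_simps)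
  qed
  then show ?thesis by blast
qed

text \<open>Fubini's theorem is applied to Borel functions, while weak derivatives are only Lebesgue measurable.\<close>

lemma borel_representative:
  fixes w :: "real \<Rightarrow> real"
  assumes S: "S \<in> sets borel" and w: "integrable (lebesgue_on S) w"
  obtains wb where "integrable lborel wb"
    "\<And>A \<phi>. A \<in> sets borel \<Longrightarrow> A \<subseteq> S \<Longrightarrow> \<phi> \<in> borel_measurable borel \<Longrightarrow>
      (LINT t|lebesgue_on A. w t * \<phi> t) = (LBINT t. wb t * (indicator A t * \<phi> t))"
proof -
  have SL: "S \<in> sets lebesgue" using S by auto
  have i: "integrable lebesgue (\<lambda>t. if t \<in> S then w t else 0)"
    using w Lebesgue_Measure.integrable_restrict_UNIV[OF SL] by blast
  then obtain wb where wb: "wb \<in> borel_measurable lborel" "AE t in lborel. (if t \<in> S then w t else 0) = wb t"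
    using completion_ex_borel_measurable_real[of _ lborel] borel_measurable_integrable by blast
  have ae: "AE t in lebesgue. (if t \<in> S then w t else 0) = wb t" using wb(2) by (rule AE_completion)
  have wbm: "wb \<in> borel_measurable lebesgue" using wb(1) by (rule measurable_completion)
  have "integrable lebesgue wb"
    by (rule integrable_cong_AE_imp[OF i wbm]) (use ae in \<open>auto elim: eventually_mono\<close>)
  then have wbi: "integrable lborel wb" using integrable_completion[OF wb(1)] by simp
  have "(LINT t|lebesgue_on A. w t * \<phi> t) = (LBINT t. wb t * (indicator A t * \<phi> t))"
    if A: "A \<in> sets borel" "A \<subseteq> S" and \<phi>: "\<phi> \<in> borel_measurable borel" for A \<phi>
  proof -
    have AL: "A \<in> sets lebesgue" using A by auto
    have m: "(\<lambda>t. wb t * (indicator A t * \<phi> t)) \<in> borel_measurable lborel"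
      using wb(1) A \<phi> by measurable
    have "(LINT t|lebesgue_on A. w t * \<phi> t) = (LINT t|lebesgue. (if t \<in> A then w t * \<phi> t else 0))"
      by (rule Lebesgue_Measure.integral_restrict_UNIV[OF AL, symmetric])
    also have "\<dots> = (LINT t|lebesgue. (if t \<in> S then w t else 0) * (indicator A t * \<phi> t))"
      using A by (intro Bochner_Integration.integral_cong) (auto simp: indicator_def)
    also have "\<dots> = (LINT t|lebesgue. wb t * (indicator A t * \<phi> t))"
    proof (rule integral_cong_AE)
      show "(\<lambda>t. (if t \<in> S then w t else 0) * (indicator A t * \<phi> t)) \<in> borel_measurable lebesgue"
        using A \<phi> by (intro borel_measurable_times borel_measurable_integrable[OF i] measurable_completion) auto
      show "(\<lambda>t. wb t * (indicator A t * \<phi> t)) \<in> borel_measurable lebesgue" using m by (rule measurable_completion)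
    qed (use ae in \<open>auto elim: eventually_mono\<close>)
    also have "\<dots> = (LBINT t. wb t * (indicator A t * \<phi> t))" by (rule integral_completion[OF m])
    finally show ?thesis .
  qed
  then show ?thesis using that wbi by blast
qed

text \<open>The difference of \<open>v\<close> and the primitive of \<open>w\<close> has weak derivative zero.  Only integrals of \<open>v\<close> are
  compared, as \<open>v\<close> itself is determined up to null sets.\<close>

lemma weak_derivative_primitive:
  fixes v w :: "real \<Rightarrow> real"
  assumes T: "0 < T" and v: "integrable (lebesgue_on {0<..<T}) v" and w: "integrable (lebesgue_on {0<..<T}) w"
    and wd: "weak_derivative T v w"
  shows "\<exists>c. \<forall>x y. 0 \<le> x \<longrightarrow> x \<le> y \<longrightarrow> y \<le> T \<longrightarrow>
    integral {x..y} v = integral {x..y} (\<lambda>t. c + integral {0..t} w)"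
proof -
  obtain vb where vb: "integrable lborel vb"
    "\<And>A \<phi>. A \<in> sets borel \<Longrightarrow> A \<subseteq> {0<..<T} \<Longrightarrow> \<phi> \<in> borel_measurable borel \<Longrightarrow>
      (LINT t|lebesgue_on A. v t * \<phi> t) = (LBINT t. vb t * (indicator A t * \<phi> t))"
    by (rule borel_representative[OF _ v]) auto
  obtain wb where wb: "integrable lborel wb"
    "\<And>A \<phi>. A \<in> sets borel \<Longrightarrow> A \<subseteq> {0<..<T} \<Longrightarrow> \<phi> \<in> borel_measurable borel \<Longrightarrow>
      (LINT t|lebesgue_on A. w t * \<phi> t) = (LBINT t. wb t * (indicator A t * \<phi> t))"
    by (rule borel_representative[OF _ w]) auto
  have sub: "integrable (lebesgue_on {x<..<y}) u" if "integrable (lebesgue_on {0<..<T}) u" "0 \<le> x" "y \<le> T"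
    for u :: "real \<Rightarrow> real" and x y
  proof -
    have "{x<..<y} \<subseteq> {0<..<T}" using that by auto
    then show ?thesis using that(1) set_integrable_subset[of lebesgue "{0<..<T}" u "{x<..<y}"]
      by (simp add: integrable_restrict_space set_integrable_def)
  qed
  have HK: "integral {x..y} u = (LBINT t. ub t * indicator {x<..<y} t)"
    if u: "integrable (lebesgue_on {0<..<T}) u" and ub: "\<And>A \<phi>. A \<in> sets borel \<Longrightarrow> A \<subseteq> {0<..<T} \<Longrightarrow> \<phi> \<in> borel_measurable borel \<Longrightarrow>
      (LINT t|lebesgue_on A. u t * \<phi> t) = (LBINT t. ub t * (indicator A t * \<phi> t))"
      and xy: "0 \<le> x" "y \<le> T" for u ub :: "real \<Rightarrow> real" and x y
  proof -
    have "integral {x..y} u = integral {x<..<y} u" by (rule integral_open_interval_real)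
    also have "\<dots> = (LINT t|lebesgue_on {x<..<y}. u t)"
      by (rule lebesgue_integral_eq_integral[symmetric]) (use sub[OF u xy] in auto)
    also have "\<dots> = (LBINT t. ub t * indicator {x<..<y} t)"
    proof -
      have "{x<..<y} \<subseteq> {0<..<T}" using xy by auto
      then show ?thesis using ub[of "{x<..<y}" "\<lambda>_. 1"] by simp
    qed
    finally show ?thesis .
  qed
  define wb' where "wb' t = wb t * indicator {0<..<T} t" for t
  have wb': "integrable lborel wb'"
    unfolding wb'_def by (rule Bochner_Integration.integrable_bound[OF wb(1)])
      (use wb(1) in \<open>auto simp: indicator_def dest: borel_measurable_integrable\<close>)
  define W where "W s = (LBINT t. indicator {..s} t * wb' t)" for s
  have [measurable]: "vb \<in> borel_measurable borel" "wb' \<in> borel_measurable borel"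
    using vb(1) wb' by (auto dest: borel_measurable_integrable)
  have [measurable]: "W \<in> borel_measurable borel"
  proof -
    have "(\<lambda>s. LBINT t. (if t \<le> s then wb' t else 0)) \<in> borel_measurable borel" by measurable
    moreover have "W = (\<lambda>s. LBINT t. (if t \<le> s then wb' t else 0))"
      unfolding W_def by (intro ext Bochner_Integration.integral_cong) (auto simp: indicator_def)
    ultimately show ?thesis by simp
  qed
  have Wb: "\<bar>W s\<bar> \<le> (LBINT t. \<bar>wb' t\<bar>)" for s
  proof -
    have "\<bar>W s\<bar> \<le> (LBINT t. \<bar>indicator {..s} t * wb' t\<bar>)" unfolding W_def by (rule integral_abs_bound)
    also have "\<dots> \<le> (LBINT t. \<bar>wb' t\<bar>)"
    proof (rule integral_mono)
      show "integrable lborel (\<lambda>t. \<bar>indicator {..s} t * wb' t\<bar>)"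
        by (rule Bochner_Integration.integrable_bound[OF wb']) (auto simp: indicator_def)
    qed (use wb' in \<open>auto simp: indicator_def\<close>)
    finally show ?thesis .
  qed
  have WHK: "W s = integral {0..s} w" if "0 \<le> s" "s \<le> T" for s
  proof -
    have "W s = (LBINT t. wb t * indicator {0<..<s} t)" unfolding W_def wb'_def
    proof (rule integral_cong_AE)
      have "AE t in lborel. t \<noteq> s" by (rule AE_lborel_singleton)
      then show "AE t in lborel. indicator {..s} t * (wb t * indicator {0<..<T} t) = wb t * indicator {0<..<s} t"
        by eventually_elim (use that in \<open>auto simp: indicator_def\<close>)
    qed (use wb(1) in \<open>auto dest: borel_measurable_integrable\<close>)
    also have "\<dots> = integral {0..s} w" by (rule HK[OF w wb(2), symmetric]) (use that in auto)
    finally show ?thesis .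
  qed
  define g where "g t = indicator {0<..<T} t * (vb t - W t)" for t
  have gi: "integrable lborel g"
  proof -
    have "integrable lborel (\<lambda>t. \<bar>vb t\<bar> + (LBINT t. \<bar>wb' t\<bar>) * indicator {0<..<T} t)"
      using vb(1) T by (intro Bochner_Integration.integrable_add integrable_abs integrable_mult_right) auto
    then show ?thesis
    proof (rule Bochner_Integration.integrable_bound)
      show "AE t in lborel. norm (g t) \<le> norm (\<bar>vb t\<bar> + (LBINT t. \<bar>wb' t\<bar>) * indicator {0<..<T} t)"
      proof (rule AE_I2)
        fix t
        have "\<bar>vb t - W t\<bar> \<le> \<bar>vb t\<bar> + (LBINT t. \<bar>wb' t\<bar>)" using Wb[of t] by linarith
        then show "norm (g t) \<le> norm (\<bar>vb t\<bar> + (LBINT t. \<bar>wb' t\<bar>) * indicator {0<..<T} t)"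
          by (cases "t \<in> {0<..<T}") (auto simp: g_def)
      qed
    qed (simp add: g_def[abs_def])
  qed
  have "\<exists>c. \<forall>x y. 0 < x \<longrightarrow> x < y \<longrightarrow> y < T \<longrightarrow> (LBINT t. g t * indicator {x<..<y} t) = c * (y - x)"
  proof (rule du_Bois_Reymond[OF T gi])
    fix \<phi> \<phi>' :: "real \<Rightarrow> real" and a b
    assume d: "\<And>t. (\<phi> has_real_derivative \<phi>' t) (at t)" and c: "continuous_on UNIV \<phi>'" and ab: "0 < a" "b < T"
      and s: "\<And>t. t \<notin> {a..b} \<Longrightarrow> \<phi> t = 0"
    have parts: "integrable lborel \<phi>'" "\<And>t. t \<notin> {a..b} \<Longrightarrow> \<phi>' t = 0"
      "(LBINT t. wb' t * \<phi> t) = - (LBINT s. \<phi>' s * (LBINT t. indicator {..s} t * wb' t))"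
      using primitive_by_parts[OF wb' d c, of a b] s by blast+
    have [measurable]: "\<phi>' \<in> borel_measurable borel" "\<phi> \<in> borel_measurable borel"
      using c d by (auto intro!: borel_measurable_continuous_onI DERIV_continuous_on[of _ \<phi> \<phi>'])
    have bd: "\<exists>M. \<forall>t. \<bar>\<phi>' t\<bar> \<le> M"
    proof -
      have "compact (\<phi>' ` {a..b})" using c by (intro compact_continuous_image) (auto intro: continuous_on_subset)
      then obtain M where "\<forall>y\<in>\<phi>' ` {a..b}. norm y \<le> M" using compact_imp_bounded bounded_iff by metis
      then have "\<bar>\<phi>' t\<bar> \<le> max M 0" for t
        using parts(2)[of t] by (cases "t \<in> {a..b}") (auto simp: le_max_iff_disj)
      then show ?thesis by blast
    qed
    then obtain M where M: "\<And>t. \<bar>\<phi>' t\<bar> \<le> M" by blast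
    have e1: "(LINT t|lebesgue_on {0<..<T}. v t * \<phi>' t) = - (LINT t|lebesgue_on {0<..<T}. w t * \<phi> t)"
      using wd d c ab s unfolding weak_derivative_def by blast
    have e2: "(LINT t|lebesgue_on {0<..<T}. v t * \<phi>' t) = (LBINT t. vb t * (indicator {0<..<T} t * \<phi>' t))"
      by (rule vb(2)) auto
    have e3: "(LINT t|lebesgue_on {0<..<T}. w t * \<phi> t) = (LBINT t. wb' t * \<phi> t)"
      unfolding wb'_def by (subst wb(2)) (auto simp: mult.assoc)
    have e4: "(LBINT t. wb' t * \<phi> t) = - (LBINT s. \<phi>' s * W s)"
      using parts(3) by (simp add: W_def)
    have i1: "integrable lborel (\<lambda>t. vb t * (indicator {0<..<T} t * \<phi>' t))"
    proof (rule Bochner_Integration.integrable_bound[of _ "\<lambda>t. M * vb t"])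
      have "\<bar>vb t\<bar> * \<bar>indicator {0<..<T} t * \<phi>' t\<bar> \<le> \<bar>vb t\<bar> * M" for t
        using M[of t] by (intro mult_left_mono) (auto simp: indicator_def)
      moreover have "0 \<le> M" using M[of 0] by linarith
      ultimately show "AE t in lborel. norm (vb t * (indicator {0<..<T} t * \<phi>' t)) \<le> norm (M * vb t)"
        by (intro AE_I2) (simp add: abs_mult mult.commute)
    qed (use vb(1) in auto)
    have i2: "integrable lborel (\<lambda>t. \<phi>' t * W t)"
    proof (rule Bochner_Integration.integrable_bound[of _ "\<lambda>t. (LBINT t. \<bar>wb' t\<bar>) * \<phi>' t"])
      have "\<bar>\<phi>' t\<bar> * \<bar>W t\<bar> \<le> \<bar>\<phi>' t\<bar> * (LBINT t. \<bar>wb' t\<bar>)" for t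
        using Wb[of t] by (intro mult_left_mono) auto
      then show "AE t in lborel. norm (\<phi>' t * W t) \<le> norm ((LBINT t. \<bar>wb' t\<bar>) * \<phi>' t)"
        by (intro AE_I2) (simp add: abs_mult mult.commute)
    qed (use parts(1) in auto)
    have "(LBINT t. g t * \<phi>' t) = (LBINT t. vb t * (indicator {0<..<T} t * \<phi>' t) - \<phi>' t * W t)"
    proof (rule Bochner_Integration.integral_cong[OF refl])
      fix t show "g t * \<phi>' t = vb t * (indicator {0<..<T} t * \<phi>' t) - \<phi>' t * W t"
        using parts(2)[of t] ab by (cases "t \<in> {0<..<T}") (auto simp: g_def algebra_simps)
    qed
    also have "\<dots> = 0" using i1 i2 e1 e2 e3 e4 by simp
    finally show "(LBINT t. g t * \<phi>' t) = 0" .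
  qed
  then obtain c where c: "\<And>x y. 0 < x \<Longrightarrow> x < y \<Longrightarrow> y < T \<Longrightarrow> (LBINT t. g t * indicator {x<..<y} t) = c * (y - x)"
    by blast
  have vHK: "v integrable_on {0..T}" and wHK: "w integrable_on {0..T}"
    using v w by (auto simp: integrable_on_Icc_iff_Ioo intro: integrable_on_lebesgue_on)
  have Wc: "continuous_on {0..T} (\<lambda>t. integral {0..t} w)" by (rule indefinite_integral_continuous_1[OF wHK])
  define H where "H t = integral {0..t} v - integral {0..t} (\<lambda>t. c + integral {0..t} w)" for t
  have Wi: "(\<lambda>t. c + integral {0..t} w) integrable_on {0..T}"
    using Wc by (intro integrable_continuous_real continuous_intros)
  have Hc: "continuous_on {0..T} H"
    unfolding H_def by (intro continuous_intros indefinite_integral_continuous_1 vHK Wi)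
  have Hd: "H y - H x = integral {x..y} v - integral {x..y} (\<lambda>t. c + integral {0..t} w)" if "0 \<le> x" "x \<le> y" "y \<le> T" for x y
  proof -
    have "integral {0..x} f + integral {x..y} f = integral {0..y} f" if "f integrable_on {0..T}" for f :: "real \<Rightarrow> real"
      using that \<open>0 \<le> x\<close> \<open>x \<le> y\<close> \<open>y \<le> T\<close>
      by (intro Henstock_Kurzweil_Integration.integral_combine integrable_on_subinterval[OF that]) auto
    from this[OF vHK] this[OF Wi] show ?thesis by (simp add: H_def)
  qed
  have H0: "H y - H x = 0" if xy: "0 < x" "x < y" "y < T" for x y
  proof -
    have "integrable lborel (\<lambda>t. vb t * indicator {x<..<y} t)"
      by (rule Bochner_Integration.integrable_bound[OF vb(1)]) (auto simp: indicator_def)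
    moreover have iW: "integrable lborel (\<lambda>t. W t * indicator {x<..<y} t)"
    proof (rule Bochner_Integration.integrable_bound[of _ "\<lambda>t. (LBINT t. \<bar>wb' t\<bar>) * indicator {x<..<y} t"])
      show "AE t in lborel. norm (W t * indicator {x<..<y} t) \<le> norm ((LBINT t. \<bar>wb' t\<bar>) * indicator {x<..<y} t)"
        using Wb by (intro AE_I2) (auto simp: indicator_def intro: order_trans[OF _ abs_ge_self])
    qed (use xy in auto)
    moreover have "(LBINT t. g t * indicator {x<..<y} t)
        = (LBINT t. vb t * indicator {x<..<y} t - W t * indicator {x<..<y} t)"
      using xy by (intro Bochner_Integration.integral_cong) (auto simp: g_def indicator_def)
    ultimately have "c * (y - x) = (LBINT t. vb t * indicator {x<..<y} t) - (LBINT t. W t * indicator {x<..<y} t)"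
      using c[OF xy] Bochner_Integration.integral_diff by metis
    also have "(LBINT t. vb t * indicator {x<..<y} t) = integral {x..y} v"
      by (rule HK[OF v vb(2), symmetric]) (use xy in auto)
    finally have "c * (y - x) = integral {x..y} v - (LBINT t. W t * indicator {x<..<y} t)" .
    moreover have "(LBINT t. W t * indicator {x<..<y} t) = integral {x..y} (\<lambda>t. integral {0..t} w)"
    proof -
      have "((\<lambda>t. W t * indicator {x<..<y} t) has_integral (LBINT t. W t * indicator {x<..<y} t)) UNIV"
        by (rule has_integral_integral_lborel[OF iW])
      moreover have "(\<lambda>t. W t * indicator {x<..<y} t) = (\<lambda>t. if t \<in> {x<..<y} then W t else 0)"
        by (auto simp: indicator_def)
      ultimately have "(W has_integral (LBINT t. W t * indicator {x<..<y} t)) {x<..<y}"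
        by (simp only: has_integral_restrict_UNIV)
      then have "integral {x..y} W = (LBINT t. W t * indicator {x<..<y} t)"
        by (simp add: has_integral_Icc_iff_Ioo integral_unique)
      moreover have "integral {x..y} W = integral {x..y} (\<lambda>t. integral {0..t} w)"
        using WHK xy by (intro Henstock_Kurzweil_Integration.integral_cong) auto
      ultimately show ?thesis by simp
    qed
    moreover have "integral {x..y} (\<lambda>t. c + integral {0..t} w) = c * (y - x) + integral {x..y} (\<lambda>t. integral {0..t} w)"
    proof -
      have "(\<lambda>t. integral {0..t} w) integrable_on {x..y}"
        using Wc xy by (intro integrable_continuous_real) (auto intro: continuous_on_subset)
      then have "integral {x..y} (\<lambda>t. c + integral {0..t} w) = integral {x..y} (\<lambda>_. c) + integral {x..y} (\<lambda>t. integral {0..t} w)"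
        by (intro Henstock_Kurzweil_Integration.integral_add integrable_const_ivl)
      then show ?thesis using xy by simp
    qed
    ultimately show ?thesis using Hd[of x y] xy by simp
  qed
  have "H t = H (T/2)" if "t \<in> {0..T}" for t
  proof (rule continuous_constant_on_closure[of "{0<..<T}" H])
    show "continuous_on (closure {0<..<T}) H" using Hc T by simp
    show "H s = H (T/2)" if "s \<in> {0<..<T}" for s
      using H0[of s "T/2"] H0[of "T/2" s] that by (cases s "T/2" rule: linorder_cases) auto
    show "t \<in> closure {0<..<T}" using that T by simp
  qed
  then have "integral {x..y} v = integral {x..y} (\<lambda>t. c + integral {0..t} w)" if "0 \<le> x" "x \<le> y" "y \<le> T" for x y
    using Hd[OF that] that by (smt (verit) atLeastAtMost_iff)
  then show ?thesis by blast
qed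


lemma L2_time_integrable:
  assumes v: "L2_time T v"
  shows "integrable (lebesgue_on {0<..<T}) v" "(\<lambda>t. (v t)\<^sup>2) integrable_on {0..T}" "v integrable_on {0..T}"
proof -
  have m: "v \<in> borel_measurable (lebesgue_on {0<..<T})" and i2: "integrable (lebesgue_on {0<..<T}) (\<lambda>t. (v t)\<^sup>2)"
    using v by (auto simp: L2_time_def)
  have c: "integrable (lebesgue_on {0<..<T}) (\<lambda>_. 1 :: real)"
    using emeasure_bounded_finite[of "{0<..<T}"]
    by (intro finite_measure.integrable_const finite_measureI)
      (auto simp: emeasure_restrict_space space_restrict_space)
  show i: "integrable (lebesgue_on {0<..<T}) v"
  proof (rule Bochner_Integration.integrable_bound[OF Bochner_Integration.integrable_add[OF c i2] m])
    have "\<bar>x\<bar> \<le> 1 + x\<^sup>2" for x :: real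
    proof -
      have "0 \<le> (\<bar>x\<bar> - 1)\<^sup>2" by simp
      then show ?thesis by (simp add: power2_eq_square algebra_simps)
    qed
    then show "AE x in lebesgue_on {0<..<T}. norm (v x) \<le> norm (1 + (v x)\<^sup>2)" by auto
  qed
  show "v integrable_on {0..T}" "(\<lambda>t. (v t)\<^sup>2) integrable_on {0..T}"
    using integrable_on_lebesgue_on[OF i] integrable_on_lebesgue_on[OF i2] by (auto simp: integrable_on_Icc_iff_Ioo)
qed

lemma DERIV_unique_within_Icc:
  fixes f :: "real \<Rightarrow> real"
  assumes "a < b" "t \<in> {a..b}" "(f has_real_derivative d) (at t within {a..b})"
    "(f has_real_derivative e) (at t within {a..b})"
  shows "d = e"
  using vector_derivative_unique_within_closed_interval[of a b t f d e] assms
  by (simp add: has_real_derivative_iff_has_vector_derivative)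

text \<open>By iterated primitives, a continuous \<open>H\<^sup>3\<close> function agrees with a twice continuously differentiable function, and the
  increments of its first two derivatives are the integrals of the weak ones.\<close>

lemma H3_time_regular:
  fixes F :: "nat \<Rightarrow> real \<Rightarrow> real"
  assumes T: "0 < T" and L2: "\<And>j. j \<le> 3 \<Longrightarrow> L2_time T (F j)"
    and wd: "\<And>j. j < 3 \<Longrightarrow> weak_derivative T (F j) (F (Suc j))"
    and cont: "continuous_on {0..T} (F 0)"
  obtains G0 G1 G2 where
    "\<And>t. (G0 has_real_derivative G1 t) (at t)" "\<And>t. (G1 has_real_derivative G2 t) (at t)"
    "\<And>t. t \<in> {0..T} \<Longrightarrow> F 0 t = G0 t"
    "\<And>x y. 0 \<le> x \<Longrightarrow> x \<le> y \<Longrightarrow> y \<le> T \<Longrightarrow> G1 y - G1 x = integral {x..y} (F 2)"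
    "\<And>x y. 0 \<le> x \<Longrightarrow> x \<le> y \<Longrightarrow> y \<le> T \<Longrightarrow> G2 y - G2 x = integral {x..y} (F 3)"
proof -
  note i = L2_time_integrable[OF L2]
  have "\<exists>c. \<forall>x y. 0 \<le> x \<longrightarrow> x \<le> y \<longrightarrow> y \<le> T \<longrightarrow>
    integral {x..y} (F j) = integral {x..y} (\<lambda>t. c + integral {0..t} (F (Suc j)))" if "j < 3" for j
    using that by (intro weak_derivative_primitive T wd i) auto
  then obtain c where c: "\<And>j x y. j < 3 \<Longrightarrow> 0 \<le> x \<Longrightarrow> x \<le> y \<Longrightarrow> y \<le> T \<Longrightarrow>
    integral {x..y} (F j) = integral {x..y} (\<lambda>t. c j + integral {0..t} (F (Suc j)))" by metis
  have comb: "integral {0..y} f - integral {0..x} f = integral {x..y} f"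
    if "f integrable_on {0..T}" "0 \<le> x" "x \<le> y" "y \<le> T" for f :: "real \<Rightarrow> real" and x y
    using Henstock_Kurzweil_Integration.integral_combine[of 0 x y f] that
      integrable_on_subinterval[OF that(1), of 0 y] by simp
  have anti: "\<exists>G. G 0 = b \<and> (\<forall>t. (G has_real_derivative g t) (at t))"
    if "continuous_on UNIV g" for g :: "real \<Rightarrow> real" and b
  proof -
    have "\<exists>F. \<forall>x. (F has_vector_derivative g x) (at x)"
      using einterval_antiderivative[of "-\<infinity>" "\<infinity>" g] that by (simp add: continuous_on_eq_continuous_at)
    then obtain F where F: "\<And>x. (F has_vector_derivative g x) (at x)" by blast
    then show ?thesis
      by (intro exI[of _ "\<lambda>t. F t - F 0 + b"])
        (auto intro!: derivative_eq_intros simp: has_real_derivative_iff_has_vector_derivative)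
  qed
  define cl where "cl t = max 0 (min T t)" for t
  have cl: "cl t \<in> {0..T}" "t \<in> {0..T} \<Longrightarrow> cl t = t" for t using T by (auto simp: cl_def)
  define G2 where "G2 t = c 2 + integral {0..cl t} (F 3)" for t
  have "continuous_on UNIV G2" unfolding G2_def
  proof (intro continuous_intros continuous_on_compose2[OF indefinite_integral_continuous_1[OF i(3)]])
    show "continuous_on UNIV cl" unfolding cl_def by (intro continuous_intros)
  qed (use cl in auto)
  then obtain G1 where G1: "G1 0 = c 1" "\<And>t. (G1 has_real_derivative G2 t) (at t)" using anti by blast
  then have "continuous_on UNIV G1" by (intro DERIV_continuous_on)
  then obtain G0 where G0: "G0 0 = c 0" "\<And>t. (G0 has_real_derivative G1 t) (at t)" using anti by blast
  have ftc: "integral {x..y} g = G y - G x" if "\<And>t. (G has_real_derivative g t) (at t)" "x \<le> y" for G g and x y :: real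
    using fundamental_theorem_of_calculus[of x y G g] that
    by (intro integral_unique) (auto simp: has_real_derivative_iff_has_vector_derivative[symmetric]
        intro: has_field_derivative_at_within)
  have d2: "G2 y - G2 x = integral {x..y} (F 3)" if "0 \<le> x" "x \<le> y" "y \<le> T" for x y
    using comb[OF i(3), of 3 x y] that cl by (simp add: G2_def)
  have d1: "G1 y - G1 x = integral {x..y} (F 2)" if xy: "0 \<le> x" "x \<le> y" "y \<le> T" for x y
  proof -
    have "integral {x..y} (F 2) = integral {x..y} (\<lambda>t. c 2 + integral {0..t} (F 3))"
      using c[of 2 x y] xy by (simp add: numeral_3_eq_3 numeral_2_eq_2)
    also have "\<dots> = integral {x..y} G2"
      using cl xy by (intro Henstock_Kurzweil_Integration.integral_cong) (auto simp: G2_def)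
    also have "\<dots> = G1 y - G1 x" using G1 xy by (intro ftc)
    finally show ?thesis by simp
  qed
  have d0: "integral {0..y} (F 1) = G0 y - c 0" if y: "0 \<le> y" "y \<le> T" for y
  proof -
    have "integral {0..y} (F 1) = integral {0..y} (\<lambda>t. c 1 + integral {0..t} (F 2))"
      using c[of 1 0 y] y by (simp add: numeral_2_eq_2)
    also have "\<dots> = integral {0..y} G1"
      using d1[of 0] G1(1) y by (intro Henstock_Kurzweil_Integration.integral_cong) (smt (verit) atLeastAtMost_iff)
    also have "\<dots> = G0 y - c 0" using G0 y ftc[OF G0(2), of 0 y] by simp
    finally show ?thesis .
  qed
  have z: "integral {0..y} (\<lambda>t. F 0 t - G0 t) = 0" if y: "0 \<le> y" "y \<le> T" for y
  proof -
    have "integral {0..y} (F 0) = integral {0..y} (\<lambda>t. c 0 + integral {0..t} (F 1))"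
      using c[of 0 0 y] y by simp
    also have "\<dots> = integral {0..y} G0"
      using d0 y by (intro Henstock_Kurzweil_Integration.integral_cong) auto
    finally have "integral {0..y} (F 0) = integral {0..y} G0" .
    moreover have "F 0 integrable_on {0..y}" using cont y by (intro integrable_continuous_real) (auto intro: continuous_on_subset)
    moreover have "G0 integrable_on {0..y}" by (intro integrable_continuous_real DERIV_continuous_on[OF has_field_derivative_at_within[OF G0(2)]])
    ultimately show ?thesis by (simp add: Henstock_Kurzweil_Integration.integral_diff)
  qed
  have e0: "F 0 t = G0 t" if t: "t \<in> {0..T}" for t
  proof -
    have "continuous_on {0..T} (\<lambda>t. F 0 t - G0 t)"
      by (intro continuous_intros cont DERIV_continuous_on[OF has_field_derivative_at_within[OF G0(2)]])
    then have "((\<lambda>y. integral {0..y} (\<lambda>t. F 0 t - G0 t)) has_real_derivative F 0 t - G0 t) (at t within {0..T})"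
      using t by (rule integral_has_real_derivative)
    then have "((\<lambda>y. 0) has_real_derivative F 0 t - G0 t) (at t within {0..T})"
      by (rule has_field_derivative_transform_within[where d = 1]) (use t z in auto)
    moreover have "((\<lambda>y. 0) has_real_derivative 0) (at t within {0..T})" by simp
    ultimately show ?thesis
      using T t by (metis DERIV_unique_within_Icc eq_iff_diff_eq_0)
  qed
  show ?thesis using that[OF G0(2) G1(2) e0 d1 d2] .
qed

lemma integral_Cauchy_Schwarz:
  fixes f :: "real \<Rightarrow> real"
  assumes "f integrable_on {x..y}" "(\<lambda>t. (f t)\<^sup>2) integrable_on {x..y}" "x \<le> y"
  shows "(integral {x..y} f)\<^sup>2 \<le> (y - x) * integral {x..y} (\<lambda>t. (f t)\<^sup>2)"
proof (cases "x = y")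
  case False
  then have xy: "x < y" using assms by simp
  define m where "m = integral {x..y} f / (y - x)"
  have "((\<lambda>t. (f t)\<^sup>2 - 2 * m * f t + m\<^sup>2) has_integral
     (integral {x..y} (\<lambda>t. (f t)\<^sup>2) - 2 * m * integral {x..y} f + m\<^sup>2 * (y - x))) {x..y}"
    using has_integral_const_real[of "m\<^sup>2" x y] xy assms
    by (intro has_integral_add has_integral_diff has_integral_mult_right integrable_integral)
      (auto simp: mult.commute)
  then have "0 \<le> integral {x..y} (\<lambda>t. (f t)\<^sup>2) - 2 * m * integral {x..y} f + m\<^sup>2 * (y - x)"
  proof (rule has_integral_nonneg)
    fix t show "0 \<le> (f t)\<^sup>2 - 2 * m * f t + m\<^sup>2"
      using zero_le_power2[of "f t - m"] by (simp add: power2_eq_square algebra_simps)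
  qed
  also have "\<dots> = integral {x..y} (\<lambda>t. (f t)\<^sup>2) - (integral {x..y} f)\<^sup>2 / (y - x)"
  proof -
    have "(y - x) * (1 / (y - x)) = 1" using xy by simp
    then have "m\<^sup>2 * (y - x) = m * integral {x..y} f" by (simp add: m_def power2_eq_square)
    moreover have "(integral {x..y} f)\<^sup>2 / (y - x) = m * integral {x..y} f" by (simp add: m_def power2_eq_square)
    ultimately show ?thesis by simp
  qed
  finally show ?thesis using xy by (simp add: field_simps)
qed (use assms in auto)

lemma taylor2_backwards:
  fixes G0 G1 G2 :: "real \<Rightarrow> real"
  assumes "\<And>t. (G0 has_real_derivative G1 t) (at t)" "\<And>t. (G1 has_real_derivative G2 t) (at t)" "0 < s"
  shows "\<exists>\<xi>. t - s \<le> \<xi> \<and> \<xi> \<le> t \<and> G0 (t - s) = G0 t - s * G1 t + s\<^sup>2 / 2 * G2 \<xi>"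
proof -
  define diff where "diff m = (if m = 0 then G0 else if m = 1 then G1 else G2)" for m :: nat
  have "\<exists>\<xi>. t - s < \<xi> \<and> \<xi> < t \<and> G0 (t - s) = (\<Sum>m<2. (diff m t / fact m) * (t - s - t)^m)
      + (diff 2 \<xi> / fact 2) * (t - s - t)^2"
    using assms by (intro Taylor_down[where b = t]) (auto simp: diff_def less_2_cases_iff)
  then obtain \<xi> where "t - s < \<xi>" "\<xi> < t" "G0 (t - s) = (\<Sum>m<2. (diff m t / fact m) * (t - s - t)^m)
      + (diff 2 \<xi> / fact 2) * (t - s - t)^2" by blast
  then show ?thesis by (intro exI[of _ \<xi>]) (auto simp: diff_def numeral_2_eq_2)
qed

lemma sqrt_bound_square: "\<bar>a\<bar> \<le> c * sqrt b \<Longrightarrow> 0 \<le> b \<Longrightarrow> a\<^sup>2 \<le> c\<^sup>2 * (b::real)"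
  using power_mono[of "\<bar>a\<bar>" "c * sqrt b" 2] by (simp add: power_mult_distrib)

text \<open>The difference quotients annihilate polynomials of the relevant degree, so only Taylor remainders
  remain; these are controlled by the oscillation of the highest continuous derivative.\<close>

lemma difference_quotient_estimates:
  fixes F :: "nat \<Rightarrow> real \<Rightarrow> real"
  assumes T: "0 < T" and L2: "\<And>j. j \<le> 3 \<Longrightarrow> L2_time T (F j)"
    and wd: "\<And>j. j < 3 \<Longrightarrow> weak_derivative T (F j) (F (Suc j))"
    and der: "\<And>t. t \<in> {0..T} \<Longrightarrow> (F 0 has_real_derivative f' t) (at t within {0..T})"
    and \<tau>: "0 < \<tau>" and t: "t \<le> T"
  shows "2 * \<tau> \<le> t \<Longrightarrow> (F 0 t - 2 * F 0 (t - \<tau>) + F 0 (t - 2 * \<tau>))\<^sup>2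
           \<le> 32 * \<tau> ^ 3 * integral {t - 2 * \<tau>..t} (\<lambda>s. (F 2 s)\<^sup>2)"
    and "2 * \<tau> \<le> t \<Longrightarrow> (F 0 t - 2 * F 0 (t - \<tau>) + F 0 (t - 2 * \<tau>))\<^sup>2
           \<le> 18 * (1 / T + T) * \<tau> ^ 4 * (integral {0..T} (\<lambda>s. (F 2 s)\<^sup>2) + integral {0..T} (\<lambda>s. (F 3 s)\<^sup>2))"
    and "2 * \<tau> \<le> t \<Longrightarrow> (3 * F 0 t - 4 * F 0 (t - \<tau>) + F 0 (t - 2 * \<tau>) - 2 * \<tau> * f' t)\<^sup>2
           \<le> 32 * \<tau> ^ 5 * integral {t - 2 * \<tau>..t} (\<lambda>s. (F 3 s)\<^sup>2)"
    and "3 * \<tau> \<le> t \<Longrightarrow> (F 0 t - 3 * F 0 (t - \<tau>) + 3 * F 0 (t - 2 * \<tau>) - F 0 (t - 3 * \<tau>))\<^sup>2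
           \<le> 432 * \<tau> ^ 5 * integral {t - 3 * \<tau>..t} (\<lambda>s. (F 3 s)\<^sup>2)"
proof -
  note i = L2_time_integrable[OF L2]
  have cont: "continuous_on {0..T} (F 0)" using der by (rule DERIV_continuous_on)
  obtain G0 G1 G2 where G:
    "\<And>t. (G0 has_real_derivative G1 t) (at t)" "\<And>t. (G1 has_real_derivative G2 t) (at t)"
    "\<And>t. t \<in> {0..T} \<Longrightarrow> F 0 t = G0 t"
    "\<And>x y. 0 \<le> x \<Longrightarrow> x \<le> y \<Longrightarrow> y \<le> T \<Longrightarrow> G1 y - G1 x = integral {x..y} (F 2)"
    "\<And>x y. 0 \<le> x \<Longrightarrow> x \<le> y \<Longrightarrow> y \<le> T \<Longrightarrow> G2 y - G2 x = integral {x..y} (F 3)"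
    using H3_time_regular[OF T L2 wd cont] by blast
  have f': "f' s = G1 s" if s: "s \<in> {0..T}" for s
  proof -
    have "(F 0 has_real_derivative G1 s) (at s within {0..T})"
      by (rule has_field_derivative_transform_within[OF has_field_derivative_at_within[OF G(1)], where d = 1])
        (use s G(3) in auto)
    then show ?thesis using der[OF s] T s DERIV_unique_within_Icc by blast
  qed
  have osc: "\<bar>integral {x..y} (F j)\<bar> \<le> sqrt ((b - a) * integral {a..b} (\<lambda>s. (F j s)\<^sup>2))"
    if j: "j \<le> 3" and xy: "0 \<le> a" "a \<le> x" "x \<le> y" "y \<le> b" "b \<le> T" for j x y a b
  proof -
    have "(integral {x..y} (F j))\<^sup>2 \<le> (y - x) * integral {x..y} (\<lambda>t. (F j t)\<^sup>2)"
      using xy i[OF j] by (intro integral_Cauchy_Schwarz) (auto intro: integrable_on_subinterval)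
    also have "\<dots> \<le> (b - a) * integral {a..b} (\<lambda>t. (F j t)\<^sup>2)"
      using xy i[OF j] by (intro mult_mono integral_subset_le integral_nonneg) (auto intro: integrable_on_subinterval)
    finally show ?thesis by (rule real_le_rsqrt[of "\<bar>_\<bar>", simplified])
  qed
  have nn: "0 \<le> integral {a..b} (\<lambda>s. (F j s)\<^sup>2)" if "j \<le> 3" "0 \<le> a" "b \<le> T" for j a b
    using that i[OF that(1)] by (intro integral_nonneg) (auto intro: integrable_on_subinterval)
  have R1: "\<bar>G0 (t - s) - (G0 t - s * G1 t)\<bar> \<le> s * sqrt (b * integral {t - b..t} (\<lambda>s. (F 2 s)\<^sup>2))"
    if s: "0 < s" "s \<le> b" "b \<le> t" for s b
  proof -
    obtain \<xi> where \<xi>: "t - s < \<xi>" "\<xi> < t" "G0 t - G0 (t - s) = s * G1 \<xi>"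
      using MVT2[of "t - s" t G0 G1] G(1) s by auto
    have "G0 (t - s) - (G0 t - s * G1 t) = s * (G1 t - G1 \<xi>)" using \<xi>(3) by (simp add: algebra_simps)
    also have "G1 t - G1 \<xi> = integral {\<xi>..t} (F 2)" using \<xi> s t by (intro G(4)) auto
    finally have "\<bar>G0 (t - s) - (G0 t - s * G1 t)\<bar> = s * \<bar>integral {\<xi>..t} (F 2)\<bar>" using s by (simp add: abs_mult)
    also have "\<dots> \<le> s * sqrt ((t - (t - b)) * integral {t - b..t} (\<lambda>s. (F 2 s)\<^sup>2))"
      using \<xi> s t by (intro mult_left_mono osc) auto
    finally show ?thesis by simp
  qed
  have R2: "\<bar>G0 (t - s) - (G0 t - s * G1 t + s\<^sup>2 / 2 * G2 t)\<bar>
      \<le> s\<^sup>2 / 2 * sqrt (b * integral {t - b..t} (\<lambda>s. (F 3 s)\<^sup>2))"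
    if s: "0 < s" "s \<le> b" "b \<le> t" for s b
  proof -
    obtain \<xi> where \<xi>: "t - s \<le> \<xi>" "\<xi> \<le> t" "G0 (t - s) = G0 t - s * G1 t + s\<^sup>2 / 2 * G2 \<xi>"
      using taylor2_backwards[OF G(1,2) s(1)] by blast
    have "G0 (t - s) - (G0 t - s * G1 t + s\<^sup>2 / 2 * G2 t) = - (s\<^sup>2 / 2 * (G2 t - G2 \<xi>))"
      unfolding \<xi>(3) right_diff_distrib by simp
    also have "G2 t - G2 \<xi> = integral {\<xi>..t} (F 3)" using \<xi> s t by (intro G(5)) auto
    finally have "\<bar>G0 (t - s) - (G0 t - s * G1 t + s\<^sup>2 / 2 * G2 t)\<bar> = s\<^sup>2 / 2 * \<bar>integral {\<xi>..t} (F 3)\<bar>"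
      by (simp add: abs_mult)
    also have "\<dots> \<le> s\<^sup>2 / 2 * sqrt ((t - (t - b)) * integral {t - b..t} (\<lambda>s. (F 3 s)\<^sup>2))"
      using \<xi> s t by (intro mult_left_mono osc) auto
    finally show ?thesis by simp
  qed
  have F: "F 0 t = G0 t" "s \<le> t \<Longrightarrow> 0 \<le> s \<Longrightarrow> F 0 (t - s) = G0 (t - s)" if "0 \<le> t" for s
    using that t by (auto intro!: G(3))
  show "(F 0 t - 2 * F 0 (t - \<tau>) + F 0 (t - 2 * \<tau>))\<^sup>2 \<le> 32 * \<tau> ^ 3 * integral {t - 2 * \<tau>..t} (\<lambda>s. (F 2 s)\<^sup>2)"
    if t2: "2 * \<tau> \<le> t"
  proof -
    define b where "b = 2 * \<tau> * integral {t - 2 * \<tau>..t} (\<lambda>s. (F 2 s)\<^sup>2)"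
    have "\<bar>G0 (t - \<tau>) - (G0 t - \<tau> * G1 t)\<bar> \<le> \<tau> * sqrt b" "\<bar>G0 (t - 2 * \<tau>) - (G0 t - 2 * \<tau> * G1 t)\<bar> \<le> 2 * \<tau> * sqrt b"
      using R1[of \<tau> "2 * \<tau>"] R1[of "2 * \<tau>" "2 * \<tau>"] t2 \<tau> by (auto simp: b_def)
    then have "\<bar>F 0 t - 2 * F 0 (t - \<tau>) + F 0 (t - 2 * \<tau>)\<bar> \<le> 4 * \<tau> * sqrt b"
      using F(1) F(2)[of \<tau>] F(2)[of "2 * \<tau>"] t2 \<tau> by (simp add: abs_le_iff algebra_simps)
    then have "(F 0 t - 2 * F 0 (t - \<tau>) + F 0 (t - 2 * \<tau>))\<^sup>2 \<le> (4 * \<tau>)\<^sup>2 * b"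
      using \<tau> t t2 nn[of 2 "t - 2 * \<tau>" t] by (intro sqrt_bound_square) (auto simp: b_def)
    then show ?thesis by (simp add: b_def power2_eq_square power3_eq_cube algebra_simps)
  qed
  show "(F 0 t - 2 * F 0 (t - \<tau>) + F 0 (t - 2 * \<tau>))\<^sup>2
      \<le> 18 * (1 / T + T) * \<tau> ^ 4 * (integral {0..T} (\<lambda>s. (F 2 s)\<^sup>2) + integral {0..T} (\<lambda>s. (F 3 s)\<^sup>2))"
    if t2: "2 * \<tau> \<le> t"
  proof -
    define I2 I3 where "I2 = integral {0..T} (\<lambda>s. (F 2 s)\<^sup>2)" and "I3 = integral {0..T} (\<lambda>s. (F 3 s)\<^sup>2)"
    have I: "0 \<le> I2" "0 \<le> I3" using nn[of 2 0 T] nn[of 3 0 T] by (auto simp: I2_def I3_def)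
    \<comment> \<open>the second derivative is bounded, since it attains its mean value\<close>
    have sup: "(G2 x)\<^sup>2 \<le> 2 * (1 / T + T) * (I2 + I3)" if x: "x \<in> {0..T}" for x
    proof -
      obtain m where m: "0 < m" "m < T" "G1 T - G1 0 = T * G2 m"
        using MVT2[of 0 T G1 G2] G(2) T by auto
      have "\<bar>T * G2 m\<bar> \<le> sqrt (T * I2)"
        using m(3) G(4)[of 0 T] osc[of 2 0 0 T T] T by (simp add: I2_def)
      then have "(T * G2 m)\<^sup>2 \<le> 1\<^sup>2 * (T * I2)" using T I by (intro sqrt_bound_square) auto
      then have a: "(G2 m)\<^sup>2 \<le> I2 / T" using T by (simp add: power2_eq_square field_simps)
      have "\<bar>G2 x - G2 m\<bar> \<le> sqrt (T * I3)"
      proof (cases "m \<le> x")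
        case True
        then show ?thesis using G(5)[of m x] osc[of 3 0 m x T] m x by (simp add: I3_def)
      next
        case False
        then show ?thesis using G(5)[of x m] osc[of 3 0 x m T] m x by (simp add: I3_def abs_minus_commute)
      qed
      then have b: "(G2 x - G2 m)\<^sup>2 \<le> 1\<^sup>2 * (T * I3)" using T I by (intro sqrt_bound_square) auto
      have "(G2 x)\<^sup>2 \<le> 2 * (G2 m)\<^sup>2 + 2 * (G2 x - G2 m)\<^sup>2"
        using zero_le_power2[of "G2 x - 2 * G2 m"] by (simp add: power2_eq_square algebra_simps)
      also have "\<dots> \<le> 2 * (I2 / T) + 2 * (T * I3)" using a b by simp
      also have "\<dots> \<le> 2 * (1 / T + T) * (I2 + I3)" proof -
        have "0 \<le> T * I2" "0 \<le> I3 / T" "I2 / T + I3 / T = (1 / T) * (I2 + I3)"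
          using T I by (auto simp: add_divide_distrib)
        then show ?thesis by (simp add: distrib_left distrib_right)
      qed
      finally show ?thesis .
    qed
    define b where "b = 2 * (1 / T + T) * (I2 + I3)"
    have b0: "0 \<le> b" using T I by (simp add: b_def)
    have "\<bar>G2 x\<bar> \<le> sqrt b" if "x \<in> {0..T}" for x
      using sup[OF that] unfolding b_def by (intro real_le_rsqrt) simp
    moreover obtain \<xi> where \<xi>: "t - \<tau> \<le> \<xi>" "\<xi> \<le> t" "G0 (t - \<tau>) = G0 t - \<tau> * G1 t + \<tau>\<^sup>2 / 2 * G2 \<xi>"
      using taylor2_backwards[OF G(1,2) \<tau>] by blast
    moreover obtain \<eta> where \<eta>: "t - 2 * \<tau> \<le> \<eta>" "\<eta> \<le> t"
      "G0 (t - 2 * \<tau>) = G0 t - 2 * \<tau> * G1 t + (2 * \<tau>)\<^sup>2 / 2 * G2 \<eta>"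
      using taylor2_backwards[OF G(1,2), of "2 * \<tau>"] \<tau> by auto
    ultimately have le: "\<bar>G2 \<xi>\<bar> \<le> sqrt b" "\<bar>G2 \<eta>\<bar> \<le> sqrt b" using t2 \<tau> t by auto
    have "F 0 t - 2 * F 0 (t - \<tau>) + F 0 (t - 2 * \<tau>) = \<tau>\<^sup>2 * (2 * G2 \<eta> - G2 \<xi>)"
      using F(1) F(2)[of \<tau>] F(2)[of "2 * \<tau>"] t2 \<tau> \<xi>(3) \<eta>(3) by (simp add: power2_eq_square algebra_simps)
    then have "\<bar>F 0 t - 2 * F 0 (t - \<tau>) + F 0 (t - 2 * \<tau>)\<bar> = \<tau>\<^sup>2 * \<bar>2 * G2 \<eta> - G2 \<xi>\<bar>" by (simp add: abs_mult)
    also have "\<dots> \<le> \<tau>\<^sup>2 * (3 * sqrt b)" using le by (intro mult_left_mono) auto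
    finally have "(F 0 t - 2 * F 0 (t - \<tau>) + F 0 (t - 2 * \<tau>))\<^sup>2 \<le> (3 * \<tau>\<^sup>2)\<^sup>2 * b"
      using b0 by (intro sqrt_bound_square) (auto simp: mult_ac)
    then show ?thesis by (simp add: b_def I2_def I3_def power2_eq_square power4_eq_xxxx algebra_simps)
  qed
  show "(3 * F 0 t - 4 * F 0 (t - \<tau>) + F 0 (t - 2 * \<tau>) - 2 * \<tau> * f' t)\<^sup>2
      \<le> 32 * \<tau> ^ 5 * integral {t - 2 * \<tau>..t} (\<lambda>s. (F 3 s)\<^sup>2)" if t2: "2 * \<tau> \<le> t"
  proof -
    define b where "b = 2 * \<tau> * integral {t - 2 * \<tau>..t} (\<lambda>s. (F 3 s)\<^sup>2)"
    have tri: "\<bar>e\<bar> \<le> B2 + 4 * B1" if "\<bar>r1\<bar> \<le> B1" "\<bar>r2\<bar> \<le> B2" "e = r2 - 4 * r1" for e r1 r2 B1 B2 :: real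
      using that by linarith
    have "\<bar>G0 (t - \<tau>) - (G0 t - \<tau> * G1 t + \<tau>\<^sup>2 / 2 * G2 t)\<bar> \<le> \<tau>\<^sup>2 / 2 * sqrt b"
      "\<bar>G0 (t - 2 * \<tau>) - (G0 t - 2 * \<tau> * G1 t + 2 * \<tau>\<^sup>2 * G2 t)\<bar> \<le> 2 * \<tau>\<^sup>2 * sqrt b"
      using R2[of \<tau> "2 * \<tau>"] R2[of "2 * \<tau>" "2 * \<tau>"] t2 \<tau> by (auto simp: b_def power_mult_distrib)
    moreover have "3 * F 0 t - 4 * F 0 (t - \<tau>) + F 0 (t - 2 * \<tau>) - 2 * \<tau> * f' t
        = (G0 (t - 2 * \<tau>) - (G0 t - 2 * \<tau> * G1 t + 2 * \<tau>\<^sup>2 * G2 t))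
          - 4 * (G0 (t - \<tau>) - (G0 t - \<tau> * G1 t + \<tau>\<^sup>2 / 2 * G2 t))"
      using F(1) F(2)[of \<tau>] F(2)[of "2 * \<tau>"] f'[of t] t t2 \<tau> by (simp add: algebra_simps)
    ultimately have "\<bar>3 * F 0 t - 4 * F 0 (t - \<tau>) + F 0 (t - 2 * \<tau>) - 2 * \<tau> * f' t\<bar>
        \<le> 2 * \<tau>\<^sup>2 * sqrt b + 4 * (\<tau>\<^sup>2 / 2 * sqrt b)" by (rule tri)
    also have "\<dots> = 4 * \<tau>\<^sup>2 * sqrt b" by simp
    finally have "\<bar>3 * F 0 t - 4 * F 0 (t - \<tau>) + F 0 (t - 2 * \<tau>) - 2 * \<tau> * f' t\<bar> \<le> 4 * \<tau>\<^sup>2 * sqrt b" .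
    then have "(3 * F 0 t - 4 * F 0 (t - \<tau>) + F 0 (t - 2 * \<tau>) - 2 * \<tau> * f' t)\<^sup>2 \<le> (4 * \<tau>\<^sup>2)\<^sup>2 * b"
      using \<tau> t t2 nn[of 3 "t - 2 * \<tau>" t] by (intro sqrt_bound_square) (auto simp: b_def)
    then show ?thesis by (simp add: b_def power2_eq_square eval_nat_numeral algebra_simps)
  qed
  show "(F 0 t - 3 * F 0 (t - \<tau>) + 3 * F 0 (t - 2 * \<tau>) - F 0 (t - 3 * \<tau>))\<^sup>2
      \<le> 432 * \<tau> ^ 5 * integral {t - 3 * \<tau>..t} (\<lambda>s. (F 3 s)\<^sup>2)" if t3: "3 * \<tau> \<le> t"
  proof -
    define b where "b = 3 * \<tau> * integral {t - 3 * \<tau>..t} (\<lambda>s. (F 3 s)\<^sup>2)"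
    have tri: "\<bar>e\<bar> \<le> 3 * B2 + 3 * B1 + B3"
      if "\<bar>r1\<bar> \<le> B1" "\<bar>r2\<bar> \<le> B2" "\<bar>r3\<bar> \<le> B3" "e = 3 * r2 - 3 * r1 - r3" for e r1 r2 r3 B1 B2 B3 :: real
      using that by linarith
    have "\<bar>G0 (t - \<tau>) - (G0 t - \<tau> * G1 t + \<tau>\<^sup>2 / 2 * G2 t)\<bar> \<le> \<tau>\<^sup>2 / 2 * sqrt b"
      "\<bar>G0 (t - 2 * \<tau>) - (G0 t - 2 * \<tau> * G1 t + 2 * \<tau>\<^sup>2 * G2 t)\<bar> \<le> 2 * \<tau>\<^sup>2 * sqrt b"
      "\<bar>G0 (t - 3 * \<tau>) - (G0 t - 3 * \<tau> * G1 t + 9 * \<tau>\<^sup>2 / 2 * G2 t)\<bar> \<le> 9 * \<tau>\<^sup>2 / 2 * sqrt b"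
      using R2[of \<tau> "3 * \<tau>"] R2[of "2 * \<tau>" "3 * \<tau>"] R2[of "3 * \<tau>" "3 * \<tau>"] t3 \<tau>
      by (auto simp: b_def power_mult_distrib)
    moreover have "F 0 t - 3 * F 0 (t - \<tau>) + 3 * F 0 (t - 2 * \<tau>) - F 0 (t - 3 * \<tau>)
        = 3 * (G0 (t - 2 * \<tau>) - (G0 t - 2 * \<tau> * G1 t + 2 * \<tau>\<^sup>2 * G2 t))
          - 3 * (G0 (t - \<tau>) - (G0 t - \<tau> * G1 t + \<tau>\<^sup>2 / 2 * G2 t))
          - (G0 (t - 3 * \<tau>) - (G0 t - 3 * \<tau> * G1 t + 9 * \<tau>\<^sup>2 / 2 * G2 t))"
      using F(1) F(2)[of \<tau>] F(2)[of "2 * \<tau>"] F(2)[of "3 * \<tau>"] t3 \<tau> by (simp add: algebra_simps)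
    ultimately have "\<bar>F 0 t - 3 * F 0 (t - \<tau>) + 3 * F 0 (t - 2 * \<tau>) - F 0 (t - 3 * \<tau>)\<bar>
        \<le> 3 * (2 * \<tau>\<^sup>2 * sqrt b) + 3 * (\<tau>\<^sup>2 / 2 * sqrt b) + 9 * \<tau>\<^sup>2 / 2 * sqrt b" by (rule tri)
    also have "\<dots> = 12 * \<tau>\<^sup>2 * sqrt b" by simp
    finally have "\<bar>F 0 t - 3 * F 0 (t - \<tau>) + 3 * F 0 (t - 2 * \<tau>) - F 0 (t - 3 * \<tau>)\<bar> \<le> 12 * \<tau>\<^sup>2 * sqrt b" .
    then have "(F 0 t - 3 * F 0 (t - \<tau>) + 3 * F 0 (t - 2 * \<tau>) - F 0 (t - 3 * \<tau>))\<^sup>2 \<le> (12 * \<tau>\<^sup>2)\<^sup>2 * b"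
      using \<tau> t t3 nn[of 3 "t - 3 * \<tau>" t] by (intro sqrt_bound_square) (auto simp: b_def)
    then show ?thesis by (simp add: b_def power2_eq_square eval_nat_numeral algebra_simps)
  qed
qed

section \<open>Energy estimate for the perturbed BDF method\<close>

text \<open>The squared seminorm that \<open>m\<close> induces.\<close>

abbreviation (input) nsq :: "('z \<Rightarrow> 'z \<Rightarrow> real) \<Rightarrow> 'z \<Rightarrow> real" where "nsq m x \<equiv> m x x"

definition semi_inner :: "('z::real_vector \<Rightarrow> 'z \<Rightarrow> real) \<Rightarrow> bool" where
  "semi_inner m \<longleftrightarrow> bilinear m \<and> (\<forall>x y. m x y = m y x) \<and> (\<forall>x. 0 \<le> m x x)"

context
  fixes m :: "'z::real_vector \<Rightarrow> 'z \<Rightarrow> real"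
  assumes m: "semi_inner m"
begin

lemma semi_inner_simps:
  "m (x + y) z = m x z + m y z" "m z (x + y) = m z x + m z y"
  "m (x - y) z = m x z - m y z" "m z (x - y) = m z x - m z y"
  "m (c *\<^sub>R x) z = c * m x z" "m z (c *\<^sub>R x) = c * m z x" "m 0 z = 0" "m z 0 = 0"
  "m (- x) z = - m x z" "m z (- x) = - m z x"
  using m unfolding semi_inner_def
  by (auto simp: bilinear_ladd bilinear_radd bilinear_lsub bilinear_rsub bilinear_lmul bilinear_rmul
      bilinear_lzero bilinear_rzero bilinear_lneg bilinear_rneg)

lemma semi_inner_commute: "m x y = m y x" using m by (auto simp: semi_inner_def)

lemma semi_inner_nonneg: "0 \<le> m x x" using m by (auto simp: semi_inner_def)

lemma semi_inner_young:
  assumes "0 < e" shows "2 * m x y \<le> e * m x x + m y y / e"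
proof -
  have "0 \<le> nsq m (e *\<^sub>R x - y)" by (rule semi_inner_nonneg)
  also have "\<dots> = e * (e * m x x) - 2 * (e * m x y) + m y y"
    by (simp add: semi_inner_simps semi_inner_commute[of y x] algebra_simps)
  finally show ?thesis using assms by (simp add: field_simps)
qed

lemma semi_inner_young': "0 < e \<Longrightarrow> - (2 * m x y) \<le> e * m x x + m y y / e"
  using semi_inner_young[of e "- x" y] by (simp add: semi_inner_simps)

lemma semi_inner_add_le: "nsq m (x + y) \<le> 2 * m x x + 2 * m y y"
  using semi_inner_nonneg[of "x - y"] by (simp add: semi_inner_simps semi_inner_commute[of y x])

lemma semi_inner_diff_le: "nsq m (x - y) \<le> 2 * m x x + 2 * m y y"
  using semi_inner_nonneg[of "x + y"] by (simp add: semi_inner_simps semi_inner_commute[of y x])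

lemma semi_inner_Cauchy_Schwarz: "(m x y)\<^sup>2 \<le> m x x * m y y"
proof (cases "m x x = 0")
  case True
  have "m x y = 0"
  proof (rule ccontr)
    assume n: "m x y \<noteq> 0"
    define t where "t = (m y y + 1) / (2 * m x y)"
    have "0 \<le> nsq m (y - t *\<^sub>R x)" by (rule semi_inner_nonneg)
    also have "\<dots> = m y y - 2 * (t * m x y)"
      using True by (simp add: semi_inner_simps semi_inner_commute[of y x])
    also have "\<dots> = -1" using n by (simp add: t_def field_simps)
    finally show False by simp
  qed
  then show ?thesis using True by simp
next
  case False
  then have p: "0 < m x x" using semi_inner_nonneg[of x] by simp
  have "0 \<le> nsq m (m x x *\<^sub>R y - m x y *\<^sub>R x)" by (rule semi_inner_nonneg)
  also have "\<dots> = m x x * (m x x * m y y - (m x y)\<^sup>2)"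
    by (simp add: semi_inner_simps semi_inner_commute[of y x] power2_eq_square algebra_simps)
  finally show ?thesis using p by (simp add: zero_le_mult_iff)
qed

text \<open>Dahlquist's \<open>G\<close>-energy of two consecutive values: the test with \<open>a\<close> becomes a difference of such energies
  plus the square of the second difference.\<close>

definition G_norm :: "'z \<Rightarrow> 'z \<Rightarrow> real" where
  "G_norm a b = m a a + nsq m (2 *\<^sub>R a - b)"

lemma bdf2_G_stability:
  "2 * m (3 *\<^sub>R a - 4 *\<^sub>R b + c) a
     = G_norm a b - G_norm b c + nsq m (a - 2 *\<^sub>R b + c)"
  unfolding G_norm_def
  by (simp add: semi_inner_simps semi_inner_commute[of b a] semi_inner_commute[of c a]
      semi_inner_commute[of c b] algebra_simps)

lemma G_norm_ge: "m a a \<le> G_norm a b"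
  using semi_inner_nonneg by (simp add: G_norm_def)

lemma G_norm_le: "G_norm a b \<le> 9 * m a a + 2 * m b b"
  using semi_inner_diff_le[of "2 *\<^sub>R a" b] by (simp add: G_norm_def semi_inner_simps)

lemma bdf2_difference_le:
  "nsq m (3 *\<^sub>R a - 4 *\<^sub>R b + c) \<le> 8 * (3 * m a a + 4 * m b b + m c c)"
  using semi_inner_nonneg[of "a + b"] semi_inner_nonneg[of "a - c"] semi_inner_nonneg[of "b + c"]
  by (simp add: semi_inner_simps semi_inner_commute[of b a] semi_inner_commute[of c a]
      semi_inner_commute[of c b] algebra_simps)

lemma bdf2_backward_difference_le:
  "nsq m (a - b) \<le> 2/9 * (nsq m (3 *\<^sub>R a - 4 *\<^sub>R b + c) + nsq m (b - c))"
proof -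
  have "9 * nsq m (a - b) = nsq m ((3 *\<^sub>R a - 4 *\<^sub>R b + c) + (b - c))"
    by (simp add: semi_inner_simps algebra_simps)
  also have "\<dots> \<le> 2 * nsq m (3 *\<^sub>R a - 4 *\<^sub>R b + c) + 2 * nsq m (b - c)"
    by (rule semi_inner_add_le)
  finally show ?thesis by simp
qed

end

text \<open>The potential consists of the \<open>G\<close>-energies of both forms and of the terms that summation by parts
  and index shifts in the absorbed terms leave behind.\<close>

definition bdf2_potential ::
  "('z::real_vector \<Rightarrow> 'z \<Rightarrow> real) \<Rightarrow> ('z \<Rightarrow> 'z \<Rightarrow> real) \<Rightarrow> real \<Rightarrow> 'z \<Rightarrow> 'z \<Rightarrow> 'z \<Rightarrow> real" where
  "bdf2_potential m k \<tau> a b s = G_norm m a b / 2 + \<tau> / 128 * G_norm k a b - 3 * m s a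
     + 3 / 1792 * nsq m (a - b) + \<tau> / 16 * (5 * k a a + k b b) + 385 * m s s"

text \<open>The equation is tested with \<open>a\<close> and with a small multiple of the difference quotient of \<open>a\<close>.  The first
  test gives the stability of the method and dissipates the second difference; the critical term
  \<open>m (s - s0) a\<close>, which lacks a factor \<open>\<tau>\<close>, is summed by parts, and the second test supplies
  the control of the difference of \<open>a\<close> that this requires.\<close>

lemma bdf2_potential_step:
  fixes m k :: "'z::real_vector \<Rightarrow> 'z \<Rightarrow> real"
  assumes m: "semi_inner m" and k: "semi_inner k" and \<tau>: "0 < \<tau>" "\<tau> \<le> 1"
    and eq: "\<And>y. y \<in> {a, 3 *\<^sub>R a - 4 *\<^sub>R b + c} \<Longrightarrow>
       m (3 *\<^sub>R a - 4 *\<^sub>R b + c) y + 2 * \<tau> * k a y =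
         3 * m (s - s0) y + 2 * \<tau> * k s y + 2 * \<tau> * m r y + 2 * \<tau> * k \<theta> y"
    and sm: "m s s \<le> 1/4000 * nsq m (a - 2 *\<^sub>R b + c)"
    and sk: "\<tau> * k s s \<le> 1/32 * nsq m (a - 2 *\<^sub>R b + c)"
  shows "bdf2_potential m k \<tau> a b s + nsq m (a - 2 *\<^sub>R b + c) / 4 + \<tau> / 2 * k a a
    \<le> bdf2_potential m k \<tau> b c s0 + 3 * \<tau> * nsq k \<theta> + 2 * \<tau> * m r r + \<tau> * m a a"
proof -
  note ms = semi_inner_simps[OF m] and ks = semi_inner_simps[OF k]
  define d where "d = 3 *\<^sub>R a - 4 *\<^sub>R b + c"
  define dd where "dd = nsq m (a - 2 *\<^sub>R b + c)"
  have e1: "m d a + 2 * \<tau> * k a a =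
         3 * m (s - s0) a + 2 * \<tau> * k s a + 2 * \<tau> * m r a + 2 * \<tau> * k \<theta> a"
    using eq[of a] by (simp add: d_def)
  have e2: "m d d + 2 * \<tau> * k a d =
         3 * m (s - s0) d + 2 * \<tau> * k s d + 2 * \<tau> * m r d + 2 * \<tau> * k \<theta> d"
    using eq[of d] by (simp add: d_def)
  have g1: "2 * m d a = G_norm m a b - G_norm m b c + dd"
    using bdf2_G_stability[OF m, of a b c] by (simp add: d_def dd_def)
  have g2: "G_norm k a b - G_norm k b c \<le> 2 * k a d"
    using bdf2_G_stability[OF k, of a b c] semi_inner_nonneg[OF k, of "a - 2 *\<^sub>R b + c"]
    by (simp add: d_def semi_inner_commute[OF k, of a])
  \<comment> \<open>\<open>G\<close>-stability makes the test with \<open>a\<close> telescope\<close>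
  have t1: "(G_norm m a b - G_norm m b c) / 2 + dd / 2 + \<tau> * k a a
      \<le> 3 * m (s - s0) a + 2 * \<tau> * k s s + 2 * \<tau> * nsq k \<theta> + \<tau> * m r r + \<tau> * m a a"
  proof -
    have "2 * \<tau> * k s a \<le> \<tau> * (2 * k s s + k a a / 2)"
      using mult_left_mono[OF semi_inner_young[OF k, of 2 s a], of \<tau>] \<tau> by simp
    moreover have "2 * \<tau> * k \<theta> a \<le> \<tau> * (2 * nsq k \<theta> + k a a / 2)"
      using mult_left_mono[OF semi_inner_young[OF k, of 2 \<theta> a], of \<tau>] \<tau> by simp
    moreover have "2 * \<tau> * m r a \<le> \<tau> * (m r r + m a a)"
      using mult_left_mono[OF semi_inner_young[OF m, of 1 r a], of \<tau>] \<tau> by simp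
    ultimately have "2 * m d a + 4 * (\<tau> * k a a) \<le> 6 * m (s - s0) a + 4 * (\<tau> * k s s)
        + 4 * (\<tau> * nsq k \<theta>) + 2 * (\<tau> * m r r) + 2 * (\<tau> * m a a) + 2 * (\<tau> * k a a)"
      using e1 unfolding mult.assoc distrib_left times_divide_eq_right by linarith
    then show ?thesis using g1 unfolding mult.assoc diff_divide_distrib by linarith
  qed
  \<comment> \<open>in the test with \<open>d\<close> the stiffness term telescopes and \<open>m d d\<close> remains\<close>
  have t2: "m d d / 2 + \<tau> * (G_norm k a b - G_norm k b c)
      \<le> 18 * m s s + 18 * m s0 s0 + 4 * \<tau> * m r r + \<tau> * (2 * k s s + 2 * nsq k \<theta>)
        + \<tau> * (8 * (3 * k a a + 4 * k b b + k c c))"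
  proof -
    have "3 * m (s - s0) d \<le> 9 * nsq m (s - s0) + m d d / 4"
      using semi_inner_young[OF m, of 6 "s - s0" d] by simp
    moreover have "nsq m (s - s0) \<le> 2 * m s s + 2 * m s0 s0" by (rule semi_inner_diff_le[OF m])
    moreover have "2 * \<tau> * m r d \<le> 4 * \<tau> * m r r + m d d / 4"
    proof -
      have "2 * m (\<tau> *\<^sub>R r) d \<le> 4 * nsq m (\<tau> *\<^sub>R r) + m d d / 4"
        by (rule semi_inner_young[OF m]) simp
      then have "2 * \<tau> * m r d \<le> 4 * (\<tau> * \<tau>) * m r r + m d d / 4" by (simp add: ms algebra_simps)
      moreover have "\<tau> * \<tau> * m r r \<le> \<tau> * m r r"
        using \<tau> semi_inner_nonneg[OF m, of r] by (intro mult_right_mono) (auto simp: mult_left_le)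
      ultimately show ?thesis by simp
    qed
    moreover have "2 * \<tau> * k s d + 2 * \<tau> * k \<theta> d \<le> \<tau> * (2 * k s s + 2 * nsq k \<theta> + k d d)"
    proof -
      have "2 * k (s + \<theta>) d \<le> nsq k (s + \<theta>) + k d d"
        using semi_inner_young[OF k, of 1 "s + \<theta>" d] by simp
      also have "\<dots> \<le> 2 * k s s + 2 * nsq k \<theta> + k d d" using semi_inner_add_le[OF k, of s \<theta>] by simp
      finally have "\<tau> * (2 * k (s + \<theta>) d) \<le> \<tau> * (2 * k s s + 2 * nsq k \<theta> + k d d)"
        using \<tau> by (intro mult_left_mono) auto
      then show ?thesis by (simp add: ks algebra_simps)
    qed
    moreover have "\<tau> * k d d \<le> \<tau> * (8 * (3 * k a a + 4 * k b b + k c c))"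
      using \<tau> bdf2_difference_le[OF k, of a b c] by (intro mult_left_mono) (auto simp: d_def)
    moreover have "\<tau> * (G_norm k a b - G_norm k b c) \<le> 2 * \<tau> * k a d"
      using mult_left_mono[OF g2, of \<tau>] \<tau> by simp
    ultimately show ?thesis using e2
      unfolding mult.assoc diff_divide_distrib distrib_left right_diff_distrib by linarith
  qed
  have parts: "3 * m (s - s0) a \<le> 3 * m s a - 3 * m s0 b + 384 * m s0 s0 + 3 / 512 * nsq m (a - b)"
  proof -
    have "2 * m s0 b - 2 * m s0 a \<le> 256 * m s0 s0 + nsq m (a - b) / 256"
      using semi_inner_young'[OF m, of 256 s0 "a - b"] by (simp add: ms(4))
    then show ?thesis unfolding semi_inner_simps(3)[OF m, of s s0 a] by simp
  qed
  have bd: "9 * nsq m (a - b) \<le> 2 * m d d + 2 * nsq m (b - c)"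
    using bdf2_backward_difference_le[OF m, of a b c] by (simp add: d_def)
  have half: "\<tau> / 2 * k a a = 1/2 * (\<tau> * k a a)" by simp
  have pot: "bdf2_potential m k \<tau> y z w = G_norm m y z / 2 + (\<tau> * G_norm k y z) / 128
      - 3 * m w y + 3 / 1792 * nsq m (y - z) + 5 / 16 * (\<tau> * k y y) + 1 / 16 * (\<tau> * k z z)
      + 385 * m w w" for y z w
    unfolding bdf2_potential_def by (simp add: distrib_left)
  have "\<tau> * m r r \<ge> 0" "\<tau> * nsq k \<theta> \<ge> 0" "m d d \<ge> 0" "m s s \<ge> 0" "\<tau> * k a a \<ge> 0" "\<tau> * k s s \<ge> 0" "dd \<ge> 0" "m s0 s0 \<ge> 0"
    using \<tau> semi_inner_nonneg[OF m] semi_inner_nonneg[OF k] by (auto simp: dd_def)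
  then show ?thesis
    using t1 t2 parts bd sm[folded dd_def] sk[folded dd_def]
    unfolding pot[of a b s] pot[of b c s0] dd_def[symmetric] mult.assoc diff_divide_distrib distrib_left
      right_diff_distrib mult.left_commute[of \<tau> "numeral w" for w] half
    by linarith
qed

lemma bdf2_potential_ge:
  assumes "semi_inner m" "semi_inner k" "0 < \<tau>"
  shows "3/8 * m a a \<le> bdf2_potential m k \<tau> a b s"
proof -
  have "6 * m s a \<le> 36 * m s s + m a a / 4"
    using semi_inner_young[OF assms(1), of 12 s "a"] semi_inner_nonneg[OF assms(1), of a]
      semi_inner_young[OF assms(1), of 36 s "3 *\<^sub>R a"]
    by (simp add: semi_inner_simps[OF assms(1)])
  moreover have "0 \<le> \<tau> / 128 * G_norm k a b" "0 \<le> \<tau> / 16 * (5 * k a a + k b b)"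
    using assms semi_inner_nonneg[OF assms(2)] G_norm_ge[OF assms(2), of a b]
    by (auto intro!: mult_nonneg_nonneg add_nonneg_nonneg order_trans[of 0 "k a a" "G_norm k a b"])
  ultimately show ?thesis
    using G_norm_ge[OF assms(1), of a b] semi_inner_nonneg[OF assms(1), of s]
      semi_inner_nonneg[OF assms(1), of "a - b"]
    unfolding bdf2_potential_def by (simp add: algebra_simps)
qed

lemma bdf2_potential_le:
  assumes "semi_inner m" "semi_inner k" "0 < \<tau>"
  shows "bdf2_potential m k \<tau> a b s
    \<le> 500 * (m a a + m b b + \<tau> * k a a + \<tau> * k b b + m s s)"
proof -
  note m0 = semi_inner_nonneg[OF assms(1)] and k0 = semi_inner_nonneg[OF assms(2)]
  have "- (3 * m s a) \<le> 2 * m s s + 2 * m a a"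
    using semi_inner_young'[OF assms(1), of 1 s a] m0[of a] m0[of s] by simp
  moreover have "\<tau> * G_norm k a b \<le> 9 * (\<tau> * k a a) + 2 * (\<tau> * k b b)"
    using mult_left_mono[OF G_norm_le[OF assms(2), of a b], of \<tau>] assms(3) by (simp add: algebra_simps)
  moreover have "0 \<le> \<tau> * k a a" "0 \<le> \<tau> * k b b" using assms(3) k0 by auto
  ultimately show ?thesis
    using G_norm_le[OF assms(1), of a b] semi_inner_diff_le[OF assms(1), of a b] m0[of a] m0[of b] m0[of s]
    unfolding bdf2_potential_def by (simp add: algebra_simps)
qed

text \<open>Summing the steps is a discrete Gronwall argument: the potentials grow at most by the consistency errors and by the factor \<open>1 / (1 - 8/3 \<tau>)\<close> per step,
  which is at most \<open>1 + 4 \<tau>\<close>.\<close>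

lemma bdf2_energy_estimate:
  fixes m k :: "'z::real_vector \<Rightarrow> 'z \<Rightarrow> real" and x s r \<theta> :: "nat \<Rightarrow> 'z"
  assumes m: "semi_inner m" and k: "semi_inner k" and \<tau>: "0 < \<tau>" "\<tau> \<le> 1/16"
    and eq: "\<And>n y. n + 3 \<le> N \<Longrightarrow> y \<in> {x (n+3), 3 *\<^sub>R x (n+3) - 4 *\<^sub>R x (n+2) + x (n+1)} \<Longrightarrow>
       m (3 *\<^sub>R x (n+3) - 4 *\<^sub>R x (n+2) + x (n+1)) y + 2 * \<tau> * k (x (n+3)) y =
         3 * m (s (n+3) - s (n+2)) y + 2 * \<tau> * k (s (n+3)) y + 2 * \<tau> * m (r (n+3)) y
         + 2 * \<tau> * k (\<theta> (n+3)) y"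
    and sm: "\<And>n. n + 3 \<le> N \<Longrightarrow> nsq m (s (n+3)) \<le>
       1/4000 * nsq m (x (n+3) - 2 *\<^sub>R x (n+2) + x (n+1))"
    and sk: "\<And>n. n + 3 \<le> N \<Longrightarrow> \<tau> * nsq k (s (n+3)) \<le>
       1/32 * nsq m (x (n+3) - 2 *\<^sub>R x (n+2) + x (n+1))"
    and init: "m (x 2) (x 2) + m (x 1) (x 1) + \<tau> * k (x 2) (x 2) + \<tau> * k (x 1) (x 1) + m (s 2) (s 2) \<le> I"
    and cons: "\<tau> * (\<Sum>n<N-2. nsq m (r (n+3)) + nsq k (\<theta> (n+3))) \<le> I"
    and N: "2 \<le> N"
  shows "m (x N) (x N) + (\<Sum>n<N-2. nsq m (x (n+3) - 2 *\<^sub>R x (n+2) + x (n+1)))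
      + \<tau> * (\<Sum>n<N-2. nsq k (x (n+3))) \<le> 5000 * exp (4 * (real N * \<tau>)) * I"
proof -
  define \<Psi> where "\<Psi> n = bdf2_potential m k \<tau> (x (n+2)) (x (n+1)) (s (n+2))" for n
  define dd where "dd n = nsq m (x (n+3) - 2 *\<^sub>R x (n+2) + x (n+1))" for n
  define xk where "xk n = nsq k (x (n+3))" for n
  define b where "b n = nsq m (r (n+3)) + nsq k (\<theta> (n+3))" for n
  have pos: "0 \<le> dd n" "0 \<le> xk n" "0 \<le> b n" for n
    using semi_inner_nonneg[OF m] semi_inner_nonneg[OF k] by (auto simp: dd_def xk_def b_def)
  have I0: "0 \<le> I"
    using cons pos \<tau> unfolding b_def[symmetric]
    by (meson mult_nonneg_nonneg less_imp_le order_trans sum_nonneg)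
  have \<Psi>ge: "3/8 * nsq m (x (n+2)) \<le> \<Psi> n" for n
    unfolding \<Psi>_def by (rule bdf2_potential_ge[OF m k \<tau>(1)])
  then have \<Psi>0: "0 \<le> \<Psi> n" for n using semi_inner_nonneg[OF m, of "x (n+2)"]
    by (meson mult_nonneg_nonneg order_trans divide_nonneg_nonneg zero_le_numeral)
  have step: "\<Psi> (Suc n) + dd n / 4 + \<tau> / 2 * xk n \<le> \<Psi> n + 3 * \<tau> * b n + \<tau> * (8/3 * \<Psi> (Suc n))"
    if n: "n + 3 \<le> N" for n
  proof -
    have "\<Psi> (Suc n) + dd n / 4 + \<tau> / 2 * xk n
      \<le> \<Psi> n + 3 * \<tau> * nsq k (\<theta> (n+3)) + 2 * \<tau> * nsq m (r (n+3)) + \<tau> * nsq m (x (n+3))"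
      using bdf2_potential_step[OF m k \<tau>(1) _ eq sm sk, OF _ n _ n n] \<tau>
      by (simp add: \<Psi>_def dd_def xk_def numeral_3_eq_3 numeral_2_eq_2)
    moreover have "\<tau> * nsq m (x (n+3)) \<le> \<tau> * (8/3 * \<Psi> (Suc n))"
      using \<Psi>ge[of "Suc n"] \<tau> by (intro mult_left_mono) (auto simp: numeral_3_eq_3)
    moreover have "0 \<le> \<tau> * nsq m (r (n+3))" using \<tau> semi_inner_nonneg[OF m] by auto
    ultimately show ?thesis by (simp add: b_def algebra_simps)
  qed
  define E where "E n = \<Psi> n + (\<Sum>j<n. dd j / 4 + \<tau> / 2 * xk j)" for n
  have E0: "0 \<le> E n" for n unfolding E_def using \<Psi>0 pos \<tau> by (auto intro!: add_nonneg_nonneg sum_nonneg)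
  have inc: "0 \<le> (\<Sum>j<n. dd j / 4 + \<tau> / 2 * xk j)" for n
    using pos \<tau> by (intro sum_nonneg add_nonneg_nonneg) auto
  have grow: "E n \<le> (1 + 4 * \<tau>) ^ n * (E 0 + 4 * \<tau> * (\<Sum>j<n. b j))" if "n + 2 \<le> N" for n
    using that
  proof (induction n)
    case 0
    then show ?case by simp
  next
    case (Suc n)
    have st: "E (Suc n) \<le> E n + 3 * \<tau> * b n + \<tau> * (8/3 * E (Suc n))"
    proof -
      have "\<Psi> (Suc n) \<le> E (Suc n)" unfolding E_def using inc[of "Suc n"] by simp
      then have "\<tau> * (8/3 * \<Psi> (Suc n)) \<le> \<tau> * (8/3 * E (Suc n))" using \<tau> by (intro mult_left_mono) auto
      then show ?thesis using step[of n] Suc.prems by (simp add: E_def)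
    qed
    have "(1 - 8/3 * \<tau>) * E (Suc n) \<le> E n + 3 * \<tau> * b n" using st by (simp add: algebra_simps)
    moreover have "E (Suc n) \<le> (1 + 4 * \<tau>) * ((1 - 8/3 * \<tau>) * E (Suc n))"
    proof -
      have "1 * E (Suc n) \<le> ((1 + 4 * \<tau>) * (1 - 8/3 * \<tau>)) * E (Suc n)"
      proof (rule mult_right_mono[OF _ E0])
        have "\<tau> * \<tau> \<le> \<tau> * (1/16)" using \<tau> by (intro mult_left_mono) auto
        then show "1 \<le> (1 + 4 * \<tau>) * (1 - 8/3 * \<tau>)" using \<tau> by (simp add: algebra_simps)
      qed
      then show ?thesis by (simp add: mult.assoc)
    qed
    ultimately have "E (Suc n) \<le> (1 + 4 * \<tau>) * (E n + 3 * \<tau> * b n)"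
      using \<tau> by (meson add_nonneg_nonneg less_imp_le mult_left_mono mult_nonneg_nonneg order_trans zero_le_numeral zero_le_one)
    also have "\<dots> \<le> (1 + 4 * \<tau>) * ((1 + 4 * \<tau>) ^ n * (E 0 + 4 * \<tau> * (\<Sum>j<n. b j)) + (1 + 4 * \<tau>) ^ n * (4 * \<tau> * b n))"
    proof (intro mult_left_mono add_mono)
      have "1 * (3 * \<tau> * b n) \<le> (1 + 4 * \<tau>) ^ n * (4 * \<tau> * b n)"
        using \<tau> pos by (intro mult_mono mult_right_mono one_le_power) auto
      then show "3 * \<tau> * b n \<le> (1 + 4 * \<tau>) ^ n * (4 * \<tau> * b n)" by simp
    qed (use Suc \<tau> in auto)
    also have "\<dots> = (1 + 4 * \<tau>) ^ Suc n * (E 0 + 4 * \<tau> * (\<Sum>j<Suc n. b j))" by (simp add: algebra_simps)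
    finally show ?case .
  qed
  have E00: "E 0 \<le> 500 * I"
    using order_trans[OF bdf2_potential_le[OF m k \<tau>(1)] mult_left_mono[OF init, of 500]]
    by (simp add: E_def \<Psi>_def numeral_2_eq_2)
  have "E (N-2) \<le> (1 + 4 * \<tau>) ^ (N-2) * (E 0 + 4 * (\<tau> * (\<Sum>j<N-2. b j)))"
    using grow[of "N-2"] N by (simp add: mult.assoc)
  also have "\<dots> \<le> exp (4 * (real N * \<tau>)) * (504 * I)"
  proof (intro mult_mono)
    have "(1 + 4 * \<tau>) ^ (N-2) \<le> (1 + 4 * \<tau>) ^ N" using \<tau> by (intro power_increasing) auto
    also have "\<dots> \<le> exp (4 * \<tau>) ^ N" using \<tau> by (intro power_mono exp_ge_add_one_self) auto
    finally show "(1 + 4 * \<tau>) ^ (N-2) \<le> exp (4 * (real N * \<tau>))"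
      by (simp add: exp_of_nat_mult[symmetric] mult_ac)
    show "E 0 + 4 * (\<tau> * (\<Sum>j<N-2. b j)) \<le> 504 * I" using E00 cons by (simp add: b_def)
    show "0 \<le> E 0 + 4 * (\<tau> * (\<Sum>j<N-2. b j))" using E0 pos \<tau> by (auto intro!: add_nonneg_nonneg mult_nonneg_nonneg sum_nonneg)
  qed auto
  finally have fin: "E (N-2) \<le> exp (4 * (real N * \<tau>)) * (504 * I)" .
  have "m (x N) (x N) + (\<Sum>n<N-2. dd n) + \<tau> * (\<Sum>n<N-2. xk n) \<le> 8 * E (N-2)"
  proof -
    have "E (N-2) = \<Psi> (N-2) + (\<Sum>j<N-2. dd j) / 4 + \<tau> / 2 * (\<Sum>j<N-2. xk j)"
      by (simp add: E_def sum.distrib sum_divide_distrib sum_distrib_left)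
    moreover have "3/8 * m (x N) (x N) \<le> \<Psi> (N-2)" using \<Psi>ge[of "N-2"] by (simp only: le_add_diff_inverse2[OF N])
    moreover have "0 \<le> (\<Sum>j<N-2. dd j)" "0 \<le> \<tau> * (\<Sum>j<N-2. xk j)" "0 \<le> m (x N) (x N)"
      using pos \<tau> semi_inner_nonneg[OF m] by (auto intro!: sum_nonneg mult_nonneg_nonneg)
    ultimately show ?thesis by simp
  qed
  also have "\<dots> \<le> 5000 * exp (4 * (real N * \<tau>)) * I"
  proof -
    have "8 * E (N-2) \<le> 4032 * (exp (4 * (real N * \<tau>)) * I)" using fin by (simp add: mult_ac)
    also have "\<dots> \<le> 5000 * (exp (4 * (real N * \<tau>)) * I)" using I0 by (intro mult_right_mono) auto
    finally show ?thesis by simp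
  qed
  finally show ?thesis by (simp add: dd_def xk_def)
qed

section \<open>Bilinear forms and nodal bases\<close>

text \<open>Coefficients are functions on \<open>nat\<close>, of which only the first entries count, so that the forms live on a real
  vector space.\<close>

definition bform :: "nat \<Rightarrow> nat \<Rightarrow> real mat \<Rightarrow> (nat \<Rightarrow> real) \<Rightarrow> (nat \<Rightarrow> real) \<Rightarrow> real" where
  "bform n n' A a b = (\<Sum>i<n. \<Sum>j<n'. a i * A $$ (i, j) * b j)"

lemma square_sum_bound:
  fixes a f :: "nat \<Rightarrow> real"
  assumes I: "finite I" and f: "\<And>i. i \<in> I \<Longrightarrow> \<bar>f i\<bar> \<le> B" and c: "real (card I) \<le> K"
  shows "(\<Sum>i\<in>I. a i * f i)\<^sup>2 \<le> K * B\<^sup>2 * (\<Sum>i\<in>I. (a i)\<^sup>2)"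
proof -
  have "(\<Sum>i\<in>I. a i * f i)\<^sup>2 \<le> (\<Sum>i\<in>I. (a i)\<^sup>2) * (\<Sum>i\<in>I. (f i)\<^sup>2)"
    by (rule Cauchy_Schwarz_ineq_sum)
  also have "\<dots> \<le> (\<Sum>i\<in>I. (a i)\<^sup>2) * (K * B\<^sup>2)"
  proof (intro mult_left_mono sum_nonneg)
    have "(\<Sum>i\<in>I. (f i)\<^sup>2) \<le> (\<Sum>i\<in>I. B\<^sup>2)"
      using f by (intro sum_mono) (metis abs_ge_zero power2_abs power_mono)
    also have "\<dots> \<le> K * B\<^sup>2" using c by (simp add: mult_right_mono)
    finally show "(\<Sum>i\<in>I. (f i)\<^sup>2) \<le> K * B\<^sup>2" .
  qed auto
  finally show ?thesis by (simp add: mult_ac)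
qed

lemma negligible_mesh_of_lower_dimension:
  fixes \<M> :: "'a::euclidean_space set set"
  assumes "mesh_of S n \<M>" "n < int DIM('a)"
  shows "negligible S"
proof -
  have "negligible T" if T: "T \<in> \<M>" for T
  proof -
    have sx: "n simplex T" using assms T by (auto simp: mesh_of_def)
    have "interior T = {}"
      using aff_dim_simplex[OF sx] assms(2) aff_dim_nonempty_interior[of T] by auto
    then show ?thesis using negligible_convex_interior[OF convex_simplex[OF sx]] by simp
  qed
  then have "negligible (\<Union>\<M>)" using assms(1) by (intro negligible_Union) (auto simp: mesh_of_def triangulation_def)
  then show ?thesis using assms(1) by (simp add: mesh_of_def)
qed

text \<open>Lebesgue measurability ignores the null set where the classical gradients are undefined.\<close>

lemma lebesgue_on_measurable_modulo_negligible:
  fixes f g :: "'a::euclidean_space \<Rightarrow> 'b::topological_space"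
  assumes S: "S \<in> sets lebesgue" and N: "negligible N" and g: "g \<in> borel_measurable borel"
    and fg: "\<And>x. x \<in> S - N \<Longrightarrow> f x = g x"
  shows "f \<in> borel_measurable (lebesgue_on S)"
proof (rule measurableI)
  fix A :: "'b set" assume A: "A \<in> sets borel"
  have gA: "g -` A \<in> sets lebesgue" using measurable_sets[OF g A] by simp
  have N': "X \<in> sets lebesgue" if "X \<subseteq> N" for X
    using negligible_subset[OF N that] negligible_imp_sets by blast
  have "f -` A \<inter> S = (g -` A \<inter> S - N) \<union> (f -` A \<inter> S \<inter> N)" using fg by auto
  moreover have "(g -` A \<inter> S - N) \<union> (f -` A \<inter> S \<inter> N) \<in> sets lebesgue"
    by (rule sets.Un[OF sets.Diff[OF sets.Int[OF gA S] N'[OF order_refl]] N']) auto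
  ultimately show "f -` A \<inter> space (lebesgue_on S) \<in> sets (lebesgue_on S)"
    using S by (simp add: sets_restrict_space_iff)
qed auto

lemma grad_eq:
  assumes "GDERIV v x :> g" shows "grad v x = g"
proof -
  have "D = g" if "GDERIV v x :> D" for D
  proof -
    have "(\<lambda>h. inner h D) = (\<lambda>h. inner h g)"
      by (rule has_derivative_unique[of v _ x]) (use assms that in \<open>simp_all add: gderiv_def\<close>)
    then have "inner (D - g) D = inner (D - g) g" by (rule fun_cong)
    then have "inner (D - g) (D - g) = 0" by (simp add: inner_diff_right)
    then show ?thesis by simp
  qed
  then have "(THE D. GDERIV v x :> D) = g" by (rule the_equality[of "\<lambda>D. GDERIV v x :> D", OF assms])
  moreover have "\<exists>D. GDERIV v x :> D" using assms by blast
  ultimately show ?thesis unfolding grad_def by simp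
qed

text \<open>Predicates for the constants of inverse estimates: a mesh is chosen after its constants, which therefore
  may not depend on it.\<close>

definition gradient_constant :: "'a::euclidean_space itself \<Rightarrow> nat \<Rightarrow> real \<Rightarrow> bool" where
  "gradient_constant _ k C \<longleftrightarrow> (\<forall>(v :: 'a \<Rightarrow> real) T x0 r M x g. v \<in> polynomials_le k \<longrightarrow> convex T \<longrightarrow> 0 < r \<longrightarrow>
     cball x0 r \<subseteq> T \<longrightarrow> (\<forall>z\<in>T. \<bar>v z\<bar> \<le> M) \<longrightarrow> x \<in> T \<longrightarrow> GDERIV v x :> g \<longrightarrow> norm g \<le> C * M / r)"

text \<open>One discretization; constants that are uniform over all discretizations enter the lemmas as hypotheses.\<close>

locale fe_mesh =
  fixes \<Omega> :: "'a::euclidean_space set" and \<sigma> :: real and k q :: nat and \<beta> :: real and D :: "'a fe_data"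
  assumes d2: "2 \<le> DIM('a)" and \<Omega>: "open \<Omega>" "bounded \<Omega>" "\<Omega> \<noteq> {}" and \<sigma>: "0 < \<sigma>" and k: "1 \<le> k"
    and fe: "fe_discretization \<Omega> \<sigma> k q \<beta> D"
begin

abbreviation "\<T> \<equiv> mesh_bulk D"
abbreviation "h \<equiv> mesh_width (mesh_bulk D)"
abbreviation "\<Gamma> \<equiv> frontier \<Omega>"
abbreviation "bulk_nodes \<equiv> dim_u D - dim_l D"
abbreviation "dx \<equiv> lebesgue_on \<Omega>"
abbreviation "dS \<equiv> surface_measure \<Gamma>"

lemma mesh:
  shows "mesh_of (closure \<Omega>) (int DIM('a)) \<T>" "quasi_uniform \<sigma> \<T>" "triangulation \<T>" "finite \<T>"
    "\<And>T. T \<in> \<T> \<Longrightarrow> int DIM('a) simplex T" "\<Union>\<T> = closure \<Omega>" "closure \<Omega> \<noteq> {}"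
    "mesh_of \<Gamma> (int DIM('a) - 1) (mesh_surf D)" "dim_l D \<le> dim_u D"
  using fe \<Omega> by (auto simp: fe_discretization_def mesh_of_def triangulation_def)

lemmas volume_bounds = mesh_volume_bounds[OF mesh(1,2) \<sigma> mesh(7)]

lemma compact_element: "T \<in> \<T> \<Longrightarrow> compact T" and convex_element: "T \<in> \<T> \<Longrightarrow> convex T"
  using compact_simplex[OF mesh(5)] convex_simplex[OF mesh(5)] by auto

lemma basis_u_pw_poly: "i < dim_u D \<Longrightarrow> basis_u D i \<in> pw_poly k \<T>"
  using fe by (auto simp: fe_discretization_def)

lemma basis_u_continuous: "i < dim_u D \<Longrightarrow> continuous_on (closure \<Omega>) (basis_u D i)"
  using basis_u_pw_poly[of i] mesh(6) by (auto simp: pw_poly_def)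

lemma basis_u_polynomial:
  assumes "i < dim_u D" "T \<in> \<T>"
  obtains P where "P \<in> polynomials_le k" "\<And>x. x \<in> T \<Longrightarrow> basis_u D i x = P x"
  using basis_u_pw_poly[OF assms(1)] assms(2) by (auto simp: pw_poly_def)

lemma node_bij: "bij_betw (node D) {..<dim_u D} (lagrange_nodes k \<T>)"
  using fe by (auto simp: fe_discretization_def)

lemma basis_u_at_node:
  assumes "i < dim_u D" "z \<in> lagrange_nodes k \<T>"
  shows "basis_u D i z = (if z = node D i then 1 else 0)"
proof -
  obtain j where j: "j < dim_u D" "z = node D j" using node_bij assms(2) by (auto simp: bij_betw_def)
  have "node D j = node D i \<longleftrightarrow> i = j"
    using node_bij assms(1) j(1) by (auto simp: bij_betw_def inj_on_def)
  then show ?thesis using fe assms(1) j by (auto simp: fe_discretization_def)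
qed

lemma element_nodes_subset: "T \<in> \<T> \<Longrightarrow> lagrange_nodes k {T} \<subseteq> lagrange_nodes k \<T>"
  using lagrange_nodes_UN[of k \<T>] by blast

definition basis_bound :: real where "basis_bound = real ((k + 1) ^ (DIM('a) + 1) * k ^ k)"

lemma basis_u_bound:
  assumes i: "i < dim_u D" and x: "x \<in> closure \<Omega>"
  shows "\<bar>basis_u D i x\<bar> \<le> basis_bound"
proof -
  obtain T where T: "T \<in> \<T>" "x \<in> T" using x mesh(6) by blast
  obtain P where P: "P \<in> polynomials_le k" "\<And>x. x \<in> T \<Longrightarrow> basis_u D i x = P x" using basis_u_polynomial[OF i T(1)] by blast
  have "\<bar>P x\<bar> \<le> real ((k + 1) ^ (DIM('a) + 1) * k ^ k) * 1"
  proof (rule nodal_bound_simplex[OF mesh(5)[OF T(1)] k P(1) _ T(2)])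
    fix z assume z: "z \<in> lagrange_nodes k {T}"
    then have "z \<in> T" "z \<in> lagrange_nodes k \<T>"
      using card_lagrange_nodes_simplex(3)[OF mesh(5)[OF T(1)] k] element_nodes_subset[OF T(1)] by auto
    then show "\<bar>P z\<bar> \<le> 1" using basis_u_at_node[OF i, of z] P(2)[of z] by auto
  qed
  then show ?thesis using P(2)[OF T(2)] by (simp add: basis_bound_def)
qed

lemma basis_u_zero_on_element:
  assumes i: "i < dim_u D" and T: "T \<in> \<T>" "x \<in> T" and n: "node D i \<notin> lagrange_nodes k {T}"
  shows "basis_u D i x = 0"
proof -
  obtain P where P: "P \<in> polynomials_le k" "\<And>x. x \<in> T \<Longrightarrow> basis_u D i x = P x" using basis_u_polynomial[OF i T(1)] by blast
  have "\<bar>P x\<bar> \<le> real ((k + 1) ^ (DIM('a) + 1) * k ^ k) * 0"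
  proof (rule nodal_bound_simplex[OF mesh(5)[OF T(1)] k P(1) _ T(2)])
    fix z assume z: "z \<in> lagrange_nodes k {T}"
    then have "z \<in> T" "z \<in> lagrange_nodes k \<T>" "z \<noteq> node D i"
      using card_lagrange_nodes_simplex(3)[OF mesh(5)[OF T(1)] k] element_nodes_subset[OF T(1)] n by auto
    then show "\<bar>P z\<bar> \<le> 0" using basis_u_at_node[OF i, of z] P(2)[of z] by auto
  qed
  then show ?thesis using P(2)[OF T(2)] by simp
qed

lemma frontier_facet:
  assumes "x \<in> \<Gamma>"
  obtains T F where "T \<in> \<T>" "F facet_of T" "F \<subseteq> \<Gamma>" "x \<in> F"
proof -
  obtain S where S: "S \<in> mesh_surf D" "x \<in> S" using mesh(8) assms by (auto simp: mesh_of_def)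
  then obtain F where "F \<in> boundary_mesh \<T> \<Gamma>" "S \<subseteq> F" using fe by (auto simp: fe_discretization_def)
  then show ?thesis using that S(2) by (auto simp: boundary_mesh_def)
qed

text \<open>A node of the boundary facet through \<open>x\<close> lies on the boundary, so an interior basis function vanishes
  at all nodes of the facet, and thus on the facet.\<close>

lemma basis_u_zero_on_frontier:
  assumes i: "i < bulk_nodes" and x: "x \<in> \<Gamma>"
  shows "basis_u D i x = 0"
proof -
  have iu: "i < dim_u D" using i by simp
  have nf: "node D i \<notin> \<Gamma>" using fe i iu by (auto simp: fe_discretization_def)
  obtain T F where T: "T \<in> \<T>" "F facet_of T" "F \<subseteq> \<Gamma>" "x \<in> F" using frontier_facet[OF x] by blast
  obtain V a where V: "finite V" "T = convex hull V" "{z. z extreme_point_of T} = V" "F = convex hull (V - {a})"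
    by (rule facet_of_simplex[OF mesh(5)[OF T(1)] T(2)])
  obtain P where P: "P \<in> polynomials_le k" "\<And>x. x \<in> T \<Longrightarrow> basis_u D i x = P x" using basis_u_polynomial[OF iu T(1)] by blast
  have FT: "F \<subseteq> T" using T(2) by (simp add: facet_of_imp_subset)
  have "P x = 0"
  proof (rule polynomial_zero_on_hull[OF _ k P(1)])
    show "finite (V - {a})" using V(1) by simp
    show "x \<in> convex hull (V - {a})" using T(4) V(4) by simp
    fix m assume m: "m \<in> multi_indices (V - {a}) k"
    let ?z = "\<Sum>z\<in>V - {a}. (real (m z) / real k) *\<^sub>R z"
    have zF: "?z \<in> F" unfolding V(4) using V(1) k m by (intro lattice_point_in_hull) auto
    have mV: "m \<in> multi_indices V k" "?z = (\<Sum>z\<in>V. (real (m z) / real k) *\<^sub>R z)"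
    proof -
      have m0: "m z = 0" if "z \<notin> V - {a}" for z using m that by (auto simp: multi_indices_def)
      have "sum m V = sum m (V - {a})" using V(1) m0 by (intro sum.mono_neutral_right) auto
      then show "m \<in> multi_indices V k" using m by (auto simp: multi_indices_def)
      show "?z = (\<Sum>z\<in>V. (real (m z) / real k) *\<^sub>R z)" using V(1) m0 by (intro sum.mono_neutral_left) auto
    qed
    then have "?z \<in> lagrange_nodes k {T}" unfolding lagrange_nodes_single[OF V(1,3)] by blast
    then have zn: "?z \<in> lagrange_nodes k \<T>" using element_nodes_subset[OF T(1)] by blast
    have "?z \<noteq> node D i"
    proof
      assume "?z = node D i"
      then have "node D i \<in> F" using zF by simp
      then show False using T(3) nf by blast
    qed
    then have "basis_u D i ?z = 0" unfolding basis_u_at_node[OF iu zn] by (rule if_not_P)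
    moreover have "basis_u D i ?z = P ?z" using zF FT by (intro P(2)) blast
    ultimately show "P ?z = 0" by simp
  qed
  then show ?thesis using P(2) T(4) FT by auto
qed

definition element_dofs :: "'a set \<Rightarrow> nat set" where
  "element_dofs T = {i. i < dim_u D \<and> node D i \<in> lagrange_nodes k {T}}"

lemma finite_element_dofs [simp]: "finite (element_dofs T)" by (simp add: element_dofs_def)

lemma card_element_dofs: "T \<in> \<T> \<Longrightarrow> real (card (element_dofs T)) \<le> real ((k + 1) ^ (DIM('a) + 1))"
proof -
  assume T: "T \<in> \<T>"
  note c = card_lagrange_nodes_simplex[OF mesh(5)[OF T] k]
  have "card (element_dofs T) \<le> card (lagrange_nodes k {T})"
    using node_bij c(1) by (intro card_inj_on_le[of "node D"]) (auto simp: element_dofs_def bij_betw_def inj_on_def)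
  then show ?thesis using c(2) by linarith
qed

lemma element_expansion:
  assumes T: "T \<in> \<T>" "x \<in> T"
  shows "(\<Sum>i<dim_u D. a i * basis_u D i x) = (\<Sum>i\<in>element_dofs T. a i * basis_u D i x)"
  using basis_u_zero_on_element[OF _ T] by (intro sum.mono_neutral_right) (auto simp: element_dofs_def)

text \<open>Every node belongs to at most \<open>\<sigma>\<^sup>-\<^sup>d\<close> elements.\<close>

lemma sum_over_elements:
  assumes a: "\<And>i. 0 \<le> a i"
  shows "(\<Sum>T\<in>\<T>. \<Sum>i\<in>element_dofs T. a i) \<le> (1 / \<sigma>) ^ DIM('a) * (\<Sum>i<dim_u D. (a i :: real))"
proof -
  have "(\<Sum>T\<in>\<T>. \<Sum>i\<in>element_dofs T. a i) = (\<Sum>T\<in>\<T>. \<Sum>i | i < dim_u D \<and> i \<in> element_dofs T. a i)"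
    by (intro sum.cong refl) (auto simp: element_dofs_def)
  also have "\<dots> = (\<Sum>i | i < dim_u D. \<Sum>T | T \<in> \<T> \<and> i \<in> element_dofs T. a i)"
    using sum.swap_restrict[OF mesh(4), of "{i. i < dim_u D}" "\<lambda>_ i. a i" "\<lambda>T i. i \<in> element_dofs T"] by simp
  also have "\<dots> \<le> (\<Sum>i<dim_u D. (1 / \<sigma>) ^ DIM('a) * a i)"
    unfolding lessThan_def[symmetric]
  proof (rule sum_mono)
    fix i
    have "{T. T \<in> \<T> \<and> i \<in> element_dofs T} \<subseteq> {T \<in> \<T>. T \<subseteq> cball (node D i) (1 * h)}"
    proof clarify
      fix T y assume T: "T \<in> \<T>" "i \<in> element_dofs T" "y \<in> T"
      have "node D i \<in> T" using T card_lagrange_nodes_simplex(3)[OF mesh(5)[OF T(1)] k] by (auto simp: element_dofs_def)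
      then show "y \<in> cball (node D i) (1 * h)" using volume_bounds(2)[OF T(1) _ T(3)] by auto
    qed
    then have "real (card {T. T \<in> \<T> \<and> i \<in> element_dofs T}) \<le> real (card {T \<in> \<T>. T \<subseteq> cball (node D i) (1 * h)})"
      using mesh(4) by (simp add: card_mono)
    also have "\<dots> \<le> (1 / \<sigma>) ^ DIM('a)" by (rule volume_bounds(3)) simp
    finally show "(\<Sum>T | T \<in> \<T> \<and> i \<in> element_dofs T. a i) \<le> (1 / \<sigma>) ^ DIM('a) * a i"
      using a[of i] by (simp add: mult_right_mono)
  qed
  finally show ?thesis by (simp add: sum_distrib_left)
qed

lemma Omega_measure:
  shows "\<Omega> \<in> sets lebesgue" "emeasure dx (space dx) < \<infinity>"
proof -
  show m: "\<Omega> \<in> sets lebesgue" using \<Omega>(1) by (simp add: lborelD)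
  have "emeasure lebesgue \<Omega> < \<infinity>"
    using bounded_set_imp_lmeasurable[OF \<Omega>(2) m] by (simp add: fmeasurable_def del: emeasure_completion)
  then show "emeasure dx (space dx) < \<infinity>"
    using m by (simp add: emeasure_restrict_space space_restrict_space del: emeasure_completion)
qed

definition ball_vol :: real where "ball_vol = unit_ball_vol (real DIM('a))"

lemma ball_vol_pos: "0 < ball_vol" by (simp add: ball_vol_def)

text \<open>An element has volume at most a constant times \<open>h\<^sup>d\<close>, and each node is counted boundedly often.\<close>

lemma integral_nodal_upper_bound:
  fixes w :: "'a \<Rightarrow> real"
  assumes w: "integrable dx w" and B: "0 \<le> B"
    and ae: "AE x in dx. \<exists>T\<in>\<T>. x \<in> T \<and> w x \<le> B * (\<Sum>i\<in>element_dofs T. (a i)\<^sup>2)"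
  shows "(LINT x|dx. w x) \<le> B * ball_vol / \<sigma> ^ DIM('a) * h ^ DIM('a) * (\<Sum>i<dim_u D. (a i)\<^sup>2)"
proof -
  let ?b = "\<lambda>T. B * (\<Sum>i\<in>element_dofs T. (a i)\<^sup>2)"
  have b0: "0 \<le> ?b T" for T using B by (simp add: sum_nonneg)
  interpret finite_measure "dx" by (rule finite_measureI) (use Omega_measure(2) in auto)
  have Ts: "T \<inter> \<Omega> \<in> sets dx" if "T \<in> \<T>" for T
    using compact_element[OF that] Omega_measure(1) by (auto simp: sets_restrict_space_iff intro!: sets.Int lborelD borel_compact)
  have iT: "integrable dx (\<lambda>x. indicator (T \<inter> \<Omega>) x * ?b T)" if "T \<in> \<T>" for T
    using Ts[OF that] emeasure_finite[of "T \<inter> \<Omega>"] by (simp add: less_top[symmetric])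
  have "(LINT x|dx. w x) \<le> (LINT x|dx. (\<Sum>T\<in>\<T>. indicator (T \<inter> \<Omega>) x * ?b T))"
  proof (rule integral_mono_AE[OF w])
    show "integrable dx (\<lambda>x. (\<Sum>T\<in>\<T>. indicator (T \<inter> \<Omega>) x * ?b T))"
      using iT by (intro Bochner_Integration.integrable_sum)
    show "AE x in dx. w x \<le> (\<Sum>T\<in>\<T>. indicator (T \<inter> \<Omega>) x * ?b T)"
      using ae AE_space
    proof eventually_elim
      case (elim x)
      then obtain T where T: "T \<in> \<T>" "x \<in> T" "w x \<le> ?b T" by blast
      have "w x \<le> indicator (T \<inter> \<Omega>) x * ?b T" using T elim(2) by (simp add: indicator_def)
      also have "\<dots> \<le> (\<Sum>T\<in>\<T>. indicator (T \<inter> \<Omega>) x * ?b T)"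
        using b0 by (intro member_le_sum[OF T(1) _ mesh(4)]) auto
      finally show ?case .
    qed
  qed
  also have "\<dots> = (\<Sum>T\<in>\<T>. (LINT x|dx. indicator (T \<inter> \<Omega>) x * ?b T))"
    by (rule Bochner_Integration.integral_sum) (rule iT)
  also have "\<dots> \<le> (\<Sum>T\<in>\<T>. ball_vol * h ^ DIM('a) * ?b T)"
  proof (rule sum_mono)
    fix T assume T: "T \<in> \<T>"
    have "measure dx (T \<inter> \<Omega>) \<le> ball_vol * h ^ DIM('a)"
    proof (cases "T = {}")
      case False
      then obtain z where z: "z \<in> T" by blast
      have sub: "T \<inter> \<Omega> \<subseteq> cball z h" using volume_bounds(2)[OF T z] by auto
      have "measure dx (T \<inter> \<Omega>) = measure lebesgue (T \<inter> \<Omega>)"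
        using Omega_measure(1) by (intro measure_restrict_space) auto
      also have "\<dots> \<le> measure lebesgue (cball z h)"
        using Ts[OF T] Omega_measure(1) by (intro measure_mono_fmeasurable[OF sub]) (auto simp: sets_restrict_space_iff)
      also have "\<dots> = ball_vol * h ^ DIM('a)" using volume_bounds(1) by (simp add: content_cball ball_vol_def)
      finally show ?thesis .
    qed (use ball_vol_pos volume_bounds(1) in auto)
    then have "measure dx (T \<inter> \<Omega>) * ?b T \<le> ball_vol * h ^ DIM('a) * ?b T"
      by (rule mult_right_mono[OF _ b0])
    moreover have "(LINT x|dx. indicator (T \<inter> \<Omega>) x * ?b T) = measure dx (T \<inter> \<Omega>) * ?b T"
      using Ts[OF T] emeasure_finite[of "T \<inter> \<Omega>"] by (simp add: less_top[symmetric])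
    ultimately show "(LINT x|dx. indicator (T \<inter> \<Omega>) x * ?b T) \<le> ball_vol * h ^ DIM('a) * ?b T" by simp
  qed
  also have "\<dots> = ball_vol * h ^ DIM('a) * B * (\<Sum>T\<in>\<T>. \<Sum>i\<in>element_dofs T. (a i)\<^sup>2)"
    by (simp add: sum_distrib_left mult_ac)
  also have "\<dots> \<le> ball_vol * h ^ DIM('a) * B * ((1 / \<sigma>) ^ DIM('a) * (\<Sum>i<dim_u D. (a i)\<^sup>2))"
    using ball_vol_pos volume_bounds(1) B by (intro mult_left_mono sum_over_elements) auto
  finally show ?thesis by (simp add: power_one_over divide_simps mult_ac)
qed


subsection \<open>Bulk matrices\<close>

definition bulk_fun :: "(nat \<Rightarrow> real) \<Rightarrow> 'a \<Rightarrow> real" where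
  "bulk_fun a x = (\<Sum>i<dim_u D. a i * basis_u D i x)"

lemma basis_u_measurable: "i < dim_u D \<Longrightarrow> basis_u D i \<in> borel_measurable dx"
  using continuous_imp_measurable_on_sets_lebesgue[OF continuous_on_subset[OF basis_u_continuous closure_subset] Omega_measure(1)] .

lemma mass_u_form:
  "bform (dim_u D) (dim_u D) (mass_u \<Omega> D) a b = (LINT x|dx. bulk_fun a x * bulk_fun b x)"
  "integrable dx (\<lambda>x. bulk_fun a x * bulk_fun b x)"
proof -
  have bd: "AE x in dx. norm (basis_u D i x) \<le> basis_bound" if "i < dim_u D" for i
    using basis_u_bound[OF that] closure_subset[of \<Omega>] by (intro AE_I2) (auto simp: space_restrict_space)
  note g = gram_sum[OF Omega_measure(2), where w = "\<lambda>_. 1" and W = 1 and \<psi> = "basis_u D" and \<psi>' = "basis_u D"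
      and n = "dim_u D" and n' = "dim_u D" and B = basis_bound, OF _ _ basis_u_measurable bd basis_u_measurable bd]
  show "bform (dim_u D) (dim_u D) (mass_u \<Omega> D) a b = (LINT x|dx. bulk_fun a x * bulk_fun b x)"
    using g(1)[of a b] by (simp add: bform_def mass_u_def bulk_fun_def)
  show "integrable dx (\<lambda>x. bulk_fun a x * bulk_fun b x)"
    using g(2)[of a b] by (simp add: bulk_fun_def)
qed

lemma bulk_fun_bound:
  assumes T: "T \<in> \<T>" "x \<in> T"
  shows "(bulk_fun a x)\<^sup>2 \<le> real ((k + 1) ^ (DIM('a) + 1)) * basis_bound\<^sup>2 * (\<Sum>i\<in>element_dofs T. (a i)\<^sup>2)"
proof -
  have "x \<in> closure \<Omega>" using T mesh(6) by blast
  then show ?thesis unfolding bulk_fun_def element_expansion[OF T]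
    using card_element_dofs[OF T(1)] basis_u_bound by (intro square_sum_bound) (auto simp: element_dofs_def)
qed

lemma mass_u_upper:
  "bform (dim_u D) (dim_u D) (mass_u \<Omega> D) a a
    \<le> real ((k + 1) ^ (DIM('a) + 1)) * basis_bound\<^sup>2 * ball_vol / \<sigma> ^ DIM('a) * h ^ DIM('a) * (\<Sum>i<dim_u D. (a i)\<^sup>2)"
  unfolding mass_u_form(1)
proof (rule integral_nodal_upper_bound[OF mass_u_form(2)])
  show "AE x in dx. \<exists>T\<in>\<T>. x \<in> T \<and> bulk_fun a x * bulk_fun a x
      \<le> real ((k + 1) ^ (DIM('a) + 1)) * basis_bound\<^sup>2 * (\<Sum>i\<in>element_dofs T. (a i)\<^sup>2)"
  proof (rule AE_I2)
    fix x assume "x \<in> space dx"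
    then have "x \<in> closure \<Omega>" using closure_subset[of \<Omega>] by (auto simp: space_restrict_space)
    then obtain T where T: "T \<in> \<T>" "x \<in> T" using mesh(6) by blast
    then show "\<exists>T\<in>\<T>. x \<in> T \<and> bulk_fun a x * bulk_fun a x
      \<le> real ((k + 1) ^ (DIM('a) + 1)) * basis_bound\<^sup>2 * (\<Sum>i\<in>element_dofs T. (a i)\<^sup>2)"
      using bulk_fun_bound[OF T, of a] by (auto simp: power2_eq_square)
  qed
qed simp

text \<open>On the interior of an element the classical gradient is that of a polynomial, to which the inverse
  estimate applies with the ball of radius \<open>\<sigma> h\<close>.\<close>

lemma grad_basis_u:
  assumes i: "i < dim_u D" and T: "T \<in> \<T>"
    and C: "gradient_constant TYPE('a) k C"
  obtains G where "continuous_on UNIV G" "\<And>x. x \<in> interior T \<Longrightarrow> GDERIV (basis_u D i) x :> G x"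
    "\<And>x. x \<in> interior T \<Longrightarrow> grad (basis_u D i) x = G x"
    "\<And>x. x \<in> T \<Longrightarrow> norm (G x) \<le> C * basis_bound / (\<sigma> * h)"
    "\<And>x. i \<notin> element_dofs T \<Longrightarrow> x \<in> interior T \<Longrightarrow> G x = 0"
proof -
  obtain P where P: "P \<in> polynomials_le k" "\<And>x. x \<in> T \<Longrightarrow> basis_u D i x = P x" using basis_u_polynomial[OF i T] by blast
  obtain G where G: "continuous_on UNIV G" "\<And>x. GDERIV P x :> G x" using polynomials_le_gradient[OF P(1)] by blast
  have transfer: "GDERIV f x :> g" if "x \<in> interior T" "GDERIV p x :> g" "\<And>y. y \<in> T \<Longrightarrow> f y = p y" for f p :: "'a \<Rightarrow> real" and x g
    using that(2) unfolding gderiv_def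
    by (rule has_derivative_transform_within_open[OF _ open_interior that(1)]) (use that(3) interior_subset in force)
  have d: "GDERIV (basis_u D i) x :> G x" if "x \<in> interior T" for x
    by (rule transfer[OF that G(2)]) (use P in auto)
  have b: "norm (G x) \<le> C * basis_bound / (\<sigma> * h)" if x: "x \<in> T" for x
  proof -
    obtain x0 where x0: "cball x0 (\<sigma> * h) \<subseteq> T" using mesh(2) T by (auto simp: quasi_uniform_def)
    have "\<forall>z\<in>T. \<bar>P z\<bar> \<le> basis_bound"
    proof
      fix z assume z: "z \<in> T"
      then have "z \<in> closure \<Omega>" using T mesh(6) by blast
      then show "\<bar>P z\<bar> \<le> basis_bound" using basis_u_bound[OF i, of z] P(2)[OF z] by simp
    qed
    then show ?thesis
      using C[unfolded gradient_constant_def, rule_format, OF P(1) convex_element[OF T] _ x0 _ x G(2)]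
        \<sigma> volume_bounds(1) by simp
  qed
  have z: "G x = 0" if n: "i \<notin> element_dofs T" and x: "x \<in> interior T" for x
  proof -
    have "basis_u D i y = 0" if "y \<in> T" for y
      using basis_u_zero_on_element[OF i T that] n i by (simp add: element_dofs_def)
    then have "GDERIV (basis_u D i) x :> 0" by (intro transfer[OF x GDERIV_const[of 0]])
    then show ?thesis using grad_eq[OF d[OF x]] grad_eq[of "basis_u D i" x 0] by simp
  qed
  show ?thesis by (rule that[OF G(1) d grad_eq[OF d] b z])
qed

lemma grad_basis_u_bound:
  assumes i: "i < dim_u D" and T: "T \<in> \<T>" and x: "x \<in> interior T"
    and C: "gradient_constant TYPE('a) k C"
  shows "norm (grad (basis_u D i) x) \<le> C * basis_bound / (\<sigma> * h)"
    and "i \<notin> element_dofs T \<Longrightarrow> grad (basis_u D i) x = 0"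
proof -
  have *: "norm (grad (basis_u D i) x) \<le> C * basis_bound / (\<sigma> * h) \<and> (i \<notin> element_dofs T \<longrightarrow> grad (basis_u D i) x = 0)"
  proof (rule grad_basis_u[OF i T, of C])
    fix G assume "\<And>x. x \<in> interior T \<Longrightarrow> grad (basis_u D i) x = G x" "\<And>x. x \<in> T \<Longrightarrow> norm (G x) \<le> C * basis_bound / (\<sigma> * h)"
      "\<And>x. i \<notin> element_dofs T \<Longrightarrow> x \<in> interior T \<Longrightarrow> G x = 0"
    then show ?thesis using x interior_subset[of T] by auto
  qed (rule C)
  show "norm (grad (basis_u D i) x) \<le> C * basis_bound / (\<sigma> * h)" using * by blast
  show "grad (basis_u D i) x = 0" if "i \<notin> element_dofs T" using * that by blast
qed

lemma element_frontiers_negligible: "negligible (\<Union>T\<in>\<T>. frontier T)"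
proof (rule negligible_Union)
  show "finite (frontier ` \<T>)" using mesh(4) by simp
  show "negligible F" if "F \<in> frontier ` \<T>" for F using that negligible_convex_frontier convex_element by auto
qed

lemma AE_element_interior: "AE x in dx. \<exists>T\<in>\<T>. x \<in> interior T"
proof -
  have "AE x in lebesgue. x \<notin> (\<Union>T\<in>\<T>. frontier T)"
    using element_frontiers_negligible by (intro AE_not_in) (simp add: negligible_iff_null_sets)
  then have "AE x in dx. x \<notin> (\<Union>T\<in>\<T>. frontier T)"
    using Omega_measure(1) by (subst AE_restrict_space_iff) (auto elim: eventually_mono)
  then show ?thesis using AE_space
  proof eventually_elim
    case (elim x)
    then have "x \<in> closure \<Omega>" using closure_subset[of \<Omega>] by (auto simp: space_restrict_space)
    then obtain T where "T \<in> \<T>" "x \<in> T" using mesh(6) by blast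
    then show ?case using elim closure_subset[of T] by (auto simp: frontier_def)
  qed
qed

lemma grad_basis_u_measurable:
  assumes i: "i < dim_u D"
  shows "grad (basis_u D i) \<in> borel_measurable dx"
proof -
  obtain C where C: "gradient_constant TYPE('a) k C"
    using polynomial_gradient_bound[OF k, where 'a = 'a] unfolding gradient_constant_def by blast
  have "\<forall>T\<in>\<T>. \<exists>G. continuous_on UNIV G \<and> (\<forall>x\<in>interior T. grad (basis_u D i) x = G x)"
  proof
    fix T assume T: "T \<in> \<T>"
    show "\<exists>G. continuous_on UNIV G \<and> (\<forall>x\<in>interior T. grad (basis_u D i) x = G x)"
    proof (rule grad_basis_u[OF i T, of C])
      fix G assume "continuous_on UNIV G" "\<And>x. x \<in> interior T \<Longrightarrow> grad (basis_u D i) x = G x"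
      then show ?thesis by blast
    qed (rule C)
  qed
  then obtain G where G: "\<forall>T\<in>\<T>. continuous_on UNIV (G T) \<and> (\<forall>x\<in>interior T. grad (basis_u D i) x = G T x)"
    unfolding bchoice_iff by blast
  define g where "g x = (\<Sum>T\<in>\<T>. indicator (interior T) x *\<^sub>R G T x)" for x
  have gm: "g \<in> borel_measurable borel" unfolding g_def
    using G by (intro borel_measurable_sum borel_measurable_scaleR borel_measurable_indicator borel_measurable_continuous_onI) auto
  show ?thesis
  proof (rule lebesgue_on_measurable_modulo_negligible[OF Omega_measure(1) element_frontiers_negligible gm])
    fix x assume x: "x \<in> \<Omega> - (\<Union>T\<in>\<T>. frontier T)"
    then have "x \<in> closure \<Omega>" using closure_subset[of \<Omega>] by auto
    then obtain T where T: "T \<in> \<T>" "x \<in> T" using mesh(6) by blast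
    then have xi: "x \<in> interior T" using x closure_subset[of T] by (auto simp: frontier_def)
    have "g x = (\<Sum>T'\<in>\<T>. if T' = T then G T x else 0)" unfolding g_def
    proof (rule sum.cong[OF refl])
      fix T' assume T': "T' \<in> \<T>"
      then have "x \<notin> interior T'" if "T' \<noteq> T"
        using triangulation_interiors_disjoint[OF mesh(3) T' T(1) that] xi by blast
      then show "indicator (interior T') x *\<^sub>R G T' x = (if T' = T then G T x else 0)"
        using xi by (auto simp: indicator_def)
    qed
    also have "\<dots> = G T x" using T mesh(4) by simp
    finally show "grad (basis_u D i) x = g x" using G T xi by simp
  qed
qed

lemma stiff_u_form:
  assumes \<alpha>: "\<alpha> \<in> borel_measurable dx" "AE x in dx. 0 \<le> \<alpha> x \<and> \<alpha> x \<le> a1"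
  shows "bform (dim_u D) (dim_u D) (stiff_u \<Omega> \<alpha> D) a b
      = (LINT x|dx. \<alpha> x * inner (\<Sum>i<dim_u D. a i *\<^sub>R grad (basis_u D i) x) (\<Sum>i<dim_u D. b i *\<^sub>R grad (basis_u D i) x))"
    "integrable dx (\<lambda>x. \<alpha> x * inner (\<Sum>i<dim_u D. a i *\<^sub>R grad (basis_u D i) x) (\<Sum>i<dim_u D. b i *\<^sub>R grad (basis_u D i) x))"
proof -
  obtain C where C: "gradient_constant TYPE('a) k C"
    using polynomial_gradient_bound[OF k, where 'a = 'a] unfolding gradient_constant_def by blast
  have bd: "AE x in dx. norm (grad (basis_u D i) x) \<le> C * basis_bound / (\<sigma> * h)" if i: "i < dim_u D" for i
    using AE_element_interior
  proof eventually_elim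
    case (elim x)
    then obtain T where T: "T \<in> \<T>" "x \<in> interior T" by blast
    show ?case by (rule grad_basis_u_bound(1)[OF i T C])
  qed
  note g = gram_sum[OF Omega_measure(2) \<alpha>, where \<psi> = "\<lambda>i. grad (basis_u D i)" and \<psi>' = "\<lambda>i. grad (basis_u D i)"
      and n = "dim_u D" and n' = "dim_u D" and B = "C * basis_bound / (\<sigma> * h)",
      OF grad_basis_u_measurable bd grad_basis_u_measurable bd]
  show "bform (dim_u D) (dim_u D) (stiff_u \<Omega> \<alpha> D) a b
      = (LINT x|dx. \<alpha> x * inner (\<Sum>i<dim_u D. a i *\<^sub>R grad (basis_u D i) x) (\<Sum>i<dim_u D. b i *\<^sub>R grad (basis_u D i) x))"
    using g(1)[of a b] by (simp add: bform_def stiff_u_def)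
  show "integrable dx (\<lambda>x. \<alpha> x * inner (\<Sum>i<dim_u D. a i *\<^sub>R grad (basis_u D i) x) (\<Sum>i<dim_u D. b i *\<^sub>R grad (basis_u D i) x))"
    using g(2)[of a b] by simp
qed

lemma stiff_u_upper:
  assumes \<alpha>: "\<alpha> \<in> borel_measurable dx" "AE x in dx. 0 \<le> \<alpha> x \<and> \<alpha> x \<le> a1"
    and C: "gradient_constant TYPE('a) k C"
  shows "h\<^sup>2 * bform (dim_u D) (dim_u D) (stiff_u \<Omega> \<alpha> D) a a
    \<le> \<bar>a1\<bar> * real ((k + 1) ^ (DIM('a) + 1)) * (C * basis_bound / \<sigma>)\<^sup>2 * ball_vol / \<sigma> ^ DIM('a) * h ^ DIM('a) * (\<Sum>i<dim_u D. (a i)\<^sup>2)"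
proof -
  let ?g = "\<lambda>x. \<Sum>i<dim_u D. a i *\<^sub>R grad (basis_u D i) x" and ?N = "real ((k + 1) ^ (DIM('a) + 1))"
  let ?B = "\<bar>a1\<bar> * (?N * (C * basis_bound / (\<sigma> * h))\<^sup>2)"
  have "bform (dim_u D) (dim_u D) (stiff_u \<Omega> \<alpha> D) a a \<le> ?B * ball_vol / \<sigma> ^ DIM('a) * h ^ DIM('a) * (\<Sum>i<dim_u D. (a i)\<^sup>2)"
    unfolding stiff_u_form(1)[OF \<alpha>]
  proof (rule integral_nodal_upper_bound[OF stiff_u_form(2)[OF \<alpha>]])
    show "AE x in dx. \<exists>T\<in>\<T>. x \<in> T \<and> \<alpha> x * inner (?g x) (?g x) \<le> ?B * (\<Sum>i\<in>element_dofs T. (a i)\<^sup>2)"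
      using AE_element_interior \<alpha>(2)
    proof eventually_elim
      case (elim x)
      then obtain T where T: "T \<in> \<T>" "x \<in> interior T" by blast
      have xT: "x \<in> T" using T(2) interior_subset by blast
      have gi: "norm (grad (basis_u D i) x) \<le> C * basis_bound / (\<sigma> * h)"
        "i \<notin> element_dofs T \<Longrightarrow> grad (basis_u D i) x = 0" if i: "i < dim_u D" for i
        using grad_basis_u_bound[OF i T C] by blast+
      have "?g x = (\<Sum>i\<in>element_dofs T. a i *\<^sub>R grad (basis_u D i) x)"
        using gi(2) by (intro sum.mono_neutral_right) (auto simp: element_dofs_def)
      then have "norm (?g x) \<le> (\<Sum>i\<in>element_dofs T. \<bar>a i\<bar> * norm (grad (basis_u D i) x))"
        using norm_sum[of "\<lambda>i. a i *\<^sub>R grad (basis_u D i) x" "element_dofs T"] by simp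
      then have "(norm (?g x))\<^sup>2 \<le> (\<Sum>i\<in>element_dofs T. \<bar>a i\<bar> * norm (grad (basis_u D i) x))\<^sup>2" by (rule power_mono) simp
      also have "\<dots> \<le> ?N * (C * basis_bound / (\<sigma> * h))\<^sup>2 * (\<Sum>i\<in>element_dofs T. \<bar>a i\<bar>\<^sup>2)"
        using gi(1) card_element_dofs[OF T(1)] by (intro square_sum_bound) (auto simp: element_dofs_def)
      finally have g2: "inner (?g x) (?g x) \<le> ?N * (C * basis_bound / (\<sigma> * h))\<^sup>2 * (\<Sum>i\<in>element_dofs T. (a i)\<^sup>2)"
        by (simp add: power2_norm_eq_inner)
      have "\<alpha> x * inner (?g x) (?g x) \<le> \<bar>a1\<bar> * (?N * (C * basis_bound / (\<sigma> * h))\<^sup>2 * (\<Sum>i\<in>element_dofs T. (a i)\<^sup>2))"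
        using elim(2) g2 by (intro mult_mono) auto
      then show ?case using T(1) xT by (intro bexI[of _ T]) (auto simp: mult.assoc)
    qed
  qed simp
  then have "h\<^sup>2 * bform (dim_u D) (dim_u D) (stiff_u \<Omega> \<alpha> D) a a
      \<le> h\<^sup>2 * (?B * ball_vol / \<sigma> ^ DIM('a) * h ^ DIM('a) * (\<Sum>i<dim_u D. (a i)\<^sup>2))"
    by (rule mult_left_mono) simp
  also have "\<dots> = (h\<^sup>2 * (C * basis_bound / (\<sigma> * h))\<^sup>2) * (\<bar>a1\<bar> * ?N * ball_vol / \<sigma> ^ DIM('a) * h ^ DIM('a) * (\<Sum>i<dim_u D. (a i)\<^sup>2))"
    by (simp add: mult_ac)
  also have "h\<^sup>2 * (C * basis_bound / (\<sigma> * h))\<^sup>2 = (C * basis_bound / \<sigma>)\<^sup>2"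
    using volume_bounds(1) by (simp add: power_mult_distrib power_divide)
  finally show ?thesis by (simp add: mult_ac)
qed

end

lemma polynomials_le_sum:
  fixes P :: "'i \<Rightarrow> 'a::euclidean_space \<Rightarrow> real"
  assumes I: "finite I" and P: "\<And>i. i \<in> I \<Longrightarrow> P i \<in> polynomials_le k"
  shows "(\<lambda>x. \<Sum>i\<in>I. a i * P i x) \<in> polynomials_le k"
proof -
  define A where "A = {m :: 'a \<Rightarrow> nat. (\<forall>b. b \<notin> Basis \<longrightarrow> m b = 0) \<and> sum m Basis \<le> k}"
  have "\<forall>i\<in>I. \<exists>c. P i = (\<lambda>x. \<Sum>m\<in>A. c m * (\<Prod>b\<in>Basis. inner x b ^ m b))"
    using P by (auto simp: polynomials_le_def A_def)
  then obtain c where c: "\<forall>i\<in>I. P i = (\<lambda>x. \<Sum>m\<in>A. c i m * (\<Prod>b\<in>Basis. inner x b ^ m b))"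
    unfolding bchoice_iff by blast
  have "(\<Sum>i\<in>I. a i * P i x) = (\<Sum>m\<in>A. (\<Sum>i\<in>I. a i * c i m) * (\<Prod>b\<in>Basis. inner x b ^ m b))" for x
  proof -
    have "(\<Sum>i\<in>I. a i * P i x) = (\<Sum>i\<in>I. \<Sum>m\<in>A. a i * c i m * (\<Prod>b\<in>Basis. inner x b ^ m b))"
      using c by (intro sum.cong) (auto simp: sum_distrib_left mult.assoc)
    also have "\<dots> = (\<Sum>m\<in>A. \<Sum>i\<in>I. a i * c i m * (\<Prod>b\<in>Basis. inner x b ^ m b))" by (rule sum.swap)
    finally show ?thesis by (simp add: sum_distrib_right)
  qed
  then show ?thesis unfolding polynomials_le_def A_def[symmetric] by auto
qed

definition copy_ratio :: "'a::euclidean_space itself \<Rightarrow> nat \<Rightarrow> real \<Rightarrow> bool" where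
  "copy_ratio _ k s \<longleftrightarrow> 0 < s \<and> s \<le> 1 \<and> (\<forall>(P :: 'a \<Rightarrow> real) K z. P \<in> polynomials_le k \<longrightarrow> compact K \<longrightarrow> convex K \<longrightarrow> z \<in> K \<longrightarrow>
     (\<exists>x\<in>K. \<forall>y\<in>K. x + s *\<^sub>R (y - x) \<in> K \<and> \<bar>P z\<bar> \<le> 2 * \<bar>P (x + s *\<^sub>R (y - x))\<bar>))"

lemma copy_ratioE:
  fixes P :: "'a::euclidean_space \<Rightarrow> real"
  assumes "copy_ratio TYPE('a) k s" "P \<in> polynomials_le k" "compact K" "convex K" "z \<in> K"
  obtains x where "x \<in> K" "\<And>y. y \<in> K \<Longrightarrow> x + s *\<^sub>R (y - x) \<in> K"
    "\<And>y. y \<in> K \<Longrightarrow> \<bar>P z\<bar> \<le> 2 * \<bar>P (x + s *\<^sub>R (y - x))\<bar>"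
proof -
  have "\<exists>x\<in>K. \<forall>y\<in>K. x + s *\<^sub>R (y - x) \<in> K \<and> \<bar>P z\<bar> \<le> 2 * \<bar>P (x + s *\<^sub>R (y - x))\<bar>"
    using assms by (auto simp: copy_ratio_def)
  then show ?thesis using that by auto
qed

definition cone_constant :: "'a::euclidean_space itself \<Rightarrow> real \<Rightarrow> bool" where
  "cone_constant _ K \<longleftrightarrow> 0 < K \<and> (\<forall>(A :: 'a set) a h T. 0 < h \<and> (\<forall>y\<in>A. dist a y \<le> h) \<and> T \<in> sets borel \<and>
      T \<subseteq> (\<Union>y\<in>A. closed_segment y a) \<longrightarrow>
      emeasure lborel T \<le> ennreal (K * h) * hausdorff_outer (DIM('a) - 1) A)"

context fe_mesh
begin

lemma bulk_fun_polynomial: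
  assumes T: "T \<in> \<T>"
  obtains P where "P \<in> polynomials_le k" "\<And>x. x \<in> T \<Longrightarrow> bulk_fun a x = P x"
proof -
  have "\<forall>i\<in>{..<dim_u D}. \<exists>P. P \<in> polynomials_le k \<and> (\<forall>x\<in>T. basis_u D i x = P x)"
  proof
    fix i assume "i \<in> {..<dim_u D}"
    then have "basis_u D i \<in> pw_poly k \<T>" using basis_u_pw_poly by simp
    then show "\<exists>P. P \<in> polynomials_le k \<and> (\<forall>x\<in>T. basis_u D i x = P x)" using T unfolding pw_poly_def by blast
  qed
  then obtain P where P: "\<forall>i\<in>{..<dim_u D}. P i \<in> polynomials_le k \<and> (\<forall>x\<in>T. basis_u D i x = P i x)"
    unfolding bchoice_iff by blast
  have "(\<lambda>x. \<Sum>i<dim_u D. a i * P i x) \<in> polynomials_le k" using P by (intro polynomials_le_sum) auto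
  moreover have "bulk_fun a x = (\<Sum>i<dim_u D. a i * P i x)" if "x \<in> T" for x
    unfolding bulk_fun_def using P that by (intro sum.cong) auto
  ultimately show ?thesis using that by blast
qed

lemma node_in: "i < dim_u D \<Longrightarrow> node D i \<in> lagrange_nodes k \<T>"
  using node_bij by (auto simp: bij_betw_def)

lemma bulk_fun_at_node:
  assumes i: "i < dim_u D" shows "bulk_fun a (node D i) = a i"
proof -
  have "bulk_fun a (node D i) = (\<Sum>j<dim_u D. if j = i then a i else 0)"
    unfolding bulk_fun_def
  proof (rule sum.cong[OF refl])
    fix j assume j: "j \<in> {..<dim_u D}"
    have "node D i = node D j \<longleftrightarrow> i = j" using node_bij i j by (auto simp: bij_betw_def inj_on_def)
    then show "a j * basis_u D j (node D i) = (if j = i then a i else 0)"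
      using basis_u_at_node[OF _ node_in[OF i], of j] j by auto
  qed
  then show ?thesis using i by simp
qed

lemma node_element:
  assumes "i < dim_u D" obtains T where "T \<in> \<T>" "node D i \<in> T"
proof -
  obtain T where "T \<in> \<T>" "node D i \<in> lagrange_nodes k {T}" using node_in[OF assms] lagrange_nodes_UN[of k \<T>] by blast
  then show ?thesis using that card_lagrange_nodes_simplex(3)[OF mesh(5) k] by blast
qed

definition overlap :: real where "overlap = (2 / \<sigma>) ^ DIM('a) * real ((k + 1) ^ (DIM('a) + 1))"

lemma overlap_bound: "real (card {i. i < dim_u D \<and> x \<in> cball (node D i) h}) \<le> overlap"
proof -
  let ?I = "{i. i < dim_u D \<and> x \<in> cball (node D i) h}"
  have "card ?I = card (node D ` ?I)"
    using node_bij by (intro card_image[symmetric]) (auto simp: bij_betw_def inj_on_def)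
  moreover have "real (card (node D ` ?I)) \<le> overlap"
    unfolding overlap_def
    by (rule nodes_in_ball_bound[OF mesh(1,2) \<sigma> mesh(7) k, of _ x]) (auto simp: node_in dist_commute)
  ultimately show ?thesis by simp
qed

lemma frontier_negligible: "negligible \<Gamma>"
  by (rule negligible_mesh_of_lower_dimension[OF mesh(8)]) simp

lemma homothetic_ball:
  fixes x y0 z :: 'a
  assumes s: "0 < s" and z: "z \<in> cball (x + s *\<^sub>R (y0 - x)) (s * r)"
  obtains y where "y \<in> cball y0 r" "z = x + s *\<^sub>R (y - x)"
proof -
  define y where "y = x + (1 / s) *\<^sub>R (z - x)"
  have "y - x = (1 / s) *\<^sub>R (z - x)" by (simp add: y_def)
  then have "z = x + s *\<^sub>R (y - x)" using s by simp
  moreover have "y0 - y = (1 / s) *\<^sub>R ((x + s *\<^sub>R (y0 - x)) - z)"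
    using s by (simp add: y_def algebra_simps)
  then have "dist y0 y = (1 / s) * dist (x + s *\<^sub>R (y0 - x)) z" using s by (simp add: dist_norm)
  then have "s * dist y0 y \<le> s * r" using z s by simp
  then have "dist y0 y \<le> r" using s by simp
  ultimately show ?thesis using that by simp
qed

text \<open>Around each node there is a ball of radius \<open>s \<sigma> h\<close> where the function keeps half of the nodal value: the
  inscribed ball of an element is shrunk to the homothetic copy on which the polynomial is large.\<close>

lemma mass_u_lower:
  assumes s: "copy_ratio TYPE('a) k s"
  shows "ball_vol * (s * \<sigma> * h) ^ DIM('a) * (\<Sum>i<dim_u D. (a i)\<^sup>2 / 4) \<le> overlap * bform (dim_u D) (dim_u D) (mass_u \<Omega> D) a a"
proof -
  have s0: "0 < s" "s \<le> 1" using s by (auto simp: copy_ratio_def)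
  have "\<exists>c. ball c (s * \<sigma> * h) \<subseteq> cball (node D i) h \<inter> closure \<Omega> \<and> (\<forall>x\<in>ball c (s * \<sigma> * h). \<bar>a i\<bar> \<le> 2 * \<bar>bulk_fun a x\<bar>)"
    if i: "i < dim_u D" for i
  proof -
    obtain T where T: "T \<in> \<T>" "node D i \<in> T" by (rule node_element[OF i])
    obtain P where P: "P \<in> polynomials_le k" "\<And>x. x \<in> T \<Longrightarrow> bulk_fun a x = P x" by (rule bulk_fun_polynomial[OF T(1), of a]) (rule that)
    obtain x where x: "x \<in> T" "\<And>y. y \<in> T \<Longrightarrow> x + s *\<^sub>R (y - x) \<in> T"
        "\<And>y. y \<in> T \<Longrightarrow> \<bar>P (node D i)\<bar> \<le> 2 * \<bar>P (x + s *\<^sub>R (y - x))\<bar>"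
      by (rule copy_ratioE[OF s P(1) compact_element[OF T(1)] convex_element[OF T(1)] T(2)]) (rule that)
    obtain y0 where y0: "cball y0 (\<sigma> * h) \<subseteq> T" using mesh(2) T by (auto simp: quasi_uniform_def)
    have "z \<in> T \<and> \<bar>a i\<bar> \<le> 2 * \<bar>bulk_fun a z\<bar>" if z: "z \<in> ball (x + s *\<^sub>R (y0 - x)) (s * \<sigma> * h)" for z
    proof -
      have "z \<in> cball (x + s *\<^sub>R (y0 - x)) (s * (\<sigma> * h))" using z by (auto simp: mult.assoc)
      then obtain y where y: "y \<in> cball y0 (\<sigma> * h)" "z = x + s *\<^sub>R (y - x)" by (rule homothetic_ball[OF s0(1)])
      then have yT: "y \<in> T" using y0 by blast
      have "z \<in> T" using x(2)[OF yT] y(2) by simp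
      moreover have "\<bar>a i\<bar> = \<bar>P (node D i)\<bar>" using bulk_fun_at_node[OF i, of a] P(2)[OF T(2)] by simp
      ultimately show ?thesis using x(3)[OF yT] P(2)[of z] y(2) by simp
    qed
    then have "ball (x + s *\<^sub>R (y0 - x)) (s * \<sigma> * h) \<subseteq> T" "\<forall>z\<in>ball (x + s *\<^sub>R (y0 - x)) (s * \<sigma> * h). \<bar>a i\<bar> \<le> 2 * \<bar>bulk_fun a z\<bar>"
      by blast+
    moreover have "T \<subseteq> cball (node D i) h" "T \<subseteq> closure \<Omega>" using volume_bounds(2)[OF T] mesh(6) T(1) by auto
    ultimately show ?thesis by blast
  qed
  then have "\<forall>i\<in>{..<dim_u D}. \<exists>c. ball c (s * \<sigma> * h) \<subseteq> cball (node D i) h \<inter> closure \<Omega> \<and> (\<forall>x\<in>ball c (s * \<sigma> * h). \<bar>a i\<bar> \<le> 2 * \<bar>bulk_fun a x\<bar>)"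
    by blast
  then obtain c where c: "\<forall>i\<in>{..<dim_u D}. ball (c i) (s * \<sigma> * h) \<subseteq> cball (node D i) h \<inter> closure \<Omega> \<and> (\<forall>x\<in>ball (c i) (s * \<sigma> * h). \<bar>a i\<bar> \<le> 2 * \<bar>bulk_fun a x\<bar>)"
    unfolding bchoice_iff by blast
  let ?A = "\<lambda>i. ball (c i) (s * \<sigma> * h) \<inter> \<Omega>"
  show ?thesis unfolding mass_u_form(1)
  proof (rule sum_local_lower_bounds[where A = ?A])
    show "integrable dx (\<lambda>x. bulk_fun a x * bulk_fun a x)" by (rule mass_u_form(2))
    show "emeasure dx (space dx) < \<infinity>" by (rule Omega_measure(2))
    fix i assume i: "i \<in> {..<dim_u D}"
    show "?A i \<in> sets dx"
      using Omega_measure(1) by (auto simp: sets_restrict_space_iff intro!: sets.Int lborelD borel_open)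
    have "measure dx (?A i) = measure lebesgue (?A i)"
      using Omega_measure(1) by (intro measure_restrict_space) auto
    also have "\<dots> = measure lebesgue (ball (c i) (s * \<sigma> * h))"
    proof (rule measure_negligible_symdiff)
      have "?A i - ball (c i) (s * \<sigma> * h) \<union> (ball (c i) (s * \<sigma> * h) - ?A i) \<subseteq> \<Gamma>"
        using c i \<Omega>(1) by (auto simp: frontier_def interior_open)
      then show "negligible (sym_diff (ball (c i) (s * \<sigma> * h)) (?A i))"
        using negligible_subset[OF frontier_negligible] by (simp add: Un_commute)
    qed simp
    also have "\<dots> = ball_vol * (s * \<sigma> * h) ^ DIM('a)"
      using s0 \<sigma> volume_bounds(1) by (simp add: content_ball ball_vol_def)
    finally show "ball_vol * (s * \<sigma> * h) ^ DIM('a) \<le> measure dx (?A i)" by simp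
    fix x assume "x \<in> ?A i"
    then have "\<bar>a i\<bar> \<le> 2 * \<bar>bulk_fun a x\<bar>" using c i by blast
    then have "\<bar>a i\<bar> \<le> \<bar>2 * bulk_fun a x\<bar>" by (simp add: abs_mult)
    then have "(a i)\<^sup>2 \<le> (2 * bulk_fun a x)\<^sup>2" by (simp add: abs_le_square_iff)
    then show "(a i)\<^sup>2 / 4 \<le> bulk_fun a x * bulk_fun a x" by (simp add: power2_eq_square)
  next
    fix x
    have "{i \<in> {..<dim_u D}. x \<in> ?A i} \<subseteq> {i. i < dim_u D \<and> x \<in> cball (node D i) h}" using c by blast
    then have "real (card {i \<in> {..<dim_u D}. x \<in> ?A i}) \<le> real (card {i. i < dim_u D \<and> x \<in> cball (node D i) h})"
      by (intro of_nat_mono card_mono) auto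
    then show "real (card {i \<in> {..<dim_u D}. x \<in> ?A i}) \<le> overlap" using overlap_bound[of x] by linarith
  qed auto
qed

subsection \<open>Surface matrices\<close>

lemmas surface = surface_measure_facts[OF d2 mesh(8)]

text \<open>Extension of boundary values by zero to the interior nodes.\<close>

definition boundary_ext :: "(nat \<Rightarrow> real) \<Rightarrow> nat \<Rightarrow> real" where
  "boundary_ext c j = (if j < bulk_nodes then 0 else c (j - bulk_nodes))"

definition surf_fun :: "(nat \<Rightarrow> real) \<Rightarrow> 'a \<Rightarrow> real" where
  "surf_fun c x = (\<Sum>i<dim_l D. c i * basis_l D i x)"

definition surf_fun_p :: "(nat \<Rightarrow> real) \<Rightarrow> 'a \<Rightarrow> real" where
  "surf_fun_p b x = (\<Sum>j<dim_p D. b j * basis_p D j x)"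

lemma sum_boundary_ext: "(\<Sum>j<dim_u D. f (boundary_ext c j) j) = (\<Sum>j<bulk_nodes. f 0 j) + (\<Sum>i<dim_l D. f (c i) (bulk_nodes + i))"
proof -
  have "{..<dim_u D} = {..<bulk_nodes} \<union> {bulk_nodes..<bulk_nodes + dim_l D}" using mesh(9) by auto
  then have "(\<Sum>j<dim_u D. f (boundary_ext c j) j) = (\<Sum>j<bulk_nodes. f (boundary_ext c j) j) + (\<Sum>j\<in>{bulk_nodes..<bulk_nodes + dim_l D}. f (boundary_ext c j) j)"
    using sum.union_disjoint[of "{..<bulk_nodes}" "{bulk_nodes..<bulk_nodes + dim_l D}" "\<lambda>j. f (boundary_ext c j) j"] by fastforce
  also have "(\<Sum>j<bulk_nodes. f (boundary_ext c j) j) = (\<Sum>j<bulk_nodes. f 0 j)"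
    by (intro sum.cong) (auto simp: boundary_ext_def)
  also have "(\<Sum>j\<in>{bulk_nodes..<bulk_nodes + dim_l D}. f (boundary_ext c j) j) = (\<Sum>i<dim_l D. f (c i) (bulk_nodes + i))"
    by (rule sum.reindex_bij_witness[where i = "\<lambda>i. bulk_nodes + i" and j = "\<lambda>j. j - bulk_nodes"]) (auto simp: boundary_ext_def)
  finally show ?thesis .
qed

lemma bulk_fun_boundary_ext: "bulk_fun (boundary_ext c) x = surf_fun c x"
  unfolding bulk_fun_def surf_fun_def basis_l_def
  using sum_boundary_ext[of "\<lambda>a j. a * basis_u D j x" c] by simp

lemma basis_l_continuous: "i < dim_l D \<Longrightarrow> continuous_on \<Gamma> (basis_l D i)"
  unfolding basis_l_def using mesh(9)
  by (intro continuous_on_subset[OF basis_u_continuous]) (auto simp: frontier_def)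

lemma basis_p_pw_poly: "j < dim_p D \<Longrightarrow> basis_p D j \<in> pw_poly q (mesh_surf D)"
  using fe by (auto simp: fe_discretization_def)

lemma surf_mesh: "finite (mesh_surf D)" "\<Union>(mesh_surf D) = \<Gamma>" "\<And>S. S \<in> mesh_surf D \<Longrightarrow> compact S" "\<And>S. S \<in> mesh_surf D \<Longrightarrow> convex S"
proof -
  have m: "triangulation (mesh_surf D)" "\<And>S. S \<in> mesh_surf D \<Longrightarrow> (int DIM('a) - 1) simplex S" "\<Union>(mesh_surf D) = \<Gamma>"
    using mesh(8) by (auto simp: mesh_of_def)
  show "finite (mesh_surf D)" using m(1) by (simp add: triangulation_def)
  show "\<Union>(mesh_surf D) = \<Gamma>" by (rule m(3))
  show "compact S" "convex S" if "S \<in> mesh_surf D" for S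
    using m(2)[OF that] compact_simplex convex_simplex by blast+
qed

lemma basis_p_continuous: "j < dim_p D \<Longrightarrow> continuous_on \<Gamma> (basis_p D j)"
  using basis_p_pw_poly[of j] surf_mesh(2) by (auto simp: pw_poly_def)

lemma continuous_family_bounded:
  fixes f :: "nat \<Rightarrow> 'a \<Rightarrow> real"
  assumes "\<And>i. i < n \<Longrightarrow> continuous_on \<Gamma> (f i)"
  obtains B where "\<And>i x. i < n \<Longrightarrow> x \<in> \<Gamma> \<Longrightarrow> \<bar>f i x\<bar> \<le> B"
proof -
  have "bounded (\<Union>i\<in>{..<n}. f i ` \<Gamma>)"
    using assms surface(1) by (intro bounded_UN ballI compact_imp_bounded[OF compact_continuous_image]) auto
  then obtain B where "\<forall>y\<in>(\<Union>i\<in>{..<n}. f i ` \<Gamma>). norm y \<le> B" using bounded_iff by metis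
  then show ?thesis using that[of B] by auto
qed

lemma surface_gram:
  fixes \<psi> \<psi>' :: "nat \<Rightarrow> 'a \<Rightarrow> real"
  assumes \<psi>: "\<And>i. i < n \<Longrightarrow> continuous_on \<Gamma> (\<psi> i)" and \<psi>': "\<And>i. i < n' \<Longrightarrow> continuous_on \<Gamma> (\<psi>' i)"
  shows "(\<Sum>i<n. \<Sum>j<n'. a i * (LINT x|dS. \<psi>' j x * \<psi> i x) * b j)
      = (LINT x|dS. (\<Sum>i<n. a i * \<psi> i x) * (\<Sum>j<n'. b j * \<psi>' j x))"
    and "integrable dS (\<lambda>x. (\<Sum>i<n. a i * \<psi> i x) * (\<Sum>j<n'. b j * \<psi>' j x))"
proof -
  obtain B where B: "\<And>i x. i < n \<Longrightarrow> x \<in> \<Gamma> \<Longrightarrow> \<bar>\<psi> i x\<bar> \<le> B" using continuous_family_bounded[of n \<psi>] \<psi> by metis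
  obtain B' where B': "\<And>i x. i < n' \<Longrightarrow> x \<in> \<Gamma> \<Longrightarrow> \<bar>\<psi>' i x\<bar> \<le> B'" using continuous_family_bounded[of n' \<psi>'] \<psi>' by metis
  have m: "\<psi> i \<in> borel_measurable dS" if "i < n" for i
    using surface_measure_continuous_measurable[OF surface(1) \<psi>[OF that]] .
  have m': "\<psi>' i \<in> borel_measurable dS" if "i < n'" for i
    using surface_measure_continuous_measurable[OF surface(1) \<psi>'[OF that]] .
  have bd: "AE x in dS. norm (\<psi> i x) \<le> max B B'" if "i < n" for i
    using B[OF that] by (intro AE_I2) (auto simp: surface(2) le_max_iff_disj)
  have bd': "AE x in dS. norm (\<psi>' i x) \<le> max B B'" if "i < n'" for i
    using B'[OF that] by (intro AE_I2) (auto simp: surface(2) le_max_iff_disj)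
  note g = gram_sum[OF surface(3), where w = "\<lambda>_. 1" and W = 1 and \<psi> = \<psi> and \<psi>' = \<psi>'
      and n = n and n' = n' and B = "max B B'", OF _ _ m bd m' bd']
  show "(\<Sum>i<n. \<Sum>j<n'. a i * (LINT x|dS. \<psi>' j x * \<psi> i x) * b j)
      = (LINT x|dS. (\<Sum>i<n. a i * \<psi> i x) * (\<Sum>j<n'. b j * \<psi>' j x))"
    using g(1)[of a b] by simp
  show "integrable dS (\<lambda>x. (\<Sum>i<n. a i * \<psi> i x) * (\<Sum>j<n'. b j * \<psi>' j x))"
    using g(2)[of a b] by simp
qed

lemma mass_l_form:
  "bform (dim_l D) (dim_l D) (mass_l \<Omega> D) a b = (LINT x|dS. surf_fun a x * surf_fun b x)"
  "integrable dS (\<lambda>x. surf_fun a x * surf_fun b x)"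
  using surface_gram[where n = "dim_l D" and n' = "dim_l D" and a = a and b = b and \<psi> = "basis_l D" and \<psi>' = "basis_l D"] basis_l_continuous
  by (simp_all add: bform_def mass_l_def surf_fun_def)

lemma mass_p_form:
  "bform (dim_p D) (dim_p D) (mass_p \<Omega> D) a b = (LINT x|dS. surf_fun_p a x * surf_fun_p b x)"
  "integrable dS (\<lambda>x. surf_fun_p a x * surf_fun_p b x)"
  using surface_gram[where n = "dim_p D" and n' = "dim_p D" and a = a and b = b and \<psi> = "basis_p D" and \<psi>' = "basis_p D"] basis_p_continuous
  by (simp_all add: bform_def mass_p_def surf_fun_p_def)

lemma coupling_p_form:
  "bform (dim_l D) (dim_p D) (coupling_p \<Omega> D) a b = (LINT x|dS. surf_fun a x * surf_fun_p b x)"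
  "integrable dS (\<lambda>x. surf_fun a x * surf_fun_p b x)"
  using surface_gram[where n = "dim_l D" and n' = "dim_p D" and a = a and b = b and \<psi> = "basis_l D" and \<psi>' = "basis_p D"] basis_l_continuous basis_p_continuous
  by (simp_all add: bform_def coupling_p_def surf_fun_def surf_fun_p_def)

lemma coupling_u_entries:
  assumes "i < dim_l D" "j < dim_u D"
  shows "coupling_u \<Omega> D $$ (i, j) = (if j < bulk_nodes then 0 else mass_l \<Omega> D $$ (i, j - bulk_nodes))"
proof (cases "j < bulk_nodes")
  case True
  have "(LINT x|dS. basis_u D j x * basis_l D i x) = (LINT x|dS. 0)"
    using basis_u_zero_on_frontier[OF True] by (intro Bochner_Integration.integral_cong) (auto simp: surface(2))
  then show ?thesis using assms True by (simp add: coupling_u_def)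
next
  case False
  then show ?thesis using assms mesh(9) by (simp add: coupling_u_def mass_l_def basis_l_def)
qed

lemma stiff_p_form:
  assumes \<kappa>: "\<kappa> \<in> borel_measurable dS" "AE x in dS. 0 \<le> \<kappa> x \<and> \<kappa> x \<le> a1"
  shows "bform (dim_p D) (dim_p D) (stiff_p \<Omega> \<kappa> D) a b
      = (LINT x|dS. \<kappa> x * inner (\<Sum>i<dim_p D. a i *\<^sub>R surface_grad \<Gamma> (basis_p D i) x) (\<Sum>i<dim_p D. b i *\<^sub>R surface_grad \<Gamma> (basis_p D i) x))"
proof -
  have "\<forall>i\<in>{..<dim_p D}. \<exists>C. surface_grad \<Gamma> (basis_p D i) \<in> borel_measurable dS \<and>
      (\<forall>x\<in>\<Gamma>. norm (surface_grad \<Gamma> (basis_p D i) x) \<le> C)"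
  proof
    fix i assume i: "i \<in> {..<dim_p D}"
    obtain g C where g: "g \<in> borel_measurable borel" "\<And>x. norm (g x) \<le> C" "\<And>x. x \<in> \<Union>(mesh_surf D) \<Longrightarrow> surface_grad (\<Union>(mesh_surf D)) (basis_p D i) x = g x"
      by (rule surface_grad_measurable_bounded[OF surf_mesh(1), of "basis_p D i" q]) (use surf_mesh(3,4) basis_p_pw_poly i in auto)
    have "surface_grad \<Gamma> (basis_p D i) \<in> borel_measurable dS \<longleftrightarrow> g \<in> borel_measurable dS"
      using g(3) unfolding surf_mesh(2) by (intro measurable_cong) (auto simp: surface(2))
    then show "\<exists>C. surface_grad \<Gamma> (basis_p D i) \<in> borel_measurable dS \<and>
      (\<forall>x\<in>\<Gamma>. norm (surface_grad \<Gamma> (basis_p D i) x) \<le> C)"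
      using surface(5)[OF g(1)] g(2,3) unfolding surf_mesh(2) by auto
  qed
  then obtain C where C: "\<forall>i\<in>{..<dim_p D}. surface_grad \<Gamma> (basis_p D i) \<in> borel_measurable dS \<and>
      (\<forall>x\<in>\<Gamma>. norm (surface_grad \<Gamma> (basis_p D i) x) \<le> C i)"
    unfolding bchoice_iff by blast
  define B where "B = (\<Sum>i<dim_p D. \<bar>C i\<bar>)"
  have "\<bar>C i\<bar> \<le> B" if "i < dim_p D" for i
    unfolding B_def using that by (intro member_le_sum[of i "{..<dim_p D}" "\<lambda>i. \<bar>C i\<bar>"]) auto
  note CB = this
  have bd: "AE x in dS. norm (surface_grad \<Gamma> (basis_p D i) x) \<le> B" if "i < dim_p D" for i
  proof (rule AE_I2)
    fix x assume "x \<in> space dS"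
    then have "norm (surface_grad \<Gamma> (basis_p D i) x) \<le> C i" using C that by (simp add: surface(2))
    then show "norm (surface_grad \<Gamma> (basis_p D i) x) \<le> B" using CB[OF that] by linarith
  qed
  have m: "surface_grad \<Gamma> (basis_p D i) \<in> borel_measurable dS" if "i < dim_p D" for i
    using C that by auto
  note g = gram_sum[OF surface(3) \<kappa>, where \<psi> = "\<lambda>i. surface_grad \<Gamma> (basis_p D i)" and \<psi>' = "\<lambda>i. surface_grad \<Gamma> (basis_p D i)"
      and n = "dim_p D" and n' = "dim_p D" and B = B, OF m bd m bd]
  show ?thesis using g(1)[of a b] by (simp add: bform_def stiff_p_def)
qed

text \<open>As for the bulk mass, with the copy of a boundary facet instead of an inscribed ball.  Its surface measure is
  bounded below because the cone over it with the opposite vertex is a copy of the element.\<close>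

lemma mass_l_lower:
  assumes s: "copy_ratio TYPE('a) k s" and K: "cone_constant TYPE('a) K"
  shows "ball_vol * (s * \<sigma> * h) ^ DIM('a) / (K * h) * (\<Sum>i<dim_l D. (c i)\<^sup>2 / 4) \<le> overlap * bform (dim_l D) (dim_l D) (mass_l \<Omega> D) c c"
proof -
  have s0: "0 < s" "s \<le> 1" using s by (auto simp: copy_ratio_def)
  have K0: "0 < K" using K by (simp add: cone_constant_def)
  have h0: "0 < h" by (rule volume_bounds(1))
  let ?\<beta> = "ball_vol * (s * \<sigma> * h) ^ DIM('a) / (K * h)"
  let ?a = "boundary_ext c"
  let ?n = "\<lambda>i. bulk_nodes + i"
  have ai: "?a (?n i) = c i" for i by (simp add: boundary_ext_def)
  have "\<exists>A. compact A \<and> A \<subseteq> cball (node D (?n i)) h \<inter> \<Gamma> \<and> (\<forall>x\<in>A. \<bar>c i\<bar> \<le> 2 * \<bar>surf_fun c x\<bar>) \<and>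
      ?\<beta> \<le> measure dS A"
    if i: "i < dim_l D" for i
  proof -
    have iu: "?n i < dim_u D" using i mesh(9) by simp
    have "node D (?n i) \<in> \<Gamma>" using fe iu by (auto simp: fe_discretization_def)
    then obtain T F where T: "T \<in> \<T>" "F facet_of T" "F \<subseteq> \<Gamma>" "node D (?n i) \<in> F" by (rule frontier_facet)
    have FT: "F \<subseteq> T" using T(2) by (simp add: facet_of_imp_subset)
    obtain V p where V: "finite V" "T = convex hull V" "p \<in> V" "F = convex hull (V - {p})"
      by (rule facet_of_simplex[OF mesh(5)[OF T(1)] T(2)])
    have Fc: "compact F" "convex F" using V by (auto simp: finite_imp_compact_convex_hull)
    obtain P where P: "P \<in> polynomials_le k" "\<And>x. x \<in> T \<Longrightarrow> bulk_fun ?a x = P x" by (rule bulk_fun_polynomial[OF T(1), of ?a]) (rule that)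
    obtain x where x: "x \<in> F" "\<And>y. y \<in> F \<Longrightarrow> x + s *\<^sub>R (y - x) \<in> F"
        "\<And>y. y \<in> F \<Longrightarrow> \<bar>P (node D (?n i))\<bar> \<le> 2 * \<bar>P (x + s *\<^sub>R (y - x))\<bar>"
      by (rule copy_ratioE[OF s P(1) Fc T(4)]) (rule that)
    define A where "A = (\<lambda>y. x + s *\<^sub>R (y - x)) ` F"
    have Ac: "compact A" unfolding A_def by (intro compact_continuous_image Fc continuous_intros)
    have AF: "A \<subseteq> F" using x(2) by (auto simp: A_def)
    have large: "\<bar>c i\<bar> \<le> 2 * \<bar>surf_fun c z\<bar>" if "z \<in> A" for z
    proof -
      obtain y where y: "y \<in> F" "z = x + s *\<^sub>R (y - x)" using \<open>z \<in> A\<close> unfolding A_def by blast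
      have zT: "z \<in> T" using \<open>z \<in> A\<close> AF FT by blast
      have "\<bar>c i\<bar> = \<bar>P (node D (?n i))\<bar>"
        using bulk_fun_at_node[OF iu, of ?a] P(2)[of "node D (?n i)"] T(4) FT ai by auto
      also have "\<dots> \<le> 2 * \<bar>P z\<bar>" unfolding y(2) by (rule x(3)[OF y(1)])
      also have "P z = surf_fun c z" using P(2)[OF zT] bulk_fun_boundary_ext by simp
      finally show ?thesis .
    qed
    obtain y0 where y0: "cball y0 (\<sigma> * h) \<subseteq> T" using mesh(2) T(1) by (auto simp: quasi_uniform_def)
    let ?S = "cball (x + s *\<^sub>R (y0 - x)) (s * (\<sigma> * h))" and ?p = "x + s *\<^sub>R (p - x)"
    have pT: "p \<in> T" using V(2,3) by (simp add: hull_inc)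
    have "dist ?p z \<le> h" if "z \<in> A" for z
    proof -
      obtain y where y: "y \<in> F" "z = x + s *\<^sub>R (y - x)" using \<open>z \<in> A\<close> unfolding A_def by blast
      have "?p - z = s *\<^sub>R (p - y)" by (simp add: y algebra_simps)
      then have "dist ?p z = s * dist p y" using s0 by (simp add: dist_norm)
      also have "\<dots> \<le> 1 * h" using s0 volume_bounds(2)[OF T(1) pT, of y] y(1) FT by (intro mult_mono) auto
      finally show ?thesis by simp
    qed
    moreover have "?S \<subseteq> (\<Union>y\<in>A. closed_segment y ?p)"
    proof
      fix z assume "z \<in> ?S"
      then obtain y where y: "y \<in> cball y0 (\<sigma> * h)" "z = x + s *\<^sub>R (y - x)" by (rule homothetic_ball[OF s0(1)])
      then have "y \<in> convex hull (insert p (V - {p}))" using y0 V(2,3) by (auto simp: insert_absorb)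
      moreover have "V - {p} \<noteq> {}" using x(1) unfolding V(4) by (intro notI) simp
      ultimately obtain u w f where uw: "0 \<le> u" "0 \<le> w" "u + w = 1" "f \<in> F" "y = u *\<^sub>R p + w *\<^sub>R f"
        unfolding V(4) by (subst (asm) convex_hull_insert) auto
      have w: "w = 1 - u" using uw(3) by simp
      have "z = (1 - u) *\<^sub>R (x + s *\<^sub>R (f - x)) + u *\<^sub>R ?p"
        unfolding y(2) uw(5) w by (simp add: algebra_simps)
      then have "z \<in> closed_segment (x + s *\<^sub>R (f - x)) ?p" using uw w by (auto simp: in_segment)
      then show "z \<in> (\<Union>y\<in>A. closed_segment y ?p)" using uw(4) by (auto simp: A_def)
    qed
    ultimately have "emeasure lborel ?S \<le> ennreal (K * h) * hausdorff_outer (DIM('a) - 1) A"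
      using conjunct2[OF K[unfolded cone_constant_def], THEN spec, of A, THEN spec, of ?p, THEN spec, of h, THEN spec, of ?S] h0
      by (simp add: borel_closed)
    moreover have eA: "emeasure dS A = hausdorff_outer (DIM('a) - 1) A"
      using surface(4)[of A] AF T(3) Ac by (auto simp: borel_compact)
    moreover have "emeasure dS A = ennreal (measure dS A)"
    proof (rule emeasure_eq_ennreal_measure)
      have "emeasure dS A \<le> emeasure dS (space dS)"
        by (rule emeasure_space)
      then show "emeasure dS A \<noteq> top_class.top" using surface(3) by auto
    qed
    moreover have "emeasure lborel ?S = ennreal (ball_vol * (s * \<sigma> * h) ^ DIM('a))"
      using s0 \<sigma> h0 by (simp add: emeasure_cball ball_vol_def mult.assoc)
    ultimately have "ennreal (ball_vol * (s * \<sigma> * h) ^ DIM('a)) \<le> ennreal (K * h) * ennreal (measure dS A)"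
      by simp
    also have "\<dots> = ennreal (K * h * measure dS A)" using K0 h0 by (simp add: ennreal_mult)
    finally have "ball_vol * (s * \<sigma> * h) ^ DIM('a) \<le> K * h * measure dS A"
      using K0 h0 by (simp add: ennreal_le_iff)
    then have "?\<beta> \<le> measure dS A" using K0 h0 by (simp add: divide_le_eq mult.commute)
    moreover have "A \<subseteq> cball (node D (?n i)) h"
    proof
      fix z assume "z \<in> A"
      then show "z \<in> cball (node D (?n i)) h"
        using AF FT volume_bounds(2)[OF T(1), of "node D (?n i)" z] T(4) unfolding mem_cball by blast
    qed
    ultimately show ?thesis using Ac AF T(3) large by blast
  qed
  then have "\<forall>i\<in>{..<dim_l D}. \<exists>A. compact A \<and> A \<subseteq> cball (node D (?n i)) h \<inter> \<Gamma> \<and> (\<forall>x\<in>A. \<bar>c i\<bar> \<le> 2 * \<bar>surf_fun c x\<bar>) \<and>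
      ?\<beta> \<le> measure dS A" by blast
  then obtain A where A: "\<forall>i\<in>{..<dim_l D}. compact (A i) \<and> A i \<subseteq> cball (node D (?n i)) h \<inter> \<Gamma> \<and> (\<forall>x\<in>A i. \<bar>c i\<bar> \<le> 2 * \<bar>surf_fun c x\<bar>) \<and>
      ?\<beta> \<le> measure dS (A i)" unfolding bchoice_iff by blast
  show ?thesis unfolding mass_l_form(1)
  proof (rule sum_local_lower_bounds[where A = A])
    show "integrable dS (\<lambda>x. surf_fun c x * surf_fun c x)" by (rule mass_l_form(2))
    show "emeasure dS (space dS) < \<infinity>" by (rule surface(3))
    fix i assume i: "i \<in> {..<dim_l D}"
    show "A i \<in> sets dS" using A i surface(4)[of "A i"] by (auto simp: borel_compact)
    show "?\<beta> \<le> measure dS (A i)" using A i by blast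
    fix x assume "x \<in> A i"
    then have "\<bar>c i\<bar> \<le> 2 * \<bar>surf_fun c x\<bar>" using A i by blast
    then have "\<bar>c i\<bar> \<le> \<bar>2 * surf_fun c x\<bar>" by (simp add: abs_mult)
    then have "(c i)\<^sup>2 \<le> (2 * surf_fun c x)\<^sup>2" by (simp add: abs_le_square_iff)
    then show "(c i)\<^sup>2 / 4 \<le> surf_fun c x * surf_fun c x" by (simp add: power2_eq_square)
  next
    fix x
    have "card {i \<in> {..<dim_l D}. x \<in> A i} \<le> card {i. i < dim_u D \<and> x \<in> cball (node D i) h}"
    proof (rule card_inj_on_le[where f = ?n])
      show "inj_on ?n {i \<in> {..<dim_l D}. x \<in> A i}" by (rule inj_onI) simp
      show "?n ` {i \<in> {..<dim_l D}. x \<in> A i} \<subseteq> {i. i < dim_u D \<and> x \<in> cball (node D i) h}"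
      proof (rule image_subsetI)
        fix i assume i: "i \<in> {i \<in> {..<dim_l D}. x \<in> A i}"
        then have "A i \<subseteq> cball (node D (?n i)) h" using A by blast
        then have "x \<in> cball (node D (?n i)) h" using i by blast
        moreover have "i < dim_l D" using i by simp
        then have "?n i < dim_u D" using mesh(9) by arith
        ultimately show "?n i \<in> {i. i < dim_u D \<and> x \<in> cball (node D i) h}" by blast
      qed
    qed simp
    then show "real (card {i \<in> {..<dim_l D}. x \<in> A i}) \<le> overlap" using overlap_bound[of x] by linarith
  qed auto
qed

end

section \<open>Error of the splitting scheme\<close>

definition prod_form :: "('v::real_vector \<Rightarrow> 'v \<Rightarrow> real) \<Rightarrow> ('q::real_vector \<Rightarrow> 'q \<Rightarrow> real) \<Rightarrow> 'v \<times> 'q \<Rightarrow> 'v \<times> 'q \<Rightarrow> real" where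
  "prod_form m m' x y = m (fst x) (fst y) + m' (snd x) (snd y)"

lemma semi_inner_prod_form:
  assumes "semi_inner m" "semi_inner m'" shows "semi_inner (prod_form m m')"
  unfolding semi_inner_def bilinear_def prod_form_def
  using semi_inner_simps[OF assms(1)] semi_inner_simps[OF assms(2)]
    semi_inner_commute[OF assms(1)] semi_inner_commute[OF assms(2)]
    semi_inner_nonneg[OF assms(1)] semi_inner_nonneg[OF assms(2)]
  by (auto intro!: linearI add_nonneg_nonneg simp: algebra_simps)

lemma scaleR_small:
  fixes x :: "'z::real_vector"
  shows "2 *\<^sub>R x = x + x" "3 *\<^sub>R x = x + x + x" "4 *\<^sub>R x = x + x + x + x"
    "9 *\<^sub>R x = x + x + x + x + x + x + x + x + x"
  using scaleR_left.add[of 1 1 x] scaleR_left.add[of 1 2 x] scaleR_left.add[of 1 3 x] scaleR_left.add[of 3 6 x]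
    scaleR_left.add[of 3 3 x] by simp_all

context
  fixes m :: "'z::real_vector \<Rightarrow> 'z \<Rightarrow> real"
  assumes m: "semi_inner m"
begin

lemma semi_inner_scaleR_square: "nsq m (c *\<^sub>R x) = c\<^sup>2 * m x x"
  by (simp add: semi_inner_simps[OF m] power2_eq_square)

lemma semi_inner_minus_square: "m (- x) (- x) = m x x"
  by (simp add: semi_inner_simps[OF m])

lemma semi_inner_add4_le: "nsq m (a + b + c + d) \<le> 4 * (m a a + m b b + m c c + m d d)"
  using semi_inner_add_le[OF m, of "a + b" "c + d"] semi_inner_add_le[OF m, of a b] semi_inner_add_le[OF m, of c d]
  by (simp add: add.assoc)

lemma semi_inner_add5_le: "nsq m (a + b + c + d + e) \<le> 8 * (m a a + m b b + m c c + m d d + m e e)"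
  using semi_inner_add_le[OF m, of "a + b + c + d" e] semi_inner_add4_le[of a b c d] semi_inner_nonneg[OF m, of e]
  by simp

end

text \<open>The bulk and surface spaces enter only through the four forms, \<open>EP\<close> (projection to the boundary and
  extension by zero) and \<open>ER\<close> (boundary part of a bulk vector); \<open>ER v = EP q\<close> says that \<open>(v, q)\<close> is coupled.
  The hypotheses \<open>EPm\<close> and \<open>EPk\<close> express the smallness of \<open>h\<close> and \<open>\<tau> / h\<close>.\<close>

lemma splitting_error_bound:
  fixes mu ku :: "'v::real_vector \<Rightarrow> 'v \<Rightarrow> real" and mp kp :: "'q::real_vector \<Rightarrow> 'q \<Rightarrow> real"
    and EP :: "'q \<Rightarrow> 'v" and ER :: "'v \<Rightarrow> 'v" and u u' y :: "nat \<Rightarrow> 'v" and p p' z :: "nat \<Rightarrow> 'q"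
    and d2u d3u ru :: "nat \<Rightarrow> 'v" and d2p d3p rp :: "nat \<Rightarrow> 'q" and \<tau> C C0 G :: real and N :: nat
  defines "d2u \<equiv> \<lambda>n. u (n+2) - 2 *\<^sub>R u (n+1) + u n" and "d3u \<equiv> \<lambda>n. u (n+3) - 3 *\<^sub>R u (n+2) + 3 *\<^sub>R u (n+1) - u n"
    and "ru \<equiv> \<lambda>n. 3 *\<^sub>R u (n+2) - 4 *\<^sub>R u (n+1) + u n - (2 * \<tau>) *\<^sub>R u' (n+2)"
    and "d2p \<equiv> \<lambda>n. p (n+2) - 2 *\<^sub>R p (n+1) + p n" and "d3p \<equiv> \<lambda>n. p (n+3) - 3 *\<^sub>R p (n+2) + 3 *\<^sub>R p (n+1) - p n"
    and "rp \<equiv> \<lambda>n. 3 *\<^sub>R p (n+2) - 4 *\<^sub>R p (n+1) + p n - (2 * \<tau>) *\<^sub>R p' (n+2)"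
  assumes forms: "semi_inner mu" "semi_inner ku" "semi_inner mp" "semi_inner kp"
    and lin: "linear EP" "linear ER" and idem: "\<And>v. ER (ER v) = ER v" "\<And>q. ER (EP q) = EP q"
    and \<tau>: "0 < \<tau>" "\<tau> \<le> 1/16" and C: "0 \<le> C"
    and EPm: "\<And>q. mu (EP q) (EP q) \<le> 1/4000 * mp q q" and EPk: "\<And>q. \<tau> * ku (EP q) (EP q) \<le> 1/32 * mp q q"
    and ERm: "\<And>v. mu (ER v) (ER v) \<le> C * mu v v" and ERk: "\<And>v. \<tau>\<^sup>2 * ku (ER v) (ER v) \<le> C * mu v v"
    and exact_coupling: "\<And>n. n \<le> N \<Longrightarrow> ER (u n) = EP (p n)"
    and scheme_coupling: "\<And>n. n + 3 \<le> N \<Longrightarrow> ER (y (n+3)) = EP (2 *\<^sub>R z (n+2) - z (n+1))"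
    and scheme: "\<And>n v q. n + 3 \<le> N \<Longrightarrow> ER v = EP q \<Longrightarrow>
       mu (3 *\<^sub>R y (n+3) - 4 *\<^sub>R y (n+2) + y (n+1) - ER (3 *\<^sub>R y (n+3) - 4 *\<^sub>R y (n+2) + y (n+1))
           + EP (5 *\<^sub>R z (n+2) - 8 *\<^sub>R z (n+1) + 3 *\<^sub>R z n) - (2 * \<tau>) *\<^sub>R u' (n+3)) v
       + 2 * \<tau> * ku (y (n+3) - u (n+3)) v
       + mp (3 *\<^sub>R z (n+3) - 4 *\<^sub>R z (n+2) + z (n+1) - (2 * \<tau>) *\<^sub>R p' (n+3)) q
       + 2 * \<tau> * kp (z (n+3) - p (n+3)) q = 0"
    and init: "\<And>j. j \<le> 2 \<Longrightarrow> nsq mu (y j - u j) + \<tau> * nsq ku (y j - u j)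
        + nsq mp (z j - p j) + \<tau> * nsq kp (z j - p j) \<le> C0 * \<tau> ^ 5"
    and d2m: "\<And>n. n + 2 \<le> N \<Longrightarrow> nsq mu (d2u n) \<le> G * \<tau> ^ 4" "\<And>n. n + 2 \<le> N \<Longrightarrow> nsq mp (d2p n) \<le> G * \<tau> ^ 4"
    and d2k: "(\<Sum>n<N-1. nsq ku (d2u n)) \<le> G * \<tau> ^ 3"
    and bdf: "(\<Sum>n<N-1. mu (ru n) (ru n)) \<le> G * \<tau> ^ 5" "(\<Sum>n<N-1. mp (rp n) (rp n)) \<le> G * \<tau> ^ 5"
    and d3: "(\<Sum>n<N-2. nsq mu (d3u n)) \<le> G * \<tau> ^ 5" "(\<Sum>n<N-2. nsq mp (d3p n)) \<le> G * \<tau> ^ 5"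
    and G: "0 \<le> G"
  shows "nsq mu (y N - u N) + nsq mp (z N - p N)
      + \<tau> * (\<Sum>j=1..N. nsq ku (y j - u j) + nsq kp (z j - p j))
      \<le> (40000 * exp (4 * (real N * \<tau>)) * (100 + 40 * C) + 8) * (C0 + G) * \<tau> ^ 4"
proof -
  note [simp] = semi_inner_simps[OF forms(1)] semi_inner_simps[OF forms(2)] semi_inner_simps[OF forms(3)] semi_inner_simps[OF forms(4)]
    linear_add[OF lin(1)] linear_diff[OF lin(1)] linear_scale[OF lin(1)] linear_add[OF lin(2)] linear_diff[OF lin(2)] linear_scale[OF lin(2)]
    linear_0[OF lin(1)]
  note nn = semi_inner_nonneg[OF forms(1)] semi_inner_nonneg[OF forms(2)] semi_inner_nonneg[OF forms(3)] semi_inner_nonneg[OF forms(4)]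
  define e where "e n = y n - u n" for n
  define ep where "ep n = z n - p n" for n
  have init_e: "mu (e j) (e j) \<le> C0 * \<tau> ^ 5" "\<tau> * ku (e j) (e j) \<le> C0 * \<tau> ^ 5"
    "mp (ep j) (ep j) \<le> C0 * \<tau> ^ 5" "\<tau> * kp (ep j) (ep j) \<le> C0 * \<tau> ^ 5" if "j \<le> 2" for j
    using init[OF that] nn(1,2)[of "e j"] nn(3,4)[of "ep j"] \<tau>(1) mult_nonneg_nonneg[of \<tau> "ku (e j) (e j)"] mult_nonneg_nonneg[of \<tau> "kp (ep j) (ep j)"]
    unfolding e_def ep_def by linarith+
  have C0: "0 \<le> C0"
  proof -
    have "0 \<le> C0 * \<tau> ^ 5" using init_e(1)[of 0] nn(1)[of "e 0"] by linarith
    then show ?thesis using \<tau>(1) by (simp add: zero_le_mult_iff)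
  qed
  have pow: "C0 * \<tau> ^ 5 \<le> C0 * \<tau> ^ 4" using C0 \<tau> by (intro mult_left_mono power_decreasing) auto
  show ?thesis
  proof (cases "N \<le> 2")
    case True
    have "\<tau> * (\<Sum>j=1..N. ku (e j) (e j) + kp (ep j) (ep j)) \<le> (\<Sum>j=1..N. 2 * (C0 * \<tau> ^ 4))"
      unfolding sum_distrib_left
    proof (rule sum_mono)
      fix j assume "j \<in> {1..N}"
      then show "\<tau> * (ku (e j) (e j) + kp (ep j) (ep j)) \<le> 2 * (C0 * \<tau> ^ 4)"
        using init_e(2,4)[of j] True pow by (simp add: distrib_left)
    qed
    also have "\<dots> \<le> 4 * (C0 * \<tau> ^ 4)"
      using True C0 \<tau> by (simp add: mult_right_mono mult.assoc[symmetric])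
    finally have "mu (e N) (e N) + mp (ep N) (ep N) + \<tau> * (\<Sum>j=1..N. ku (e j) (e j) + kp (ep j) (ep j)) \<le> 8 * (C0 * \<tau> ^ 4)"
      using init_e(1,3)[OF True] pow mult_nonneg_nonneg[OF C0, of "\<tau> ^ 4"] by simp
    also have "\<dots> \<le> (40000 * exp (4 * (real N * \<tau>)) * (100 + 40 * C) + 8) * ((C0 + G) * \<tau> ^ 4)"
      using C0 G C \<tau> by (intro mult_mono mult_right_mono) auto
    finally show ?thesis by (simp add: e_def ep_def mult.assoc)
  next
    case False
    then have N: "3 \<le> N" by simp
    \<comment> \<open>with truncated subtraction, \<open>th\<close> is constant on the indices \<open>0, 1, 2\<close> that precede the first step\<close>
    define th where "th n = d2u (n - 2)" for n
    define thp where "thp n = d2p (n - 2)" for n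
    \<comment> \<open>The boundary part of the error is replaced by the projected surface error.  For the initial data this
      enforces the coupling; from step \<open>3\<close> on it only adds \<open>th n\<close> and \<open>EP (dd n)\<close>, by \<open>xu_late\<close>.\<close>
    define xu where "xu n = e n + - ER (e n) + th n + - EP (thp n) + EP (ep n)" for n
    define dd where "dd n = ep n - 2 *\<^sub>R ep (n-1) + ep (n-2)" for n
    define x where "x n = (xu n, ep n)" for n
    define s where "s n = (EP (dd n), 0 :: 'q)" for n
    define D3 where "D3 w n = 3 *\<^sub>R w (n+3) - 4 *\<^sub>R w (n+2) + w (n+1)" for w :: "nat \<Rightarrow> 'v" and n
    define D3' where "D3' w n = 3 *\<^sub>R w (n+3) - 4 *\<^sub>R w (n+2) + w (n+1)" for w :: "nat \<Rightarrow> 'q" and n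
    define R where "R n = - ru (n-2) + D3 th (n-3) + - EP (D3' thp (n-3)) + 3 *\<^sub>R EP (d3p (n-3))" for n
    define r where "r n = ((1 / (2 * \<tau>)) *\<^sub>R R n, - ((1 / (2 * \<tau>)) *\<^sub>R rp (n-2)))" for n
    define \<theta> where "\<theta> n = (th n, 0 :: 'q)" for n
    let ?m = "prod_form mu mp" and ?k = "prod_form ku kp"
    have th_coupling: "ER (th n) = EP (thp n)" if "n \<le> N" for n
    proof -
      have "n - 2 + 2 \<le> N" using that N by simp
      then show ?thesis
        using exact_coupling[of "n-2"] exact_coupling[of "n-2+1"] exact_coupling[of "n-2+2"]
        by (simp add: th_def thp_def d2u_def d2p_def)
    qed
    have x_coupled: "ER (xu n) = EP (ep n)" if "n \<le> N" for n
      using th_coupling[OF that] idem by (simp add: xu_def linear_neg[OF lin(2)])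
    have xu_late: "e n = xu n + - EP (dd n) + - th n" if n: "3 \<le> n" "n \<le> N" for n
    proof -
      obtain j where j: "n = j + 3" using n(1) by (metis le_add_diff_inverse2)
      have "ER (e n) = EP (2 *\<^sub>R z (n-1) - z (n-2)) - EP (p n)"
        using scheme_coupling[of j] exact_coupling[OF n(2)] n(2) by (simp add: e_def j numeral_3_eq_3 numeral_2_eq_2)
      also have "2 *\<^sub>R z (n-1) - z (n-2) = p n - thp n + ep n - dd n"
        by (simp add: dd_def ep_def thp_def d2p_def j numeral_3_eq_3 numeral_2_eq_2 algebra_simps)
      finally show ?thesis by (simp add: xu_def)
    qed
    have eq: "?m (3 *\<^sub>R x (n+3) - 4 *\<^sub>R x (n+2) + x (n+1)) (v, q) + 2 * \<tau> * ?k (x (n+3)) (v, q) =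
         3 * ?m (s (n+3) - s (n+2)) (v, q) + 2 * \<tau> * ?k (s (n+3)) (v, q) + 2 * \<tau> * ?m (r (n+3)) (v, q)
         + 2 * \<tau> * ?k (\<theta> (n+3)) (v, q)" if n: "n + 3 \<le> N" and vq: "ER v = EP q" for n v q
    proof -
      have c: "ER (u (n+3)) = EP (p (n+3))" "ER (u (n+2)) = EP (p (n+2))" "ER (u (n+1)) = EP (p (n+1))"
        using n by (auto intro!: exact_coupling)
      have "2 * \<tau> * mu (fst (r (n+3))) v = mu (R (n+3)) v" using \<tau>(1) by (simp add: r_def)
      moreover have "2 * \<tau> * mp (snd (r (n+3))) q = - mp (rp (n+1)) q" using \<tau>(1) by (simp add: r_def)
      moreover have "ku (y (n+3) - u (n+3)) v = ku (xu (n+3)) v - ku (EP (dd (n+3))) v - ku (th (n+3)) v"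
        using xu_late[of "n+3"] n by (simp add: e_def)
      moreover have "mu (3 *\<^sub>R y (n+3) - 4 *\<^sub>R y (n+2) + y (n+1) - ER (3 *\<^sub>R y (n+3) - 4 *\<^sub>R y (n+2) + y (n+1))
           + EP (5 *\<^sub>R z (n+2) - 8 *\<^sub>R z (n+1) + 3 *\<^sub>R z n) - (2 * \<tau>) *\<^sub>R u' (n+3)) v
          = mu (D3 xu n) v - 3 * mu (EP (dd (n+3)) - EP (dd (n+2))) v - mu (R (n+3)) v"
        unfolding D3_def R_def D3'_def xu_def dd_def e_def ep_def ru_def d3p_def
        using c by (simp add: numeral_3_eq_3 numeral_2_eq_2 algebra_simps)
      moreover have "mp (3 *\<^sub>R z (n+3) - 4 *\<^sub>R z (n+2) + z (n+1) - (2 * \<tau>) *\<^sub>R p' (n+3)) q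
          = mp (3 *\<^sub>R ep (n+3) - 4 *\<^sub>R ep (n+2) + ep (n+1)) q + mp (rp (n+1)) q"
        by (simp add: ep_def rp_def numeral_3_eq_3 numeral_2_eq_2 algebra_simps)
      moreover have tri: "(M1 + P1) + 2 * t * (K1 + kq) = 3 * M2 + 2 * t * K2 + 2 * t * (r1 + r2) + 2 * t * K3"
        if "A + 2 * t * B + B' + 2 * t * kq = 0" "2 * t * r1 = RR" "2 * t * r2 = - S" "B = K1 - K2 - K3" "A = M1 - 3 * M2 - RR" "B' = P1 + S"
        for M1 P1 t K1 kq M2 K2 r1 r2 K3 A B B' RR S :: real
      proof -
        have "2 * t * (r1 + r2) = RR - S" using that(2,3) by (simp add: distrib_left)
        then show ?thesis using that(1) unfolding that(4-6) by (simp add: algebra_simps)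
      qed
      moreover have "?m (3 *\<^sub>R x (n+3) - 4 *\<^sub>R x (n+2) + x (n+1)) (v, q) = mu (D3 xu n) v + mp (3 *\<^sub>R ep (n+3) - 4 *\<^sub>R ep (n+2) + ep (n+1)) q"
        by (simp add: prod_form_def x_def D3_def)
      moreover have "?k (x (n+3)) (v, q) = ku (xu (n+3)) v + kp (z (n+3) - p (n+3)) q" by (simp add: prod_form_def x_def ep_def)
      moreover have "?m (s (n+3) - s (n+2)) (v, q) = mu (EP (dd (n+3)) - EP (dd (n+2))) v" by (simp add: prod_form_def s_def)
      moreover have "?k (s (n+3)) (v, q) = ku (EP (dd (n+3))) v" by (simp add: prod_form_def s_def)
      moreover have "?m (r (n+3)) (v, q) = mu (fst (r (n+3))) v + mp (snd (r (n+3))) q" by (simp add: prod_form_def)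
      moreover have "?k (\<theta> (n+3)) (v, q) = ku (th (n+3)) v" by (simp add: prod_form_def \<theta>_def)
      ultimately show ?thesis using scheme[OF n vq] by (simp only:)
    qed
    have EPm': "mu (EP q) (EP q) \<le> mp q q" for q using EPm[of q] nn(3)[of q] by linarith
    define I where "I = (100 + 40 * C) * (C0 + G) * \<tau> ^ 4"
    have GI: "C0 * \<tau> ^ 4 \<le> (C0 + G) * \<tau> ^ 4" "G * \<tau> ^ 4 \<le> (C0 + G) * \<tau> ^ 4" "0 \<le> C0 * \<tau> ^ 4" "0 \<le> G * \<tau> ^ 4"
      using C0 G \<tau> by (auto intro!: mult_right_mono)
    have th_k: "\<tau> * ku (th n) (th n) \<le> G * \<tau> ^ 4" if "n \<le> N" for n
    proof -
      have "ku (th n) (th n) \<le> (\<Sum>n<N-1. nsq ku (d2u n))"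
        unfolding th_def using that N nn by (intro member_le_sum[of "n - 2" _ "\<lambda>n. nsq ku (d2u n)"]) auto
      then have "\<tau> * ku (th n) (th n) \<le> \<tau> * (G * \<tau> ^ 3)" using d2k \<tau> by (intro mult_left_mono) auto
      then show ?thesis by (simp add: power_numeral_reduce mult_ac)
    qed
    have th_m: "mu (th n) (th n) \<le> G * \<tau> ^ 4" "nsq mp (thp n) \<le> G * \<tau> ^ 4" if "n \<le> N" for n
      unfolding th_def thp_def using that N by (auto intro!: d2m)
    have init_x: "?m (x j) (x j) + \<tau> * ?k (x j) (x j) \<le> (34 + 16 * C) * (C0 * \<tau> ^ 4) + 32 * (G * \<tau> ^ 4)" if j: "j \<le> 2" for j
    proof -
      have jN: "j \<le> N" using j N by simp
      have "mu (xu j) (xu j) \<le> 8 * (mu (e j) (e j) + nsq mu (ER (e j)) + mu (th j) (th j) + nsq mu (EP (thp j)) + nsq mu (EP (ep j)))"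
        unfolding xu_def using semi_inner_add5_le[OF forms(1), of "e j" "- ER (e j)" "th j" "- EP (thp j)" "EP (ep j)"]
        by (simp only: semi_inner_minus_square[OF forms(1)])
      moreover have "nsq mu (ER (e j)) \<le> C * (C0 * \<tau> ^ 4)"
        using ERm[of "e j"] mult_left_mono[OF order_trans[OF init_e(1)[OF j] pow] C] by linarith
      ultimately have 1: "mu (xu j) (xu j) \<le> 8 * (C0 * \<tau> ^ 4 + C * (C0 * \<tau> ^ 4) + G * \<tau> ^ 4 + G * \<tau> ^ 4 + C0 * \<tau> ^ 4)"
        using init_e(1,3)[OF j] pow th_m[OF jN] EPm'[of "thp j"] EPm'[of "ep j"] unfolding distrib_left by linarith
      have "\<tau> * ku (xu j) (xu j) \<le> \<tau> * (8 * (ku (e j) (e j) + nsq ku (ER (e j)) + ku (th j) (th j) + nsq ku (EP (thp j)) + nsq ku (EP (ep j))))"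
        unfolding xu_def using semi_inner_add5_le[OF forms(2), of "e j" "- ER (e j)" "th j" "- EP (thp j)" "EP (ep j)"] \<tau>
        unfolding semi_inner_minus_square[OF forms(2)] by (intro mult_left_mono) auto
      also have "\<dots> = 8 * (\<tau> * ku (e j) (e j) + \<tau> * nsq ku (ER (e j)) + \<tau> * ku (th j) (th j) + \<tau> * nsq ku (EP (thp j)) + \<tau> * nsq ku (EP (ep j)))"
        by (simp add: algebra_simps)
      finally have "\<tau> * ku (xu j) (xu j) \<le> \<dots>" .
      moreover have "\<tau> * nsq ku (ER (e j)) \<le> C * (C0 * \<tau> ^ 4)"
      proof -
        have "\<tau> * (\<tau> * nsq ku (ER (e j))) \<le> C * (C0 * \<tau> ^ 5)"
          using ERk[of "e j"] mult_left_mono[OF init_e(1)[OF j] C] by (simp add: power2_eq_square mult.assoc)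
        also have "\<dots> = \<tau> * (C * (C0 * \<tau> ^ 4))" by (simp add: power_numeral_reduce mult_ac)
        finally show ?thesis using \<tau>(1) by (simp only: mult_le_cancel_left_pos)
      qed
      ultimately have 2: "\<tau> * ku (xu j) (xu j) \<le> 8 * (C0 * \<tau> ^ 4 + C * (C0 * \<tau> ^ 4) + G * \<tau> ^ 4 + G * \<tau> ^ 4 + C0 * \<tau> ^ 4)"
        using init_e(2,3)[OF j] pow th_m[OF jN] th_k[OF jN] EPk[of "thp j"] EPk[of "ep j"] nn(3)[of "ep j"] nn(3)[of "thp j"] unfolding distrib_left by linarith
      have "?m (x j) (x j) + \<tau> * ?k (x j) (x j) = mu (xu j) (xu j) + mp (ep j) (ep j) + (\<tau> * ku (xu j) (xu j) + \<tau> * kp (ep j) (ep j))"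
        by (simp add: prod_form_def x_def distrib_left)
      then show ?thesis using 1 2 init_e(3,4)[OF j] pow by (simp add: algebra_simps)
    qed
    have init_s: "?m (s 2) (s 2) \<le> 18 * (C0 * \<tau> ^ 4)"
    proof -
      have "mp (dd 2) (dd 2) \<le> 4 * (mp (ep 2) (ep 2) + nsq mp (- (2 *\<^sub>R ep 1)) + nsq mp (1 *\<^sub>R ep 0) + mp 0 0)"
        using semi_inner_add4_le[OF forms(3), of "ep 2" "- (2 *\<^sub>R ep 1)" "ep 0" 0] by (simp add: dd_def)
      then have "mp (dd 2) (dd 2) \<le> 24 * (C0 * \<tau> ^ 4)"
        using init_e(3)[of 2] init_e(3)[of 1] init_e(3)[of 0] pow by simp
      then show ?thesis using EPm[of "dd 2"] nn(3)[of "dd 2"] GI(3) by (simp add: prod_form_def s_def)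
    qed
    \<comment> \<open>\<open>th\<close> has no difference between the indices \<open>1\<close> and \<open>2\<close>, so one third difference is absent for \<open>n = 0\<close>\<close>
    define pu where "pu n = (if n = 0 then 0 else nsq mu (d3u (n-1)))" for n
    define pp where "pp n = (if n = 0 then 0 else nsq mp (d3p (n-1)))" for n
    have D3th: "nsq mu (D3 th n) \<le> 18 * nsq mu (d3u n) + 2 * pu n"
      and D3thp: "nsq mp (D3' thp n) \<le> 18 * nsq mp (d3p n) + 2 * pp n" for n
    proof -
      have "D3 th n = (if n = 0 then 3 *\<^sub>R d3u n else 3 *\<^sub>R d3u n - d3u (n-1))" 
        by (cases n) (auto simp: D3_def th_def d2u_def d3u_def numeral_3_eq_3 numeral_2_eq_2 scaleR_small algebra_simps)
      then show "nsq mu (D3 th n) \<le> 18 * nsq mu (d3u n) + 2 * pu n"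
        using semi_inner_diff_le[OF forms(1), of "3 *\<^sub>R d3u n" "d3u (n-1)"] nn(1)[of "d3u n"] by (auto simp: pu_def)
      have "D3' thp n = (if n = 0 then 3 *\<^sub>R d3p n else 3 *\<^sub>R d3p n - d3p (n-1))" 
        by (cases n) (auto simp: D3'_def thp_def d2p_def d3p_def numeral_3_eq_3 numeral_2_eq_2 scaleR_small algebra_simps)
      then show "nsq mp (D3' thp n) \<le> 18 * nsq mp (d3p n) + 2 * pp n"
        using semi_inner_diff_le[OF forms(3), of "3 *\<^sub>R d3p n" "d3p (n-1)"] nn(3)[of "d3p n"] by (auto simp: pp_def)
    qed
    have shifted: "(\<Sum>n<K. if n = 0 then 0 else f (n-1)) \<le> (\<Sum>n<K. f n)" if "\<And>n. 0 \<le> f n" for f :: "nat \<Rightarrow> real" and K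
    proof (cases K)
      case (Suc k)
      have "(\<Sum>n<Suc k. if n = 0 then 0 else f (n-1)) = (\<Sum>n<k. f n)" by (subst sum.lessThan_Suc_shift) simp
      then show ?thesis using that[of k] Suc by simp
    qed simp
    have late: "(\<Sum>n<N-2. f (n+1)) \<le> (\<Sum>n<N-1. f n)" if "\<And>n. 0 \<le> f n" for f :: "nat \<Rightarrow> real"
    proof -
      have "N - 1 = Suc (N - 2)" using N by simp
      then show ?thesis using that[of 0] by (simp only: sum.lessThan_Suc_shift) simp
    qed
    have cons: "\<tau> * (\<Sum>n<N-2. nsq ?m (r (n+3)) + nsq ?k (\<theta> (n+3))) \<le> 60 * (G * \<tau> ^ 4)"
    proof -
      define W where "W n = nsq mu (ru (n+1)) + (18 * nsq mu (d3u n) + 2 * pu n)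
          + (18 * nsq mp (d3p n) + 2 * pp n) + 9 * nsq mp (d3p n)" for n
      have r1: "4 * \<tau>\<^sup>2 * nsq ?m (r (n+3)) \<le> 4 * W n + nsq mp (rp (n+1))" for n
      proof -
        have "4 * \<tau>\<^sup>2 * nsq ?m (r (n+3)) = nsq mu (R (n+3)) + nsq mp (rp (n+1))"
          using \<tau>(1) by (simp add: prod_form_def r_def field_simps power2_eq_square)
        moreover have "nsq mu (R (n+3)) \<le> 4 * (nsq mu (ru (n+1)) + nsq mu (D3 th n) + nsq mu (EP (D3' thp n)) + 9 * nsq mu (EP (d3p n)))"
          using semi_inner_add4_le[OF forms(1), of "- ru (n+1)" "D3 th n" "- EP (D3' thp n)" "3 *\<^sub>R EP (d3p n)"]
          unfolding semi_inner_minus_square[OF forms(1)] semi_inner_scaleR_square[OF forms(1)] by (simp add: R_def)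
        ultimately show ?thesis
          using D3th[of n] D3thp[of n] EPm'[of "D3' thp n"] EPm'[of "d3p n"] unfolding W_def distrib_left by linarith
      qed
      have "4 * \<tau>\<^sup>2 * (\<Sum>n<N-2. nsq ?m (r (n+3))) \<le> (\<Sum>n<N-2. 4 * W n + nsq mp (rp (n+1)))"
        unfolding sum_distrib_left using r1 by (intro sum_mono) auto
      also have "\<dots> = 4 * ((\<Sum>n<N-2. nsq mu (ru (n+1))) + 18 * (\<Sum>n<N-2. nsq mu (d3u n)) + 2 * (\<Sum>n<N-2. pu n)
          + 27 * (\<Sum>n<N-2. nsq mp (d3p n)) + 2 * (\<Sum>n<N-2. pp n))
          + (\<Sum>n<N-2. nsq mp (rp (n+1)))"
        unfolding W_def sum.distrib sum_distrib_left by (simp add: sum.distrib sum_distrib_left)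
      also have "\<dots> \<le> 4 * (G * \<tau> ^ 5 + 18 * (G * \<tau> ^ 5) + 2 * (G * \<tau> ^ 5) + 27 * (G * \<tau> ^ 5) + 2 * (G * \<tau> ^ 5)) + G * \<tau> ^ 5"
      proof (intro add_mono mult_left_mono)
        show "(\<Sum>n<N-2. nsq mu (ru (n+1))) \<le> G * \<tau> ^ 5" using late[of "\<lambda>n. mu (ru n) (ru n)", OF nn(1)] bdf(1) by linarith
        show "(\<Sum>n<N-2. nsq mp (rp (n+1))) \<le> G * \<tau> ^ 5" using late[of "\<lambda>n. mp (rp n) (rp n)", OF nn(3)] bdf(2) by linarith
        show "(\<Sum>n<N-2. pu n) \<le> G * \<tau> ^ 5"
          using shifted[of "\<lambda>n. nsq mu (d3u n)" "N-2", OF nn(1)] d3(1) unfolding pu_def by linarith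
        show "(\<Sum>n<N-2. pp n) \<le> G * \<tau> ^ 5"
          using shifted[of "\<lambda>n. nsq mp (d3p n)" "N-2", OF nn(3)] d3(2) unfolding pp_def by linarith
      qed (use d3 in auto)
      also have "\<dots> = 4 * \<tau>\<^sup>2 * (201 / 4 * (G * \<tau> ^ 3))" by (simp add: power_numeral_reduce power2_eq_square)
      finally have scaled: "4 * \<tau>\<^sup>2 * (\<Sum>n<N-2. nsq ?m (r (n+3))) \<le> 4 * \<tau>\<^sup>2 * (201 / 4 * (G * \<tau> ^ 3))" .
      have "(\<Sum>n<N-2. nsq ?m (r (n+3))) \<le> 201 / 4 * (G * \<tau> ^ 3)"
        by (rule mult_left_le_imp_le[OF scaled]) (use \<tau>(1) in simp)
      then have 1: "\<tau> * (\<Sum>n<N-2. nsq ?m (r (n+3))) \<le> \<tau> * (201 / 4 * (G * \<tau> ^ 3))" using \<tau> by (intro mult_left_mono) auto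
      have "(\<Sum>n<N-2. nsq ?k (\<theta> (n+3))) = (\<Sum>n<N-2. nsq ku (d2u (n+1)))"
        by (simp add: prod_form_def \<theta>_def th_def)
      also have "\<dots> \<le> G * \<tau> ^ 3" using late[of "\<lambda>n. nsq ku (d2u n)", OF nn(2)] d2k by linarith
      finally have 2: "\<tau> * (\<Sum>n<N-2. nsq ?k (\<theta> (n+3))) \<le> \<tau> * (G * \<tau> ^ 3)" using \<tau> by (intro mult_left_mono) auto
      have 3: "\<tau> * (201 / 4 * (G * \<tau> ^ 3)) = 201 / 4 * (G * \<tau> ^ 4)" "\<tau> * (G * \<tau> ^ 3) = G * \<tau> ^ 4"
        by (simp_all add: power_numeral_reduce)
      show ?thesis using 1 2 GI(4) unfolding sum.distrib distrib_left 3 by linarith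
    qed
    define X where "X = 5000 * exp (4 * (real N * \<tau>)) * I"
    have energy: "?m (x N) (x N) + (\<Sum>n<N-2. nsq ?m (x (n+3) - 2 *\<^sub>R x (n+2) + x (n+1)))
      + \<tau> * (\<Sum>n<N-2. nsq ?k (x (n+3))) \<le> X"
      unfolding X_def
    proof (rule bdf2_energy_estimate[where s = s and r = r and \<theta> = \<theta>, OF semi_inner_prod_form[OF forms(1,3)] semi_inner_prod_form[OF forms(2,4)] \<tau>])
      fix n w assume n: "n + 3 \<le> N" and w: "w \<in> {x (n+3), 3 *\<^sub>R x (n+3) - 4 *\<^sub>R x (n+2) + x (n+1)}"
      obtain v q where vq: "w = (v, q)" by (cases w)
      have "ER v = EP q" using w n x_coupled[of "n+3"] x_coupled[of "n+2"] x_coupled[of "n+1"] by (auto simp: vq x_def)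
      then show "?m (3 *\<^sub>R x (n+3) - 4 *\<^sub>R x (n+2) + x (n+1)) w + 2 * \<tau> * ?k (x (n+3)) w =
         3 * ?m (s (n+3) - s (n+2)) w + 2 * \<tau> * ?k (s (n+3)) w + 2 * \<tau> * ?m (r (n+3)) w
         + 2 * \<tau> * ?k (\<theta> (n+3)) w" unfolding vq by (rule eq[OF n])
    next
      fix n assume n: "n + 3 \<le> N"
      let ?d = "x (n+3) - 2 *\<^sub>R x (n+2) + x (n+1)"
      have d: "nsq mp (dd (n+3)) \<le> ?m ?d ?d"
        using nn(1)[of "fst ?d"] by (simp add: prod_form_def x_def dd_def numeral_3_eq_3 numeral_2_eq_2 del: semi_inner_simps[OF forms(1)] semi_inner_simps[OF forms(3)])
      show "nsq ?m (s (n+3)) \<le> 1/4000 * ?m ?d ?d"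
        using EPm[of "dd (n+3)"] d by (simp add: prod_form_def s_def)
      show "\<tau> * nsq ?k (s (n+3)) \<le> 1/32 * ?m ?d ?d"
        using EPk[of "dd (n+3)"] d by (simp add: prod_form_def s_def)
    next
      have "?m (x 2) (x 2) + ?m (x 1) (x 1) + \<tau> * ?k (x 2) (x 2) + \<tau> * ?k (x 1) (x 1) + ?m (s 2) (s 2)
         \<le> 2 * ((34 + 16 * C) * (C0 * \<tau> ^ 4) + 32 * (G * \<tau> ^ 4)) + 18 * (C0 * \<tau> ^ 4)"
        using init_x[of 1, OF one_le_numeral] init_x[of 2, OF order_refl] init_s unfolding distrib_left by linarith
      also have "\<dots> \<le> (100 + 40 * C) * (C0 * \<tau> ^ 4) + (100 + 40 * C) * (G * \<tau> ^ 4)"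
        using mult_nonneg_nonneg[OF C GI(3)] mult_nonneg_nonneg[OF C GI(4)] GI(3,4) by (simp add: algebra_simps)
      also have "\<dots> = I" by (simp add: I_def algebra_simps)
      finally show "?m (x 2) (x 2) + ?m (x 1) (x 1) + \<tau> * ?k (x 2) (x 2) + \<tau> * ?k (x 1) (x 1) + ?m (s 2) (s 2) \<le> I" .
      have "60 * (G * \<tau> ^ 4) \<le> (100 + 40 * C) * (C0 * \<tau> ^ 4) + (100 + 40 * C) * (G * \<tau> ^ 4)"
        using mult_nonneg_nonneg[OF C GI(3)] mult_nonneg_nonneg[OF C GI(4)] GI(3,4) by (simp add: algebra_simps)
      also have "\<dots> = I" by (simp add: I_def algebra_simps)
      finally show "\<tau> * (\<Sum>n<N-2. nsq ?m (r (n+3)) + nsq ?k (\<theta> (n+3))) \<le> I" using cons by linarith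
    qed (use N in simp)
    define SD where "SD = (\<Sum>n<N-2. nsq ?m (x (n+3) - 2 *\<^sub>R x (n+2) + x (n+1)))"
    define SK where "SK = (\<Sum>n<N-2. nsq ku (xu (n+3)))"
    define SP where "SP = (\<Sum>n<N-2. nsq kp (ep (n+3)))"
    have kx: "(\<Sum>n<N-2. nsq ?k (x (n+3))) = SK + SP" by (simp add: SK_def SP_def prod_form_def x_def sum.distrib)
    have mx: "?m (x N) (x N) = mu (xu N) (xu N) + mp (ep N) (ep N)" by (simp add: prod_form_def x_def)
    have en: "mu (xu N) (xu N) + mp (ep N) (ep N) + SD + \<tau> * SK + \<tau> * SP \<le> X"
      using energy unfolding kx mx SD_def by (simp add: distrib_left)
    have pos: "0 \<le> SK" "0 \<le> SP" "0 \<le> \<tau> * SK" "0 \<le> \<tau> * SP"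
      using nn \<tau> by (auto simp: SK_def SP_def intro!: sum_nonneg mult_nonneg_nonneg)
    have dd: "(\<Sum>n<N-2. nsq mp (dd (n+3))) \<le> SD"
      unfolding SD_def
    proof (rule sum_mono)
      fix n
      let ?d = "x (n+3) - 2 *\<^sub>R x (n+2) + x (n+1)"
      show "nsq mp (dd (n+3)) \<le> ?m ?d ?d"
        using nn(1)[of "fst ?d"] by (simp add: prod_form_def x_def dd_def numeral_3_eq_3 numeral_2_eq_2 del: semi_inner_simps[OF forms(1)] semi_inner_simps[OF forms(3)])
    qed
    have SD0: "0 \<le> SD" using dd sum_nonneg[of "{..<N-2}" "\<lambda>n. nsq mp (dd (n+3))"] nn(3) by fastforce
    have late_e: "mu (e n) (e n) \<le> 4 * (mu (xu n) (xu n) + mp (dd n) (dd n) + mu (th n) (th n))"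
      "\<tau> * ku (e n) (e n) \<le> 4 * (\<tau> * ku (xu n) (xu n) + mp (dd n) (dd n) + \<tau> * ku (th n) (th n))" if n: "3 \<le> n" "n \<le> N" for n
    proof -
      have "mu (e n) (e n) \<le> 4 * (mu (xu n) (xu n) + nsq mu (EP (dd n)) + mu (th n) (th n) + mu 0 0)"
        using semi_inner_add4_le[OF forms(1), of "xu n" "- EP (dd n)" "- th n" 0]
        unfolding semi_inner_minus_square[OF forms(1)] xu_late[OF n, symmetric] add_0_right .
      then show "mu (e n) (e n) \<le> 4 * (mu (xu n) (xu n) + mp (dd n) (dd n) + mu (th n) (th n))" using EPm'[of "dd n"] by simp
      have "ku (e n) (e n) \<le> 4 * (ku (xu n) (xu n) + nsq ku (EP (dd n)) + ku (th n) (th n) + ku 0 0)"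
        using semi_inner_add4_le[OF forms(2), of "xu n" "- EP (dd n)" "- th n" 0]
        unfolding semi_inner_minus_square[OF forms(2)] xu_late[OF n, symmetric] add_0_right .
      then have "\<tau> * ku (e n) (e n) \<le> \<tau> * (4 * (ku (xu n) (xu n) + nsq ku (EP (dd n)) + ku (th n) (th n)))" using \<tau> by (intro mult_left_mono) auto
      also have "\<dots> = 4 * (\<tau> * ku (xu n) (xu n) + \<tau> * nsq ku (EP (dd n)) + \<tau> * ku (th n) (th n))" by (simp add: algebra_simps)
      finally show "\<tau> * ku (e n) (e n) \<le> 4 * (\<tau> * ku (xu n) (xu n) + mp (dd n) (dd n) + \<tau> * ku (th n) (th n))"
        using EPk[of "dd n"] nn(3)[of "dd n"] by simp
    qed
    have "mp (dd N) (dd N) \<le> (\<Sum>n<N-2. nsq mp (dd (n+3)))"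
      using member_le_sum[of "N-3" "{..<N-2}" "\<lambda>n. nsq mp (dd (n+3))"] N nn(3) by simp
    then have eN: "mu (e N) (e N) \<le> 4 * (mu (xu N) (xu N) + SD + G * \<tau> ^ 4)"
      using late_e(1)[OF N order_refl] th_m(1)[OF order_refl] dd unfolding distrib_left by linarith
    have "(\<Sum>n<N-2. \<tau> * nsq ku (e (n+3))) \<le> (\<Sum>n<N-2. 4 * (\<tau> * nsq ku (xu (n+3)) + nsq mp (dd (n+3)) + \<tau> * nsq ku (d2u (n+1))))"
    proof (rule sum_mono)
      fix n assume "n \<in> {..<N-2}"
      then show "\<tau> * nsq ku (e (n+3)) \<le> 4 * (\<tau> * nsq ku (xu (n+3)) + nsq mp (dd (n+3)) + \<tau> * nsq ku (d2u (n+1)))"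
        using late_e(2)[of "n+3"] by (simp add: th_def)
    qed
    also have "\<dots> = 4 * (\<tau> * SK + (\<Sum>n<N-2. nsq mp (dd (n+3))) + \<tau> * (\<Sum>n<N-2. nsq ku (d2u (n+1))))"
      by (simp only: SK_def sum.distrib sum_distrib_left distrib_left)
    also have "\<dots> \<le> 4 * (\<tau> * SK + SD + G * \<tau> ^ 4)"
    proof -
      have "(\<Sum>n<N-2. nsq ku (d2u (n+1))) \<le> G * \<tau> ^ 3" using late[of "\<lambda>n. nsq ku (d2u n)", OF nn(2)] d2k by linarith
      then have "\<tau> * (\<Sum>n<N-2. nsq ku (d2u (n+1))) \<le> \<tau> * (G * \<tau> ^ 3)" using \<tau> by (intro mult_left_mono) auto
      also have "\<dots> = G * \<tau> ^ 4" by (simp add: power_numeral_reduce)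
      finally show ?thesis using dd unfolding distrib_left by linarith
    qed
    finally have SKe: "(\<Sum>n<N-2. \<tau> * nsq ku (e (n+3))) \<le> 4 * (\<tau> * SK + SD + G * \<tau> ^ 4)" .
    have split: "(\<Sum>j=1..N. f j) = f 1 + f 2 + (\<Sum>n<N-2. f (n+3))" for f :: "nat \<Rightarrow> real"
    proof -
      have "{1..N} = {1,2} \<union> {3..N}" using N by auto
      then have "(\<Sum>j=1..N. f j) = f 1 + f 2 + (\<Sum>j=3..N. f j)" by (simp add: sum.union_disjoint)
      also have "(\<Sum>j=3..N. f j) = (\<Sum>n<N-2. f (n+3))"
        using N by (intro sum.reindex_bij_witness[where i = "\<lambda>n. n + 3" and j = "\<lambda>j. j - 3"]) auto
      finally show ?thesis .
    qed
    have "\<tau> * (\<Sum>j=1..N. ku (e j) (e j) + kp (ep j) (ep j))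
        = \<tau> * ku (e 1) (e 1) + \<tau> * kp (ep 1) (ep 1) + \<tau> * ku (e 2) (e 2) + \<tau> * kp (ep 2) (ep 2)
          + (\<Sum>n<N-2. \<tau> * nsq ku (e (n+3))) + \<tau> * SP"
      unfolding split SP_def by (simp add: sum.distrib distrib_left sum_distrib_left)
    also have "\<dots> \<le> 4 * (C0 * \<tau> ^ 4) + 4 * (\<tau> * SK + SD + G * \<tau> ^ 4) + \<tau> * SP"
      using init_e(2,4)[of 1] init_e(2,4)[of 2] pow SKe by linarith
    finally have "mu (e N) (e N) + mp (ep N) (ep N) + \<tau> * (\<Sum>j=1..N. ku (e j) (e j) + kp (ep j) (ep j))
        \<le> 8 * (mu (xu N) (xu N) + mp (ep N) (ep N) + SD + \<tau> * SK + \<tau> * SP) + 8 * (C0 * \<tau> ^ 4) + 8 * (G * \<tau> ^ 4)"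
      using eN pos nn(1)[of "xu N"] nn(3)[of "ep N"] SD0 GI(3,4) by (simp add: algebra_simps)
    also have "\<dots> \<le> 8 * X + 8 * (C0 * \<tau> ^ 4) + 8 * (G * \<tau> ^ 4)" using en unfolding distrib_left by linarith
    also have "\<dots> = (40000 * exp (4 * (real N * \<tau>)) * (100 + 40 * C) + 8) * (C0 + G) * \<tau> ^ 4"
      by (simp add: X_def I_def algebra_simps)
    finally show ?thesis unfolding e_def ep_def .
  qed
qed

section \<open>Regularity at the time steps\<close>

text \<open>The energy estimate needs a real vector space, which the vectors of variable dimension do not form.\<close>

instantiation "fun" :: (type, real_vector) real_vector
begin

definition scaleR_fun :: "real \<Rightarrow> ('a \<Rightarrow> 'b) \<Rightarrow> 'a \<Rightarrow> 'b" where "scaleR_fun c f = (\<lambda>x. c *\<^sub>R f x)"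

instance by standard (auto simp: scaleR_fun_def fun_eq_iff scaleR_add_right scaleR_add_left)

end

definition cf :: "real vec \<Rightarrow> nat \<Rightarrow> real" where "cf v i = (if i < dim_vec v then v $ i else 0)"

lemma cf_nth: "v \<in> carrier_vec n \<Longrightarrow> i < n \<Longrightarrow> cf v i = v $ i" by (auto simp: cf_def)

lemma bform_rows: "bform n n' A a b = (\<Sum>i<n. a i * (\<Sum>j<n'. A $$ (i, j) * b j))"
  by (simp add: bform_def sum_distrib_left mult.assoc)

lemma bform_cong: "(\<And>i. i < n \<Longrightarrow> a i = a' i) \<Longrightarrow> (\<And>j. j < n' \<Longrightarrow> b j = b' j) \<Longrightarrow> bform n n' A a b = bform n n' A a' b'"
  by (simp add: bform_def)

lemma mult_mat_vec_nth:
  "A \<in> carrier_mat n n' \<Longrightarrow> v \<in> carrier_vec n' \<Longrightarrow> i < n \<Longrightarrow> (A *\<^sub>v v) $ i = (\<Sum>j<n'. A $$ (i, j) * cf v j)"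
  by (auto simp: scalar_prod_def cf_def lessThan_atLeast0 intro!: sum.cong)

lemma norm_sq_bform:
  assumes "A \<in> carrier_mat n n" "v \<in> carrier_vec n" shows "norm_sq A v = bform n n A (cf v) (cf v)"
proof -
  have "norm_sq A v = (\<Sum>i<n. v $ i * (A *\<^sub>v v) $ i)"
    using assms by (simp add: norm_sq_def scalar_prod_def[of v] lessThan_atLeast0)
  also have "\<dots> = bform n n A (cf v) (cf v)"
    unfolding bform_rows using assms by (intro sum.cong refl) (auto simp: mult_mat_vec_nth cf_def simp del: index_mult_mat_vec)
  finally show ?thesis .
qed

lemma bilinear_bform: "bilinear (bform n n' A)"
  unfolding bilinear_def bform_def
  by (auto intro!: linearI simp: scaleR_fun_def sum.distrib sum_distrib_left algebra_simps)

lemma semi_inner_bform: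
  assumes "\<And>a b. bform n n A a b = bform n n A b a" "\<And>a. 0 \<le> bform n n A a a"
  shows "semi_inner (bform n n A)"
  using assms bilinear_bform by (auto simp: semi_inner_def)

lemma L2_time_add:
  assumes "L2_time T v" "L2_time T w" shows "L2_time T (\<lambda>t. v t + w t)"
proof -
  have m: "v \<in> borel_measurable (lebesgue_on {0<..<T})" "w \<in> borel_measurable (lebesgue_on {0<..<T})"
    using assms by (auto simp: L2_time_def)
  have "integrable (lebesgue_on {0<..<T}) (\<lambda>t. (v t + w t)\<^sup>2)"
  proof (rule Bochner_Integration.integrable_bound[of _ "\<lambda>t. 2 * (v t)\<^sup>2 + 2 * (w t)\<^sup>2"])
    show "integrable (lebesgue_on {0<..<T}) (\<lambda>t. 2 * (v t)\<^sup>2 + 2 * (w t)\<^sup>2)"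
      using assms by (intro Bochner_Integration.integrable_add integrable_mult_right) (auto simp: L2_time_def)
    have "(a + b)\<^sup>2 \<le> 2 * a\<^sup>2 + 2 * b\<^sup>2" for a b :: real using sum_squares_bound[of a b] by (simp add: power2_sum)
    then show "AE t in lebesgue_on {0<..<T}. norm ((v t + w t)\<^sup>2) \<le> norm (2 * (v t)\<^sup>2 + 2 * (w t)\<^sup>2)" by simp
  qed (use m in measurable)
  then show ?thesis using m by (simp add: L2_time_def)
qed

lemma L2_time_scale: "L2_time T v \<Longrightarrow> L2_time T (\<lambda>t. c * v t)"
  by (auto simp: L2_time_def power_mult_distrib)

lemma L2_time_sum:
  fixes n :: nat
  shows "(\<And>i. i < n \<Longrightarrow> L2_time T (v i)) \<Longrightarrow> L2_time T (\<lambda>t. \<Sum>i<n. c i * v i t)"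
proof (induction n)
  case 0
  then show ?case by (simp add: L2_time_def)
next
  case (Suc n)
  then show ?case by (simp add: L2_time_add L2_time_scale)
qed

text \<open>By polarization, from the squares.\<close>

lemma L2_time_product:
  assumes "L2_time T v" "L2_time T w"
  shows "integrable (lebesgue_on {0<..<T}) (\<lambda>t. v t * w t)"
proof -
  have "integrable (lebesgue_on {0<..<T}) (\<lambda>t. (1/2) * ((v t + w t)\<^sup>2 - (v t)\<^sup>2 - (w t)\<^sup>2))"
    using assms L2_time_add[OF assms]
    by (intro integrable_mult_right Bochner_Integration.integrable_diff) (auto simp: L2_time_def)
  moreover have "(1/2) * ((a + b)\<^sup>2 - a\<^sup>2 - b\<^sup>2) = a * b" for a b :: real by (simp add: power2_sum)
  ultimately show ?thesis by simp
qed

lemma weak_derivative_sum: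
  fixes n :: nat
  assumes v: "\<And>i. i < n \<Longrightarrow> L2_time T (v i)" "\<And>i. i < n \<Longrightarrow> L2_time T (w i)"
    and d: "\<And>i. i < n \<Longrightarrow> weak_derivative T (v i) (w i)"
  shows "weak_derivative T (\<lambda>t. \<Sum>i<n. c i * v i t) (\<lambda>t. \<Sum>i<n. c i * w i t)"
  unfolding weak_derivative_def
proof (intro allI impI)
  fix \<phi> \<phi>' :: "real \<Rightarrow> real"
  assume A: "(\<forall>t. (\<phi> has_real_derivative \<phi>' t) (at t)) \<and> continuous_on UNIV \<phi>' \<and>
        (\<exists>a b. 0 < a \<and> b < T \<and> (\<forall>t. t \<notin> {a..b} \<longrightarrow> \<phi> t = 0))"
  have c: "continuous_on UNIV \<phi>" "continuous_on UNIV \<phi>'"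
    using A by (auto intro!: continuous_at_imp_continuous_on DERIV_isCont)
  have L2: "L2_time T g" if g: "continuous_on UNIV g" for g :: "real \<Rightarrow> real"
  proof -
    have gm: "g \<in> borel_measurable borel" using g by (rule borel_measurable_continuous_onI)
    have "bounded (g ` {0..T})"
      by (intro compact_imp_bounded compact_continuous_image continuous_on_subset[OF g]) auto
    then obtain B where B: "\<forall>t\<in>{0..T}. \<bar>g t\<bar> \<le> B" unfolding bounded_iff by auto
    have gm': "g \<in> borel_measurable (lebesgue_on {0<..<T})"
      using gm by (intro measurable_restrict_space1) (simp add: measurable_completion)
    have "integrable (lebesgue_on {0<..<T}) (\<lambda>t. (g t)\<^sup>2)"
    proof (rule finite_measure.integrable_const_bound[where B = "B\<^sup>2"])
      show "finite_measure (lebesgue_on {0<..<T})"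
        using emeasure_bounded_finite[of "{0<..<T}"]
        by (intro finite_measureI) (auto simp: emeasure_restrict_space space_restrict_space)
      show "AE t in lebesgue_on {0<..<T}. norm ((g t)\<^sup>2) \<le> B\<^sup>2"
      proof (rule AE_I2)
        fix t assume "t \<in> space (lebesgue_on {0<..<T})"
        then have "t \<in> {0..T}" by (auto simp: space_restrict_space)
        then have "\<bar>g t\<bar>\<^sup>2 \<le> B\<^sup>2" using B by (intro power_mono) auto
        then show "norm ((g t)\<^sup>2) \<le> B\<^sup>2" by simp
      qed
    qed (use gm' in measurable)
    then show ?thesis using gm' by (simp add: L2_time_def)
  qed
  have e: "(LINT t|lebesgue_on {0<..<T}. (\<Sum>i<n. c i * f i t) * g t) = (\<Sum>i<n. c i * (LINT t|lebesgue_on {0<..<T}. f i t * g t))"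
    if f: "\<And>i. i < n \<Longrightarrow> L2_time T (f i)" and g: "continuous_on UNIV g" for f and g :: "real \<Rightarrow> real"
  proof -
    have "(LINT t|lebesgue_on {0<..<T}. (\<Sum>i<n. c i * f i t) * g t) = (LINT t|lebesgue_on {0<..<T}. (\<Sum>i<n. c i * (f i t * g t)))"
      by (simp add: sum_distrib_right mult.assoc)
    also have "\<dots> = (\<Sum>i<n. LINT t|lebesgue_on {0<..<T}. c i * (f i t * g t))"
      using L2_time_product[OF f L2[OF g]] by (intro Bochner_Integration.integral_sum integrable_mult_right) auto
    finally show ?thesis by simp
  qed
  have "(LINT t|lebesgue_on {0<..<T}. v i t * \<phi>' t) = - (LINT t|lebesgue_on {0<..<T}. w i t * \<phi> t)" if "i < n" for i
    using d[OF that] A unfolding weak_derivative_def by blast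
  then show "(LINT t|lebesgue_on {0<..<T}. (\<Sum>i<n. c i * v i t) * \<phi>' t) = - (LINT t|lebesgue_on {0<..<T}. (\<Sum>i<n. c i * w i t) * \<phi> t)"
    by (simp add: e v c sum_negf)
qed

lemma integral_lebesgue_on_open_interval:
  assumes "integrable (lebesgue_on {0<..<T}) (g :: real \<Rightarrow> real)"
  shows "integral {0..T} g = (LINT t|lebesgue_on {0<..<T}. g t)" "g integrable_on {0..T}"
proof -
  have "(g has_integral (LINT t|lebesgue_on {0<..<T}. g t)) {0<..<T}"
    by (rule has_integral_integral_lebesgue_on[OF assms]) simp
  then have "(g has_integral (LINT t|lebesgue_on {0<..<T}. g t)) {0..T}"
    using has_integral_open_interval[of g _ 0 T] by (simp add: box_real cbox_interval)
  then show "integral {0..T} g = (LINT t|lebesgue_on {0<..<T}. g t)" "g integrable_on {0..T}" by auto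
qed

lemma sum_overlapping_differences:
  fixes a :: "nat \<Rightarrow> real"
  shows "(\<Sum>n<M. a (n+2) - a n) = a (M+1) + a M - a 1 - a 0"
    and "(\<Sum>n<M. a (n+3) - a n) = a (M+2) + a (M+1) + a M - a 2 - a 1 - a 0"
  by (induction M) (simp_all add: numeral_3_eq_3 numeral_2_eq_2)

text \<open>Telescoping in the primitive: a stencil of width \<open>j\<close> covers every point at most \<open>j\<close> times.\<close>

lemma sum_overlapping_integrals:
  fixes g :: "real \<Rightarrow> real"
  assumes g: "g integrable_on {0..T}" "\<And>t. 0 \<le> g t" and \<tau>: "0 < \<tau>"
  shows "real (M + 1) * \<tau> \<le> T \<Longrightarrow> (\<Sum>n<M. integral {real n * \<tau>..real (n + 2) * \<tau>} g) \<le> 2 * integral {0..T} g"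
    and "real (M + 2) * \<tau> \<le> T \<Longrightarrow> (\<Sum>n<M. integral {real n * \<tau>..real (n + 3) * \<tau>} g) \<le> 3 * integral {0..T} g"
proof -
  define a where "a n = integral {0..real n * \<tau>} g" for n
  have comb: "integral {real n * \<tau>..real m * \<tau>} g = a m - a n" if "n \<le> m" "real m * \<tau> \<le> T" for n m
  proof -
    have "real n * \<tau> \<le> real m * \<tau>" using that \<tau> by simp
    then show ?thesis
      using Henstock_Kurzweil_Integration.integral_combine[of 0 "real n * \<tau>" "real m * \<tau>" g] \<tau>
        integrable_on_subinterval[OF g(1), of 0 "real m * \<tau>"] that(2) by (simp add: a_def)
  qed
  have a: "a n \<le> integral {0..T} g" if "real n * \<tau> \<le> T" for n
    unfolding a_def using that \<tau> g by (intro integral_subset_le) (auto intro: integrable_on_subinterval)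
  have a0: "0 \<le> a n" if "real n * \<tau> \<le> T" for n
    unfolding a_def using that g by (intro integral_nonneg) (auto intro: integrable_on_subinterval)
  have mono: "real n * \<tau> \<le> T" if "n \<le> m" "real m * \<tau> \<le> T" for n m
    using that \<tau> by (meson mult_right_mono of_nat_mono less_imp_le order_trans)
  show "(\<Sum>n<M. integral {real n * \<tau>..real (n + 2) * \<tau>} g) \<le> 2 * integral {0..T} g" if M: "real (M + 1) * \<tau> \<le> T"
  proof -
    have "(\<Sum>n<M. integral {real n * \<tau>..real (n + 2) * \<tau>} g) = (\<Sum>n<M. a (n+2) - a n)"
      by (intro sum.cong refl comb mono[OF _ M]) auto
    also have "\<dots> \<le> 2 * integral {0..T} g"
    proof (cases M)
      case (Suc M')
      then show ?thesis unfolding sum_overlapping_differences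
        using a[of "M+1"] a[of M] a0[of 1] a0[of 0] M mono[OF _ M, of M] mono[OF _ M, of 1] mono[OF _ M, of 0] by simp
    qed (use a[of 0] a0[of 0] mono[OF _ M, of 0] in simp)
    finally show ?thesis .
  qed
  show "(\<Sum>n<M. integral {real n * \<tau>..real (n + 3) * \<tau>} g) \<le> 3 * integral {0..T} g" if M: "real (M + 2) * \<tau> \<le> T"
  proof -
    have "(\<Sum>n<M. integral {real n * \<tau>..real (n + 3) * \<tau>} g) = (\<Sum>n<M. a (n+3) - a n)"
      by (intro sum.cong refl comb mono[OF _ M]) auto
    also have "\<dots> \<le> 3 * integral {0..T} g"
    proof (cases M)
      case (Suc M')
      then show ?thesis unfolding sum_overlapping_differences
        using a[of "M+2"] a[of "M+1"] a[of M] a0[of 2] a0[of 1] a0[of 0] M mono[OF _ M, of "M+1"] mono[OF _ M, of M] mono[OF _ M, of 2] mono[OF _ M, of 1] mono[OF _ M, of 0] by simp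
    qed (use a[of 0] a0[of 0] mono[OF _ M, of 0] in simp)
    finally show ?thesis .
  qed
qed

lemma sobolev_form_integrable:
  assumes V: "sobolev_derivs 3 T N v V" and j: "j \<le> 3"
  shows "integrable (lebesgue_on {0<..<T}) (\<lambda>t. nsq (bform N N A) (cf (V j t)))"
proof -
  have c: "V j t \<in> carrier_vec N" for t using V j by (auto simp: sobolev_derivs_def)
  have L: "L2_time T (\<lambda>t. cf (V j t) i)" if "i < N" for i
    using V j that by (auto simp: sobolev_derivs_def cf_nth[OF c that])
  have "integrable (lebesgue_on {0<..<T}) (\<lambda>t. \<Sum>i<N. \<Sum>i'<N. A $$ (i, i') * (cf (V j t) i * cf (V j t) i'))"
    using L2_time_product[OF L L] by (intro Bochner_Integration.integrable_sum integrable_mult_right) auto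
  then show ?thesis by (simp add: bform_def mult_ac)
qed

text \<open>Testing with the difference itself reduces the vectorial estimates to scalar ones:
  if \<open>m y y\<close> is the value of a difference of \<open>t \<mapsto> m y (v t)\<close>, then its square is at most a time
  integral of \<open>(m y (V t))\<^sup>2 \<le> m y y \<cdot> m (V t) (V t)\<close>.\<close>

lemma sampled_regularity:
  fixes A :: "real mat" and N :: nat and \<tau> T :: real and v v' :: "real \<Rightarrow> real vec" and V :: "nat \<Rightarrow> real \<Rightarrow> real vec"
  defines "m \<equiv> bform N N A" and "w \<equiv> \<lambda>n. cf (v (real n * \<tau>))" and "w' \<equiv> \<lambda>n. cf (v' (real n * \<tau>))"
  assumes m: "semi_inner (bform N N A)" and T: "0 < T" and \<tau>: "0 < \<tau>"
    and V: "sobolev_derivs 3 T N v V" and v': "vec_derivative_on T N v v'"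
    and R: "(\<Sum>j\<le>3. integral {0..T} (\<lambda>t. nsq (bform N N A) (cf (V j t)))) \<le> R"
  shows "real (n + 2) * \<tau> \<le> T \<Longrightarrow>
       nsq m (w (n+2) - 2 *\<^sub>R w (n+1) + w n) \<le> 18 * (1 / T + T) * \<tau> ^ 4 * R"
    and "real (M + 1) * \<tau> \<le> T \<Longrightarrow>
       (\<Sum>n<M. nsq m (w (n+2) - 2 *\<^sub>R w (n+1) + w n)) \<le> 64 * \<tau> ^ 3 * R"
    and "real (M + 1) * \<tau> \<le> T \<Longrightarrow>
       (\<Sum>n<M. nsq m (3 *\<^sub>R w (n+2) - 4 *\<^sub>R w (n+1) + w n - (2 * \<tau>) *\<^sub>R w' (n+2))) \<le> 64 * \<tau> ^ 5 * R"
    and "real (M + 2) * \<tau> \<le> T \<Longrightarrow>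
       (\<Sum>n<M. nsq m (w (n+3) - 3 *\<^sub>R w (n+2) + 3 *\<^sub>R w (n+1) - w n)) \<le> 1296 * \<tau> ^ 5 * R"
proof -
  define g where "g j t = nsq m (cf (V j t))" for j t
  have mm: "semi_inner m" using m by (simp add: m_def)
  note sm = semi_inner_simps[OF mm]
  have nn: "0 \<le> m y y" for y by (rule semi_inner_nonneg[OF mm])
  have g0: "0 \<le> g j t" for j t by (simp add: g_def nn)
  have c: "V j t \<in> carrier_vec N" if "j \<le> 3" for j t using V that by (auto simp: sobolev_derivs_def)
  have V0: "V 0 = v" using V by (simp add: sobolev_derivs_def)
  have gi: "integrable (lebesgue_on {0<..<T}) (g j)" if "j \<le> 3" for j
    using sobolev_form_integrable[OF V that] by (simp add: g_def[abs_def] m_def)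
  note gI = integral_lebesgue_on_open_interval[OF gi]
  have gR: "integral {0..T} (g j) \<le> R" if "j \<le> 3" for j
  proof -
    have "integral {0..T} (g j) \<le> (\<Sum>j\<le>3. integral {0..T} (g j))"
      using that gI(2) g0 by (intro member_le_sum[of j _ "\<lambda>j. integral {0..T} (g j)"] integral_nonneg) auto
    then show ?thesis using R by (simp add: g_def[abs_def] m_def)
  qed
  have g2R: "integral {0..T} (g 2) + integral {0..T} (g 3) \<le> R"
  proof -
    have "0 \<le> integral {0..T} (g 0)" "0 \<le> integral {0..T} (g 1)" using gI(2) g0 by (auto intro!: integral_nonneg)
    moreover have "(\<Sum>j\<le>3. integral {0..T} (g j)) = integral {0..T} (g 0) + integral {0..T} (g 1) + integral {0..T} (g 2) + integral {0..T} (g 3)"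
      by (simp add: numeral_3_eq_3 numeral_2_eq_2 atMost_Suc)
    ultimately show ?thesis using R by (simp add: g_def[abs_def] m_def)
  qed
  define F where "F y j t = m y (cf (V j t))" for y j t
  have F: "F y j = (\<lambda>t. \<Sum>i<N. (\<Sum>i'<N. y i' * A $$ (i', i)) * V j t $ i)" if "j \<le> 3" for y j
  proof
    fix t
    have "F y j t = (\<Sum>i'<N. \<Sum>i<N. y i' * A $$ (i', i) * V j t $ i)"
      unfolding F_def m_def bform_def by (intro sum.cong refl) (auto simp: cf_nth[OF c[OF that]])
    also have "\<dots> = (\<Sum>i<N. \<Sum>i'<N. y i' * A $$ (i', i) * V j t $ i)" by (rule sum.swap)
    finally show "F y j t = (\<Sum>i<N. (\<Sum>i'<N. y i' * A $$ (i', i)) * V j t $ i)" by (simp add: sum_distrib_right)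
  qed
  have L2: "L2_time T (F y j)" if "j \<le> 3" for y j
    unfolding F[OF that] using V that by (intro L2_time_sum) (auto simp: sobolev_derivs_def)
  have wd: "weak_derivative T (F y j) (F y (Suc j))" if j: "j < 3" for y j
  proof -
    have j3: "j \<le> 3" "Suc j \<le> 3" using j by auto
    show ?thesis unfolding F[OF j3(1)] F[OF j3(2)]
      using V j j3 by (intro weak_derivative_sum) (auto simp: sobolev_derivs_def)
  qed
  have der: "(F y 0 has_real_derivative m y (cf (v' t))) (at t within {0..T})" if t: "t \<in> {0..T}" for y t
  proof -
    have cv: "v' t \<in> carrier_vec N" and d: "\<And>i. i < N \<Longrightarrow> ((\<lambda>s. v s $ i) has_real_derivative v' t $ i) (at t within {0..T})"
      using v' t by (auto simp: vec_derivative_on_def)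
    have "m y (cf (v' t)) = (\<Sum>i'<N. \<Sum>i<N. y i' * A $$ (i', i) * v' t $ i)"
      unfolding m_def bform_def by (intro sum.cong refl) (auto simp: cf_nth[OF cv])
    also have "\<dots> = (\<Sum>i<N. (\<Sum>i'<N. y i' * A $$ (i', i)) * v' t $ i)"
      by (subst sum.swap) (simp add: sum_distrib_right)
    finally show ?thesis unfolding F[of 0, simplified] V0 using d by (auto intro!: DERIV_sum DERIV_cmult)
  qed
  have F2: "integral {a..b} (\<lambda>s. (F y j s)\<^sup>2) \<le> m y y * integral {a..b} (g j)" if j: "j \<le> 3" "0 \<le> a" "b \<le> T" for y j a b
  proof -
    have "integral {a..b} (\<lambda>s. (F y j s)\<^sup>2) \<le> integral {a..b} (\<lambda>s. m y y * g j s)"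
    proof (rule integral_le)
      show "(\<lambda>s. (F y j s)\<^sup>2) integrable_on {a..b}"
        using integrable_on_subinterval[OF L2_time_integrable(2)[OF L2[OF j(1)]]] j by auto
      show "(\<lambda>s. m y y * g j s) integrable_on {a..b}"
        using integrable_on_subinterval[OF gI(2)[OF j(1)]] j by (intro integrable_on_mult_right) auto
      show "(F y j s)\<^sup>2 \<le> m y y * g j s" for s unfolding F_def g_def by (rule semi_inner_Cauchy_Schwarz[OF mm])
    qed
    then show ?thesis by simp
  qed
  have cancel: "m y y \<le> K * J" if "(m y y)\<^sup>2 \<le> K * I" "I \<le> m y y * J" "0 \<le> K" "0 \<le> J" for y K I J
  proof (cases "m y y = 0")
    case False
    then have p: "0 < m y y" using nn[of y] by simp
    have "m y y * m y y \<le> m y y * (K * J)"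
      using that(1) mult_left_mono[OF that(2,3)] by (simp add: power2_eq_square mult_ac)
    then show ?thesis using p by simp
  qed (use that in simp)
  have sub0: "0 \<le> integral {a..b} (g j)" if "j \<le> 3" "0 \<le> a" "b \<le> T" for j a b
    using integrable_on_subinterval[OF gI(2)[OF that(1)]] that g0 by (intro integral_nonneg) auto
  have times: "real (n + 2) * \<tau> - \<tau> = real (n + 1) * \<tau>" "real (n + 2) * \<tau> - 2 * \<tau> = real n * \<tau>"
    "real (n + 3) * \<tau> - \<tau> = real (n + 2) * \<tau>" "real (n + 3) * \<tau> - 2 * \<tau> = real (n + 1) * \<tau>"
    "real (n + 3) * \<tau> - 3 * \<tau> = real n * \<tau>" for n
    by (simp_all add: algebra_simps)
  have wF: "m y (w n) = F y 0 (real n * \<tau>)" for y n by (simp add: F_def w_def V0)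
  note est = difference_quotient_estimates[of T "F y" for y, OF T L2 wd der \<tau>]
  have E2: "m y y \<le> 32 * \<tau> ^ 3 * integral {real n * \<tau>..real (n + 2) * \<tau>} (g 2)"
    "m y y \<le> 18 * (1 / T + T) * \<tau> ^ 4 * (integral {0..T} (g 2) + integral {0..T} (g 3))"
    if n: "real (n + 2) * \<tau> \<le> T" and y: "y = w (n+2) - 2 *\<^sub>R w (n+1) + w n" for n y
  proof -
    have t2: "2 * \<tau> \<le> real (n + 2) * \<tau>" using \<tau> by (simp add: algebra_simps)
    have eq: "m y y = F y 0 (real (n + 2) * \<tau>) - 2 * F y 0 (real (n + 1) * \<tau>) + F y 0 (real n * \<tau>)"
      using wF[of y] by (subst (2) y) (simp add: sm)
    show "m y y \<le> 32 * \<tau> ^ 3 * integral {real n * \<tau>..real (n + 2) * \<tau>} (g 2)"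
    proof (rule cancel)
      show "(m y y)\<^sup>2 \<le> 32 * \<tau> ^ 3 * integral {real n * \<tau>..real (n + 2) * \<tau>} (\<lambda>s. (F y 2 s)\<^sup>2)"
        unfolding eq using est(1)[OF _ _ _ n t2, of y] unfolding times by blast
    qed (use F2[of 2] sub0[of 2] \<tau> n in auto)
    show "m y y \<le> 18 * (1 / T + T) * \<tau> ^ 4 * (integral {0..T} (g 2) + integral {0..T} (g 3))"
    proof (rule cancel)
      show "(m y y)\<^sup>2 \<le> 18 * (1 / T + T) * \<tau> ^ 4 * (integral {0..T} (\<lambda>s. (F y 2 s)\<^sup>2) + integral {0..T} (\<lambda>s. (F y 3 s)\<^sup>2))"
        unfolding eq using est(2)[OF _ _ _ n t2, of y] unfolding times by blast
      show "integral {0..T} (\<lambda>s. (F y 2 s)\<^sup>2) + integral {0..T} (\<lambda>s. (F y 3 s)\<^sup>2) \<le> m y y * (integral {0..T} (g 2) + integral {0..T} (g 3))"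
        using F2[of 2 0 T y] F2[of 3 0 T y] by (simp add: distrib_left)
    qed (use sub0[of 2 0 T] sub0[of 3 0 T] T \<tau> in auto)
  qed
  have E3: "m y y \<le> 32 * \<tau> ^ 5 * integral {real n * \<tau>..real (n + 2) * \<tau>} (g 3)"
    if n: "real (n + 2) * \<tau> \<le> T" and y: "y = 3 *\<^sub>R w (n+2) - 4 *\<^sub>R w (n+1) + w n - (2 * \<tau>) *\<^sub>R w' (n+2)" for n y
  proof -
    have t2: "2 * \<tau> \<le> real (n + 2) * \<tau>" using \<tau> by (simp add: algebra_simps)
    have eq: "m y y = 3 * F y 0 (real (n + 2) * \<tau>) - 4 * F y 0 (real (n + 1) * \<tau>) + F y 0 (real n * \<tau>) - 2 * \<tau> * m y (cf (v' (real (n + 2) * \<tau>)))"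
      using wF[of y] by (subst (2) y) (simp add: sm w'_def)
    show ?thesis
    proof (rule cancel)
      show "(m y y)\<^sup>2 \<le> 32 * \<tau> ^ 5 * integral {real n * \<tau>..real (n + 2) * \<tau>} (\<lambda>s. (F y 3 s)\<^sup>2)"
        unfolding eq using est(3)[OF _ _ _ n t2, of y] unfolding times by blast
    qed (use F2[of 3] sub0[of 3] \<tau> n in auto)
  qed
  have E4: "m y y \<le> 432 * \<tau> ^ 5 * integral {real n * \<tau>..real (n + 3) * \<tau>} (g 3)"
    if n: "real (n + 3) * \<tau> \<le> T" and y: "y = w (n+3) - 3 *\<^sub>R w (n+2) + 3 *\<^sub>R w (n+1) - w n" for n y
  proof -
    have t3: "3 * \<tau> \<le> real (n + 3) * \<tau>" using \<tau> by (simp add: algebra_simps)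
    have eq: "m y y = F y 0 (real (n + 3) * \<tau>) - 3 * F y 0 (real (n + 2) * \<tau>) + 3 * F y 0 (real (n + 1) * \<tau>) - F y 0 (real n * \<tau>)"
      using wF[of y] by (subst (2) y) (simp add: sm)
    show ?thesis
    proof (rule cancel)
      show "(m y y)\<^sup>2 \<le> 432 * \<tau> ^ 5 * integral {real n * \<tau>..real (n + 3) * \<tau>} (\<lambda>s. (F y 3 s)\<^sup>2)"
        unfolding eq using est(4)[OF _ _ _ n t3, of y] unfolding times by blast
    qed (use F2[of 3] sub0[of 3] \<tau> n in auto)
  qed
  have mono: "real n * \<tau> \<le> T" if "n \<le> M" "real M * \<tau> \<le> T" for n M
    using that \<tau> by (meson mult_right_mono of_nat_mono less_imp_le order_trans)
  have step: "(\<Sum>n<M. f n) \<le> K * R'"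
    if "\<And>n. n < M \<Longrightarrow> f n \<le> K * i n" "(\<Sum>n<M. i n) \<le> R'" "0 \<le> K" for f i :: "nat \<Rightarrow> real" and K R' M
  proof -
    have "(\<Sum>n<M. f n) \<le> (\<Sum>n<M. K * i n)" using that(1) by (intro sum_mono) auto
    also have "\<dots> \<le> K * R'" using that(2,3) by (simp add: sum_distrib_left[symmetric] mult_left_mono)
    finally show ?thesis .
  qed
  show "nsq m (w (n+2) - 2 *\<^sub>R w (n+1) + w n) \<le> 18 * (1 / T + T) * \<tau> ^ 4 * R"
    if "real (n + 2) * \<tau> \<le> T"
  proof (rule order_trans[OF E2(2)[OF that refl]])
    show "18 * (1 / T + T) * \<tau> ^ 4 * (integral {0..T} (g 2) + integral {0..T} (g 3)) \<le> 18 * (1 / T + T) * \<tau> ^ 4 * R"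
      using g2R T \<tau> by (intro mult_left_mono) auto
  qed
  note ov = sum_overlapping_integrals[OF gI(2) g0 \<tau>]
  show "(\<Sum>n<M. nsq m (w (n+2) - 2 *\<^sub>R w (n+1) + w n)) \<le> 64 * \<tau> ^ 3 * R"
    if M: "real (M + 1) * \<tau> \<le> T"
  proof -
    have "(\<Sum>n<M. nsq m (w (n+2) - 2 *\<^sub>R w (n+1) + w n)) \<le> 32 * \<tau> ^ 3 * (2 * R)"
    proof (rule step[OF E2(1)])
      show "(\<Sum>n<M. integral {real n * \<tau>..real (n + 2) * \<tau>} (g 2)) \<le> 2 * R"
        using ov(1)[of 2 M, OF _ M] gR[of 2] by simp
      show "real (n + 2) * \<tau> \<le> T" if "n < M" for n using that by (intro mono[OF _ M]) simp
    qed (use \<tau> in auto)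
    then show ?thesis by simp
  qed
  show "(\<Sum>n<M. nsq m (3 *\<^sub>R w (n+2) - 4 *\<^sub>R w (n+1) + w n - (2 * \<tau>) *\<^sub>R w' (n+2))) \<le> 64 * \<tau> ^ 5 * R"
    if M: "real (M + 1) * \<tau> \<le> T"
  proof -
    have "(\<Sum>n<M. nsq m (3 *\<^sub>R w (n+2) - 4 *\<^sub>R w (n+1) + w n - (2 * \<tau>) *\<^sub>R w' (n+2))) \<le> 32 * \<tau> ^ 5 * (2 * R)"
    proof (rule step[OF E3])
      show "(\<Sum>n<M. integral {real n * \<tau>..real (n + 2) * \<tau>} (g 3)) \<le> 2 * R"
        using ov(1)[of 3 M, OF _ M] gR[of 3] by simp
      show "real (n + 2) * \<tau> \<le> T" if "n < M" for n using that by (intro mono[OF _ M]) simp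
    qed (use \<tau> in auto)
    then show ?thesis by simp
  qed
  show "(\<Sum>n<M. nsq m (w (n+3) - 3 *\<^sub>R w (n+2) + 3 *\<^sub>R w (n+1) - w n)) \<le> 1296 * \<tau> ^ 5 * R"
    if M: "real (M + 2) * \<tau> \<le> T"
  proof -
    have "(\<Sum>n<M. nsq m (w (n+3) - 3 *\<^sub>R w (n+2) + 3 *\<^sub>R w (n+1) - w n)) \<le> 432 * \<tau> ^ 5 * (3 * R)"
    proof (rule step[OF E4])
      show "(\<Sum>n<M. integral {real n * \<tau>..real (n + 3) * \<tau>} (g 3)) \<le> 3 * R"
        using ov(2)[of 3 M, OF _ M] gR[of 3] by simp
      show "real (n + 3) * \<tau> \<le> T" if "n < M" for n using that by (intro mono[OF _ M]) simp
    qed (use \<tau> in auto)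
    then show ?thesis by simp
  qed
qed

lemma sobolev_norm_bound:
  assumes V: "sobolev_derivs 3 T N v V" and A: "A \<in> carrier_mat N N" "B \<in> carrier_mat N N"
    and s: "semi_inner (bform N N A)" "semi_inner (bform N N B)" and R: "sobolev_norm_sq 3 T (A + B) V \<le> R"
  shows "(\<Sum>j\<le>3. integral {0..T} (\<lambda>t. nsq (bform N N A) (cf (V j t)))) \<le> R"
    and "(\<Sum>j\<le>3. integral {0..T} (\<lambda>t. nsq (bform N N B) (cf (V j t)))) \<le> R"
proof -
  let ?a = "\<lambda>A j. integral {0..T} (\<lambda>t. nsq (bform N N A) (cf (V j t)))"
  have e: "bform N N (A + B) x y = bform N N A x y + bform N N B x y" for x y
    using A by (simp add: bform_def algebra_simps sum.distrib)
  note i = sobolev_form_integrable[OF V]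
  have "(LINT t|lebesgue_on {0<..<T}. norm_sq (A + B) (V j t)) = ?a A j + ?a B j" if j: "j \<le> 3" for j
  proof -
    have c: "V j t \<in> carrier_vec N" for t using V j by (auto simp: sobolev_derivs_def)
    have AB: "A + B \<in> carrier_mat N N" using A by simp
    have "(LINT t|lebesgue_on {0<..<T}. norm_sq (A + B) (V j t))
        = (LINT t|lebesgue_on {0<..<T}. nsq (bform N N A) (cf (V j t)) + nsq (bform N N B) (cf (V j t)))"
      by (simp add: norm_sq_bform[OF AB c] e)
    also have "\<dots> = ?a A j + ?a B j"
      using i[OF j] by (simp add: integral_lebesgue_on_open_interval(1))
    finally show ?thesis .
  qed
  then have "sobolev_norm_sq 3 T (A + B) V = (\<Sum>j\<le>3. ?a A j) + (\<Sum>j\<le>3. ?a B j)"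
    by (simp add: sobolev_norm_sq_def sum.distrib)
  moreover have "0 \<le> (\<Sum>j\<le>3. ?a A j)" "0 \<le> (\<Sum>j\<le>3. ?a B j)"
    using integral_lebesgue_on_open_interval(2)[OF i] semi_inner_nonneg[OF s(1)] semi_inner_nonneg[OF s(2)]
    by (auto intro!: sum_nonneg integral_nonneg)
  ultimately show "(\<Sum>j\<le>3. ?a A j) \<le> R" "(\<Sum>j\<le>3. ?a B j) \<le> R" using R by linarith+
qed

section \<open>The discrete system in variational form\<close>

lemma positive_definite_inverse:
  assumes A: "A \<in> carrier_mat n n" and pos: "\<And>a i. bform n n A a a \<le> 0 \<Longrightarrow> i < n \<Longrightarrow> a i = 0"
  obtains B :: "real mat" where "B \<in> carrier_mat n n" "A * B = 1\<^sub>m n" "B * A = 1\<^sub>m n"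
proof -
  have "Determinant.det A \<noteq> 0"
  proof
    assume "Determinant.det A = 0"
    then obtain v where v: "v \<in> carrier_vec n" "v \<noteq> 0\<^sub>v n" "A *\<^sub>v v = 0\<^sub>v n"
      using det_0_iff_vec_prod_zero_field[OF A] by auto
    have "norm_sq A v = 0" using v by (simp add: norm_sq_def)
    then have "cf v i = 0" if "i < n" for i using pos[of "cf v", OF _ that] norm_sq_bform[OF A v(1)] by simp
    then have "v = 0\<^sub>v n" using v(1) by (intro eq_vecI) (auto simp: cf_def)
    then show False using v(2) by simp
  qed
  from det_non_zero_imp_unit[OF A this, where b = "()"] that show ?thesis
    by (auto simp: Units_def ring_mat_def)
qed

lemma block_mult_nth:
  "x \<in> carrier_vec c \<Longrightarrow> i < r \<Longrightarrow> (Matrix.mat r c f *\<^sub>v x) $ i = (\<Sum>j<c. f (i, j) * x $ j)"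
  by (auto simp: scalar_prod_def lessThan_atLeast0)

lemma transpose_mult_nth:
  assumes "A \<in> carrier_mat n n'" "v \<in> carrier_vec n" "i < n'"
  shows "(transpose_mat A *\<^sub>v v) $ i = (\<Sum>a<n. A $$ (a, i) * cf v a)"
  using assms mult_mat_vec_nth[of "transpose_mat A" n' n v i] by (auto intro!: sum.cong)

lemma sum_pairing_swap:
  fixes v l :: "nat \<Rightarrow> real"
  shows "(\<Sum>i<n'. v i * (\<Sum>a<n. A $$ (a, i) * l a)) = (\<Sum>a<n. l a * (\<Sum>i<n'. A $$ (a, i) * v i))"
proof -
  have "(\<Sum>i<n'. v i * (\<Sum>a<n. A $$ (a, i) * l a)) = (\<Sum>i<n'. \<Sum>a<n. l a * (A $$ (a, i) * v i))"
    by (simp add: sum_distrib_left mult_ac)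
  also have "\<dots> = (\<Sum>a<n. \<Sum>i<n'. l a * (A $$ (a, i) * v i))" by (rule sum.swap)
  finally show ?thesis by (simp add: sum_distrib_left)
qed

context fe_mesh
begin

definition boundary_part :: "(nat \<Rightarrow> real) \<Rightarrow> nat \<Rightarrow> real" where
  "boundary_part v = boundary_ext (\<lambda>i. if i < dim_l D then v (bulk_nodes + i) else 0)"

lemma boundary_part_nth: "boundary_part v j = (if bulk_nodes \<le> j \<and> j < dim_u D then v j else 0)"
  using mesh(9) by (auto simp: boundary_part_def boundary_ext_def)

lemma linear_boundary_part: "linear boundary_part"
  by (rule linearI) (auto simp: boundary_part_nth fun_eq_iff scaleR_fun_def)

lemma linear_boundary_ext: "linear boundary_ext"
  by (rule linearI) (auto simp: boundary_ext_def fun_eq_iff scaleR_fun_def)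

lemma sum_split_nodes: "(\<Sum>j<dim_u D. F j) = (\<Sum>j<bulk_nodes. F j) + (\<Sum>a<dim_l D. F (bulk_nodes + a))"
  using sum_boundary_ext[of "\<lambda>_ j. F j"] by simp

lemma matrix_dims [simp]:
  "mass_u \<Omega> D \<in> carrier_mat (dim_u D) (dim_u D)" "stiff_u \<Omega> \<alpha> D \<in> carrier_mat (dim_u D) (dim_u D)"
  "mass_p \<Omega> D \<in> carrier_mat (dim_p D) (dim_p D)" "stiff_p \<Omega> \<kappa> D \<in> carrier_mat (dim_p D) (dim_p D)"
  "mass_l \<Omega> D \<in> carrier_mat (dim_l D) (dim_l D)" "coupling_u \<Omega> D \<in> carrier_mat (dim_l D) (dim_u D)"
  "coupling_p \<Omega> D \<in> carrier_mat (dim_l D) (dim_p D)"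
  by (auto simp: mass_u_def stiff_u_def mass_p_def stiff_p_def mass_l_def coupling_u_def coupling_p_def)

abbreviation "Mu \<equiv> bform (dim_u D) (dim_u D) (mass_u \<Omega> D)"
abbreviation "Ku \<alpha> \<equiv> bform (dim_u D) (dim_u D) (stiff_u \<Omega> \<alpha> D)"
abbreviation "Mp \<equiv> bform (dim_p D) (dim_p D) (mass_p \<Omega> D)"
abbreviation "Kp \<kappa> \<equiv> bform (dim_p D) (dim_p D) (stiff_p \<Omega> \<kappa> D)"
abbreviation "Ml \<equiv> bform (dim_l D) (dim_l D) (mass_l \<Omega> D)"

lemma forms_semi_inner:
  shows "semi_inner Mu" "semi_inner Mp" "semi_inner Ml"
    and "\<alpha> \<in> borel_measurable dx \<Longrightarrow> AE x in dx. 0 \<le> \<alpha> x \<and> \<alpha> x \<le> a1 \<Longrightarrow> semi_inner (Ku \<alpha>)"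
    and "\<kappa> \<in> borel_measurable dS \<Longrightarrow> AE x in dS. 0 \<le> \<kappa> x \<and> \<kappa> x \<le> a1 \<Longrightarrow> semi_inner (Kp \<kappa>)"
proof -
  show "semi_inner Mu" by (rule semi_inner_bform) (simp_all add: mass_u_form mult.commute)
  show "semi_inner Mp" by (rule semi_inner_bform) (simp_all add: mass_p_form mult.commute)
  show "semi_inner Ml" by (rule semi_inner_bform) (simp_all add: mass_l_form mult.commute)
  show "semi_inner (Ku \<alpha>)" if a: "\<alpha> \<in> borel_measurable dx" "AE x in dx. 0 \<le> \<alpha> x \<and> \<alpha> x \<le> a1"
  proof (rule semi_inner_bform)
    show "0 \<le> Ku \<alpha> v v" for v unfolding stiff_u_form(1)[OF a]
      by (rule integral_nonneg_AE) (use a(2) in \<open>auto elim!: eventually_mono\<close>)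
  qed (simp add: stiff_u_form(1)[OF a] inner_commute)
  show "semi_inner (Kp \<kappa>)" if a: "\<kappa> \<in> borel_measurable dS" "AE x in dS. 0 \<le> \<kappa> x \<and> \<kappa> x \<le> a1"
  proof (rule semi_inner_bform)
    show "0 \<le> Kp \<kappa> v v" for v unfolding stiff_p_form[OF a]
      by (rule integral_nonneg_AE) (use a(2) in \<open>auto elim!: eventually_mono\<close>)
  qed (simp add: stiff_p_form[OF a] inner_commute)
qed

text \<open>The constraint \<open>B\<^sub>u u = B\<^sub>p p\<close>, in which only the boundary values of the bulk vector enter.\<close>

definition coupled :: "(nat \<Rightarrow> real) \<Rightarrow> (nat \<Rightarrow> real) \<Rightarrow> bool" where
  "coupled v b \<longleftrightarrow> (\<forall>i<dim_l D. (\<Sum>a<dim_l D. mass_l \<Omega> D $$ (i, a) * v (bulk_nodes + a)) = (\<Sum>k<dim_p D. coupling_p \<Omega> D $$ (i, k) * b k))"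

lemma coupling_u_boundary:
  assumes i: "i < dim_l D" and a: "a < dim_l D"
  shows "coupling_u \<Omega> D $$ (i, bulk_nodes + a) = mass_l \<Omega> D $$ (i, a)"
proof -
  have "bulk_nodes + a < dim_u D" using mesh(9) a by arith
  then show ?thesis using coupling_u_entries[OF i, of "bulk_nodes + a"] by simp
qed

lemma coupling_u_sum:
  assumes "i < dim_l D"
  shows "(\<Sum>j<dim_u D. coupling_u \<Omega> D $$ (i, j) * v j) = (\<Sum>a<dim_l D. mass_l \<Omega> D $$ (i, a) * v (bulk_nodes + a))"
proof -
  have "coupling_u \<Omega> D $$ (i, j) = 0" if "j < bulk_nodes" for j
    using coupling_u_entries[OF assms, of j] that by simp
  then show ?thesis unfolding sum_split_nodes using coupling_u_boundary[OF assms] by simp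
qed

lemma mass_l_symmetric: "i < dim_l D \<Longrightarrow> j < dim_l D \<Longrightarrow> mass_l \<Omega> D $$ (i, j) = mass_l \<Omega> D $$ (j, i)"
  by (simp add: mass_l_def mult.commute)

text \<open>The multiplier sees a coupled test pair only through \<open>B\<^sub>u v - B\<^sub>p b = 0\<close>.\<close>

lemma semidiscrete_tested:
  assumes c: "u \<in> carrier_vec (dim_u D)" "p \<in> carrier_vec (dim_p D)" "l \<in> carrier_vec (dim_l D)"
      "u' \<in> carrier_vec (dim_u D)" "p' \<in> carrier_vec (dim_p D)"
    and eq: "mass_u \<Omega> D *\<^sub>v u' + stiff_u \<Omega> \<alpha> D *\<^sub>v u - transpose_mat (coupling_u \<Omega> D) *\<^sub>v l = f"
      "mass_p \<Omega> D *\<^sub>v p' + stiff_p \<Omega> \<kappa> D *\<^sub>v p + transpose_mat (coupling_p \<Omega> D) *\<^sub>v l = g"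
    and vb: "coupled v b"
  shows "Mu v (cf u') + Ku \<alpha> v (cf u) + Mp b (cf p') + Kp \<kappa> b (cf p) = (\<Sum>i<dim_u D. v i * f $ i) + (\<Sum>i<dim_p D. b i * g $ i)"
proof -
  have "f $ i = (\<Sum>j<dim_u D. mass_u \<Omega> D $$ (i, j) * cf u' j) + (\<Sum>j<dim_u D. stiff_u \<Omega> \<alpha> D $$ (i, j) * cf u j)
      - (\<Sum>a<dim_l D. coupling_u \<Omega> D $$ (a, i) * cf l a)" if i: "i < dim_u D" for i
    unfolding eq(1)[symmetric] mult_mat_vec_nth[OF matrix_dims(1) c(4) i, symmetric]
      mult_mat_vec_nth[OF matrix_dims(2) c(1) i, symmetric] transpose_mult_nth[OF matrix_dims(6) c(3) i, symmetric]
    using i by (simp add: mass_u_def stiff_u_def coupling_u_def)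
  note row_u = this
  have fu: "(\<Sum>i<dim_u D. v i * f $ i) = Mu v (cf u') + Ku \<alpha> v (cf u) - (\<Sum>i<dim_u D. v i * (\<Sum>a<dim_l D. coupling_u \<Omega> D $$ (a, i) * cf l a))"
    unfolding bform_rows sum.distrib[symmetric] sum_subtractf[symmetric]
    by (intro sum.cong refl) (simp add: row_u right_diff_distrib distrib_left)
  have "g $ i = (\<Sum>j<dim_p D. mass_p \<Omega> D $$ (i, j) * cf p' j) + (\<Sum>j<dim_p D. stiff_p \<Omega> \<kappa> D $$ (i, j) * cf p j)
      + (\<Sum>a<dim_l D. coupling_p \<Omega> D $$ (a, i) * cf l a)" if i: "i < dim_p D" for i
    unfolding eq(2)[symmetric] mult_mat_vec_nth[OF matrix_dims(3) c(5) i, symmetric]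
      mult_mat_vec_nth[OF matrix_dims(4) c(2) i, symmetric] transpose_mult_nth[OF matrix_dims(7) c(3) i, symmetric]
    using i by (simp add: mass_p_def stiff_p_def coupling_p_def)
  note row_p = this
  have gp: "(\<Sum>i<dim_p D. b i * g $ i) = Mp b (cf p') + Kp \<kappa> b (cf p) + (\<Sum>i<dim_p D. b i * (\<Sum>a<dim_l D. coupling_p \<Omega> D $$ (a, i) * cf l a))"
    unfolding bform_rows sum.distrib[symmetric]
    by (intro sum.cong refl) (simp add: row_p distrib_left)
  have "(\<Sum>i<dim_u D. v i * (\<Sum>a<dim_l D. coupling_u \<Omega> D $$ (a, i) * cf l a)) = (\<Sum>i<dim_p D. b i * (\<Sum>a<dim_l D. coupling_p \<Omega> D $$ (a, i) * cf l a))"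
    unfolding sum_pairing_swap using vb by (intro sum.cong refl) (simp add: coupling_u_sum coupled_def)
  then show ?thesis using fu gp by linarith
qed

text \<open>The two bulk block rows combine to one equation with the mixed difference quotient \<open>W\<close>, which is the BDF one
  at the interior nodes and \<open>w\<close> at the boundary nodes.\<close>

lemma splitting_step_tested:
  assumes c: "\<And>n. un n \<in> carrier_vec (dim_u D)" "\<And>n. pn n \<in> carrier_vec (dim_p D)" "lam \<in> carrier_vec (dim_l D)" "w \<in> carrier_vec (dim_l D)"
      "f (real (n + 3) * \<tau>) \<in> carrier_vec (dim_u D)"
    and step: "splitting_step \<Omega> \<alpha> \<kappa> D \<tau> f g un pn lam w n" and \<tau>: "0 < \<tau>"
  defines "W \<equiv> \<lambda>j. if j < bulk_nodes then cf (3 \<cdot>\<^sub>v un (n+3) - 4 \<cdot>\<^sub>v un (n+2) + un (n+1)) j / (2 * \<tau>) else cf w (j - bulk_nodes)"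
  shows "coupled v b \<Longrightarrow> Mu v W + Ku \<alpha> v (cf (un (n+3))) + Mp b (cf (D_BDF \<tau> pn n)) + Kp \<kappa> b (cf (pn (n+3)))
      = (\<Sum>i<dim_u D. v i * f (real (n + 3) * \<tau>) $ i) + (\<Sum>i<dim_p D. b i * g (real (n + 3) * \<tau>) $ i)"
    and "coupled (cf (un (n+3))) (cf (2 \<cdot>\<^sub>v pn (n+2) - pn (n+1)))"
    and "coupled W (cf (D_alt \<tau> pn n))"
proof -
  let ?M = "mass_u \<Omega> D" and ?K = "stiff_u \<Omega> \<alpha> D" and ?f = "f (real (n + 3) * \<tau>)" and ?g = "g (real (n + 3) * \<tau>)"
  define D1 where "D1 = D_BDF \<tau> (\<lambda>j. vec_first (un j) bulk_nodes) n"
  define u1 where "u1 = vec_first (un (n+3)) bulk_nodes"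
  define u2 where "u2 = vec_last (un (n+3)) (dim_l D)"
  have l: "dim_l D \<le> dim_u D" "dim_u D - bulk_nodes = dim_l D" using mesh(9) by auto
  have d: "dim_row ?M = dim_u D" "dim_col ?M = dim_u D" "dim_row ?K = dim_u D" "dim_col ?K = dim_u D"
    "dim_row (mass_l \<Omega> D) = dim_l D" "dim_row (coupling_p \<Omega> D) = dim_l D"
    "dim_row (mass_p \<Omega> D) = dim_p D" "dim_row (stiff_p \<Omega> \<kappa> D) = dim_p D" "dim_col (coupling_p \<Omega> D) = dim_p D"
    by (auto simp: mass_u_def stiff_u_def mass_l_def coupling_p_def mass_p_def stiff_p_def)
  have D1c: "D1 \<in> carrier_vec bulk_nodes" by (simp add: D1_def D_BDF_def)
  have u1c: "u1 \<in> carrier_vec bulk_nodes" "u2 \<in> carrier_vec (dim_l D)" by (simp_all add: u1_def u2_def)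
  have D1n: "D1 $ j = W j" if "j < bulk_nodes" for j
    using that c(1) by (simp add: D1_def D_BDF_def W_def vec_first_def cf_def carrier_vecD[OF c(1)])
  have wn: "w $ a = W (bulk_nodes + a)" if "a < dim_l D" for a using that c(4) by (simp add: W_def cf_nth)
  have u1n: "u1 $ j = cf (un (n+3)) j" if "j < bulk_nodes" for j
    using that by (simp add: u1_def vec_first_def cf_def carrier_vecD[OF c(1)])
  have u2n: "u2 $ a = cf (un (n+3)) (bulk_nodes + a)" if "a < dim_l D" for a
    using that l by (simp add: u2_def vec_last_def cf_def carrier_vecD[OF c(1)])
  have eqs: "Matrix.mat bulk_nodes bulk_nodes (\<lambda>ij. ?M $$ ij) *\<^sub>v D1 + Matrix.mat bulk_nodes bulk_nodes (\<lambda>ij. ?K $$ ij) *\<^sub>v u1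
        = vec_first ?f bulk_nodes - Matrix.mat bulk_nodes (dim_l D) (\<lambda>(i,j). ?M $$ (i, j + bulk_nodes)) *\<^sub>v w
          - Matrix.mat bulk_nodes (dim_l D) (\<lambda>(i,j). ?K $$ (i, j + bulk_nodes)) *\<^sub>v u2"
     "Matrix.mat (dim_l D) bulk_nodes (\<lambda>(i,j). ?M $$ (i + bulk_nodes, j)) *\<^sub>v D1 + Matrix.mat (dim_l D) bulk_nodes (\<lambda>(i,j). ?K $$ (i + bulk_nodes, j)) *\<^sub>v u1
          - mass_l \<Omega> D *\<^sub>v lam
        = vec_last ?f (dim_l D) - Matrix.mat (dim_l D) (dim_l D) (\<lambda>(i,j). ?M $$ (i + bulk_nodes, j + bulk_nodes)) *\<^sub>v w
          - Matrix.mat (dim_l D) (dim_l D) (\<lambda>(i,j). ?K $$ (i + bulk_nodes, j + bulk_nodes)) *\<^sub>v u2"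
     "mass_l \<Omega> D *\<^sub>v u2 = coupling_p \<Omega> D *\<^sub>v (2 \<cdot>\<^sub>v pn (n+2) - pn (n+1))"
     "mass_l \<Omega> D *\<^sub>v w = coupling_p \<Omega> D *\<^sub>v D_alt \<tau> pn n"
     "mass_p \<Omega> D *\<^sub>v D_BDF \<tau> pn n + stiff_p \<Omega> \<kappa> D *\<^sub>v pn (n+3) + transpose_mat (coupling_p \<Omega> D) *\<^sub>v lam = ?g"
    using step unfolding splitting_step_def split_block_def Let_def
    by (simp_all only: split d l(2) D1_def u1_def u2_def)
  have altc: "D_alt \<tau> pn n \<in> carrier_vec (dim_p D)" "D_BDF \<tau> pn n \<in> carrier_vec (dim_p D)" "2 \<cdot>\<^sub>v pn (n+2) - pn (n+1) \<in> carrier_vec (dim_p D)"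
    using c(2) by (auto simp: D_alt_def D_BDF_def)
  show "coupled (cf (un (n+3))) (cf (2 \<cdot>\<^sub>v pn (n+2) - pn (n+1)))"
    unfolding coupled_def
  proof (intro allI impI)
    fix i assume i: "i < dim_l D"
    show "(\<Sum>a<dim_l D. mass_l \<Omega> D $$ (i, a) * cf (un (n+3)) (bulk_nodes + a)) = (\<Sum>k<dim_p D. coupling_p \<Omega> D $$ (i, k) * cf (2 \<cdot>\<^sub>v pn (n+2) - pn (n+1)) k)"
      using arg_cong[OF eqs(3), of "\<lambda>x. x $ i"] unfolding mult_mat_vec_nth[OF matrix_dims(5) u1c(2) i] mult_mat_vec_nth[OF matrix_dims(7) altc(3) i]
      by (simp add: u2n cf_nth[OF u1c(2)])
  qed
  show "coupled W (cf (D_alt \<tau> pn n))"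
    unfolding coupled_def
  proof (intro allI impI)
    fix i assume i: "i < dim_l D"
    show "(\<Sum>a<dim_l D. mass_l \<Omega> D $$ (i, a) * W (bulk_nodes + a)) = (\<Sum>k<dim_p D. coupling_p \<Omega> D $$ (i, k) * cf (D_alt \<tau> pn n) k)"
      using arg_cong[OF eqs(4), of "\<lambda>x. x $ i"] unfolding mult_mat_vec_nth[OF matrix_dims(5) c(4) i] mult_mat_vec_nth[OF matrix_dims(7) altc(1) i]
      by (simp add: wn cf_nth[OF c(4)])
  qed
  define L where "L i = (\<Sum>a<dim_l D. coupling_u \<Omega> D $$ (a, i) * cf lam a)" for i
  have L0: "L i = 0" if "i < bulk_nodes" for i
    using that l(1) by (simp add: L_def coupling_u_entries)
  have L1: "L (bulk_nodes + i) = (mass_l \<Omega> D *\<^sub>v lam) $ i" if i: "i < dim_l D" for i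
    unfolding mult_mat_vec_nth[OF matrix_dims(5) c(3) i] L_def
    by (intro sum.cong refl) (simp only: lessThan_iff coupling_u_boundary[OF _ i] mass_l_symmetric[OF _ i])
  have row: "?f $ i = (\<Sum>j<dim_u D. ?M $$ (i, j) * W j) + (\<Sum>j<dim_u D. ?K $$ (i, j) * cf (un (n+3)) j) - L i" if i: "i < dim_u D" for i
  proof (cases "i < bulk_nodes")
    case True
    have "(\<Sum>j<bulk_nodes. ?M $$ (i, j) * W j) + (\<Sum>j<bulk_nodes. ?K $$ (i, j) * cf (un (n+3)) j)
        = ?f $ i - (\<Sum>a<dim_l D. ?M $$ (i, a + bulk_nodes) * W (bulk_nodes + a)) - (\<Sum>a<dim_l D. ?K $$ (i, a + bulk_nodes) * cf (un (n+3)) (bulk_nodes + a))"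
      using arg_cong[OF eqs(1), of "\<lambda>x. x $ i"] True block_mult_nth[OF D1c True] block_mult_nth[OF u1c(1) True] block_mult_nth[OF u1c(2) True] block_mult_nth[OF c(4) True]
      by (simp add: D1n u1n u2n wn vec_first_def del: index_mult_mat_vec)
    then show ?thesis using L0[OF True] unfolding sum_split_nodes by (simp add: add.commute)
  next
    case False
    define a where "a = i - bulk_nodes"
    have ai: "i = bulk_nodes + a" and a: "a < dim_l D" using False i l by (auto simp: a_def)
    have "(\<Sum>j<bulk_nodes. ?M $$ (i, j) * W j) + (\<Sum>j<bulk_nodes. ?K $$ (i, j) * cf (un (n+3)) j) - L i
        = ?f $ i - (\<Sum>a<dim_l D. ?M $$ (i, a + bulk_nodes) * W (bulk_nodes + a)) - (\<Sum>a<dim_l D. ?K $$ (i, a + bulk_nodes) * cf (un (n+3)) (bulk_nodes + a))"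
      using arg_cong[OF eqs(2), of "\<lambda>x. x $ a"] a L1[OF a] block_mult_nth[OF D1c a] block_mult_nth[OF u1c(1) a] block_mult_nth[OF u1c(2) a] block_mult_nth[OF c(4) a]
      by (simp add: D1n u1n u2n wn vec_last_def ai add.commute d l carrier_vecD[OF c(5)] del: index_mult_mat_vec of_nat_add)
    then show ?thesis unfolding sum_split_nodes by (simp add: add.commute)
  qed
  show "Mu v W + Ku \<alpha> v (cf (un (n+3))) + Mp b (cf (D_BDF \<tau> pn n)) + Kp \<kappa> b (cf (pn (n+3)))
      = (\<Sum>i<dim_u D. v i * ?f $ i) + (\<Sum>i<dim_p D. b i * ?g $ i)" if vb: "coupled v b"
  proof -
    have fu: "(\<Sum>i<dim_u D. v i * ?f $ i) = Mu v W + Ku \<alpha> v (cf (un (n+3))) - (\<Sum>i<dim_u D. v i * L i)"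
      unfolding bform_rows sum.distrib[symmetric] sum_subtractf[symmetric]
      by (intro sum.cong refl) (simp add: row right_diff_distrib distrib_left del: of_nat_add)
    have "?g $ i = (\<Sum>j<dim_p D. mass_p \<Omega> D $$ (i, j) * cf (D_BDF \<tau> pn n) j) + (\<Sum>j<dim_p D. stiff_p \<Omega> \<kappa> D $$ (i, j) * cf (pn (n+3)) j)
        + (\<Sum>a<dim_l D. coupling_p \<Omega> D $$ (a, i) * cf lam a)" if i: "i < dim_p D" for i
      unfolding eqs(5)[symmetric] mult_mat_vec_nth[OF matrix_dims(3) altc(2) i, symmetric]
        mult_mat_vec_nth[OF matrix_dims(4) c(2) i, symmetric] transpose_mult_nth[OF matrix_dims(7) c(3) i, symmetric]
      using i by (simp add: d)
    note row_p = this
    have gp: "(\<Sum>i<dim_p D. b i * ?g $ i) = Mp b (cf (D_BDF \<tau> pn n)) + Kp \<kappa> b (cf (pn (n+3))) + (\<Sum>i<dim_p D. b i * (\<Sum>a<dim_l D. coupling_p \<Omega> D $$ (a, i) * cf lam a))"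
      unfolding bform_rows sum.distrib[symmetric]
      by (intro sum.cong refl) (simp add: row_p distrib_left del: of_nat_add)
    have "(\<Sum>i<dim_u D. v i * L i) = (\<Sum>i<dim_p D. b i * (\<Sum>a<dim_l D. coupling_p \<Omega> D $$ (a, i) * cf lam a))"
      unfolding L_def sum_pairing_swap using vb by (intro sum.cong refl) (simp add: coupling_u_sum coupled_def)
    then show ?thesis using fu gp by linarith
  qed
qed

text \<open>\<open>P\<close> is the \<open>L\<^sup>2\<close> projection of surface functions onto the traces, given by the inverse boundary mass
  matrix; as a projection it does not increase the norm.\<close>

lemma boundary_projection:
  assumes s: "copy_ratio TYPE('a) k s" and K: "cone_constant TYPE('a) K"
  obtains P :: "(nat \<Rightarrow> real) \<Rightarrow> nat \<Rightarrow> real" where "linear P" "\<And>q i. dim_l D \<le> i \<Longrightarrow> P q i = 0"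
    "\<And>v q. coupled v q \<longleftrightarrow> boundary_part v = boundary_ext (P q)" "\<And>q. Ml (P q) (P q) \<le> Mp q q"
proof -
  let ?n = "dim_l D" and ?A = "mass_l \<Omega> D"
  have "a i = 0" if a: "Ml a a \<le> 0" and i: "i < ?n" for a i
  proof -
    have p: "0 < ball_vol * (s * \<sigma> * h) ^ DIM('a) / (K * h)"
      using s K \<sigma> volume_bounds(1) ball_vol_pos by (simp add: copy_ratio_def cone_constant_def)
    have "overlap * Ml a a \<le> 0" using a \<sigma> by (simp add: overlap_def mult_nonneg_nonpos)
    then have "ball_vol * (s * \<sigma> * h) ^ DIM('a) / (K * h) * (\<Sum>i<?n. (a i)\<^sup>2 / 4) \<le> 0"
      using mass_l_lower[OF s K, of a] by linarith
    then have "(\<Sum>i<?n. (a i)\<^sup>2 / 4) \<le> 0" using p by (simp only: mult_le_0_iff) auto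
    then have "(\<Sum>i<?n. (a i)\<^sup>2 / 4) = 0" by (intro antisym sum_nonneg) auto
    then show ?thesis using i by (simp add: sum_nonneg_eq_0_iff)
  qed
  then obtain B where B: "B \<in> carrier_mat ?n ?n" "?A * B = 1\<^sub>m ?n" "B * ?A = 1\<^sub>m ?n"
    using positive_definite_inverse[OF matrix_dims(5)] by metis
  have e: "(\<Sum>a<?n. X $$ (i, a) * (\<Sum>j<?n. Y $$ (a, j) * w j)) = w i"
    if X: "X \<in> carrier_mat ?n ?n" "Y \<in> carrier_mat ?n ?n" "X * Y = 1\<^sub>m ?n" and i: "i < ?n" for X Y :: "real mat" and w :: "nat \<Rightarrow> real" and i
  proof -
    have "(\<Sum>a<?n. X $$ (i, a) * (\<Sum>j<?n. Y $$ (a, j) * w j)) = (\<Sum>a<?n. \<Sum>j<?n. X $$ (i, a) * Y $$ (a, j) * w j)"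
      by (simp add: sum_distrib_left mult.assoc)
    also have "\<dots> = (\<Sum>j<?n. \<Sum>a<?n. X $$ (i, a) * Y $$ (a, j) * w j)" by (rule sum.swap)
    also have "\<dots> = (\<Sum>j<?n. (X * Y) $$ (i, j) * w j)"
      using X(1,2) i by (intro sum.cong refl) (simp add: scalar_prod_def lessThan_atLeast0 sum_distrib_right)
    also have "\<dots> = (\<Sum>j<?n. if i = j then w j else 0)" unfolding X(3) using i by (intro sum.cong refl) simp
    also have "\<dots> = w i" using i by simp
    finally show ?thesis .
  qed
  define b where "b q j = (\<Sum>k<dim_p D. coupling_p \<Omega> D $$ (j, k) * q k)" for q :: "nat \<Rightarrow> real" and j
  define P where "P q i = (if i < ?n then \<Sum>j<?n. B $$ (i, j) * b q j else 0)" for q i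
  have AP: "(\<Sum>a<?n. ?A $$ (i, a) * P q a) = b q i" if "i < ?n" for q i
    using e[OF matrix_dims(5) B(1,2) that, of "b q"] by (simp add: P_def)
  have uniq: "c i = P q i" if "\<And>i. i < ?n \<Longrightarrow> (\<Sum>a<?n. ?A $$ (i, a) * c a) = b q i" "i < ?n" for c q i
    using e[OF B(1) matrix_dims(5) B(3) that(2), of c] that by (simp add: P_def)
  show ?thesis
  proof (rule that)
    show "linear P"
      by (rule linearI) (auto simp: P_def b_def fun_eq_iff scaleR_fun_def sum.distrib sum_distrib_left algebra_simps)
    show "P q i = 0" if "?n \<le> i" for q i using that by (simp add: P_def)
    show "coupled v q \<longleftrightarrow> boundary_part v = boundary_ext (P q)" for v q
    proof
      assume "coupled v q"
      then have vP: "v (bulk_nodes + i) = P q i" if "i < ?n" for i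
        using that by (intro uniq) (auto simp: coupled_def b_def)
      have "(if i < ?n then v (bulk_nodes + i) else 0) = P q i" for i
        by (cases "i < ?n") (simp add: vP, simp add: P_def)
      then show "boundary_part v = boundary_ext (P q)" by (simp add: boundary_part_def)
    next
      assume a: "boundary_part v = boundary_ext (P q)"
      have "v (bulk_nodes + i) = P q i" if "i < ?n" for i
      proof -
        have "bulk_nodes + i < dim_u D" using mesh(9) that by arith
        then show ?thesis using fun_cong[OF a, of "bulk_nodes + i"] by (simp add: boundary_part_nth boundary_ext_def)
      qed
      then show "coupled v q" using AP by (simp add: coupled_def b_def)
    qed
    show "Ml (P q) (P q) \<le> Mp q q" for q
    proof -
      have c: "bform ?n (dim_p D) (coupling_p \<Omega> D) (P q) q = Ml (P q) (P q)"
        unfolding bform_rows using AP[of _ q] by (intro sum.cong refl) (simp add: b_def)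
      note i = mass_l_form(2)[of "P q" "P q"] mass_p_form(2)[of q q] coupling_p_form(2)[of "P q" q]
      have "0 \<le> (LINT x|dS. (surf_fun_p q x * surf_fun_p q x + surf_fun (P q) x * surf_fun (P q) x) - 2 * (surf_fun (P q) x * surf_fun_p q x))"
      proof (rule Bochner_Integration.integral_nonneg)
        have "0 \<le> y * y + z * z - 2 * (z * y)" for y z :: real
          using zero_le_power2[of "y - z"] by (simp add: power2_eq_square algebra_simps)
        then show "0 \<le> (surf_fun_p q x * surf_fun_p q x + surf_fun (P q) x * surf_fun (P q) x) - 2 * (surf_fun (P q) x * surf_fun_p q x)" for x
          .
      qed
      also have "\<dots> = Mp q q + Ml (P q) (P q) - 2 * bform ?n (dim_p D) (coupling_p \<Omega> D) (P q) q"
        using i by (simp add: mass_l_form mass_p_form coupling_p_form)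
      finally show ?thesis unfolding c by simp
    qed
  qed
qed

text \<open>Both sides are compared with the Euclidean norm of the coefficients.  A trace has the boundary mass of order
  \<open>h\<^sup>d\<^sup>-\<^sup>1\<close> per node, its extension by zero only the bulk mass of order \<open>h\<^sup>d\<close>.\<close>

lemma coefficient_bounds:
  assumes s: "copy_ratio TYPE('a) k s" and K: "cone_constant TYPE('a) K" and C: "gradient_constant TYPE('a) k C"
    and \<alpha>: "\<alpha> \<in> borel_measurable dx" "AE x in dx. 0 \<le> \<alpha> x \<and> \<alpha> x \<le> a1"
  defines "A1 \<equiv> real ((k + 1) ^ (DIM('a) + 1)) * basis_bound\<^sup>2 * ball_vol / \<sigma> ^ DIM('a)"
    and "A2 \<equiv> \<bar>a1\<bar> * real ((k + 1) ^ (DIM('a) + 1)) * (C * basis_bound / \<sigma>)\<^sup>2 * ball_vol / \<sigma> ^ DIM('a)"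
    and "L \<equiv> ball_vol * (s * \<sigma>) ^ DIM('a) / (4 * overlap)"
  shows "nsq Mu (boundary_ext c) \<le> (A1 + A2) * (1 + K) / L * h * Ml c c"
    and "h * nsq (Ku \<alpha>) (boundary_ext c) \<le> (A1 + A2) * (1 + K) / L * Ml c c"
    and "nsq Mu (boundary_part v) \<le> (A1 + A2) * (1 + K) / L * Mu v v"
    and "h\<^sup>2 * nsq (Ku \<alpha>) (boundary_part v) \<le> (A1 + A2) * (1 + K) / L * Mu v v"
proof -
  let ?d = "DIM('a)"
  have h: "0 < h" by (rule volume_bounds(1))
  have K0: "0 < K" and s0: "0 < s" using K s by (auto simp: cone_constant_def copy_ratio_def)
  have ov: "0 < overlap"
  proof -
    have "0 < (k + 1) ^ (?d + 1)" by simp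
    then have "0 < real ((k + 1) ^ (?d + 1))" by (simp only: of_nat_0_less_iff)
    then show ?thesis unfolding overlap_def using \<sigma> by (intro mult_pos_pos) auto
  qed
  have A: "0 \<le> A1" "0 \<le> A2" and L: "0 < L" using \<sigma> s0 ball_vol_pos ov by (auto simp: A1_def A2_def L_def)
  define C' where "C' = (A1 + A2) * (1 + K) / L"
  have CL: "C' * L = (A1 + A2) * (1 + K)" using L by (simp add: C'_def)
  have le: "A1 \<le> C' * L" "A2 \<le> C' * L" "A1 * K \<le> C' * L" "A2 * K \<le> C' * L"
    unfolding CL using A K0 mult_nonneg_nonneg[OF A(1), of K] mult_nonneg_nonneg[OF A(2), of K] by (simp_all add: algebra_simps)
  have C0: "0 \<le> C'" using A K0 L by (simp add: C'_def)
  have lowU: "L * (h ^ ?d * (\<Sum>i<dim_u D. (a i)\<^sup>2)) \<le> Mu a a" for a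
  proof -
    have "overlap * (L * (h ^ ?d * (\<Sum>i<dim_u D. (a i)\<^sup>2))) = ball_vol * (s * \<sigma> * h) ^ ?d * (\<Sum>i<dim_u D. (a i)\<^sup>2 / 4)"
      using ov by (simp add: L_def power_mult_distrib sum_divide_distrib[symmetric])
    also have "\<dots> \<le> overlap * Mu a a" by (rule mass_u_lower[OF s])
    finally show ?thesis using ov by (rule mult_left_le_imp_le)
  qed
  have lowL: "L * (h ^ ?d * (\<Sum>i<dim_l D. (c i)\<^sup>2)) \<le> K * h * Ml c c" for c
  proof -
    have "overlap * (L * (h ^ ?d * (\<Sum>i<dim_l D. (c i)\<^sup>2))) = K * h * (ball_vol * (s * \<sigma> * h) ^ ?d / (K * h) * (\<Sum>i<dim_l D. (c i)\<^sup>2 / 4))"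
      using ov K0 h by (simp add: L_def power_mult_distrib sum_divide_distrib[symmetric])
    also have "\<dots> \<le> K * h * (overlap * Ml c c)" using mass_l_lower[OF s K, of c] K0 h by (intro mult_left_mono) auto
    also have "\<dots> = overlap * (K * h * Ml c c)" by simp
    finally show ?thesis using ov by (rule mult_left_le_imp_le)
  qed
  have upM: "Mu a a \<le> A1 * (h ^ ?d * (\<Sum>i<dim_u D. (a i)\<^sup>2))" for a
    using mass_u_upper[of a] by (simp add: A1_def mult.assoc)
  have upK: "h\<^sup>2 * Ku \<alpha> a a \<le> A2 * (h ^ ?d * (\<Sum>i<dim_u D. (a i)\<^sup>2))" for a
    using stiff_u_upper[OF \<alpha> C, of a] by (simp add: A2_def mult.assoc)
  have ext: "(\<Sum>i<dim_u D. (boundary_ext c i)\<^sup>2) = (\<Sum>i<dim_l D. (c i)\<^sup>2)" for c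
    using sum_boundary_ext[of "\<lambda>x _. x\<^sup>2" c] by simp
  have part: "(\<Sum>i<dim_u D. (boundary_part v i)\<^sup>2) \<le> (\<Sum>i<dim_u D. (v i)\<^sup>2)" for v
    by (intro sum_mono) (auto simp: boundary_part_nth)
  have key: "A * S \<le> C' * X" if "A * K' \<le> C' * L" "L * S \<le> K' * X" "0 \<le> A" "0 \<le> X" for A S X K'
  proof -
    have "L * (A * S) \<le> A * (K' * X)" using mult_left_mono[OF that(2,3)] by (simp add: mult_ac)
    also have "\<dots> \<le> L * (C' * X)" using mult_right_mono[OF that(1,4)] by (simp add: mult_ac)
    finally show ?thesis using L by simp
  qed
  have nn: "0 \<le> Ml c c" "0 \<le> Mu v v" for c v using semi_inner_nonneg[OF forms_semi_inner(3)] semi_inner_nonneg[OF forms_semi_inner(1)] by auto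
  have low': "L * (h ^ ?d * (\<Sum>i<dim_l D. (c i)\<^sup>2)) \<le> K * (h * Ml c c)" for c using lowL[of c] by (simp add: mult.assoc)
  have k1: "A1 * (h ^ ?d * (\<Sum>i<dim_l D. (c i)\<^sup>2)) \<le> C' * (h * Ml c c)"
    by (rule key[OF le(3) low']) (use A h nn in auto)
  then show "nsq Mu (boundary_ext c) \<le> (A1 + A2) * (1 + K) / L * h * Ml c c"
    using upM[of "boundary_ext c"] unfolding ext C'_def[symmetric] by (simp add: mult.assoc)
  have k2: "A2 * (h ^ ?d * (\<Sum>i<dim_l D. (c i)\<^sup>2)) \<le> C' * (h * Ml c c)"
    by (rule key[OF le(4) low']) (use A h nn in auto)
  have "h * (h * nsq (Ku \<alpha>) (boundary_ext c)) \<le> h * (C' * Ml c c)"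
    using k2 upK[of "boundary_ext c"] unfolding ext by (simp add: power2_eq_square mult_ac)
  then show "h * nsq (Ku \<alpha>) (boundary_ext c) \<le> (A1 + A2) * (1 + K) / L * Ml c c"
    using h unfolding C'_def[symmetric] by (simp only: mult_le_cancel_left_pos)
  have lowP: "L * (h ^ ?d * (\<Sum>i<dim_u D. (boundary_part v i)\<^sup>2)) \<le> 1 * Mu v v"
  proof -
    have "L * (h ^ ?d * (\<Sum>i<dim_u D. (boundary_part v i)\<^sup>2)) \<le> L * (h ^ ?d * (\<Sum>i<dim_u D. (v i)\<^sup>2))"
      using part L h by (intro mult_left_mono) auto
    then show ?thesis using lowU[of v] by simp
  qed
  show "nsq Mu (boundary_part v) \<le> (A1 + A2) * (1 + K) / L * Mu v v"
    using order_trans[OF upM key[OF _ lowP]] le A nn unfolding C'_def[symmetric] by simp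
  show "h\<^sup>2 * nsq (Ku \<alpha>) (boundary_part v) \<le> (A1 + A2) * (1 + K) / L * Mu v v"
    using order_trans[OF upK key[OF _ lowP]] le A nn unfolding C'_def[symmetric] by simp
qed

end

section \<open>Convergence\<close>

context fe_mesh
begin

text \<open>The hypotheses \<open>small\<close> contain the mesh restriction and the CFL condition that make the zero extension
  absorbable in \<open>splitting_error_bound\<close>.\<close>

lemma error_bound:
  fixes T \<tau> C C0 R :: real and N :: nat
  assumes s: "copy_ratio TYPE('a) k s" and K: "cone_constant TYPE('a) K"
    and \<alpha>: "\<alpha> \<in> borel_measurable dx" "AE x in dx. 0 \<le> \<alpha> x \<and> \<alpha> x \<le> a1"
    and \<kappa>: "\<kappa> \<in> borel_measurable dS" "AE x in dS. 0 \<le> \<kappa> x \<and> \<kappa> x \<le> b1"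
    and C: "1 \<le> C"
    and ext: "\<And>c. nsq Mu (boundary_ext c) \<le> C * h * Ml c c" "\<And>c. h * nsq (Ku \<alpha>) (boundary_ext c) \<le> C * Ml c c"
    and part: "\<And>v. nsq Mu (boundary_part v) \<le> C * Mu v v" "\<And>v. h\<^sup>2 * nsq (Ku \<alpha>) (boundary_part v) \<le> C * Mu v v"
    and small: "C * h \<le> 1/4000" "\<tau> * C \<le> h / 32" "0 < \<tau>" "\<tau> \<le> 1/16" and T: "0 < T"
    and f: "continuous_data T (dim_u D) f"
    and sol: "semidiscrete_solution \<Omega> \<alpha> \<kappa> T D f g u p l"
    and sob: "sobolev_derivs 3 T (dim_u D) u U" "sobolev_derivs 3 T (dim_p D) p P"
    and R: "sobolev_norm_sq 3 T (mass_u \<Omega> D + stiff_u \<Omega> \<alpha> D) U \<le> R" "sobolev_norm_sq 3 T (mass_p \<Omega> D + stiff_p \<Omega> \<kappa> D) P \<le> R"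
    and init: "\<And>j. j \<le> 2 \<Longrightarrow>
          norm_sq (mass_u \<Omega> D) (un j - u (real j * \<tau>)) + \<tau> * norm_sq (stiff_u \<Omega> \<alpha> D) (un j - u (real j * \<tau>))
        + norm_sq (mass_p \<Omega> D) (pn j - p (real j * \<tau>)) + \<tau> * norm_sq (stiff_p \<Omega> \<kappa> D) (pn j - p (real j * \<tau>)) \<le> C0 * \<tau> ^ 5"
    and scheme: "splitting_scheme \<Omega> \<alpha> \<kappa> T D \<tau> f g un pn"
    and N: "real N * \<tau> \<le> T"
  shows "norm_sq (mass_u \<Omega> D) (un N - u (real N * \<tau>)) + norm_sq (mass_p \<Omega> D) (pn N - p (real N * \<tau>))
        + \<tau> * (\<Sum>j=1..N. norm_sq (stiff_u \<Omega> \<alpha> D) (un j - u (real j * \<tau>)) + norm_sq (stiff_p \<Omega> \<kappa> D) (pn j - p (real j * \<tau>)))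
      \<le> (40000 * exp (4 * T) * (100 + 40 * C) + 8) * (\<bar>C0\<bar> + (18 * (1 / T + T) + 1296) * \<bar>R\<bar>) * \<tau> ^ 4"
proof -
  obtain Pr :: "(nat \<Rightarrow> real) \<Rightarrow> nat \<Rightarrow> real" where Pr: "linear Pr" "\<And>q i. dim_l D \<le> i \<Longrightarrow> Pr q i = 0"
    "\<And>v q. coupled v q \<longleftrightarrow> boundary_part v = boundary_ext (Pr q)" "\<And>q. Ml (Pr q) (Pr q) \<le> Mp q q"
    by (rule boundary_projection[OF s K]) (rule that)
  define EP where "EP q = boundary_ext (Pr q)" for q
  have EP: "linear EP" using linear_compose[OF Pr(1) linear_boundary_ext] by (simp add: EP_def[abs_def] comp_def)
  obtain u' p' where d: "vec_derivative_on T (dim_u D) u u'" "vec_derivative_on T (dim_p D) p p'"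
    and eq: "\<And>t. t \<in> {0..T} \<Longrightarrow> mass_u \<Omega> D *\<^sub>v u' t + stiff_u \<Omega> \<alpha> D *\<^sub>v u t - transpose_mat (coupling_u \<Omega> D) *\<^sub>v l t = f t"
      "\<And>t. t \<in> {0..T} \<Longrightarrow> mass_p \<Omega> D *\<^sub>v p' t + stiff_p \<Omega> \<kappa> D *\<^sub>v p t + transpose_mat (coupling_p \<Omega> D) *\<^sub>v l t = g t"
      "\<And>t. t \<in> {0..T} \<Longrightarrow> coupling_u \<Omega> D *\<^sub>v u t - coupling_p \<Omega> D *\<^sub>v p t = 0\<^sub>v (dim_l D)"
    using sol unfolding semidiscrete_solution_def by blast
  have c: "u t \<in> carrier_vec (dim_u D)" "p t \<in> carrier_vec (dim_p D)" "l t \<in> carrier_vec (dim_l D)" for t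
    using sol by (auto simp: semidiscrete_solution_def)
  have cn: "un n \<in> carrier_vec (dim_u D)" "pn n \<in> carrier_vec (dim_p D)" for n
    using scheme by (auto simp: splitting_scheme_def)
  have c': "u' t \<in> carrier_vec (dim_u D)" "p' t \<in> carrier_vec (dim_p D)" if "t \<in> {0..T}" for t
    using d that by (auto simp: vec_derivative_on_def)
  have fc: "f t \<in> carrier_vec (dim_u D)" for t using f by (auto simp: continuous_data_def)
  note [simp] = carrier_vecD[OF c(1)] carrier_vecD[OF c(2)] carrier_vecD[OF cn(1)] carrier_vecD[OF cn(2)]
  note forms = forms_semi_inner(1) forms_semi_inner(4)[OF \<alpha>] forms_semi_inner(2) forms_semi_inner(5)[OF \<kappa>]
  have h0: "0 < h" by (rule volume_bounds(1))
  have time: "real n * \<tau> \<in> {0..T}" if "n \<le> N" for n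
  proof -
    have "real n * \<tau> \<le> real N * \<tau>" using that small(3) by (intro mult_right_mono) auto
    then have "real n * \<tau> \<le> T" using N by linarith
    then show ?thesis using small(3) by simp
  qed
  define G where "G = (18 * (1 / T + T) + 1296) * \<bar>R\<bar>"
  have cT: "0 \<le> 1 / T + T" using T by simp
  have G: "18 * (1 / T + T) * \<bar>R\<bar> \<le> G" "64 * \<bar>R\<bar> \<le> G" "1296 * \<bar>R\<bar> \<le> G" "0 \<le> G"
    using mult_nonneg_nonneg[OF cT abs_ge_zero[of R]] unfolding G_def by (auto simp: distrib_right)
  have Gpow: "K' * \<tau> ^ i * \<bar>R\<bar> \<le> G * \<tau> ^ i" if "K' * \<bar>R\<bar> \<le> G" for K' i
    using mult_right_mono[OF that, of "\<tau> ^ i"] small(3) by (simp add: mult_ac)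
  have Rabs: "X \<le> R \<Longrightarrow> X \<le> \<bar>R\<bar>" for X by linarith
  note su = sobolev_norm_bound[OF sob(1) matrix_dims(1,2) forms(1,2) R(1), THEN Rabs]
  note sp = sobolev_norm_bound[OF sob(2) matrix_dims(3,4) forms(3,4) R(2), THEN Rabs]
  note regM = sampled_regularity[OF forms(1) T small(3) sob(1) d(1) su(1)]
  note regK = sampled_regularity[OF forms(2) T small(3) sob(1) d(1) su(2)]
  note regP = sampled_regularity[OF forms(3) T small(3) sob(2) d(2) sp(1)]
  have N1: "N - 1 = 0 \<or> real (N - 1 + 1) * \<tau> \<le> T" and N2: "N - 2 = 0 \<or> real (N - 2 + 2) * \<tau> \<le> T"
    using time[of "N - 1 + 1"] time[of "N - 2 + 2"] by fastforce+
  have nonneg: "0 \<le> G * \<tau> ^ i" for i using G(4) small(3) by simp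
  let ?y = "\<lambda>n. cf (un n)" and ?z = "\<lambda>n. cf (pn n)" and ?u = "\<lambda>n. cf (u (real n * \<tau>))" and ?p = "\<lambda>n. cf (p (real n * \<tau>))"
    and ?u' = "\<lambda>n. cf (u' (real n * \<tau>))" and ?p' = "\<lambda>n. cf (p' (real n * \<tau>))"
  have ce: "cf (un n - u (real n * \<tau>)) = ?y n - ?u n" "cf (pn n - p (real n * \<tau>)) = ?z n - ?p n" for n
    by (auto simp: cf_def fun_eq_iff)
  have cd: "un n - u (real n * \<tau>) \<in> carrier_vec (dim_u D)" "pn n - p (real n * \<tau>) \<in> carrier_vec (dim_p D)" for n
    using c cn by auto
  note ns = norm_sq_bform[OF matrix_dims(1) cd(1)] norm_sq_bform[OF matrix_dims(2) cd(1)]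
    norm_sq_bform[OF matrix_dims(3) cd(2)] norm_sq_bform[OF matrix_dims(4) cd(2)]
  have bound: "nsq Mu (?y N - ?u N) + nsq Mp (?z N - ?p N)
      + \<tau> * (\<Sum>j=1..N. nsq (Ku \<alpha>) (?y j - ?u j) + nsq (Kp \<kappa>) (?z j - ?p j))
      \<le> (40000 * exp (4 * (real N * \<tau>)) * (100 + 40 * C) + 8) * (\<bar>C0\<bar> + G) * \<tau> ^ 4"
  proof (rule splitting_error_bound[where EP = EP and ER = boundary_part and u' = ?u' and p' = ?p', OF forms EP linear_boundary_part])
    show "boundary_part (boundary_part v) = boundary_part v" for v by (auto simp: boundary_part_nth fun_eq_iff)
    show "boundary_part (EP q) = EP q" for q
    proof
      fix j
      show "boundary_part (EP q) j = EP q j"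
      proof (cases "j < dim_u D")
        case False
        then have "dim_l D \<le> j - bulk_nodes" using mesh(9) by arith
        then show ?thesis using False Pr(2) by (simp add: boundary_part_nth EP_def boundary_ext_def)
      qed (auto simp: boundary_part_nth EP_def boundary_ext_def)
    qed
    show "0 < \<tau>" "\<tau> \<le> 1/16" "0 \<le> C" "0 \<le> G" using small C G by auto
    have l0: "0 \<le> Ml c c" for c by (rule semi_inner_nonneg[OF forms_semi_inner(3)])
    show "Mu (EP q) (EP q) \<le> 1/4000 * Mp q q" for q
    proof -
      have "Mu (EP q) (EP q) \<le> (C * h) * Ml (Pr q) (Pr q)" unfolding EP_def by (rule ext(1))
      also have "\<dots> \<le> 1/4000 * Mp q q" using small(1) Pr(4)[of q] l0 by (intro mult_mono) auto
      finally show ?thesis .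
    qed
    show "\<tau> * Ku \<alpha> (EP q) (EP q) \<le> 1/32 * Mp q q" for q
    proof -
      have "\<tau> * (h * Ku \<alpha> (EP q) (EP q)) \<le> \<tau> * (C * Ml (Pr q) (Pr q))"
        using ext(2)[of "Pr q"] small(3) unfolding EP_def by (intro mult_left_mono) auto
      also have "\<dots> = (\<tau> * C) * Ml (Pr q) (Pr q)" by simp
      also have "\<dots> \<le> (h / 32) * Mp q q" using small(2) h0 Pr(4)[of q] l0 by (intro mult_mono) auto
      also have "\<dots> = h * (1/32 * Mp q q)" by simp
      finally have "h * (\<tau> * Ku \<alpha> (EP q) (EP q)) \<le> h * (1/32 * Mp q q)" by (simp only: mult.left_commute[of \<tau> h])
      then show ?thesis by (rule mult_left_le_imp_le[OF _ h0])
    qed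
    show "nsq Mu (boundary_part v) \<le> C * Mu v v" for v by (rule part(1))
    show "\<tau>\<^sup>2 * nsq (Ku \<alpha>) (boundary_part v) \<le> C * Mu v v" for v
    proof -
      have "\<tau> * 1 \<le> \<tau> * C" using C small(3) by (intro mult_left_mono) auto
      then have "\<tau> \<le> h" using small(2) h0 by linarith
      then have "\<tau>\<^sup>2 \<le> h\<^sup>2" using small(3) by (intro power_mono) auto
      then have "\<tau>\<^sup>2 * nsq (Ku \<alpha>) (boundary_part v) \<le> h\<^sup>2 * nsq (Ku \<alpha>) (boundary_part v)"
        using semi_inner_nonneg[OF forms(2)] by (rule mult_right_mono)
      then show ?thesis using part(2)[of v] by linarith
    qed
    show "boundary_part (?u n) = EP (?p n)" if n: "n \<le> N" for n
    proof -
      have "coupled (?u n) (?p n)"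
        unfolding coupled_def
      proof (intro allI impI)
        fix i assume i: "i < dim_l D"
        have "(coupling_u \<Omega> D *\<^sub>v u (real n * \<tau>)) $ i - (coupling_p \<Omega> D *\<^sub>v p (real n * \<tau>)) $ i = 0"
          using arg_cong[OF eq(3)[OF time[OF n]], of "\<lambda>x. x $ i"] i by (simp add: coupling_p_def coupling_u_def)
        then show "(\<Sum>a<dim_l D. mass_l \<Omega> D $$ (i, a) * ?u n (bulk_nodes + a)) = (\<Sum>k<dim_p D. coupling_p \<Omega> D $$ (i, k) * ?p n k)"
          unfolding mult_mat_vec_nth[OF matrix_dims(6) c(1) i] mult_mat_vec_nth[OF matrix_dims(7) c(2) i] coupling_u_sum[OF i] by simp
      qed
      then show ?thesis by (simp add: Pr(3) EP_def)
    qed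
    have step: "\<exists>lam w. lam \<in> carrier_vec (dim_l D) \<and> w \<in> carrier_vec (dim_l D) \<and> splitting_step \<Omega> \<alpha> \<kappa> D \<tau> f g un pn lam w n" if "n + 3 \<le> N" for n
    proof -
      have "real (n + 3) * \<tau> \<le> T" using time[OF that] by (simp del: of_nat_add)
      then show ?thesis using scheme unfolding splitting_scheme_def by blast
    qed
    show "boundary_part (?y (n+3)) = EP (2 *\<^sub>R ?z (n+2) - ?z (n+1))" if n: "n + 3 \<le> N" for n
    proof -
      obtain lam w where lw: "lam \<in> carrier_vec (dim_l D)" "w \<in> carrier_vec (dim_l D)" "splitting_step \<Omega> \<alpha> \<kappa> D \<tau> f g un pn lam w n"
        using step[OF n] by blast
      have "cf (2 \<cdot>\<^sub>v pn (n+2) - pn (n+1)) = 2 *\<^sub>R ?z (n+2) - ?z (n+1)" by (auto simp: cf_def fun_eq_iff scaleR_fun_def)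
      then show ?thesis using splitting_step_tested(2)[OF cn lw(1,2) fc lw(3) small(3)] by (simp add: Pr(3) EP_def)
    qed
    show "Mu (3 *\<^sub>R ?y (n+3) - 4 *\<^sub>R ?y (n+2) + ?y (n+1) - boundary_part (3 *\<^sub>R ?y (n+3) - 4 *\<^sub>R ?y (n+2) + ?y (n+1))
           + EP (5 *\<^sub>R ?z (n+2) - 8 *\<^sub>R ?z (n+1) + 3 *\<^sub>R ?z n) - (2 * \<tau>) *\<^sub>R ?u' (n+3)) v
       + 2 * \<tau> * Ku \<alpha> (?y (n+3) - ?u (n+3)) v
       + Mp (3 *\<^sub>R ?z (n+3) - 4 *\<^sub>R ?z (n+2) + ?z (n+1) - (2 * \<tau>) *\<^sub>R ?p' (n+3)) q
       + 2 * \<tau> * Kp \<kappa> (?z (n+3) - ?p (n+3)) q = 0" if n: "n + 3 \<le> N" and vq: "boundary_part v = EP q" for n v q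
    proof -
      obtain lam w where lw: "lam \<in> carrier_vec (dim_l D)" "w \<in> carrier_vec (dim_l D)" "splitting_step \<Omega> \<alpha> \<kappa> D \<tau> f g un pn lam w n"
        using step[OF n] by blast
      have vq': "coupled v q" using vq by (simp add: Pr(3) EP_def)
      define W where "W j = (if j < bulk_nodes then cf (3 \<cdot>\<^sub>v un (n+3) - 4 \<cdot>\<^sub>v un (n+2) + un (n+1)) j / (2 * \<tau>) else cf w (j - bulk_nodes))" for j
      note st = splitting_step_tested[OF cn lw(1,2) fc lw(3) small(3), folded W_def[abs_def]]
      define Y where "Y = 3 *\<^sub>R ?y (n+3) - 4 *\<^sub>R ?y (n+2) + ?y (n+1)"
      define Z where "Z = 3 *\<^sub>R ?z (n+3) - 4 *\<^sub>R ?z (n+2) + ?z (n+1)"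
      define Za where "Za = 5 *\<^sub>R ?z (n+2) - 8 *\<^sub>R ?z (n+1) + 3 *\<^sub>R ?z n"
      have cY: "cf (3 \<cdot>\<^sub>v un (n+3) - 4 \<cdot>\<^sub>v un (n+2) + un (n+1)) = Y" by (auto simp: Y_def cf_def fun_eq_iff scaleR_fun_def)
      have cZ: "cf (D_BDF \<tau> pn n) = (1 / (2 * \<tau>)) *\<^sub>R Z" by (auto simp: Z_def D_BDF_def cf_def fun_eq_iff scaleR_fun_def)
      have cZa: "cf (D_alt \<tau> pn n) = (1 / (2 * \<tau>)) *\<^sub>R Za" by (auto simp: Za_def D_alt_def cf_def fun_eq_iff scaleR_fun_def)
      have bW: "boundary_part W = (1 / (2 * \<tau>)) *\<^sub>R EP Za"
        using st(3) unfolding Pr(3) EP_def[symmetric] cZa by (simp add: linear_scale[OF EP])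
      have X: "(Y - boundary_part Y + EP Za) j = ((2 * \<tau>) *\<^sub>R W) j" if j: "j < dim_u D" for j
      proof (cases "j < bulk_nodes")
        case True
        have "W j = Y j / (2 * \<tau>)" using True unfolding W_def cY by simp
        then show ?thesis using True small(3) by (simp add: boundary_part_nth EP_def boundary_ext_def scaleR_fun_def)
      next
        case False
        then have "W j = boundary_part W j" using j by (simp add: boundary_part_nth)
        then show ?thesis using small(3) False j unfolding bW by (simp add: boundary_part_nth scaleR_fun_def)
      qed
      have "Mu (Y - boundary_part Y + EP Za) v = Mu ((2 * \<tau>) *\<^sub>R W) v" by (rule bform_cong[OF X]) auto
      then have e1: "Mu (Y - boundary_part Y + EP Za) v = 2 * \<tau> * Mu v W"
        by (simp add: semi_inner_simps[OF forms(1)] semi_inner_commute[OF forms(1), of W])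
      have e2: "Mp Z q = 2 * \<tau> * Mp q (cf (D_BDF \<tau> pn n))"
        using small(3) unfolding cZ by (simp add: semi_inner_simps[OF forms(3)] semi_inner_commute[OF forms(3), of q])
      note t = time[OF n]
      have S1: "Mu v W + Ku \<alpha> v (?y (n+3)) + Mp q (cf (D_BDF \<tau> pn n)) + Kp \<kappa> q (?z (n+3))
         = Mu v (?u' (n+3)) + Ku \<alpha> v (?u (n+3)) + Mp q (?p' (n+3)) + Kp \<kappa> q (?p (n+3))"
        unfolding st(1)[OF vq'] by (rule semidiscrete_tested[OF c c'[OF t] eq(1,2)[OF t] vq', symmetric])
      have "Mu (Y - boundary_part Y + EP Za - (2 * \<tau>) *\<^sub>R ?u' (n+3)) v + 2 * \<tau> * Ku \<alpha> (?y (n+3) - ?u (n+3)) v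
          + Mp (Z - (2 * \<tau>) *\<^sub>R ?p' (n+3)) q + 2 * \<tau> * Kp \<kappa> (?z (n+3) - ?p (n+3)) q
          = 2 * \<tau> * ((Mu v W + Ku \<alpha> v (?y (n+3)) + Mp q (cf (D_BDF \<tau> pn n)) + Kp \<kappa> q (?z (n+3)))
             - (Mu v (?u' (n+3)) + Ku \<alpha> v (?u (n+3)) + Mp q (?p' (n+3)) + Kp \<kappa> q (?p (n+3))))"
        unfolding semi_inner_simps(3)[OF forms(1)] semi_inner_simps(3)[OF forms(2)] semi_inner_simps(3)[OF forms(3)] semi_inner_simps(3)[OF forms(4)] e1 e2
          semi_inner_simps(5)[OF forms(1)] semi_inner_simps(5)[OF forms(3)]
          semi_inner_commute[OF forms(1), of "?u' (n+3)" v] semi_inner_commute[OF forms(2), of "?y (n+3)" v] semi_inner_commute[OF forms(2), of "?u (n+3)" v]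
          semi_inner_commute[OF forms(3), of "?p' (n+3)" q] semi_inner_commute[OF forms(4), of "?z (n+3)" q] semi_inner_commute[OF forms(4), of "?p (n+3)" q]
        by (simp add: algebra_simps)
      then show ?thesis unfolding S1 Y_def Z_def Za_def by simp
    qed
    show "nsq Mu (?y j - ?u j) + \<tau> * nsq (Ku \<alpha>) (?y j - ?u j)
        + nsq Mp (?z j - ?p j) + \<tau> * nsq (Kp \<kappa>) (?z j - ?p j) \<le> \<bar>C0\<bar> * \<tau> ^ 5" if "j \<le> 2" for j
    proof -
      have "C0 * \<tau> ^ 5 \<le> \<bar>C0\<bar> * \<tau> ^ 5" using small(3) by (intro mult_right_mono) auto
      then show ?thesis using init[OF that] unfolding ns ce by linarith
    qed
    show "nsq Mu (?u (n+2) - 2 *\<^sub>R ?u (n+1) + ?u n) \<le> G * \<tau> ^ 4" if "n + 2 \<le> N" for n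
      using regM(1)[of n] Gpow[OF G(1), of 4] time[OF that] by (simp del: of_nat_add)
    show "nsq Mp (?p (n+2) - 2 *\<^sub>R ?p (n+1) + ?p n) \<le> G * \<tau> ^ 4" if "n + 2 \<le> N" for n
      using regP(1)[of n] Gpow[OF G(1), of 4] time[OF that] by (simp del: of_nat_add)
    show "(\<Sum>n<N-1. nsq (Ku \<alpha>) (?u (n+2) - 2 *\<^sub>R ?u (n+1) + ?u n)) \<le> G * \<tau> ^ 3"
      using N1
    proof
      assume "real (N - 1 + 1) * \<tau> \<le> T"
      from regK(2)[OF this] show ?thesis using Gpow[OF G(2), of 3] by (rule order_trans)
    qed (use nonneg in simp)
    show "(\<Sum>n<N-1. nsq Mu (3 *\<^sub>R ?u (n+2) - 4 *\<^sub>R ?u (n+1) + ?u n - (2 * \<tau>) *\<^sub>R ?u' (n+2))) \<le> G * \<tau> ^ 5"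
      using N1
    proof
      assume "real (N - 1 + 1) * \<tau> \<le> T"
      from regM(3)[OF this] show ?thesis using Gpow[OF G(2), of 5] by (rule order_trans)
    qed (use nonneg in simp)
    show "(\<Sum>n<N-1. nsq Mp (3 *\<^sub>R ?p (n+2) - 4 *\<^sub>R ?p (n+1) + ?p n - (2 * \<tau>) *\<^sub>R ?p' (n+2))) \<le> G * \<tau> ^ 5"
      using N1
    proof
      assume "real (N - 1 + 1) * \<tau> \<le> T"
      from regP(3)[OF this] show ?thesis using Gpow[OF G(2), of 5] by (rule order_trans)
    qed (use nonneg in simp)
    show "(\<Sum>n<N-2. nsq Mu (?u (n+3) - 3 *\<^sub>R ?u (n+2) + 3 *\<^sub>R ?u (n+1) - ?u n)) \<le> G * \<tau> ^ 5"
      using N2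
    proof
      assume "real (N - 2 + 2) * \<tau> \<le> T"
      from regM(4)[OF this] show ?thesis using Gpow[OF G(3), of 5] by (rule order_trans)
    qed (use nonneg in simp)
    show "(\<Sum>n<N-2. nsq Mp (?p (n+3) - 3 *\<^sub>R ?p (n+2) + 3 *\<^sub>R ?p (n+1) - ?p n)) \<le> G * \<tau> ^ 5"
      using N2
    proof
      assume "real (N - 2 + 2) * \<tau> \<le> T"
      from regP(4)[OF this] show ?thesis using Gpow[OF G(3), of 5] by (rule order_trans)
    qed (use nonneg in simp)
  qed
  have "exp (4 * (real N * \<tau>)) \<le> exp (4 * T)" using N by simp
  then have "(40000 * exp (4 * (real N * \<tau>)) * (100 + 40 * C) + 8) * (\<bar>C0\<bar> + G) * \<tau> ^ 4
      \<le> (40000 * exp (4 * T) * (100 + 40 * C) + 8) * (\<bar>C0\<bar> + G) * \<tau> ^ 4"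
    using C G(4) small(3) by (intro mult_right_mono add_right_mono mult_left_mono) auto
  then show ?thesis using bound unfolding ns ce G_def by linarith
qed

end

theorem theorem4p12:
  fixes \<Omega> :: "'a::euclidean_space set" and \<alpha> \<kappa> :: "'a \<Rightarrow> real"
    and T \<sigma> \<beta> :: real and k q :: nat
  assumes "DIM('a) = 2 \<or> DIM('a) = 3"
    and "lipschitz_domain \<Omega>"
    and "uniformly_positive_Linfty (lebesgue_on \<Omega>) \<alpha>"
    and "uniformly_positive_Linfty (surface_measure (frontier \<Omega>)) \<kappa>"
    and "0 < T" and "0 < \<sigma>" and "0 < \<beta>" and "1 \<le> k" and "1 \<le> q"
  shows "\<exists>h\<^sub>0>0. \<exists>c_CFL>0. \<forall>C\<^sub>0 R :: real. \<exists>C :: real.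
    \<forall>(D :: 'a fe_data) (\<tau> :: real) f g u p l U P un pn.
      fe_discretization \<Omega> \<sigma> k q \<beta> D \<and>
      mesh_width (mesh_bulk D) \<le> h\<^sub>0 \<and>
      0 < \<tau> \<and> \<tau> \<le> c_CFL * mesh_width (mesh_bulk D) \<and>
      continuous_data T (dim_u D) f \<and> continuous_data T (dim_p D) g \<and>
      semidiscrete_solution \<Omega> \<alpha> \<kappa> T D f g u p l \<and>
      sobolev_derivs 3 T (dim_u D) u U \<and> sobolev_derivs 3 T (dim_p D) p P \<and>
      sobolev_norm_sq 3 T (mass_u \<Omega> D + stiff_u \<Omega> \<alpha> D) U \<le> R \<and>
      sobolev_norm_sq 3 T (mass_p \<Omega> D + stiff_p \<Omega> \<kappa> D) P \<le> R \<and>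
      (\<forall>j\<le>2.
          norm_sq (mass_u \<Omega> D) (un j - u (real j * \<tau>))
        + \<tau> * norm_sq (stiff_u \<Omega> \<alpha> D) (un j - u (real j * \<tau>))
        + norm_sq (mass_p \<Omega> D) (pn j - p (real j * \<tau>))
        + \<tau> * norm_sq (stiff_p \<Omega> \<kappa> D) (pn j - p (real j * \<tau>)) \<le> C\<^sub>0 * \<tau> ^ 5) \<and>
      coupling_u \<Omega> D *\<^sub>v un 2 = coupling_p \<Omega> D *\<^sub>v pn 2 \<and>
      splitting_scheme \<Omega> \<alpha> \<kappa> T D \<tau> f g un pn \<longrightarrow>
      (\<forall>n. real n * \<tau> \<le> T \<longrightarrow>
          norm_sq (mass_u \<Omega> D) (un n - u (real n * \<tau>))
        + norm_sq (mass_p \<Omega> D) (pn n - p (real n * \<tau>))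
        + \<tau> * (\<Sum>j=1..n. norm_sq (stiff_u \<Omega> \<alpha> D) (un j - u (real j * \<tau>))
                         + norm_sq (stiff_p \<Omega> \<kappa> D) (pn j - p (real j * \<tau>)))
          \<le> C * \<tau> ^ 4)"
proof -
  have d2: "2 \<le> DIM('a)" using assms(1) by auto
  have \<Omega>: "open \<Omega>" "bounded \<Omega>" "\<Omega> \<noteq> {}" using assms(2) by (auto simp: lipschitz_domain_def)
  obtain a0 a1 where a: "\<alpha> \<in> borel_measurable (lebesgue_on \<Omega>)" "0 < a0" "AE x in lebesgue_on \<Omega>. a0 \<le> \<alpha> x \<and> \<alpha> x \<le> a1"
    using assms(3) by (auto simp: uniformly_positive_Linfty_def)
  obtain b0 b1 where b: "\<kappa> \<in> borel_measurable (surface_measure (frontier \<Omega>))" "0 < b0" "AE x in surface_measure (frontier \<Omega>). b0 \<le> \<kappa> x \<and> \<kappa> x \<le> b1"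
    using assms(4) by (auto simp: uniformly_positive_Linfty_def)
  have a': "AE x in lebesgue_on \<Omega>. 0 \<le> \<alpha> x \<and> \<alpha> x \<le> a1" using a(3) by (rule eventually_mono) (use a(2) in auto)
  have b': "AE x in surface_measure (frontier \<Omega>). 0 \<le> \<kappa> x \<and> \<kappa> x \<le> b1" using b(3) by (rule eventually_mono) (use b(2) in auto)
  obtain s where s: "copy_ratio TYPE('a) k s" using polynomial_large_on_copy[OF assms(8), where 'a = 'a] unfolding copy_ratio_def by blast
  obtain K where K: "cone_constant TYPE('a) K" using volume_cone_le_hausdorff[OF d2] unfolding cone_constant_def by blast
  obtain Cg where Cg: "gradient_constant TYPE('a) k Cg"
    using polynomial_gradient_bound[OF assms(8), where 'a = 'a] unfolding gradient_constant_def by blast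
  \<comment> \<open>the constants of \<open>coefficient_bounds\<close>, written out to show that they are the same for all meshes\<close>
  define n0 where "n0 = real ((k + 1) ^ (DIM('a) + 1))"
  define Bb where "Bb = real ((k + 1) ^ (DIM('a) + 1) * k ^ k)"
  define v0 where "v0 = unit_ball_vol (real DIM('a))"
  define A1 where "A1 = n0 * Bb\<^sup>2 * v0 / \<sigma> ^ DIM('a)"
  define A2 where "A2 = \<bar>a1\<bar> * n0 * (Cg * Bb / \<sigma>)\<^sup>2 * v0 / \<sigma> ^ DIM('a)"
  define L where "L = v0 * (s * \<sigma>) ^ DIM('a) / (4 * ((2 / \<sigma>) ^ DIM('a) * n0))"
  define C where "C = max 1 ((A1 + A2) * (1 + K) / L)"
  have C1: "1 \<le> C" "(A1 + A2) * (1 + K) / L \<le> C" by (auto simp: C_def)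
  show ?thesis
  proof (rule exI[of _ "1 / (4000 * C)"], intro conjI, simp add: C_def less_max_iff_disj, rule exI[of _ "1 / (32 * C)"], intro conjI allI, simp add: C_def less_max_iff_disj,
      rule exI, intro allI impI, elim conjE)
    fix C0 R \<tau> :: real and D :: "'a fe_data" and f g u p l U P un pn and n :: nat
    assume fe: "fe_discretization \<Omega> \<sigma> k q \<beta> D" and hs: "mesh_width (mesh_bulk D) \<le> 1 / (4000 * C)"
      and \<tau>: "0 < \<tau>" "\<tau> \<le> 1 / (32 * C) * mesh_width (mesh_bulk D)"
      and f: "continuous_data T (dim_u D) f"
      and sol: "semidiscrete_solution \<Omega> \<alpha> \<kappa> T D f g u p l"
      and sob: "sobolev_derivs 3 T (dim_u D) u U" "sobolev_derivs 3 T (dim_p D) p P"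
      and R: "sobolev_norm_sq 3 T (mass_u \<Omega> D + stiff_u \<Omega> \<alpha> D) U \<le> R"
        "sobolev_norm_sq 3 T (mass_p \<Omega> D + stiff_p \<Omega> \<kappa> D) P \<le> R"
      and init: "\<forall>j\<le>2.
          norm_sq (mass_u \<Omega> D) (un j - u (real j * \<tau>))
        + \<tau> * norm_sq (stiff_u \<Omega> \<alpha> D) (un j - u (real j * \<tau>))
        + norm_sq (mass_p \<Omega> D) (pn j - p (real j * \<tau>))
        + \<tau> * norm_sq (stiff_p \<Omega> \<kappa> D) (pn j - p (real j * \<tau>)) \<le> C0 * \<tau> ^ 5"
      and scheme: "splitting_scheme \<Omega> \<alpha> \<kappa> T D \<tau> f g un pn"
      and n: "real n * \<tau> \<le> T"
    interpret M: fe_mesh \<Omega> \<sigma> k q \<beta> D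
      by unfold_locales (use d2 \<Omega> assms(6,8) fe in auto)
    have h: "0 < mesh_width (mesh_bulk D)" by (rule M.volume_bounds(1))
    note cb = M.coefficient_bounds[OF s K Cg a(1) a', unfolded M.basis_bound_def M.ball_vol_def M.overlap_def,
        folded v0_def n0_def Bb_def, folded A1_def A2_def L_def]
    have l0: "0 \<le> M.Ml c c" and u0: "0 \<le> M.Mu v v" for c v
      using semi_inner_nonneg[OF M.forms_semi_inner(3)] semi_inner_nonneg[OF M.forms_semi_inner(1)] by auto
    have up: "X \<le> C * Y" if "X \<le> (A1 + A2) * (1 + K) / L * Y" "0 \<le> Y" for X Y
      using that(1) mult_right_mono[OF C1(2) that(2)] by linarith
    have Ch: "C * mesh_width (mesh_bulk D) \<le> 1/4000" using hs C1(1) by (simp add: field_simps)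
    have \<tau>C: "\<tau> * C \<le> mesh_width (mesh_bulk D) / 32" using \<tau>(2) C1(1) by (simp add: field_simps)
    have "\<tau> * 1 \<le> \<tau> * C" "1 * mesh_width (mesh_bulk D) \<le> C * mesh_width (mesh_bulk D)"
      using C1(1) \<tau>(1) h by (auto intro: mult_left_mono mult_right_mono)
    then have \<tau>16: "\<tau> \<le> 1/16" using Ch \<tau>C by linarith
    show "norm_sq (mass_u \<Omega> D) (un n - u (real n * \<tau>))
        + norm_sq (mass_p \<Omega> D) (pn n - p (real n * \<tau>))
        + \<tau> * (\<Sum>j=1..n. norm_sq (stiff_u \<Omega> \<alpha> D) (un j - u (real j * \<tau>))
                         + norm_sq (stiff_p \<Omega> \<kappa> D) (pn j - p (real j * \<tau>)))
          \<le> (40000 * exp (4 * T) * (100 + 40 * C) + 8) * (\<bar>C0\<bar> + (18 * (1 / T + T) + 1296) * \<bar>R\<bar>) * \<tau> ^ 4"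
    proof (rule M.error_bound[OF s K a(1) a' b(1) b' C1(1) _ _ _ _ Ch \<tau>C \<tau>(1) \<tau>16 assms(5) f sol sob R _ scheme n])
      show "nsq M.Mu (M.boundary_ext c) \<le> C * mesh_width (mesh_bulk D) * M.Ml c c" for c
        using up[of _ "mesh_width (mesh_bulk D) * M.Ml c c"] cb(1)[of c] h l0[of c] by (simp add: mult.assoc)
      show "mesh_width (mesh_bulk D) * nsq (M.Ku \<alpha>) (M.boundary_ext c) \<le> C * M.Ml c c" for c
        by (rule up[OF cb(2) l0])
      show "nsq M.Mu (M.boundary_part v) \<le> C * M.Mu v v" for v by (rule up[OF cb(3) u0])
      show "(mesh_width (mesh_bulk D))\<^sup>2 * nsq (M.Ku \<alpha>) (M.boundary_part v) \<le> C * M.Mu v v" for v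
        by (rule up[OF cb(4) u0])
    qed (use init in auto)
  qed
qed

end
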